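(* There exists a constant $\gamma>0$, independent of the mesh parameters $h$ and $\Delta t$, such that for every $n$ and all $(\mathbf{u}_h^n,\mathbf{z}_h^n,p_h^n)\in\mathcal{V}_h^X$, $$\gamma\,|||(\mathbf{u}_h^n,\mathbf{z}_h^n,p_h^n)|||_A\;\le\;\sup_{0\neq(\mathbf{v}_h,\mathbf{w}_h,q_h)\in\mathcal{V}_h^X}\frac{B_h^n[(\mathbf{u}_h,\mathbf{z}_h,p_h),(\mathbf{v}_h,\mathbf{w}_h,q_h)]}{|||(\mathbf{v}_h,\mathbf{w}_h,q_h)|||_A},$$ where $$B_h^n[(\mathbf{u}_h,\mathbf{z}_h,p_h),(\mathbf{v}_h,\mathbf{w}_h,q_h)]=a(\mathbf{u}_h^n,\mathbf{v}_h)+\Delta t(k^{-1}\mathbf{z}_h^n,\mathbf{w}_h)-(p_h^n,\nabla\cdot\mathbf{v}_h)-\Delta t(p_h^n,\nabla\cdot\mathbf{w}_h)+(\nabla\cdot\mathbf{u}_h^n,q_h)+\Delta t(\nabla\cdot\mathbf{z}_h^n,q_h)+J(p_h^n,q_h).$$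
   Context: Setting. $\Omega\subset\mathbb{R}^d$, $d\in\{2,3\}$, is a bounded domain with $\partial\Omega=\Gamma_D\cup\Gamma_N=\Gamma_P\cup\Gamma_F$ and outward unit normal $\mathbf n$; $(\cdot,\cdot)$ is the $L^2(\Omega)$ inner product and $\|\cdot\|_{s,\Omega}$ the $H^s(\Omega)$ norm. $\mathbf{W}^E(\Omega)=\{\mathbf u\in(H^1(\Omega))^d:\mathbf u=\mathbf 0\text{ on }\Gamma_D\}$, $\epsilon(\mathbf u)$ is the symmetric gradient, and with Lamé parameters $\lambda,\mu$ $$a(\mathbf u,\mathbf v)=\int_\Omega 2\mu\,\epsilon(\mathbf u):\epsilon(\mathbf v)+\lambda(\nabla\cdot\mathbf u)(\nabla\cdot\mathbf v)\,dx .$$ It is assumed that $a(\mathbf u,\mathbf v)\le C_c\|\mathbf u\|_{1,\Omega}\|\mathbf v\|_{1,\Omega}$ on $(H^1(\Omega))^d$ and (Korn) $a(\mathbf v,\mathbf v)\ge C_k\|\mathbf v\|_{1,\Omega}^2$ on $\mathbf W^E(\Omega)$, $C_c,C_k>0$. The permeability $k(\mathbf x)$ is a symmetric tensor for which there are $\lambda_{min},\lambda_{max}>0$ with $\lambda_{min}|\eta|^2\le\eta^tk(\mathbf x)\eta\le\lambda_{max}|\eta|^2$ for all $\eta\in\mathbb R^d$, $\mathbf x\in\Omega$. Discretization. $\mathcal T^h$ is a quasi-uniform partition of $\Omega$ into non-overlapping (simplicial) elements $K$ of maximal size $h$; $\Delta t>0$ is the time step. $\mathbf W_h^E$ (resp.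 $\mathbf W_h^D$) is the space of continuous $\mathbb R^d$-valued functions on $\Omega$ that are linear polynomials on each $K$ and vanish on $\Gamma_D$ (resp. have zero normal component on $\Gamma_F$). $Q_h$ is the space of functions constant on each $K$, with the additional constraint $\int_\Omega p_h=0$ if $\Gamma_N\cup\Gamma_P=\emptyset$. $\mathcal V_h^X=\mathbf W_h^E\times\mathbf W_h^D\times Q_h$. The stabilization form is $J(p,q)=\delta\sum_K\int_{\partial K\setminus\partial\Omega}h_{\partial K}[p][q]\,ds$, where $h_{\partial K}$ is the diameter of the edge ($d=2$) or face ($d=3$), $[\cdot]$ is the jump across it, and $\delta>0$ is a parameter independent of $h$ and $\Delta t$; $|q|_{J,\Omega}=J(q,q)^{1/2}$. Norm: $|||(\mathbf v,\mathbf w,q)|||_A^2=\|\mathbf v\|_{1,\Omega}^2+\Delta t^2\|\nabla\cdot\mathbf w\|_{0,\Omega}^2+\Delta t\|\mathbf w\|_{0,\Omega}^2+\|q\|_{0,\Omega}^2+|q|_{J,\Omega}^2$. Standing assumption on pressures: to each $p\in Q_h$ is associated $\mathbf v_p\in(H^1_0(\Omega))^d$ with $\nabla\cdot\mathbf v_p=-p$ and $\|\mathbf v_p\|_{1,\Omega}\le c\|p\|_{0,\Omega}$, and the Clément projection $\pi_h^1$ onto continuous piecewise linears satisfies $\pi_h^1\mathbf v_p\in(H_0^1(\Omega))^d$, $\|\pi_h^1\mathbf v_p\|_{1,\Omega}\le\hat c\|p\|_{0,\Omega}$ and $\|\mathbf v_p-\pi_h^1\mathbf v_p\|_{0,K}\le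 Ch\|\mathbf v_p\|_{H^1(\omega_K)}$, where $\omega_K$ is the union of the elements whose closure meets $\overline K$; $c,\hat c,C$ are independent of $h$. *)

theory Defs
  imports "HOL-Analysis.Analysis"
begin

section \<open>Sobolev spaces\<close>

definition L2_on :: "(real^'n) set \<Rightarrow> (real^'n \<Rightarrow> 'b::euclidean_space) \<Rightarrow> bool" where
  "L2_on S f \<longleftrightarrow> f \<in> borel_measurable (lebesgue_on S) \<and>
     integrable (lebesgue_on S) (\<lambda>x. (norm (f x))\<^sup>2)"

definition L2_inner ::
    "(real^'n) set \<Rightarrow> (real^'n \<Rightarrow> 'b::euclidean_space) \<Rightarrow> (real^'n \<Rightarrow> 'b) \<Rightarrow> real" where
  "L2_inner S f g = (LINT x|lebesgue_on S. f x \<bullet> g x)"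

text \<open>On \<^typ>\<open>real^'n^'n\<close> the library norm and inner product are those of Frobenius.\<close>

definition L2_norm :: "(real^'n) set \<Rightarrow> (real^'n \<Rightarrow> 'b::euclidean_space) \<Rightarrow> real" where
  "L2_norm S f = sqrt (L2_inner S f f)"

definition partial_deriv :: "'n \<Rightarrow> (real^'n \<Rightarrow> real) \<Rightarrow> real^'n \<Rightarrow> real" where
  "partial_deriv i f x = frechet_derivative f (at x) (axis i 1)"

fun Ck :: "nat \<Rightarrow> (real^'n \<Rightarrow> real) \<Rightarrow> bool" where
  "Ck 0 f \<longleftrightarrow> continuous_on UNIV f"
| "Ck (Suc m) f \<longleftrightarrow> (\<forall>x. f differentiable (at x)) \<and> (\<forall>i. Ck m (partial_deriv i f))"

definition test_function :: "(real^'n) set \<Rightarrow> (real^'n \<Rightarrow> real) \<Rightarrow> bool" where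
  "test_function \<Omega> \<phi> \<longleftrightarrow> (\<forall>m. Ck m \<phi>) \<and>
     compact (closure {x. \<phi> x \<noteq> 0}) \<and> closure {x. \<phi> x \<noteq> 0} \<subseteq> \<Omega>"

text \<open>The entry \<open>G x $ i $ j\<close> is the weak derivative of the component \<open>v\<^sub>i\<close> in direction \<open>j\<close>.\<close>

definition has_weak_jacobian ::
    "(real^'n) set \<Rightarrow> (real^'n \<Rightarrow> real^'n) \<Rightarrow> (real^'n \<Rightarrow> real^'n^'n) \<Rightarrow> bool" where
  "has_weak_jacobian \<Omega> v G \<longleftrightarrow> L2_on \<Omega> G \<and>
     (\<forall>\<phi> i j. test_function \<Omega> \<phi> \<longrightarrow>
        (LINT x|lebesgue_on \<Omega>. v x $ i * partial_deriv j \<phi> x) =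
        - (LINT x|lebesgue_on \<Omega>. G x $ i $ j * \<phi> x))"

definition H1 :: "(real^'n) set \<Rightarrow> (real^'n \<Rightarrow> real^'n) set" where
  "H1 \<Omega> = {v. L2_on \<Omega> v \<and> (\<exists>G. has_weak_jacobian \<Omega> v G)}"

text \<open>The weak derivative is determined up to a null set; only integrals of it are used below.\<close>

definition weak_jacobian :: "(real^'n) set \<Rightarrow> (real^'n \<Rightarrow> real^'n) \<Rightarrow> real^'n \<Rightarrow> real^'n^'n" where
  "weak_jacobian \<Omega> v = (SOME G. has_weak_jacobian \<Omega> v G)"

definition H1_norm :: "(real^'n) set \<Rightarrow> (real^'n \<Rightarrow> real^'n) \<Rightarrow> real" where
  "H1_norm \<Omega> v = sqrt ((L2_norm \<Omega> v)\<^sup>2 + (L2_norm \<Omega> (weak_jacobian \<Omega> v))\<^sup>2)"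

definition divergence :: "(real^'n) set \<Rightarrow> (real^'n \<Rightarrow> real^'n) \<Rightarrow> real^'n \<Rightarrow> real" where
  "divergence \<Omega> v x = trace (weak_jacobian \<Omega> v x)"

definition sym_grad :: "(real^'n) set \<Rightarrow> (real^'n \<Rightarrow> real^'n) \<Rightarrow> real^'n \<Rightarrow> real^'n^'n" where
  "sym_grad \<Omega> v x = (1/2) *\<^sub>R (weak_jacobian \<Omega> v x + transpose (weak_jacobian \<Omega> v x))"

definition H10 :: "(real^'n) set \<Rightarrow> (real^'n \<Rightarrow> real^'n) set" where
  "H10 \<Omega> = {v \<in> H1 \<Omega>. \<exists>\<phi> :: nat \<Rightarrow> real^'n \<Rightarrow> real^'n.
     (\<forall>m i. test_function \<Omega> (\<lambda>x. \<phi> m x $ i)) \<and>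
     (\<lambda>m. H1_norm \<Omega> (\<lambda>x. v x - \<phi> m x)) \<longlonglongrightarrow> 0}"

text \<open>
  Boundary values of an \<open>H\<^sup>1\<close> function: the trace at a boundary point is the limit of the
  averages of the function over \<open>\<Omega> \<inter> B(x,r)\<close>, in the sense of Lebesgue points. It exists outside
  a set of vanishing \<open>(d-1)\<close>-dimensional Hausdorff measure, and there agrees with the value
  of the usual trace operator.
\<close>

definition surface_null :: "(real^'n) set \<Rightarrow> bool" where
  "surface_null N \<longleftrightarrow> (\<forall>e>0. \<exists>C :: nat \<Rightarrow> (real^'n) set. N \<subseteq> (\<Union>m. C m) \<and>
     (\<forall>m. bounded (C m)) \<and> summable (\<lambda>m. diameter (C m) ^ (CARD('n) - 1)) \<and>
     (\<Sum>m. diameter (C m) ^ (CARD('n) - 1)) < e)"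

definition has_trace_at ::
    "(real^'n) set \<Rightarrow> (real^'n \<Rightarrow> real^'n) \<Rightarrow> real^'n \<Rightarrow> real^'n \<Rightarrow> bool" where
  "has_trace_at \<Omega> v x b \<longleftrightarrow>
     ((\<lambda>r. (LINT y|lebesgue_on (\<Omega> \<inter> ball x r). norm (v y - b)) / measure lebesgue (\<Omega> \<inter> ball x r))
        \<longlongrightarrow> 0) (at_right 0)"

definition W_E :: "(real^'n) set \<Rightarrow> (real^'n) set \<Rightarrow> (real^'n \<Rightarrow> real^'n) set" where
  "W_E \<Omega> \<Gamma>D = {v \<in> H1 \<Omega>. \<exists>N. surface_null N \<and> (\<forall>x\<in>\<Gamma>D - N. has_trace_at \<Omega> v x 0)}"

definition elasticity_form ::
    "(real^'n) set \<Rightarrow> real \<Rightarrow> real \<Rightarrow> (real^'n \<Rightarrow> real^'n) \<Rightarrow> (real^'n \<Rightarrow> real^'n) \<Rightarrow> real" where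
  "elasticity_form \<Omega> lam mu u v =
     (LINT x|lebesgue_on \<Omega>. 2 * mu * (sym_grad \<Omega> u x \<bullet> sym_grad \<Omega> v x)
        + lam * (divergence \<Omega> u x * divergence \<Omega> v x))"


section \<open>Meshes and finite element spaces\<close>

text \<open>
  Elements are closed simplices with disjoint interiors. Since \<open>\<Omega>\<close> is the interior of their union,
  it is a polygonal or polyhedral domain without slits.
\<close>

definition mesh :: "(real^'n) set \<Rightarrow> (real^'n) set set \<Rightarrow> bool" where
  "mesh \<Omega> T \<longleftrightarrow> finite T \<and> (\<forall>K\<in>T. int CARD('n) simplex K) \<and>
     (\<forall>K\<in>T. \<forall>K'\<in>T. K \<noteq> K' \<longrightarrow> interior K \<inter> interior K' = {}) \<and>
     \<Union>T = closure \<Omega> \<and> interior (\<Union>T) = \<Omega>"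

definition mesh_size :: "(real^'n) set set \<Rightarrow> real" where
  "mesh_size T = Max (diameter ` T)"

definition quasi_uniform :: "real \<Rightarrow> (real^'n) set set \<Rightarrow> bool" where
  "quasi_uniform \<sigma> T \<longleftrightarrow> (\<forall>K\<in>T. \<exists>x. cball x (\<sigma> * mesh_size T) \<subseteq> K)"

definition patch :: "(real^'n) set set \<Rightarrow> (real^'n) set \<Rightarrow> (real^'n) set" where
  "patch T K = interior (\<Union>{K'\<in>T. K' \<inter> K \<noteq> {}})"

text \<open>
  Functions on the closure of \<open>\<Omega>\<close> are extended by zero, and piecewise constants, which are
  defined only almost everywhere, are given the value zero off the open elements. Thus different
  members of the spaces below are different as discrete functions.
\<close>

definition P1_space :: "(real^'n) set \<Rightarrow> (real^'n) set set \<Rightarrow> (real^'n \<Rightarrow> real^'n) set" where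
  "P1_space \<Omega> T = {v. continuous_on (closure \<Omega>) v \<and>
     (\<forall>K\<in>T. \<exists>(A :: real^'n^'n) b. \<forall>x\<in>K. v x = A *v x + b) \<and>
     (\<forall>x. x \<notin> closure \<Omega> \<longrightarrow> v x = 0)}"

definition outward_normal :: "(real^'n) set \<Rightarrow> real^'n \<Rightarrow> real^'n \<Rightarrow> bool" where
  "outward_normal \<Omega> x \<nu> \<longleftrightarrow> norm \<nu> = 1 \<and>
     (\<exists>r>0. \<Omega> \<inter> ball x r = {y \<in> ball x r. (y - x) \<bullet> \<nu> < 0})"

definition WE_h ::
    "(real^'n) set \<Rightarrow> (real^'n) set \<Rightarrow> (real^'n) set set \<Rightarrow> (real^'n \<Rightarrow> real^'n) set" where
  "WE_h \<Omega> \<Gamma>D T = {v \<in> P1_space \<Omega> T. \<forall>x\<in>\<Gamma>D. v x = 0}"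

text \<open>The corners and edges of \<open>\<Omega>\<close>, where there is no normal, carry no condition.\<close>

definition WD_h ::
    "(real^'n) set \<Rightarrow> (real^'n) set \<Rightarrow> (real^'n) set set \<Rightarrow> (real^'n \<Rightarrow> real^'n) set" where
  "WD_h \<Omega> \<Gamma>F T =
     {w \<in> P1_space \<Omega> T. \<forall>x\<in>\<Gamma>F. \<forall>\<nu>. outward_normal \<Omega> x \<nu> \<longrightarrow> w x \<bullet> \<nu> = 0}"

definition Q_h ::
    "(real^'n) set \<Rightarrow> (real^'n) set \<Rightarrow> (real^'n) set \<Rightarrow> (real^'n) set set \<Rightarrow> (real^'n \<Rightarrow> real) set" where
  "Q_h \<Omega> \<Gamma>N \<Gamma>P T = {q. (\<forall>K\<in>T. \<exists>c. \<forall>x\<in>interior K. q x = c) \<and>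
     (\<forall>x. x \<notin> (\<Union>K\<in>T. interior K) \<longrightarrow> q x = 0) \<and>
     (\<Gamma>N \<union> \<Gamma>P = {} \<longrightarrow> (LINT x|lebesgue_on \<Omega>. q x) = 0)}"

type_synonym 'n state = "(real^'n \<Rightarrow> real^'n) \<times> (real^'n \<Rightarrow> real^'n) \<times> (real^'n \<Rightarrow> real)"

abbreviation zero_state :: "'n::finite state" where
  "zero_state \<equiv> (\<lambda>_. 0, \<lambda>_. 0, \<lambda>_. 0)"

definition V_h ::
    "(real^'n) set \<Rightarrow> (real^'n) set \<Rightarrow> (real^'n) set \<Rightarrow> (real^'n) set \<Rightarrow> (real^'n) set \<Rightarrow>
     (real^'n) set set \<Rightarrow> 'n state set" where
  "V_h \<Omega> \<Gamma>D \<Gamma>N \<Gamma>P \<Gamma>F T = WE_h \<Omega> \<Gamma>D T \<times> WD_h \<Omega> \<Gamma>F T \<times> Q_h \<Omega> \<Gamma>N \<Gamma>P T"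


section \<open>Stabilization, mesh-dependent norm and bilinear form\<close>

text \<open>
  The sign of the normal is chosen arbitrarily. It affects only the sign of the jump, which cancels
  in the stabilization form.
\<close>

definition face_normal :: "(real^'n) set \<Rightarrow> real^'n" where
  "face_normal F = (SOME \<nu>. norm \<nu> = 1 \<and> (\<forall>x\<in>F. \<forall>y\<in>F. (x - y) \<bullet> \<nu> = 0))"

definition jump :: "real^'n \<Rightarrow> (real^'n \<Rightarrow> real) \<Rightarrow> real^'n \<Rightarrow> real" where
  "jump \<nu> p x = Lim (at_right 0) (\<lambda>t. p (x - t *\<^sub>R \<nu>)) - Lim (at_right 0) (\<lambda>t. p (x + t *\<^sub>R \<nu>))"

text \<open>
  The surface integral over a compact convex subset \<open>F\<close> of a hyperplane is written as the volume
  integral over the right prism of height 1 with mid-section \<open>F\<close>, the integrand being constant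
  in the normal direction: on that prism, \<open>closest_point F\<close> is the orthogonal projection to \<open>F\<close>.
\<close>

definition face_integral :: "(real^'n) set \<Rightarrow> (real^'n \<Rightarrow> real) \<Rightarrow> real" where
  "face_integral F f =
     (LINT y|lebesgue_on {x + t *\<^sub>R face_normal F |x t. x \<in> F \<and> \<bar>t\<bar> \<le> 1/2}. f (closest_point F y))"

definition J_form ::
    "(real^'n) set \<Rightarrow> (real^'n) set set \<Rightarrow> real \<Rightarrow> (real^'n \<Rightarrow> real) \<Rightarrow> (real^'n \<Rightarrow> real) \<Rightarrow> real" where
  "J_form \<Omega> T \<delta> p q = \<delta> * (\<Sum>K\<in>T. \<Sum>F\<in>{F. F facet_of K}.
     face_integral F (\<lambda>x. indicator (- frontier \<Omega>) x *
       (diameter F * jump (face_normal F) p x * jump (face_normal F) q x)))"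

definition J_seminorm :: "(real^'n) set \<Rightarrow> (real^'n) set set \<Rightarrow> real \<Rightarrow> (real^'n \<Rightarrow> real) \<Rightarrow> real" where
  "J_seminorm \<Omega> T \<delta> q = sqrt (J_form \<Omega> T \<delta> q q)"

fun norm_A :: "(real^'n) set \<Rightarrow> (real^'n) set set \<Rightarrow> real \<Rightarrow> real \<Rightarrow> 'n state \<Rightarrow> real" where
  "norm_A \<Omega> T \<delta> dt (v, w, q) =
     sqrt ((H1_norm \<Omega> v)\<^sup>2 + dt\<^sup>2 * (L2_norm \<Omega> (divergence \<Omega> w))\<^sup>2 + dt * (L2_norm \<Omega> w)\<^sup>2
       + (L2_norm \<Omega> q)\<^sup>2 + (J_seminorm \<Omega> T \<delta> q)\<^sup>2)"

fun B_h ::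
    "(real^'n) set \<Rightarrow> real \<Rightarrow> real \<Rightarrow> (real^'n \<Rightarrow> real^'n^'n) \<Rightarrow> (real^'n) set set \<Rightarrow> real \<Rightarrow> real \<Rightarrow>
     'n state \<Rightarrow> 'n state \<Rightarrow> real" where
  "B_h \<Omega> lam mu k T \<delta> dt (u, z, p) (v, w, q) =
     elasticity_form \<Omega> lam mu u v
     + dt * L2_inner \<Omega> (\<lambda>x. matrix_inv (k x) *v z x) w
     - L2_inner \<Omega> p (divergence \<Omega> v) - dt * L2_inner \<Omega> p (divergence \<Omega> w)
     + L2_inner \<Omega> (divergence \<Omega> u) q + dt * L2_inner \<Omega> (divergence \<Omega> z) q
     + J_form \<Omega> T \<delta> p q"


section \<open>Standing assumption on the discrete pressures\<close>

text \<open>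
  The operator \<open>Cl\<close> stands for the Clement projection, of which only the listed properties are
  used. Note that \<open>v \<in> H10 \<Omega>\<close> with divergence \<open>- p\<close> forces \<open>p\<close> to have mean value zero.
\<close>

definition pressure_assumption ::
    "(real^'n) set \<Rightarrow> (real^'n) set \<Rightarrow> (real^'n) set \<Rightarrow> (real^'n) set set \<Rightarrow>
     ((real^'n \<Rightarrow> real^'n) \<Rightarrow> (real^'n \<Rightarrow> real^'n)) \<Rightarrow> real \<Rightarrow> real \<Rightarrow> real \<Rightarrow> bool" where
  "pressure_assumption \<Omega> \<Gamma>N \<Gamma>P T Cl c c' C \<longleftrightarrow>
     (\<forall>v\<in>H1 \<Omega>. Cl v \<in> P1_space \<Omega> T) \<and>
     (\<forall>p\<in>Q_h \<Omega> \<Gamma>N \<Gamma>P T. \<exists>v\<in>H10 \<Omega>.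
        (AE x in lebesgue_on \<Omega>. divergence \<Omega> v x = - p x) \<and>
        H1_norm \<Omega> v \<le> c * L2_norm \<Omega> p \<and>
        Cl v \<in> H10 \<Omega> \<and>
        H1_norm \<Omega> (Cl v) \<le> c' * L2_norm \<Omega> p \<and>
        (\<forall>K\<in>T. L2_norm K (\<lambda>x. v x - Cl v x) \<le> C * mesh_size T * H1_norm (patch T K) v))"

end

theory Submission
  imports Defs
begin

text \<open>
  The pressure is controlled by testing with \<open>(u + \<beta> Cl v\<^sub>p, z, p + \<gamma> \<Delta>t q\<^sub>0)\<close>, where \<open>q\<^sub>0\<close> is the
  piecewise constant divergence of \<open>z\<close>. The term \<open>(p, div (v\<^sub>p - Cl v\<^sub>p))\<close> is integrated by parts
  elementwise: only the interior jumps of \<open>p\<close> remain, and Young's inequality on every facet together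
  with a trace inequality and the approximation property of \<open>Cl\<close> bounds it by a multiple of
  \<open>J(p, p)\<close> plus a small multiple of \<open>\<parallel>p\<parallel>\<^sup>2\<close>. The elementwise integration by parts is obtained from
  a cut-off argument along the hyperplanes that carry the facets. Membership of \<open>Cl v\<^sub>p\<close> in \<open>WE_h\<close>
  holds because a piecewise linear field in \<open>H10\<close> is continuous up to the boundary and vanishes there.
\<close>

text \<open>The mesh axioms ask only for disjoint interiors, so a facet may touch parts of several
  other facets and cannot be matched with one opposite facet. Integration by parts is therefore
  organised by hyperplanes: off their intersections each side of a hyperplane lies in one element or
  outside the mesh. Surface integrals are integrals over prisms of height 1, and stretching a layer
  of width 1/n by the factor n along the normal produces such a prism, so no surface measure has to
  be introduced. The factor \<Delta>t in front of q_0 makes the pairing with div z produce the term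
  \<Delta>t^2 |div z|^2 of the norm; the cross term J(p, q_0) is absorbed by an inverse inequality,
  a further use of quasi-uniformity. If \<Gamma>_N and \<Gamma>_P are empty, q_0 must have mean
  value zero, which says that the flux of z through the boundary vanishes. A state of norm zero, for
  which the test state yields no positive quotient, is treated by comparing some nonzero state with
  its negative.\<close>

section \<open>Lebesgue measure under orthogonal maps and directional stretches\<close>

text \<open>The measure of orthogonal images is taken from the case of a well-ordered index type,
  while the index type here is merely finite. A copy of an initial segment of the naturals supplies
  an order on a type with the same number of elements.\<close>

typedef ('a::finite) ordered_copy = "{..<CARD('a)}"
  by (rule exI[of _ 0]) simp

instantiation ordered_copy :: (finite) linorder
begin

definition "x \<le> y \<longleftrightarrow> Rep_ordered_copy x \<le> Rep_ordered_copy y"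
definition "x < y \<longleftrightarrow> Rep_ordered_copy x < Rep_ordered_copy y"

instance
  by standard (auto simp: less_eq_ordered_copy_def less_ordered_copy_def Rep_ordered_copy_inject)

end

lemma bij_Rep_ordered_copy: "bij_betw (Rep_ordered_copy :: 'a::finite ordered_copy \<Rightarrow> nat) UNIV {..<CARD('a)}"
  by (metis bij_betw_def inj_onI Rep_ordered_copy_inject type_definition.Rep_range
      type_definition_ordered_copy)

instance ordered_copy :: (finite) finite
  by standard (use bij_Rep_ordered_copy bij_betw_finite in blast)

instance ordered_copy :: (finite) wellorder
proof
  fix P :: "'a ordered_copy \<Rightarrow> bool" and a
  assume *: "\<And>x. (\<And>y. y < x \<Longrightarrow> P y) \<Longrightarrow> P x"
  have "\<forall>a. Rep_ordered_copy a = n \<longrightarrow> P a" for n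
    by (induction n rule: less_induct) (metis * less_ordered_copy_def)
  then show "P a" by blast
qed

lemma ordered_copy_bij:
  obtains \<pi> :: "'a::finite \<Rightarrow> 'a ordered_copy" where "bij \<pi>"
proof -
  have "CARD('a) = CARD('a ordered_copy)"
    using bij_betw_same_card[OF bij_Rep_ordered_copy[where 'a='a]] by simp
  then show ?thesis
    using that by (metis finite_same_card_bij finite_code)
qed

text \<open>Lebesgue measure is determined by its values on boxes. The preimage of a box is its
  image under the inverse map, and orthogonal images preserve measure.\<close>

lemma lborel_distr_orthogonal_wellorder:
  fixes f :: "real^'n::{finite,wellorder} \<Rightarrow> real^'n::_"
  assumes f: "orthogonal_transformation f"
  shows "distr lborel borel f = lborel"
proof (rule lborel_eqI[symmetric])
  have meas: "f \<in> borel_measurable borel"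
    using f by (intro borel_measurable_continuous_onI linear_continuous_on)
      (simp add: linear_conv_bounded_linear[symmetric] orthogonal_transformation_linear)
  obtain g :: "real^'n::_ \<Rightarrow> real^'n::_"
    where g: "orthogonal_transformation g" "\<And>x. f (g x) = x" "\<And>x. g (f x) = x"
    using f by (metis orthogonal_transformation_inv orthogonal_transformation_bij bij_inv_eq_iff)
  fix l u :: "real^'n::_" assume le: "\<And>b. b \<in> Basis \<Longrightarrow> l \<bullet> b \<le> u \<bullet> b"
  have "f -` box l u = g ` box l u"
    using g by (auto simp: image_iff) metis
  moreover have "f -` box l u \<in> sets lborel"
    using measurable_sets[OF meas, of "box l u"] by simp
  ultimately have m: "emeasure lborel (f -` box l u) = emeasure lebesgue (g ` box l u)"
    using emeasure_completion[of "f -` box l u" lborel] by simp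
  show "emeasure (distr lborel borel f) (box l u) = (\<Prod>b\<in>Basis. (u - l) \<bullet> b)"
  proof -
    have "emeasure lebesgue (g ` box l u) = ennreal (measure lebesgue (box l u))"
      using measure_orthogonal_image[OF g(1), of "box l u"] measurable_orthogonal_image[OF g(1), of "box l u"]
      by (simp add: emeasure_eq_measure2)
    then show ?thesis
      using meas m le by (simp add: emeasure_distr measure_lborel_box_eq)
  qed
qed simp

text \<open>The preimage of a box is the box with permuted corners, and the product of its side
  lengths does not depend on their order.\<close>

lemma lborel_distr_permute_coordinates:
  fixes \<pi> :: "'m::finite \<Rightarrow> 'n::finite"
  assumes "bij \<pi>"
  shows "distr lborel borel (\<lambda>x :: real^'n. (\<chi> i. x $ \<pi> i) :: real^'m) = lborel"
proof (rule lborel_eqI[symmetric])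
  let ?J = "\<lambda>x :: real^'n. (\<chi> i. x $ \<pi> i) :: real^'m"
  have meas: "?J \<in> borel_measurable borel"
    by (intro borel_measurable_continuous_onI continuous_intros)
  fix l u :: "real^'m" assume le: "\<And>b. b \<in> Basis \<Longrightarrow> l \<bullet> b \<le> u \<bullet> b"
  let ?l = "(\<chi> i. l $ inv \<pi> i) :: real^'n" and ?u = "(\<chi> i. u $ inv \<pi> i) :: real^'n"
  have le': "l $ i \<le> u $ i" for i
    using le[of "axis i 1"] by (simp add: inner_axis axis_in_Basis_iff)
  have "?J -` box l u = box ?l ?u"
    using assms by (auto simp: mem_box_cart) (metis bij_inv_eq_iff)+
  moreover have "(\<Prod>b\<in>Basis. (?u - ?l) \<bullet> b) = (\<Prod>b\<in>Basis. (u - l) \<bullet> b)"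
  proof -
    have *: "(\<Prod>b\<in>Basis. (f::real^'k) \<bullet> b) = (\<Prod>i\<in>UNIV. f $ i)" for f :: "real^'k::finite"
      by (simp add: Basis_vec_def prod.reindex UNION_singleton_eq_range inj_on_def axis_eq_axis inner_axis)
    have "(\<Prod>i\<in>UNIV. (u - l) $ inv \<pi> i) = (\<Prod>i\<in>UNIV. (u - l) $ i)"
      using prod.reindex_bij_betw[OF bij_imp_bij_inv[OF assms], of "\<lambda>i. (u - l) $ i"] by simp
    then show ?thesis unfolding * by simp
  qed
  moreover have "\<forall>b\<in>Basis. ?l \<bullet> b \<le> ?u \<bullet> b"
    using le' by (auto simp: Basis_vec_def inner_axis)
  ultimately show "emeasure (distr lborel borel ?J) (box l u) = (\<Prod>b\<in>Basis. (u - l) \<bullet> b)"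
    using meas by (simp add: emeasure_distr emeasure_lborel_box_eq)
qed simp

text \<open>Conjugation with a relabelling of the coordinates transports the well-ordered case,
  since relabelling preserves both the measure and the norm.\<close>

lemma lborel_distr_orthogonal:
  fixes f :: "real^'n \<Rightarrow> real^'n"
  assumes f: "orthogonal_transformation f"
  shows "distr lborel borel f = lborel"
proof -
  obtain \<pi> :: "'n \<Rightarrow> 'n ordered_copy" where \<pi>: "bij \<pi>" by (rule ordered_copy_bij)
  define J where "J x = (\<chi> i. x $ inv \<pi> i)" for x :: "real^'n"
  define J' where "J' x = (\<chi> i. x $ \<pi> i)" for x :: "real^('n ordered_copy)"
  have JJ': "J (J' x) = x" "J' (J y) = y" for x y
    using \<pi> by (auto simp: J_def J'_def vec_eq_iff bij_is_surj surj_f_inv_f bij_is_inj inv_f_f)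
  have dJ: "distr lborel borel J = lborel" "distr lborel borel J' = lborel"
    unfolding J_def J'_def using \<pi> by (auto intro!: lborel_distr_permute_coordinates bij_imp_bij_inv)
  have lin: "linear J" "linear J'"
    by (auto simp: linear_iff J_def J'_def vec_eq_iff)
  have [measurable]: "J \<in> borel_measurable borel" "J' \<in> borel_measurable borel" "f \<in> borel_measurable borel"
    using lin f by (auto intro!: borel_measurable_continuous_onI linear_continuous_on
      simp: linear_conv_bounded_linear[symmetric] orthogonal_transformation_linear)
  have norm: "norm (J' x) = norm x" for x
  proof -
    have "(\<Sum>i\<in>UNIV. (x $ \<pi> i)\<^sup>2) = (\<Sum>i\<in>UNIV. (x $ i)\<^sup>2)"
      using sum.reindex_bij_betw[OF \<pi>, of "\<lambda>i. (x $ i)\<^sup>2"] by simp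
    then show ?thesis by (simp add: norm_vec_def L2_set_def J'_def)
  qed
  have norm': "norm (J x) = norm x" for x using norm[of "J x"] JJ' by simp
  have "orthogonal_transformation (J \<circ> f \<circ> J')"
    using f lin by (auto simp: orthogonal_transformation norm norm' intro!: linear_compose)
  then have d: "distr lborel borel (J \<circ> f \<circ> J') = lborel"
    by (rule lborel_distr_orthogonal_wellorder)
  have "distr (distr (distr lborel borel J) borel (J \<circ> f \<circ> J')) borel J' = distr lborel borel (J' \<circ> (J \<circ> f \<circ> J') \<circ> J)"
    by (simp add: distr_distr o_assoc)
  also have "J' \<circ> (J \<circ> f \<circ> J') \<circ> J = f"
    by (auto simp: JJ')
  finally show ?thesis unfolding dJ d by simp
qed

text \<open>The map multiplies the signed distance to the hyperplane \<nu> \<bullet> y = c by a and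
  keeps the orthogonal projection. Rotating \<nu> to a coordinate axis makes it a diagonal affine
  map. The case a = 1/n shrinks a slab of width 1 to a layer of width 1/n, and a = -1 is the
  reflection in the hyperplane.\<close>

lemma lborel_directional_stretch:
  fixes \<nu> :: "real^'n"
  assumes \<nu>: "norm \<nu> = 1" and a: "a \<noteq> 0"
  shows "lborel = density (distr lborel borel (\<lambda>y. y + ((a - 1) * (\<nu> \<bullet> y - c)) *\<^sub>R \<nu>)) (\<lambda>_. ennreal \<bar>a\<bar>)"
proof -
  obtain k :: 'n where True by blast
  obtain f :: "real^'n \<Rightarrow> real^'n" where f: "orthogonal_transformation f" "f \<nu> = axis k 1"
    using orthogonal_transformation_exists_1[OF \<nu> norm_axis_1[of k]] by blast
  obtain g :: "real^'n \<Rightarrow> real^'n"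
    where g: "orthogonal_transformation g" "\<And>x. f (g x) = x" "\<And>x. g (f x) = x"
    using f by (metis orthogonal_transformation_inv orthogonal_transformation_bij bij_inv_eq_iff)
  define s where "s j = (if j = axis k 1 then a else 1)" for j :: "real^'n"
  \<comment> \<open>Translation and diagonal part are separated to fit
    \<open>lborel_affine_euclidean\<close>; only the entry along the chosen axis differs from
    1.\<close>
  define D where "D x = (-((a - 1) * c)) *\<^sub>R axis k 1 + (\<Sum>j\<in>Basis. (s j * (x \<bullet> j)) *\<^sub>R j)" for x :: "real^'n"
  have D: "D x = x + ((a - 1) * (axis k 1 \<bullet> x - c)) *\<^sub>R axis k 1" for x
  proof -
    have "(\<Sum>j\<in>Basis. (s j * (x \<bullet> j)) *\<^sub>R j) = (\<Sum>j\<in>Basis. (x \<bullet> j) *\<^sub>R j + (if j = axis k 1 then ((a - 1) * (x \<bullet> j)) *\<^sub>R j else 0))"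
      by (intro sum.cong) (auto simp: s_def algebra_simps)
    also have "\<dots> = x + ((a - 1) * (x \<bullet> axis k 1)) *\<^sub>R axis k 1"
      by (simp add: sum.distrib euclidean_representation sum.delta axis_in_Basis_iff)
    finally show ?thesis by (simp add: D_def algebra_simps inner_commute)
  qed
  have D_density: "lborel = density (distr lborel borel D) (\<lambda>_. ennreal \<bar>a\<bar>)"
  proof -
    have "(\<Prod>j\<in>Basis. \<bar>s j\<bar>) = \<bar>a\<bar>"
      by (simp add: s_def if_distrib prod.delta axis_in_Basis_iff cong: if_cong)
    then show ?thesis
      using lborel_affine_euclidean[of s "(-((a - 1) * c)) *\<^sub>R axis k 1"] a
      unfolding D_def by (simp add: s_def)
  qed
  have lin: "linear f" "linear g" using f g by (auto simp: orthogonal_transformation_linear)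
  have meas: "f \<in> borel_measurable borel" "g \<in> borel_measurable borel"
    using lin by (auto intro!: borel_measurable_continuous_onI linear_continuous_on simp: linear_conv_bounded_linear[symmetric])
  have measD: "D \<in> borel_measurable borel" unfolding D_def by measurable
  have T: "(\<lambda>y. y + ((a - 1) * (\<nu> \<bullet> y - c)) *\<^sub>R \<nu>) = g \<circ> D \<circ> f"
  proof
    fix y
    have "axis k 1 \<bullet> f y = \<nu> \<bullet> y" using f by (metis orthogonal_transformation_def)
    moreover have "g (axis k 1) = \<nu>" using f g by metis
    ultimately show "y + ((a - 1) * (\<nu> \<bullet> y - c)) *\<^sub>R \<nu> = (g \<circ> D \<circ> f) y"
      using lin g by (simp add: D linear_add linear_scale)
  qed
  have "distr lborel borel (g \<circ> D \<circ> f) = distr (distr (distr lborel borel f) borel D) borel g"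
    using meas measD by (simp add: distr_distr o_assoc)
  also have "\<dots> = distr (distr lborel borel D) borel g"
    using lborel_distr_orthogonal[OF f(1)] by simp
  finally have "density (distr lborel borel (g \<circ> D \<circ> f)) (\<lambda>_. ennreal \<bar>a\<bar>) =
      distr (density (distr lborel borel D) (\<lambda>_. ennreal \<bar>a\<bar>)) borel g"
    using meas measD by (simp add: density_distr)
  then show ?thesis
    unfolding T D_density[symmetric] using lborel_distr_orthogonal[OF g(1)] by simp
qed

lemma
  fixes \<nu> :: "real^'n" and f :: "real^'n \<Rightarrow> real"
  assumes \<nu>: "norm \<nu> = 1" and a: "a \<noteq> 0" and f[measurable]: "f \<in> borel_measurable borel"
  shows integral_directional_stretch:
      "(LINT y|lborel. f (y + ((a - 1) * (\<nu> \<bullet> y - c)) *\<^sub>R \<nu>)) * \<bar>a\<bar> = (LINT x|lborel. f x)"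
    and integrable_directional_stretch:
      "integrable lborel (\<lambda>y. f (y + ((a - 1) * (\<nu> \<bullet> y - c)) *\<^sub>R \<nu>)) \<longleftrightarrow> integrable lborel f"
proof -
  show "(LINT y|lborel. f (y + ((a - 1) * (\<nu> \<bullet> y - c)) *\<^sub>R \<nu>)) * \<bar>a\<bar> = (LINT x|lborel. f x)"
    by (subst (2) lborel_directional_stretch[OF \<nu> a, of c])
      (simp add: integral_density integral_distr)
  show "integrable lborel (\<lambda>y. f (y + ((a - 1) * (\<nu> \<bullet> y - c)) *\<^sub>R \<nu>)) \<longleftrightarrow> integrable lborel f"
    by (subst (2) lborel_directional_stretch[OF \<nu> a, of c])
      (simp add: integrable_density integrable_distr_eq a)
qed

section \<open>Bounded convergence for Lebesgue measure\<close>

lemma borel_measurable_lebesgue_AE_cong: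
  fixes f g :: "'a::euclidean_space \<Rightarrow> 'b::topological_space"
  assumes f: "f \<in> borel_measurable lebesgue" and eq: "AE x in lebesgue. f x = g x"
  shows "g \<in> borel_measurable lebesgue"
proof (rule measurableI)
  fix A :: "'b set" assume A: "A \<in> sets borel"
  have "AE x in lebesgue. x \<in> f -` A \<longleftrightarrow> x \<in> g -` A" using eq by eventually_elim simp
  moreover have "f -` A \<in> sets lebesgue" using measurable_sets[OF f A] by simp
  ultimately show "g -` A \<inter> space lebesgue \<in> sets lebesgue"
    using completion.in_sets_AE[of "f -` A" "g -` A" lborel] by simp
qed simp

lemma borel_measurable_lebesgueI: "f \<in> borel_measurable borel \<Longrightarrow> f \<in> borel_measurable lebesgue"
  by (simp add: measurable_completion)

lemma integrable_lebesgue_bounded: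
  fixes f :: "'a::euclidean_space \<Rightarrow> 'b::euclidean_space"
  assumes f: "f \<in> borel_measurable lebesgue"
    and B: "\<And>x. norm (f x) \<le> B" and R: "\<And>x. norm x > R \<Longrightarrow> f x = 0"
  shows "integrable lebesgue f"
proof (rule Bochner_Integration.integrable_bound)
  show "integrable lebesgue (\<lambda>x::'a. B * indicator (cball 0 R) x)"
    by (intro integrable_mult_right integrable_real_indicator) (use emeasure_bounded_finite[OF bounded_cball, of 0 R] in auto)
  show "AE x in lebesgue. norm (f x) \<le> norm (B * indicator (cball 0 R) x)"
  proof (rule AE_I2)
    fix x show "norm (f x) \<le> norm (B * indicator (cball 0 R) x)"
      using B[of x] R[of x] by (auto simp: indicator_def)
  qed
qed (fact f)

text \<open>Measurability of \<open>f\<close> is a conclusion: an almost everywhere limit of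
  measurable functions is measurable because Lebesgue measure is complete. In this way jumps that
  are known only as pointwise limits turn out to be integrable.\<close>

lemma
  fixes f :: "'a::euclidean_space \<Rightarrow> real"
  assumes s: "\<And>i. s i \<in> borel_measurable lebesgue"
    and B: "\<And>i x. norm (s i x) \<le> B" and R: "\<And>i x. norm x > R \<Longrightarrow> s i x = 0"
    and lim: "AE x in lebesgue. (\<lambda>i. s i x) \<longlonglongrightarrow> f x"
  shows borel_measurable_lebesgue_bounded_limit: "f \<in> borel_measurable lebesgue"
    and integrable_lebesgue_bounded_limit: "integrable lebesgue f"
    and lebesgue_bounded_convergence: "(\<lambda>i. LINT x|lebesgue. s i x) \<longlonglongrightarrow> (LINT x|lebesgue. f x)"
proof -
  show meas: "f \<in> borel_measurable lebesgue"
  proof (rule borel_measurable_lebesgue_AE_cong)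
    show "(\<lambda>x. lim (\<lambda>i. s i x)) \<in> borel_measurable lebesgue"
      using s by (rule borel_measurable_lim_metric)
    show "AE x in lebesgue. lim (\<lambda>i. s i x) = f x"
      using lim by eventually_elim (rule limI)
  qed
  have w: "integrable lebesgue (\<lambda>x::'a. B * indicator (cball 0 R) x)"
    by (intro integrable_mult_right integrable_real_indicator) (use emeasure_bounded_finite[OF bounded_cball, of 0 R] in auto)
  have dom: "AE x in lebesgue. norm (s i x) \<le> B * indicator (cball 0 R) x" for i
    using B[of i] R[of _ i] by (intro AE_I2) (auto simp: indicator_def)
  show "integrable lebesgue f"
    by (rule integrable_dominated_convergence[OF meas s w lim dom])
  show "(\<lambda>i. LINT x|lebesgue. s i x) \<longlonglongrightarrow> (LINT x|lebesgue. f x)"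
    by (rule integral_dominated_convergence[OF meas s w lim dom])
qed

lemma AE_lebesgue_not_hyperplane:
  fixes a :: "'a::euclidean_space"
  assumes "a \<noteq> 0 \<or> b \<noteq> 0"
  shows "AE x in lebesgue. a \<bullet> x \<noteq> b"
  using negligible_hyperplane[OF assms] AE_not_in[of "{x. a \<bullet> x = b}" lebesgue]
  by (simp add: negligible_iff_null_sets)

lemma integral_lebesgue_translate:
  fixes f :: "'a::euclidean_space \<Rightarrow> real"
  assumes f[measurable]: "f \<in> borel_measurable borel"
  shows "(LINT x|lebesgue. f (x + a)) = (LINT x|lebesgue. f x)"
proof -
  have "(LINT x|lebesgue. f x) = (LINT x|distr lborel borel (\<lambda>x. a + x). f x)"
    by (simp add: integral_completion lborel_distr_plus)
  also have "\<dots> = (LINT x|lebesgue. f (x + a))"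
    by (simp add: integral_distr integral_completion add.commute)
  finally show ?thesis by simp
qed

text \<open>The fundamental theorem of calculus tolerates finitely many points without derivative.
  Along a line these will be the crossings with the hyperplanes and the kinks of the cut-off
  functions.\<close>

lemma lipschitz_along_line:
  fixes f f' :: "real \<Rightarrow> real"
  assumes S: "finite S" and t: "0 \<le> t"
    and cont: "continuous_on {0..t} f"
    and der: "\<And>\<tau>. \<tau> \<in> {0..t} - S \<Longrightarrow> (f has_real_derivative f' \<tau>) (at \<tau>)"
    and L: "\<And>\<tau>. \<tau> \<in> {0..t} - S \<Longrightarrow> \<bar>f' \<tau>\<bar> \<le> L" "0 \<le> L"
  shows "\<bar>f t - f 0\<bar> \<le> L * t"
proof -
  let ?g = "\<lambda>\<tau>. if \<tau> \<in> S then 0 else f' \<tau>"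
  have "(?g has_integral (f t - f 0)) {0..t}"
    using der by (intro fundamental_theorem_of_calculus_strong[OF S t _ cont])
      (auto simp: has_real_derivative_iff_has_vector_derivative)
  then have "norm (f t - f 0) \<le> L * measure lborel (cbox 0 t)"
    using L by (intro has_integral_bound[of L ?g]) auto
  then show ?thesis using t by simp
qed

section \<open>Integration by parts across finitely many hyperplanes\<close>

definition hyperplane_proj :: "('h \<Rightarrow> 'a::real_inner) \<Rightarrow> ('h \<Rightarrow> real) \<Rightarrow> 'h \<Rightarrow> 'a \<Rightarrow> 'a" where
  "hyperplane_proj \<nu> c H y = y - (\<nu> H \<bullet> y - c H) *\<^sub>R \<nu> H"

text \<open>The product of the functions \<open>layer\<close> vanishes on all hyperplanes; as the width \<open>1/n\<close> of the
  layers tends to zero, its derivative concentrates on them.\<close>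

context
  fixes HH :: "(real^'n) set set" and \<nu> :: "(real^'n) set \<Rightarrow> real^'n" and c :: "(real^'n) set \<Rightarrow> real"
    and g dg :: "real^'n \<Rightarrow> real" and e :: "real^'n" and M R :: real
  assumes fin: "finite HH"
    and unit: "\<And>H. H \<in> HH \<Longrightarrow> norm (\<nu> H) = 1"
    and hyp: "\<And>H. H \<in> HH \<Longrightarrow> H = {x. \<nu> H \<bullet> x = c H}"
    and g[measurable]: "g \<in> borel_measurable borel" and dg[measurable]: "dg \<in> borel_measurable borel"
    and g_bound: "\<And>x. \<bar>g x\<bar> \<le> M" and dg_bound: "\<And>x. \<bar>dg x\<bar> \<le> M"
    and support: "\<And>x. norm x > R \<Longrightarrow> g x = 0" "\<And>x. norm x > R \<Longrightarrow> dg x = 0"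
    and deriv: "\<And>x. x \<notin> \<Union>HH \<Longrightarrow> ((\<lambda>t. g (x + t *\<^sub>R e)) has_real_derivative dg x) (at 0)"
begin

text \<open>The factor 2 makes the full width of the layer, both sides together, equal to 1/n.
  Stretched by n it becomes the slab of half-width 1/2 that underlies
  \<open>face_integral\<close>.\<close>

definition layer :: "real \<Rightarrow> (real^'n) set \<Rightarrow> real^'n \<Rightarrow> real" where
  "layer n H x = min 1 (2 * n * \<bar>\<nu> H \<bullet> x - c H\<bar>)"

definition dlayer :: "real \<Rightarrow> (real^'n) set \<Rightarrow> real^'n \<Rightarrow> real" where
  "dlayer n H x = (if 2 * n * \<bar>\<nu> H \<bullet> x - c H\<bar> < 1 then 2 * n * sgn (\<nu> H \<bullet> x - c H) else 0)"

text \<open>Excluded are the hyperplanes themselves and the kinks of \<open>layer\<close> at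
  distance 1/(2n), so that \<open>cut n\<close> is differentiable along e at the remaining
  points.\<close>

definition generic :: "real \<Rightarrow> real^'n \<Rightarrow> bool" where
  "generic n x \<longleftrightarrow> (\<forall>H\<in>HH. \<nu> H \<bullet> x \<noteq> c H \<and> 2 * n * \<bar>\<nu> H \<bullet> x - c H\<bar> \<noteq> 1)"

definition cut :: "real \<Rightarrow> real^'n \<Rightarrow> real" where
  "cut n x = (\<Prod>H\<in>HH. layer n H x) * g x"

definition dcut :: "real \<Rightarrow> real^'n \<Rightarrow> real" where
  "dcut n x = (\<Prod>H\<in>HH. layer n H x) * dg x +
     (\<Sum>H\<in>HH. (\<nu> H \<bullet> e) * (dlayer n H x * (\<Prod>H'\<in>HH - {H}. layer n H' x) * g x))"

lemma layer_bounds: "0 \<le> n \<Longrightarrow> 0 \<le> layer n H x" "layer n H x \<le> 1"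
  by (auto simp: layer_def)

lemma prod_layer_bounds: "0 \<le> n \<Longrightarrow> 0 \<le> (\<Prod>H\<in>X. layer n H x)" "0 \<le> n \<Longrightarrow> (\<Prod>H\<in>X. layer n H x) \<le> 1"
  by (auto intro!: prod_nonneg prod_le_1 layer_bounds)

lemma layer_measurable[measurable]: "layer n H \<in> borel_measurable borel" "dlayer n H \<in> borel_measurable borel"
  unfolding layer_def dlayer_def by measurable

lemma generic_not_in: "generic n x \<Longrightarrow> x \<notin> \<Union>HH"
  using hyp by (auto simp: generic_def)

lemma AE_generic:
  assumes "n > 0"
  shows "AE x in lebesgue. generic n x"
proof -
  have "AE x in lebesgue. \<nu> H \<bullet> x \<noteq> c H \<and> 2 * n * \<bar>\<nu> H \<bullet> x - c H\<bar> \<noteq> 1" if "H \<in> HH" for H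
  proof -
    have nz: "\<nu> H \<noteq> 0" using unit[OF that] by auto
    have "AE x in lebesgue. \<nu> H \<bullet> x \<noteq> b" for b
      using nz by (intro AE_lebesgue_not_hyperplane) simp
    from this[of "c H"] this[of "c H + 1 / (2 * n)"] this[of "c H - 1 / (2 * n)"]
    show ?thesis
      by eventually_elim (use assms in \<open>auto simp: field_simps abs_if split: if_splits\<close>)
  qed
  then show ?thesis
    unfolding generic_def using fin by (intro AE_finite_allI) auto
qed

lemma deriv_layer:
  assumes "H \<in> HH" "generic n x" "n > 0"
  shows "((\<lambda>t. layer n H (x + t *\<^sub>R e)) has_real_derivative (\<nu> H \<bullet> e) * dlayer n H x) (at 0)"
proof -
  let ?s = "\<nu> H \<bullet> x - c H"
  let ?f = "\<lambda>t. 2 * n * \<bar>?s + t * (\<nu> H \<bullet> e)\<bar>"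
  have s: "?s \<noteq> 0" "2 * n * \<bar>?s\<bar> \<noteq> 1" using assms by (auto simp: generic_def)
  have eq: "layer n H (x + t *\<^sub>R e) = min 1 (?f t)" for t
    by (simp add: layer_def inner_add_right algebra_simps)
  have id: "((\<lambda>t::real. t) \<longlongrightarrow> 0) (nhds 0)" by (rule filterlim_ident)
  have cont: "(?f \<longlongrightarrow> 2 * n * \<bar>?s\<bar>) (nhds 0)"
    using id by (auto intro!: tendsto_eq_intros)
  have d: "(?f has_real_derivative 2 * n * sgn ?s * (\<nu> H \<bullet> e)) (at 0)"
  proof -
    have "((\<lambda>t. ?s + t * (\<nu> H \<bullet> e)) \<longlongrightarrow> ?s) (nhds 0)"
      using id by (auto intro!: tendsto_eq_intros)
    note lim = order_tendstoD[OF this, of 0]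
    have "\<forall>\<^sub>F t in nhds 0. sgn (?s + t * (\<nu> H \<bullet> e)) = sgn ?s"
    proof (cases "?s > 0")
      case True
      from lim(1)[OF this] show ?thesis by eventually_elim (use True in simp)
    next
      case False
      then have "?s < 0" using s by simp
      from lim(2)[OF this] show ?thesis by eventually_elim (use \<open>?s < 0\<close> in simp)
    qed
    then have "\<forall>\<^sub>F t in nhds 0. ?f t = 2 * n * (sgn ?s * (?s + t * (\<nu> H \<bullet> e)))"
      by eventually_elim (metis abs_sgn mult.commute)
    moreover have "((\<lambda>t. 2 * n * (sgn ?s * (?s + t * (\<nu> H \<bullet> e)))) has_real_derivative 2 * n * sgn ?s * (\<nu> H \<bullet> e)) (at 0)"
      by (auto intro!: derivative_eq_intros)
    ultimately show ?thesis by (subst DERIV_cong_ev[OF refl _ refl])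
  qed
  show ?thesis
  proof (cases "2 * n * \<bar>?s\<bar> < 1")
    case True
    then have "\<forall>\<^sub>F t in nhds 0. ?f t < 1" by (rule order_tendstoD(2)[OF cont])
    then have "\<forall>\<^sub>F t in nhds 0. layer n H (x + t *\<^sub>R e) = ?f t"
      by eventually_elim (simp add: eq)
    then show ?thesis
      using d True by (subst DERIV_cong_ev[OF refl _ refl]) (auto simp: dlayer_def mult_ac)
  next
    case False
    then have "2 * n * \<bar>?s\<bar> > 1" using s by simp
    then have "\<forall>\<^sub>F t in nhds 0. ?f t > 1" by (rule order_tendstoD(1)[OF cont])
    then have "\<forall>\<^sub>F t in nhds 0. layer n H (x + t *\<^sub>R e) = 1"
      by eventually_elim (simp add: eq)
    then show ?thesis
      using False by (subst DERIV_cong_ev[OF refl _ refl]) (auto simp: dlayer_def)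
  qed
qed

lemma deriv_cut:
  assumes "generic n x" "n > 0"
  shows "((\<lambda>t. cut n (x + t *\<^sub>R e)) has_real_derivative dcut n x) (at 0)"
proof -
  have "((\<lambda>t. \<Prod>H\<in>HH. layer n H (x + t *\<^sub>R e)) has_real_derivative
     (\<Sum>H\<in>HH. ((\<nu> H \<bullet> e) * dlayer n H x) * (\<Prod>H'\<in>HH - {H}. layer n H' (x + 0 *\<^sub>R e)))) (at 0)"
    using assms by (intro has_field_derivative_prod deriv_layer)
  from DERIV_mult[OF this deriv[OF generic_not_in[OF assms(1)]]] show ?thesis
    by (simp add: cut_def dcut_def sum_distrib_left sum_distrib_right mult_ac add.commute)
qed

text \<open>\<open>g\<close> may jump across a hyperplane, but there one factor of the product
  vanishes while the other factors and \<open>g\<close> stay bounded.\<close>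

lemma cut_continuous:
  assumes "n > 0"
  shows "isCont (\<lambda>t. cut n (x + t *\<^sub>R e)) \<tau>"
proof (cases "x + \<tau> *\<^sub>R e \<in> \<Union>HH")
  case False
  from deriv[OF this] have "((\<lambda>t. g (x + t *\<^sub>R e)) has_real_derivative dg (x + \<tau> *\<^sub>R e)) (at \<tau>)"
    using DERIV_shift[of "\<lambda>t. g (x + t *\<^sub>R e)" _ 0 \<tau>] by (simp add: algebra_simps)
  then have "isCont (\<lambda>t. g (x + t *\<^sub>R e)) \<tau>"
    by (rule DERIV_isCont)
  then show ?thesis
    unfolding cut_def layer_def by (intro continuous_intros) auto
next
  case True
  then obtain H where H: "H \<in> HH" "\<nu> H \<bullet> (x + \<tau> *\<^sub>R e) = c H" using hyp by blast
  have zero: "cut n (x + \<tau> *\<^sub>R e) = 0"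
    using H fin by (auto simp: cut_def layer_def intro!: bexI[of _ H])
  have bound: "\<bar>cut n y\<bar> \<le> layer n H y * M" for y
  proof -
    have "\<bar>cut n y\<bar> = layer n H y * ((\<Prod>H'\<in>HH - {H}. layer n H' y) * \<bar>g y\<bar>)"
      using H fin assms by (simp add: cut_def abs_mult prod.remove layer_bounds prod_layer_bounds)
    also have "\<dots> \<le> layer n H y * (1 * M)"
      using assms g_bound by (intro mult_left_mono mult_mono prod_layer_bounds layer_bounds) auto
    finally show ?thesis by simp
  qed
  have "((\<lambda>t. layer n H (x + t *\<^sub>R e) * M) \<longlongrightarrow> layer n H (x + \<tau> *\<^sub>R e) * M) (at \<tau>)"
    unfolding layer_def by (intro tendsto_intros)
  moreover have "layer n H (x + \<tau> *\<^sub>R e) * M = 0" using H by (simp add: layer_def)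
  ultimately have "((\<lambda>t. layer n H (x + t *\<^sub>R e) * M) \<longlongrightarrow> 0) (at \<tau>)" by simp
  then have "((\<lambda>t. cut n (x + t *\<^sub>R e)) \<longlongrightarrow> 0) (at \<tau>)"
    by (rule Lim_null_comparison[rotated]) (simp add: bound)
  then show ?thesis by (simp add: isCont_def zero)
qed

lemma dcut_bound:
  assumes "n > 0"
  shows "\<bar>dcut n x\<bar> \<le> M + (\<Sum>H\<in>HH. \<bar>\<nu> H \<bullet> e\<bar> * (2 * n * M))"
proof -
  have M: "0 \<le> M" using g_bound[of 0] by simp
  have "\<bar>(\<Prod>H\<in>HH. layer n H x) * dg x\<bar> \<le> 1 * M"
    unfolding abs_mult using assms dg_bound[of x] M
    by (intro mult_mono) (auto simp: prod_layer_bounds)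
  moreover have "\<bar>(\<Sum>H\<in>HH. (\<nu> H \<bullet> e) * (dlayer n H x * (\<Prod>H'\<in>HH - {H}. layer n H' x) * g x))\<bar>
      \<le> (\<Sum>H\<in>HH. \<bar>\<nu> H \<bullet> e\<bar> * (2 * n * M))"
  proof (rule order_trans[OF sum_abs sum_mono])
    fix H
    have d: "\<bar>dlayer n H x\<bar> \<le> 2 * n" using assms by (auto simp: dlayer_def abs_mult sgn_if)
    have "\<bar>dlayer n H x * (\<Prod>H'\<in>HH - {H}. layer n H' x) * g x\<bar> \<le> 2 * n * 1 * M"
      unfolding abs_mult using assms d g_bound[of x] M
      by (intro mult_mono) (auto simp: prod_layer_bounds)
    then show "\<bar>(\<nu> H \<bullet> e) * (dlayer n H x * (\<Prod>H'\<in>HH - {H}. layer n H' x) * g x)\<bar> \<le> \<bar>\<nu> H \<bullet> e\<bar> * (2 * n * M)"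
      unfolding abs_mult[of "\<nu> H \<bullet> e"] by (intro mult_left_mono) auto
  qed
  ultimately show ?thesis unfolding dcut_def by linarith
qed

text \<open>The Lipschitz constant grows with n, which is harmless: it only has to dominate
  difference quotients while n is held fixed.\<close>

lemma cut_lipschitz:
  assumes "generic n x" "n > 0" "0 \<le> t"
  shows "\<bar>cut n (x + t *\<^sub>R e) - cut n x\<bar> \<le> (M + (\<Sum>H\<in>HH. \<bar>\<nu> H \<bullet> e\<bar> * (2 * n * M))) * t"
proof -
  have M: "0 \<le> M" using g_bound[of 0] by simp
  define S where "S = {\<tau>. \<not> generic n (x + \<tau> *\<^sub>R e)}"
  have "S \<subseteq> (\<Union>H\<in>HH. {\<tau>. \<nu> H \<bullet> e \<noteq> 0 \<and> \<tau> \<in> {(c H - \<nu> H \<bullet> x) / (\<nu> H \<bullet> e),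
      (c H + 1 / (2 * n) - \<nu> H \<bullet> x) / (\<nu> H \<bullet> e), (c H - 1 / (2 * n) - \<nu> H \<bullet> x) / (\<nu> H \<bullet> e)}})"
  proof
    fix \<tau> assume "\<tau> \<in> S"
    then obtain H where H: "H \<in> HH" "\<nu> H \<bullet> (x + \<tau> *\<^sub>R e) = c H \<or> 2 * n * \<bar>\<nu> H \<bullet> (x + \<tau> *\<^sub>R e) - c H\<bar> = 1"
      by (auto simp: S_def generic_def)
    \<comment> \<open>If e were parallel to \<open>H\<close>, the signed distance to
      \<open>H\<close> would be constant on the line and x itself would fail to be generic.\<close>
    have ne: "\<nu> H \<bullet> e \<noteq> 0"
      using H assms(1) by (auto simp: generic_def inner_add_right)
    from H(2) have "\<nu> H \<bullet> x + \<tau> * (\<nu> H \<bullet> e) \<in> {c H, c H + 1 / (2 * n), c H - 1 / (2 * n)}"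
      using assms(2) by (auto simp: inner_add_right field_simps abs_if split: if_splits)
    then show "\<tau> \<in> (\<Union>H\<in>HH. {\<tau>. \<nu> H \<bullet> e \<noteq> 0 \<and> \<tau> \<in> {(c H - \<nu> H \<bullet> x) / (\<nu> H \<bullet> e),
      (c H + 1 / (2 * n) - \<nu> H \<bullet> x) / (\<nu> H \<bullet> e), (c H - 1 / (2 * n) - \<nu> H \<bullet> x) / (\<nu> H \<bullet> e)}})"
      using H(1) ne by (intro UN_I[of H]) (auto simp: nonzero_eq_divide_eq)
  qed
  then have S: "finite S"
    by (rule finite_subset) (use fin in auto)
  have "\<bar>cut n (x + t *\<^sub>R e) - cut n (x + 0 *\<^sub>R e)\<bar> \<le> (M + (\<Sum>H\<in>HH. \<bar>\<nu> H \<bullet> e\<bar> * (2 * n * M))) * t"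
  proof (rule lipschitz_along_line[OF S assms(3)])
    show "continuous_on {0..t} (\<lambda>t. cut n (x + t *\<^sub>R e))"
      using cut_continuous[OF assms(2)] by (intro continuous_at_imp_continuous_on) blast
    fix \<tau> assume "\<tau> \<in> {0..t} - S"
    then have "generic n (x + \<tau> *\<^sub>R e)" by (simp add: S_def)
    from deriv_cut[OF this assms(2)]
    show "((\<lambda>t. cut n (x + t *\<^sub>R e)) has_real_derivative dcut n (x + \<tau> *\<^sub>R e)) (at \<tau>)"
      using DERIV_shift[of "\<lambda>t. cut n (x + t *\<^sub>R e)" _ 0 \<tau>] by (simp add: algebra_simps)
  qed (use M assms dcut_bound in \<open>auto intro!: add_nonneg_nonneg sum_nonneg\<close>)
  then show ?thesis by simp
qed

lemma cut_measurable[measurable]: "cut n \<in> borel_measurable borel" "dcut n \<in> borel_measurable borel"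
  unfolding cut_def dcut_def by measurable

text \<open>By translation invariance every difference quotient of \<open>cut n\<close> integrates
  to 0, and the quotients converge boundedly to \<open>dcut n\<close> at generic points.\<close>

lemma integral_dcut:
  assumes n: "n > 0"
  shows "(LINT x|lebesgue. dcut n x) = 0"
proof -
  define L where "L = M + (\<Sum>H\<in>HH. \<bar>\<nu> H \<bullet> e\<bar> * (2 * n * M))"
  define E where "E = {x. generic n x}"
  have [measurable]: "E \<in> sets borel" unfolding E_def generic_def using fin by measurable
  \<comment> \<open>The Lipschitz bound holds at generic points; the quotient is replaced by 0 on
    the remaining null set.\<close>
  define q where "q i x = indicator E x * ((cut n (x + (1 / real (Suc i)) *\<^sub>R e) - cut n x) * real (Suc i))" for i x
  have "(\<lambda>i. LINT x|lebesgue. q i x) \<longlonglongrightarrow> (LINT x|lebesgue. dcut n x)"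
  proof (rule lebesgue_bounded_convergence[where B = L and R = "R + norm e"])
    show "q i \<in> borel_measurable lebesgue" for i
      unfolding q_def by (intro borel_measurable_lebesgueI) measurable
    show "norm (q i x) \<le> L" for i x
    proof (cases "generic n x")
      case True
      from cut_lipschitz[OF this n, of "1 / real (Suc i)"]
      have "\<bar>cut n (x + (1 / real (Suc i)) *\<^sub>R e) - cut n x\<bar> \<le> L * (1 / real (Suc i))"
        by (simp add: L_def)
      then have "\<bar>cut n (x + (1 / real (Suc i)) *\<^sub>R e) - cut n x\<bar> * real (Suc i) \<le> L"
        by (simp add: field_simps)
      then show ?thesis using True by (simp add: q_def abs_mult E_def)
    next
      case False
      have "0 \<le> L" using n g_bound[of 0] by (auto simp: L_def intro!: add_nonneg_nonneg sum_nonneg)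
      with False show ?thesis by (simp add: q_def E_def)
    qed
    show "q i x = 0" if x: "norm x > R + norm e" for i x
    proof -
      have "norm ((1 / real (Suc i)) *\<^sub>R e) \<le> norm e"
        by (simp add: divide_simps mult_le_cancel_left1)
      then have "norm (x + (1 / real (Suc i)) *\<^sub>R e) > R"
        using x norm_diff_ineq[of x "(1 / real (Suc i)) *\<^sub>R e"] by linarith
      moreover have "norm x > R" using x norm_ge_zero[of e] by linarith
      ultimately show ?thesis by (simp add: q_def cut_def support)
    qed
    show "AE x in lebesgue. (\<lambda>i. q i x) \<longlonglongrightarrow> dcut n x"
      using AE_generic[OF n]
    proof eventually_elim
      case (elim x)
      have "(\<lambda>i. (cut n (x + (0 + 1 / real (Suc i)) *\<^sub>R e) - cut n (x + 0 *\<^sub>R e)) / (1 / real (Suc i))) \<longlonglongrightarrow> dcut n x"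
        using deriv_cut[OF elim n] unfolding DERIV_def
        by (rule filterlim_compose)
          (use LIMSEQ_inverse_real_of_nat in \<open>auto simp: filterlim_at inverse_eq_divide\<close>)
      then show ?case using elim by (simp add: q_def E_def)
    qed
  qed
  moreover have "(LINT x|lebesgue. q i x) = 0" for i
  proof -
    have int: "integrable lebesgue (cut n)"
    proof (rule integrable_lebesgue_bounded)
      show "norm (cut n x) \<le> M" for x
        using n g_bound[of x] mult_mono[OF prod_layer_bounds(2)[of n x HH] g_bound[of x]]
        by (simp add: cut_def abs_mult prod_layer_bounds)
      show "norm x > R \<Longrightarrow> cut n x = 0" for x by (simp add: cut_def support)
    qed (intro borel_measurable_lebesgueI, measurable)
    have int': "integrable lebesgue (\<lambda>x. cut n (x + a))" for a
    proof (rule integrable_lebesgue_bounded)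
      show "norm (cut n (x + a)) \<le> M" for x
        using n g_bound[of "x + a"] mult_mono[OF prod_layer_bounds(2)[of n "x + a" HH] g_bound[of "x + a"]]
        by (simp add: cut_def abs_mult prod_layer_bounds)
      show "norm x > R + norm a \<Longrightarrow> cut n (x + a) = 0" for x
        using norm_diff_ineq[of x a] by (simp add: cut_def support)
    qed (intro borel_measurable_lebesgueI, measurable)
    have "(LINT x|lebesgue. q i x) = (LINT x|lebesgue. (cut n (x + (1 / real (Suc i)) *\<^sub>R e) - cut n x) * real (Suc i))"
    proof (rule integral_cong_AE)
      show "AE x in lebesgue. q i x = (cut n (x + (1 / real (Suc i)) *\<^sub>R e) - cut n x) * real (Suc i)"
        using AE_generic[OF n] by eventually_elim (simp add: q_def E_def)
    qed (unfold q_def, (intro borel_measurable_lebesgueI, measurable)+)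
    also have "\<dots> = 0"
      using int int' by (simp add: integral_lebesgue_translate)
    finally show ?thesis .
  qed
  ultimately show ?thesis by (simp add: LIMSEQ_const_iff)
qed

text \<open>Equality from some index on, and not merely in the limit, allows finitely many layers to
  be treated at once.\<close>

lemma layer_tendsto:
  assumes a: "a \<noteq> 0" and "(\<lambda>i. \<nu> H \<bullet> x i - c H) \<longlonglongrightarrow> a"
  shows "\<forall>\<^sub>F i in sequentially. layer (real (Suc i)) H (x i) = 1"
proof -
  have "\<forall>\<^sub>F i in sequentially. \<bar>a\<bar> / 2 < \<bar>\<nu> H \<bullet> x i - c H\<bar>"
    using tendsto_rabs[OF assms(2)] a by (intro order_tendstoD(1)) auto
  moreover have "\<forall>\<^sub>F i in sequentially. 1 / \<bar>a\<bar> < real (Suc i)"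
    using filterlim_compose[OF filterlim_real_sequentially filterlim_Suc]
    by (simp add: filterlim_at_top_dense)
  ultimately show ?thesis
  proof eventually_elim
    case (elim i)
    let ?d = "\<nu> H \<bullet> x i - c H"
    have "1 < real (Suc i) * \<bar>a\<bar>" using elim(2) a by (simp add: field_simps)
    also have "\<dots> \<le> real (Suc i) * (2 * \<bar>?d\<bar>)" using elim(1) by (intro mult_left_mono) auto
    finally have "1 < 2 * real (Suc i) * \<bar>?d\<bar>" by (simp add: algebra_simps)
    then show ?case unfolding layer_def by linarith
  qed
qed

text \<open>The points may move with the index: the layers of the other hyperplanes are evaluated at
  points that approach one hyperplane along its normal.\<close>

lemma prod_layer_tendsto:
  assumes X: "X \<subseteq> HH" and x: "x \<longlonglongrightarrow> y" and y: "y \<notin> \<Union>X"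
  shows "\<forall>\<^sub>F i in sequentially. (\<Prod>H\<in>X. layer (real (Suc i)) H (x i)) = 1"
proof -
  have "\<forall>\<^sub>F i in sequentially. layer (real (Suc i)) H (x i) = 1" if "H \<in> X" for H
  proof -
    have "H \<in> HH" "y \<notin> H" using that X y by auto
    then have "\<nu> H \<bullet> y - c H \<noteq> 0" using hyp by auto
    moreover have "(\<lambda>i. \<nu> H \<bullet> x i - c H) \<longlonglongrightarrow> \<nu> H \<bullet> y - c H"
      by (intro tendsto_intros x)
    ultimately show ?thesis by (rule layer_tendsto)
  qed
  then have "\<forall>\<^sub>F i in sequentially. \<forall>H\<in>X. layer (real (Suc i)) H (x i) = 1"
    using fin X by (intro eventually_ball_finite) (auto intro: finite_subset)
  then show ?thesis by eventually_elim simp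
qed

text \<open>The projection to \<open>H\<close> pulls another hyperplane \<open>H'\<close> back to
  the solutions of an affine equation m \<bullet> y = b. They form a null set unless m and b both
  vanish, and then H' = H.\<close>

lemma AE_projection_not_in_others:
  assumes H: "H \<in> HH"
  shows "AE y in lebesgue. \<nu> H \<bullet> y \<noteq> c H \<and> y - (\<nu> H \<bullet> y - c H) *\<^sub>R \<nu> H \<notin> \<Union>(HH - {H})"
proof -
  have "AE y in lebesgue. y - (\<nu> H \<bullet> y - c H) *\<^sub>R \<nu> H \<notin> H'" if "H' \<in> HH" "H' \<noteq> H" for H'
  proof -
    define m where "m = \<nu> H' - (\<nu> H \<bullet> \<nu> H') *\<^sub>R \<nu> H"
    define b where "b = c H' - (\<nu> H \<bullet> \<nu> H') * c H"
    have eq: "y - (\<nu> H \<bullet> y - c H) *\<^sub>R \<nu> H \<in> H' \<longleftrightarrow> m \<bullet> y = b" for y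
    proof -
      have "z \<in> H' \<longleftrightarrow> \<nu> H' \<bullet> z = c H'" for z using hyp[OF that(1)] by blast
      then show ?thesis
        by (auto simp: m_def b_def inner_diff_right inner_diff_left inner_commute[of "\<nu> H'" "\<nu> H"] algebra_simps)
    qed
    have "m \<noteq> 0 \<or> b \<noteq> 0"
    proof (rule ccontr)
      assume "\<not> (m \<noteq> 0 \<or> b \<noteq> 0)"
      then have m: "m = 0" and b: "b = 0" by blast+
      define k where "k = \<nu> H \<bullet> \<nu> H'"
      have k: "\<nu> H' = k *\<^sub>R \<nu> H" "c H' = k * c H"
        using m b unfolding m_def b_def k_def right_minus_eq .
      have "k \<noteq> 0"
      proof
        assume "k = 0"
        with k(1) have "\<nu> H' = 0" by simp
        with unit[OF that(1)] show False by simp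
      qed
      have "x \<in> H \<longleftrightarrow> x \<in> H'" for x
      proof -
        have "x \<in> H \<longleftrightarrow> \<nu> H \<bullet> x = c H" "x \<in> H' \<longleftrightarrow> \<nu> H' \<bullet> x = c H'"
          using hyp[OF H] hyp[OF that(1)] by blast+
        then show ?thesis unfolding k using \<open>k \<noteq> 0\<close> by simp
      qed
      then have "H = H'" by blast
      then show False using that by simp
    qed
    then show ?thesis unfolding eq by (rule AE_lebesgue_not_hyperplane)
  qed
  then have "AE y in lebesgue. \<forall>H'\<in>HH - {H}. y - (\<nu> H \<bullet> y - c H) *\<^sub>R \<nu> H \<notin> H'"
    using fin by (intro AE_finite_allI) auto
  moreover have "AE y in lebesgue. \<nu> H \<bullet> y \<noteq> c H"
    using unit[OF H] by (intro AE_lebesgue_not_hyperplane) auto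
  ultimately show ?thesis by eventually_elim auto
qed

lemma proj_in:
  assumes H: "H \<in> HH"
  shows "hyperplane_proj \<nu> c H y \<in> H"
proof -
  have "\<nu> H \<bullet> hyperplane_proj \<nu> c H y = c H"
    using unit[OF H] by (simp add: hyperplane_proj_def inner_diff_right norm_eq_1)
  then show ?thesis using hyp[OF H] by blast
qed

text \<open>Stretching by n turns the slope 2n of the layer into 2 on a slab of width 1, while the
  argument of \<open>g\<close> moves to a distance from \<open>H\<close> that is divided by n.
  Reflection in \<open>H\<close> then pairs the two halves of the slab and accounts for the factor
  2.\<close>

lemma
  assumes H: "H \<in> HH"
    and jump: "\<And>x. x \<in> H \<Longrightarrow> x \<notin> \<Union>(HH - {H}) \<Longrightarrow>
      ((\<lambda>t. g (x + t *\<^sub>R \<nu> H) - g (x - t *\<^sub>R \<nu> H)) \<longlongrightarrow> j x) (at_right 0)"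
  shows layer_integral_tendsto:
      "(\<lambda>i. LINT x|lebesgue. dlayer (real (Suc i)) H x * (\<Prod>H'\<in>HH - {H}. layer (real (Suc i)) H' x) * g x)
       \<longlonglongrightarrow> (LINT y|lebesgue. indicator {y. \<bar>\<nu> H \<bullet> y - c H\<bar> \<le> 1/2} y * j (hyperplane_proj \<nu> c H y))"
    and jump_integrable: "integrable lebesgue (\<lambda>y. indicator {y. \<bar>\<nu> H \<bullet> y - c H\<bar> \<le> 1/2} y * j (hyperplane_proj \<nu> c H y))"
proof -
  let ?s = "\<lambda>y. \<nu> H \<bullet> y - c H"
  let ?P = "\<lambda>i x. \<Prod>H'\<in>HH - {H}. layer (real (Suc i)) H' x"
  let ?T = "\<lambda>a y. y + ((a - 1) * ?s y) *\<^sub>R \<nu> H"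
  define u where "u i \<tau> y = g (hyperplane_proj \<nu> c H y + (\<tau> / real (Suc i)) *\<^sub>R \<nu> H) * ?P i (hyperplane_proj \<nu> c H y + (\<tau> / real (Suc i)) *\<^sub>R \<nu> H)" for i \<tau> y
  \<comment> \<open>Values at equal distance on both sides are subtracted, so that only the limit of
    the difference in \<open>jump\<close> enters, not one-sided limits of \<open>g\<close>.\<close>
  define q where "q i y = (if 0 < \<bar>?s y\<bar> \<and> \<bar>?s y\<bar> < 1/2 then u i \<bar>?s y\<bar> y - u i (- \<bar>?s y\<bar>) y else 0)" for i y
  have \<nu>: "norm (\<nu> H) = 1" "\<nu> H \<bullet> \<nu> H = 1" using unit[OF H] by (auto simp: norm_eq_1)
  have [measurable]: "(\<lambda>x. \<Prod>H'\<in>X. layer n H' x) \<in> borel_measurable borel" for X n by measurable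
  have M: "0 \<le> M" using g_bound[of 0] by simp
  have proj_measurable[measurable]: "hyperplane_proj \<nu> c H \<in> borel_measurable borel" unfolding hyperplane_proj_def by measurable
  have ubound: "\<bar>u i \<tau> y\<bar> \<le> M" for i \<tau> y
    using mult_mono[OF g_bound prod_layer_bounds(2)[of "real (Suc i)"], of _ "HH - {H}"] M
    by (simp add: u_def abs_mult prod_layer_bounds)
  have usupp: "u i \<tau> y = 0" if "norm y > R + 1" "\<bar>\<tau>\<bar> < 1/2" "\<bar>?s y\<bar> < 1/2" for i \<tau> y
  proof -
    let ?z = "hyperplane_proj \<nu> c H y + (\<tau> / real (Suc i)) *\<^sub>R \<nu> H"
    have "norm (y - ?z) = norm ((?s y - \<tau> / real (Suc i)) *\<^sub>R \<nu> H)"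
      by (simp add: hyperplane_proj_def algebra_simps)
    also have "\<dots> \<le> \<bar>?s y\<bar> + \<bar>\<tau> / real (Suc i)\<bar>"
      using \<nu> abs_triangle_ineq4[of "?s y" "\<tau> / real (Suc i)"] by simp
    also have "\<bar>\<tau> / real (Suc i)\<bar> \<le> \<bar>\<tau>\<bar>" by (simp add: divide_le_eq mult_le_cancel_left1)
    finally have "norm (y - ?z) < 1" using that by linarith
    then have "norm ?z > R" using that(1) norm_triangle_ineq2[of y "y - ?z"] by simp
    then show ?thesis by (simp add: u_def support)
  qed
  have q_eq: "2 * (LINT x|lebesgue. dlayer (real (Suc i)) H x * ?P i x * g x) = 2 * (LINT y|lebesgue. q i y)" for i
  proof -
    let ?F = "\<lambda>x. dlayer (real (Suc i)) H x * ?P i x * g x"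
    let ?n = "real (Suc i)"
    define U where "U y = (if 0 < ?s y \<and> ?s y < 1/2 then u i (?s y) y else 0)" for y
    define V where "V y = (if ?s y < 0 \<and> - ?s y < 1/2 then u i (?s y) y else 0)" for y
    have Tproj: "?T (1 / ?n) y = hyperplane_proj \<nu> c H y + (?s y / ?n) *\<^sub>R \<nu> H" for y
    proof -
      have "((1 / ?n - 1) * ?s y) *\<^sub>R \<nu> H = (?s y / ?n) *\<^sub>R \<nu> H - ?s y *\<^sub>R \<nu> H"
        unfolding scaleR_left_diff_distrib[symmetric] left_diff_distrib by simp
      then show ?thesis by (simp add: hyperplane_proj_def)
    qed
    have sproj: "?s (hyperplane_proj \<nu> c H y + \<tau> *\<^sub>R \<nu> H) = \<tau>" for y \<tau>
      by (simp add: hyperplane_proj_def inner_add_right inner_diff_right \<nu>)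
    have sR: "?s (?T (-1) y) = - ?s y" for y
      by (simp add: inner_add_right \<nu> algebra_simps)
    have projR: "hyperplane_proj \<nu> c H (?T (-1) y) = hyperplane_proj \<nu> c H y" for y
    proof -
      have "((-1 - 1) * ?s y) *\<^sub>R \<nu> H = (- ?s y - ?s y) *\<^sub>R \<nu> H" by simp
      then show ?thesis
        unfolding hyperplane_proj_def sR by (simp only: scaleR_left_diff_distrib scaleR_minus_left) simp
    qed
    have [measurable]: "U \<in> borel_measurable borel" "V \<in> borel_measurable borel"
      unfolding U_def V_def u_def by measurable
    \<comment> \<open>The Jacobian 1/n cancels the n in the slope of the layer.\<close>
    have UV: "?F (?T (1 / ?n) y) * (1 / ?n) = 2 * (U y - V y)" for y
    proof -
      have n: "2 * ?n * \<bar>?s y / ?n\<bar> = 2 * \<bar>?s y\<bar>" by (simp add: abs_divide del: of_nat_Suc)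
      have "sgn (?s y / ?n) = sgn (?s y)" by (simp add: sgn_divide)
      then have d: "dlayer ?n H (?T (1 / ?n) y) * (1 / ?n) = (if 2 * \<bar>?s y\<bar> < 1 then 2 * sgn (?s y) else 0)"
        unfolding Tproj dlayer_def sproj n by (simp del: of_nat_Suc)
      have "?F (?T (1 / ?n) y) * (1 / ?n) = dlayer ?n H (?T (1 / ?n) y) * (1 / ?n) * u i (?s y) y"
        unfolding u_def Tproj[symmetric] by (simp only: mult_ac)
      also have "\<dots> = 2 * (U y - V y)"
        unfolding d U_def V_def by (cases "?s y" "0::real" rule: linorder_cases) simp_all
      finally show ?thesis .
    qed
    have int: "integrable lebesgue U" "integrable lebesgue V"
        "integrable lebesgue (\<lambda>y. U (?T (-1) y))" "integrable lebesgue (\<lambda>y. V (?T (-1) y))"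
    proof -
      have "integrable lebesgue W \<and> integrable lebesgue (\<lambda>y. W (?T (-1) y))" if W: "W = U \<or> W = V" for W
      proof -
        have [measurable]: "W \<in> borel_measurable borel" using W by auto
        have i: "integrable lebesgue W"
        proof (rule integrable_lebesgue_bounded)
          show "norm (W x) \<le> M" for x using W ubound M by (auto simp: U_def V_def)
          show "norm x > R + 1 \<Longrightarrow> W x = 0" for x using W usupp[of x] by (auto simp: U_def V_def)
        qed (intro borel_measurable_lebesgueI, measurable)
        then show ?thesis
          using integrable_directional_stretch[OF \<nu>(1), of "-1" W "c H"] by (simp add: integrable_completion)
      qed
      then show "integrable lebesgue U" "integrable lebesgue V"
        "integrable lebesgue (\<lambda>y. U (?T (-1) y))" "integrable lebesgue (\<lambda>y. V (?T (-1) y))" by auto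
    qed
    have reflect: "(LINT y|lebesgue. W (?T (-1) y)) = (LINT y|lebesgue. W y)" if [measurable]: "W \<in> borel_measurable borel" for W :: "real^'n \<Rightarrow> real"
      using integral_directional_stretch[OF \<nu>(1), of "-1" W "c H"] that by (simp add: integral_completion)
    have "(LINT x|lebesgue. ?F x) = (LINT y|lebesgue. ?F (?T (1 / ?n) y)) * \<bar>1 / ?n\<bar>"
      using integral_directional_stretch[OF \<nu>(1), of "1 / ?n" ?F "c H"] by (simp add: integral_completion)
    also have "\<dots> = (LINT y|lebesgue. ?F (?T (1 / ?n) y) * (1 / ?n))"
      by (simp add: integral_mult_left_zero)
    also have "\<dots> = 2 * ((LINT y|lebesgue. U y) - (LINT y|lebesgue. V y))"
      unfolding UV using int by simp
    \<comment> \<open>One of the two copies of each half-slab integral is moved to the opposite half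
      by reflection, so that the integrand fills the whole slab.\<close>
    also have "\<dots> = (LINT y|lebesgue. U y) + (LINT y|lebesgue. U (?T (-1) y)) - (LINT y|lebesgue. V y) - (LINT y|lebesgue. V (?T (-1) y))"
      unfolding reflect[OF \<open>U \<in> borel_measurable borel\<close>] reflect[OF \<open>V \<in> borel_measurable borel\<close>] by simp
    also have "\<dots> = (LINT y|lebesgue. U y + U (?T (-1) y) - V y - V (?T (-1) y))"
      using int by simp
    also have "(\<lambda>y. U y + U (?T (-1) y) - V y - V (?T (-1) y)) = q i"
    proof
      fix y
      have uR: "u i \<tau> (?T (-1) y) = u i \<tau> y" for \<tau> by (simp only: u_def projR)
      show "U y + U (?T (-1) y) - V y - V (?T (-1) y) = q i y"
        unfolding U_def V_def q_def sR uR by (cases "?s y" "0::real" rule: linorder_cases) simp_all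
    qed
    finally show ?thesis by simp
  qed
  have "(\<lambda>i. LINT y|lebesgue. q i y) \<longlonglongrightarrow> (LINT y|lebesgue. indicator {y. \<bar>?s y\<bar> \<le> 1/2} y * j (hyperplane_proj \<nu> c H y))
     \<and> integrable lebesgue (\<lambda>y. indicator {y. \<bar>\<nu> H \<bullet> y - c H\<bar> \<le> 1/2} y * j (hyperplane_proj \<nu> c H y))"
  proof (intro conjI lebesgue_bounded_convergence[where B = "2 * M" and R = "R + 1"]
      integrable_lebesgue_bounded_limit[where B = "2 * M" and R = "R + 1" and s = q])
    show m: "q i \<in> borel_measurable lebesgue" for i
      unfolding q_def u_def by (intro borel_measurable_lebesgueI) measurable
    then show "q i \<in> borel_measurable lebesgue" for i .
    show b: "norm (q i x) \<le> 2 * M" for i x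
      using ubound[of i "\<bar>?s x\<bar>" x] ubound[of i "-\<bar>?s x\<bar>" x] M by (auto simp: q_def)
    then show "norm (q i x) \<le> 2 * M" for i x .
    show z: "q i x = 0" if "norm x > R + 1" for i x
      using usupp[OF that] by (auto simp: q_def)
    then show "q i x = 0" if "norm x > R + 1" for i x using that by blast
    have half: "AE y in lebesgue. \<nu> H \<bullet> y \<noteq> b" for b
      using unit[OF H] by (intro AE_lebesgue_not_hyperplane) auto
    show l: "AE y in lebesgue. (\<lambda>i. q i y) \<longlonglongrightarrow> indicator {y. \<bar>?s y\<bar> \<le> 1/2} y * j (hyperplane_proj \<nu> c H y)"
      using AE_projection_not_in_others[OF H] half[of "c H + 1/2"] half[of "c H - 1/2"]
    proof eventually_elim
      case (elim y)
      show ?case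
      proof (cases "\<bar>?s y\<bar> \<le> 1/2")
        case True
        then have s: "0 < \<bar>?s y\<bar>" "\<bar>?s y\<bar> < 1/2" using elim by (auto simp: abs_if split: if_splits)
        have nin: "hyperplane_proj \<nu> c H y \<notin> \<Union>(HH - {H})" using elim by (simp add: hyperplane_proj_def)
        let ?t = "\<lambda>i. \<bar>?s y\<bar> / real (Suc i)"
        have t: "filterlim ?t (at_right 0) sequentially"
          using s tendsto_mult_right[OF LIMSEQ_inverse_real_of_nat, of "\<bar>?s y\<bar>"]
          by (auto simp: filterlim_at eventually_sequentially inverse_eq_divide)
        then have t0: "?t \<longlonglongrightarrow> 0" by (simp add: filterlim_at)
        have lim: "(\<lambda>i. hyperplane_proj \<nu> c H y + (\<tau> * ?t i) *\<^sub>R \<nu> H) \<longlonglongrightarrow> hyperplane_proj \<nu> c H y" for \<tau>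
          by (rule tendsto_eq_intros t0 refl | simp)+
        have P: "\<forall>\<^sub>F i in sequentially. ?P i (hyperplane_proj \<nu> c H y + (\<tau> * ?t i) *\<^sub>R \<nu> H) = 1" for \<tau>
          by (rule prod_layer_tendsto[OF _ lim nin]) auto
        have "\<forall>\<^sub>F i in sequentially. q i y = g (hyperplane_proj \<nu> c H y + ?t i *\<^sub>R \<nu> H) - g (hyperplane_proj \<nu> c H y - ?t i *\<^sub>R \<nu> H)"
          using P[of 1] P[of "-1"] by eventually_elim (use s in \<open>simp add: q_def u_def\<close>)
        moreover have "(\<lambda>i. g (hyperplane_proj \<nu> c H y + ?t i *\<^sub>R \<nu> H) - g (hyperplane_proj \<nu> c H y - ?t i *\<^sub>R \<nu> H)) \<longlonglongrightarrow> j (hyperplane_proj \<nu> c H y)"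
          by (rule filterlim_compose[OF jump[OF proj_in[OF H] nin] t])
        ultimately have "(\<lambda>i. q i y) \<longlonglongrightarrow> j (hyperplane_proj \<nu> c H y)"
          by (subst tendsto_cong)
        then show ?thesis using True by simp
      next
        case False then show ?thesis by (simp add: q_def)
      qed
    qed
    then show "AE y in lebesgue. (\<lambda>i. q i y) \<longlonglongrightarrow> indicator {y. \<bar>?s y\<bar> \<le> 1/2} y * j (hyperplane_proj \<nu> c H y)" .
  qed
  then show "(\<lambda>i. LINT x|lebesgue. dlayer (real (Suc i)) H x * ?P i x * g x)
       \<longlonglongrightarrow> (LINT y|lebesgue. indicator {y. \<bar>\<nu> H \<bullet> y - c H\<bar> \<le> 1/2} y * j (hyperplane_proj \<nu> c H y))"
    and "integrable lebesgue (\<lambda>y. indicator {y. \<bar>\<nu> H \<bullet> y - c H\<bar> \<le> 1/2} y * j (hyperplane_proj \<nu> c H y))"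
    using q_eq by auto
qed

text \<open>The limit of \<open>integral_dcut\<close> for layers of vanishing width: the first term
  of \<open>dcut\<close> tends to the integral of \<open>dg\<close>, and every other summand
  concentrates on its hyperplane.\<close>

theorem integral_directional_derivative:
  assumes jump: "\<And>H x. H \<in> HH \<Longrightarrow> x \<in> H \<Longrightarrow> x \<notin> \<Union>(HH - {H}) \<Longrightarrow>
      ((\<lambda>t. g (x + t *\<^sub>R \<nu> H) - g (x - t *\<^sub>R \<nu> H)) \<longlongrightarrow> j H x) (at_right 0)"
  shows "(LINT x|lebesgue. dg x) =
    - (\<Sum>H\<in>HH. (\<nu> H \<bullet> e) * (LINT y|lebesgue. indicator {y. \<bar>\<nu> H \<bullet> y - c H\<bar> \<le> 1/2} y * j H (hyperplane_proj \<nu> c H y)))"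
proof -
  let ?\<psi> = "\<lambda>i x. \<Prod>H\<in>HH. layer (real (Suc i)) H x"
  let ?P = "\<lambda>i H x. \<Prod>H'\<in>HH - {H}. layer (real (Suc i)) H' x"
  let ?I = "\<lambda>i H. LINT x|lebesgue. dlayer (real (Suc i)) H x * ?P i H x * g x"
  have M: "0 \<le> M" using g_bound[of 0] by simp
  have [measurable]: "(\<lambda>x. \<Prod>H'\<in>X. layer n H' x) \<in> borel_measurable borel" for X n by measurable
  have b1: "norm (?\<psi> i x * dg x) \<le> M" for i x
    using mult_mono[OF prod_layer_bounds(2)[of "real (Suc i)" x HH] dg_bound[of x]] M
    by (simp add: abs_mult prod_layer_bounds)
  have 1: "(\<lambda>i. LINT x|lebesgue. ?\<psi> i x * dg x) \<longlonglongrightarrow> (LINT x|lebesgue. dg x)"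
  proof (rule lebesgue_bounded_convergence[where B = M and R = R])
    show "AE x in lebesgue. (\<lambda>i. ?\<psi> i x * dg x) \<longlonglongrightarrow> dg x"
      using AE_generic[OF zero_less_one]
    proof eventually_elim
      case (elim x)
      have "\<forall>\<^sub>F i in sequentially. ?\<psi> i x = 1"
        by (rule prod_layer_tendsto[OF _ tendsto_const generic_not_in[OF elim]]) simp
      then show ?case by (intro tendsto_eventually) (auto elim: eventually_mono)
    qed
  qed (use b1 support in \<open>auto intro!: borel_measurable_lebesgueI\<close>)
  have 2: "(LINT x|lebesgue. ?\<psi> i x * dg x) + (\<Sum>H\<in>HH. (\<nu> H \<bullet> e) * ?I i H) = 0" for i
  proof -
    have i1: "integrable lebesgue (\<lambda>x. ?\<psi> i x * dg x)"
      by (rule integrable_lebesgue_bounded[where B = M and R = R])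
        (use b1 support in \<open>auto intro!: borel_measurable_lebesgueI\<close>)
    have i2: "integrable lebesgue (\<lambda>x. dlayer (real (Suc i)) H x * ?P i H x * g x)" for H
    proof (rule integrable_lebesgue_bounded[where B = "2 * real (Suc i) * 1 * M" and R = R])
      show "norm (dlayer (real (Suc i)) H x * ?P i H x * g x) \<le> 2 * real (Suc i) * 1 * M" for x
        unfolding real_norm_def abs_mult using g_bound[of x] M
        by (intro mult_mono) (auto simp: prod_layer_bounds dlayer_def sgn_if abs_mult)
    qed (use support in \<open>auto intro!: borel_measurable_lebesgueI\<close>)
    show ?thesis
      using integral_dcut[of "real (Suc i)"] i1 i2 unfolding dcut_def by (simp add: integral_add integral_sum)
  qed
  have "(\<lambda>i. (LINT x|lebesgue. ?\<psi> i x * dg x) + (\<Sum>H\<in>HH. (\<nu> H \<bullet> e) * ?I i H)) \<longlonglongrightarrow>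
     (LINT x|lebesgue. dg x) + (\<Sum>H\<in>HH. (\<nu> H \<bullet> e) * (LINT y|lebesgue. indicator {y. \<bar>\<nu> H \<bullet> y - c H\<bar> \<le> 1/2} y * j H (hyperplane_proj \<nu> c H y)))"
    using jump by (intro tendsto_intros 1 layer_integral_tendsto) auto
  then show ?thesis unfolding 2 by (simp add: LIMSEQ_const_iff add_eq_0_iff)
qed

end

text \<open>A quadratic polynomial without negative values has nonpositive discriminant. The signs
  of a and c are consequences, so that the Cauchy-Schwarz inequality for any semidefinite form
  follows, here for the L2 and the H1 inner product.\<close>

lemma abs_le_sqrt_mult:
  fixes a b c :: real
  assumes "\<And>t. 0 \<le> a + 2 * t * b + t\<^sup>2 * c"
  shows "\<bar>b\<bar> \<le> sqrt a * sqrt c"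
proof -
  have a: "0 \<le> a" using assms[of 0] by simp
  have c: "0 \<le> c"
  proof (rule ccontr)
    assume "\<not> 0 \<le> c"
    then have c: "c < 0" by simp
    \<comment> \<open>Large enough for the negative term \<open>t\<^sup>2 * c\<close> to outweigh
      the constant and the linear term.\<close>
    define t where "t = (2 * \<bar>b\<bar> + a + 1) / (- c) + 1"
    have t: "t \<ge> 1" using c a by (simp add: t_def divide_nonneg_neg)
    have "t * (- c) = 2 * \<bar>b\<bar> + a + 1 - c" using c by (simp add: t_def field_simps)
    then have "t * (t * (- c)) \<ge> t * (2 * \<bar>b\<bar> + a + 1)" using t c by (intro mult_left_mono) auto
    moreover have "t * (a + 1) \<ge> a + 1" using t a by (simp add: mult_le_cancel_right1)
    moreover have "2 * t * b \<le> t * (2 * \<bar>b\<bar>)" using t by (simp add: mult_left_mono)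
    ultimately show False using assms[of t] by (simp add: power2_eq_square algebra_simps)
  qed
  have "b\<^sup>2 \<le> a * c"
  proof (cases "c = 0")
    case True
    have "b = 0"
    proof (rule ccontr)
      assume "b \<noteq> 0"
      then show False using assms[of "- (a + 1) / (2 * b)"] True a by (simp add: field_simps)
    qed
    then show ?thesis using True by simp
  next
    case False
    have "a + 2 * (- b / c) * b + (- b / c)\<^sup>2 * c = a - b * b / c"
      using False by (simp add: field_simps power2_eq_square)
    then have "b * b / c \<le> a" using assms[of "- b / c"] by simp
    then show ?thesis using False c by (simp add: pos_divide_le_eq power2_eq_square)
  qed
  then have "sqrt (b\<^sup>2) \<le> sqrt (a * c)" by (rule real_sqrt_le_mono)
  then show ?thesis by (simp add: real_sqrt_mult)
qed

section \<open>Square-integrable functions\<close>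

context
  fixes S :: "(real^'n) set"
  assumes S[measurable]: "S \<in> sets lebesgue"
begin

lemma L2_inner_integrable:
  fixes f g :: "real^'n \<Rightarrow> 'b::euclidean_space"
  assumes "L2_on S f" "L2_on S g"
  shows "integrable (lebesgue_on S) (\<lambda>x. f x \<bullet> g x)"
proof (rule Bochner_Integration.integrable_bound)
  have [measurable]: "f \<in> borel_measurable (lebesgue_on S)" "g \<in> borel_measurable (lebesgue_on S)"
    using assms by (auto simp: L2_on_def)
  show "integrable (lebesgue_on S) (\<lambda>x. (norm (f x))\<^sup>2 + (norm (g x))\<^sup>2)"
    using assms by (intro Bochner_Integration.integrable_add) (auto simp: L2_on_def)
  show "(\<lambda>x. f x \<bullet> g x) \<in> borel_measurable (lebesgue_on S)" by measurable
  show "AE x in lebesgue_on S. norm (f x \<bullet> g x) \<le> norm ((norm (f x))\<^sup>2 + (norm (g x))\<^sup>2)"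
  proof (rule AE_I2)
    fix x
    have "\<bar>f x \<bullet> g x\<bar> \<le> norm (f x) * norm (g x)" by (rule Cauchy_Schwarz_ineq2)
    also have "\<dots> \<le> (norm (f x))\<^sup>2 + (norm (g x))\<^sup>2"
    proof -
      have "0 \<le> norm (f x) * norm (g x)" by simp
      then show ?thesis using sum_squares_bound[of "norm (f x)" "norm (g x)"] unfolding mult.assoc by linarith
    qed
    finally show "norm (f x \<bullet> g x) \<le> norm ((norm (f x))\<^sup>2 + (norm (g x))\<^sup>2)" by simp
  qed
qed

lemma L2_on_cmul:
  fixes f :: "real^'n \<Rightarrow> 'b::euclidean_space"
  assumes "L2_on S f" shows "L2_on S (\<lambda>x. a *\<^sub>R f x)"
  using assms by (auto simp: L2_on_def power_mult_distrib)

lemma L2_on_add: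
  fixes f g :: "real^'n \<Rightarrow> 'b::euclidean_space"
  assumes f: "L2_on S f" and g: "L2_on S g" shows "L2_on S (\<lambda>x. f x + g x)"
proof -
  have "integrable (lebesgue_on S) (\<lambda>x. f x \<bullet> f x + 2 * (f x \<bullet> g x) + g x \<bullet> g x)"
    using f g by (intro Bochner_Integration.integrable_add integrable_mult_right L2_inner_integrable)
  then have "integrable (lebesgue_on S) (\<lambda>x. (norm (f x + g x))\<^sup>2)"
    by (simp add: power2_norm_eq_inner inner_add_left inner_add_right inner_commute algebra_simps)
  then show ?thesis using f g by (auto simp: L2_on_def)
qed

lemma L2_on_lincomb:
  fixes f g :: "real^'n \<Rightarrow> 'b::euclidean_space"
  assumes "L2_on S f" "L2_on S g" shows "L2_on S (\<lambda>x. f x + a *\<^sub>R g x)"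
  using assms by (intro L2_on_add L2_on_cmul)

lemma L2_inner_lincomb:
  fixes f g h :: "real^'n \<Rightarrow> 'b::euclidean_space"
  assumes "L2_on S f" "L2_on S g" "L2_on S h"
  shows "L2_inner S h (\<lambda>x. f x + a *\<^sub>R g x) = L2_inner S h f + a * L2_inner S h g"
    and "L2_inner S (\<lambda>x. f x + a *\<^sub>R g x) h = L2_inner S f h + a * L2_inner S g h"
  using assms by (simp_all add: L2_inner_def inner_add_right inner_add_left L2_inner_integrable)

lemma L2_norm_nonneg: "0 \<le> L2_inner S f f" "0 \<le> L2_norm S f" "(L2_norm S f)\<^sup>2 = L2_inner S f f"
proof -
  show "0 \<le> L2_inner S f f" unfolding L2_inner_def by (rule integral_nonneg_AE) simp
  then show "0 \<le> L2_norm S f" "(L2_norm S f)\<^sup>2 = L2_inner S f f" by (simp_all add: L2_norm_def)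
qed

lemma L2_inner_commute: "L2_inner S f g = L2_inner S g f"
  by (simp add: L2_inner_def inner_commute)

lemma L2_inner_self_lincomb:
  fixes f g :: "real^'n \<Rightarrow> 'b::euclidean_space"
  assumes "L2_on S f" "L2_on S g"
  shows "L2_inner S (\<lambda>x. f x + a *\<^sub>R g x) (\<lambda>x. f x + a *\<^sub>R g x) =
    L2_inner S f f + 2 * a * L2_inner S f g + a\<^sup>2 * L2_inner S g g"
  using assms by (simp add: L2_inner_lincomb L2_on_lincomb L2_inner_commute[of g f] power2_eq_square algebra_simps)

lemma L2_Cauchy_Schwarz:
  fixes f g :: "real^'n \<Rightarrow> 'b::euclidean_space"
  assumes "L2_on S f" "L2_on S g"
  shows "\<bar>L2_inner S f g\<bar> \<le> L2_norm S f * L2_norm S g"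
  unfolding L2_norm_def
proof (rule abs_le_sqrt_mult)
  fix t show "0 \<le> L2_inner S f f + 2 * t * L2_inner S f g + t\<^sup>2 * L2_inner S g g"
    using L2_norm_nonneg(1)[of "\<lambda>x. f x + t *\<^sub>R g x"] L2_inner_self_lincomb[OF assms, of t] by simp
qed

lemma L2_inner_cong_AE:
  fixes f g :: "real^'n \<Rightarrow> 'b::euclidean_space"
  assumes "L2_on S f" "L2_on S f'" "L2_on S g" "L2_on S g'"
    and "AE x in lebesgue_on S. f x = f' x" "AE x in lebesgue_on S. g x = g' x"
  shows "L2_inner S f g = L2_inner S f' g'"
  unfolding L2_inner_def
proof (rule integral_cong_AE)
  show "AE x in lebesgue_on S. f x \<bullet> g x = f' x \<bullet> g' x"
    using assms(5,6) by eventually_elim simp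
qed (rule borel_measurable_integrable[OF L2_inner_integrable], fact+)+

lemma L2_onI_bounded:
  fixes f :: "real^'n \<Rightarrow> 'b::euclidean_space"
  assumes "bounded S" and f: "f \<in> borel_measurable (lebesgue_on S)" and B: "\<And>x. norm (f x) \<le> B"
  shows "L2_on S f"
proof -
  have fin: "emeasure lebesgue S < \<infinity>"
    using bounded_set_imp_lmeasurable[OF assms(1) S] unfolding fmeasurable_def by blast
  have "integrable (lebesgue_on S) (\<lambda>x. (norm (f x))\<^sup>2)"
  proof (rule Bochner_Integration.integrable_bound)
    show "integrable (lebesgue_on S) (\<lambda>x. B\<^sup>2)"
      using fin by (intro finite_measure.integrable_const finite_measureI)
        (simp add: emeasure_restrict_space S space_restrict_space)
    show "AE x in lebesgue_on S. norm ((norm (f x))\<^sup>2) \<le> norm (B\<^sup>2)"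
      using B by (intro AE_I2) (simp add: power_mono)
  qed (use f in measurable)
  then show ?thesis using f by (simp add: L2_on_def)
qed

end

section \<open>Smooth bump functions\<close>

lemma Ck_Suc_imp: "Ck (Suc m) f \<Longrightarrow> Ck m f"
proof (induction m arbitrary: f)
  case 0
  then show ?case
    by (auto intro!: continuous_at_imp_continuous_on differentiable_imp_continuous_within)
qed auto

lemma partial_derivI: "(f has_derivative f') (at x) \<Longrightarrow> partial_deriv i f x = f' (axis i 1)"
  by (metis frechet_derivative_at partial_deriv_def)

lemma has_derivative_frechet: "f differentiable (at x) \<Longrightarrow> (f has_derivative frechet_derivative f (at x)) (at x)"
  by (simp add: frechet_derivative_works[symmetric])

lemma Ck_add: "Ck m f \<Longrightarrow> Ck m g \<Longrightarrow> Ck m (\<lambda>x. f x + g x)"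
proof (induction m arbitrary: f g)
  case 0 then show ?case by (auto intro: continuous_on_add)
next
  case (Suc m)
  have d: "f differentiable (at x)" "g differentiable (at x)" for x using Suc.prems by auto
  have "partial_deriv i (\<lambda>x. f x + g x) = (\<lambda>x. partial_deriv i f x + partial_deriv i g x)" for i
    by (rule ext) (simp add: partial_derivI[OF has_derivative_add[OF has_derivative_frechet[OF d(1)] has_derivative_frechet[OF d(2)]]],
      simp add: partial_deriv_def)
  then show ?case using Suc d by (auto intro: differentiable_add)
qed

lemma Ck_const: "Ck m (\<lambda>x::real^'n. a)"
proof (induction m arbitrary: a)
  case (Suc m)
  have "partial_deriv i (\<lambda>x::real^'n. a) = (\<lambda>x. 0)" for i
    by (intro ext partial_derivI[OF has_derivative_const, simplified])
  then show ?case using Suc by auto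
qed auto

lemma Ck_mult: "Ck m f \<Longrightarrow> Ck m g \<Longrightarrow> Ck m (\<lambda>x. f x * g x)"
proof (induction m arbitrary: f g)
  case 0 then show ?case by (auto intro: continuous_on_mult)
next
  case (Suc m)
  have d: "f differentiable (at x)" "g differentiable (at x)" for x using Suc.prems by auto
  have "partial_deriv i (\<lambda>x. f x * g x) = (\<lambda>x. f x * partial_deriv i g x + partial_deriv i f x * g x)" for i
    by (rule ext) (simp add: partial_derivI[OF has_derivative_mult[OF has_derivative_frechet[OF d(1)] has_derivative_frechet[OF d(2)]]],
      simp add: partial_deriv_def)
  moreover have "Ck m f" "Ck m g" using Suc.prems by (auto dest: Ck_Suc_imp simp del: Ck.simps)
  ultimately show ?case using Suc d by (auto intro!: differentiable_mult Ck_add)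
qed

lemma Ck_prod: "finite I \<Longrightarrow> (\<And>i. i \<in> I \<Longrightarrow> Ck m (f i)) \<Longrightarrow> Ck m (\<lambda>x. \<Prod>i\<in>I. f i x)"
  by (induction I rule: finite_induct) (auto intro: Ck_const Ck_mult)

text \<open>The induction passes from \<open>D k\<close> to \<open>D (Suc k)\<close>, therefore the
  whole sequence of derivatives is supplied at once.\<close>

lemma Ck_coordinate:
  assumes D: "\<And>k x. (D k has_real_derivative D (Suc k) x) (at x)"
  shows "Ck m (\<lambda>x::real^'n. D k (x $ i))"
proof (induction m arbitrary: k)
  case 0
  have "isCont (D k) x" for x using D DERIV_isCont by blast
  then have "isCont (\<lambda>x::real^'n. D k (x $ i)) x" for x
    by (intro isCont_o2[OF linear_continuous_at[OF bounded_linear_vec_nth]])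
  then show ?case by (simp add: continuous_at_imp_continuous_on)
next
  case (Suc m)
  have h: "((\<lambda>x::real^'n. D k (x $ i)) has_derivative (\<lambda>h. D (Suc k) (x $ i) * h $ i)) (at x)" for x
    using has_derivative_compose[OF bounded_linear_imp_has_derivative[OF bounded_linear_vec_nth[of i]]
        D[of k "x $ i", unfolded has_field_derivative_def]] by simp
  have "partial_deriv j (\<lambda>x::real^'n. D k (x $ i)) = (\<lambda>x. D (Suc k) (x $ i) * (if i = j then 1 else 0))" for j
    by (rule ext) (simp add: partial_derivI[OF h] axis_def)
  then show ?case
    using Suc h by (auto simp: differentiable_def intro!: Ck_mult Ck_const)
qed

text \<open>The k-th derivative of exp (-1/x), extended by 0. Differentiating p(1/x) exp (-1/x)
  gives (1/x)^2 (p(1/x) - p'(1/x)) exp (-1/x), whence the iterated operator on polynomials.\<close>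

definition step_deriv :: "nat \<Rightarrow> real \<Rightarrow> real" where
  "step_deriv k x = (if x > 0 then poly (((\<lambda>p. [:0, 0, 1:] * (p - pderiv p)) ^^ k) 1) (1 / x) * exp (- 1 / x) else 0)"

lemma poly_exp_tendsto_0:
  fixes p :: "real poly"
  shows "((\<lambda>y. poly p y * exp (- y)) \<longlongrightarrow> 0) at_top"
proof -
  have "((\<lambda>y. \<Sum>i\<le>degree p. coeff p i * (y ^ i / exp y)) \<longlongrightarrow> (\<Sum>i\<le>degree p. coeff p i * 0)) at_top"
    by (intro tendsto_intros tendsto_power_div_exp_0)
  then show ?thesis
    by (simp add: poly_altdef sum_divide_distrib exp_minus field_simps sum_distrib_left)
qed

lemma step_deriv_deriv: "(step_deriv k has_real_derivative step_deriv (Suc k) x) (at x)"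
proof -
  define p where "p = ((\<lambda>p::real poly. [:0, 0, 1:] * (p - pderiv p)) ^^ k) 1"
  have k: "step_deriv k y = (if y > 0 then poly p (1 / y) * exp (- 1 / y) else 0)" for y
    by (simp add: step_deriv_def p_def)
  have Suc: "step_deriv (Suc k) y = (if y > 0 then (1 / y)\<^sup>2 * (poly p (1 / y) - poly (pderiv p) (1 / y)) * exp (- 1 / y) else 0)" for y
    by (simp add: step_deriv_def p_def power2_eq_square algebra_simps)
  consider "x > 0" | "x < 0" | "x = 0" by linarith
  then show ?thesis
  proof cases
    case 1
    have "((\<lambda>y. poly p (1 / y) * exp (- 1 / y)) has_real_derivative step_deriv (Suc k) x) (at x)"
      unfolding Suc using 1
      by (auto intro!: derivative_eq_intros DERIV_chain2[OF poly_DERIV] simp: power2_eq_square field_simps)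
    moreover have "\<forall>\<^sub>F y in nhds x. step_deriv k y = poly p (1 / y) * exp (- 1 / y)"
      using eventually_nhds_in_open[of "{0<..}" x] 1 by (auto simp: k elim: eventually_mono)
    ultimately show ?thesis by (subst DERIV_cong_ev[OF refl _ refl])
  next
    case 2
    moreover have "\<forall>\<^sub>F y in nhds x. step_deriv k y = 0"
      using eventually_nhds_in_open[of "{..<0}" x] 2 by (auto simp: k elim: eventually_mono)
    ultimately show ?thesis by (subst DERIV_cong_ev[OF refl _ refl]) (auto simp: Suc)
  next
    case 3
    \<comment> \<open>The difference quotient at 0 carries an additional factor 1/y, which
      \<open>pCons 0\<close> absorbs into the polynomial.\<close>
    have "((\<lambda>y. poly (pCons 0 p) (inverse y) * exp (- inverse y)) \<longlongrightarrow> 0) (at_right (0::real))"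
      by (rule filterlim_compose[OF poly_exp_tendsto_0 filterlim_inverse_at_top_right])
    then have "((\<lambda>y. step_deriv k y / y) \<longlongrightarrow> 0) (at_right 0)"
      by (rule Lim_transform_eventually)
        (auto simp: k eventually_at_right_less field_simps inverse_eq_divide intro!: eventually_mono[OF eventually_at_right_less[of 0]])
    moreover have "((\<lambda>y. step_deriv k y / y) \<longlongrightarrow> 0) (at_left 0)"
      by (rule tendsto_eventually) (auto simp: k eventually_at_left_field intro!: exI[of _ "-1"])
    ultimately have "((\<lambda>y. step_deriv k y / y) \<longlongrightarrow> 0) (at 0)"
      by (rule filterlim_split_at[rotated])
    then show ?thesis using 3 by (simp add: DERIV_def Suc k)
  qed
qed

definition step :: "real \<Rightarrow> real" where "step = step_deriv 0"

lemma step_eq: "step x = (if x > 0 then exp (- 1 / x) else 0)"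
  by (simp add: step_def step_deriv_def)

lemma Ck_step: "Ck m (\<lambda>x::real^'n. step (a * x $ i + b))"
proof -
  have "((\<lambda>x. a ^ k * step_deriv k (a * x + b)) has_real_derivative a ^ Suc k * step_deriv (Suc k) (a * x + b)) (at x)" for k x
  proof -
    have "((\<lambda>x. a * x + b) has_real_derivative a) (at x)" by (auto intro!: derivative_eq_intros)
    from DERIV_cmult[OF DERIV_chain2[where f = "step_deriv k" and g = "\<lambda>x. a * x + b", OF step_deriv_deriv this], of "a ^ k"]
    show ?thesis by (simp add: mult_ac)
  qed
  from Ck_coordinate[of "\<lambda>k x. a ^ k * step_deriv k (a * x + b)", OF this, of m 0 i]
  show ?thesis by (simp add: step_def)
qed

text \<open>Each factor cuts off one side of the box. The scaling by \<open>Suc n\<close> sharpens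
  the cut-off without changing the set where the function is positive.\<close>

definition box_bump :: "nat \<Rightarrow> real^'n \<Rightarrow> real^'n \<Rightarrow> real^'n \<Rightarrow> real" where
  "box_bump n a b x = (\<Prod>i\<in>UNIV. step (real (Suc n) * x $ i + (- (real (Suc n) * a $ i))) * step (- real (Suc n) * x $ i + real (Suc n) * b $ i))"

lemma step_bounds: "0 \<le> step x" "step x \<le> 1" by (auto simp: step_eq)

lemma box_bump_bounds: "0 \<le> box_bump n a b x" "box_bump n a b x \<le> 1"
  unfolding box_bump_def by (intro prod_nonneg prod_le_1 ballI conjI mult_nonneg_nonneg mult_le_one step_bounds)+

lemma box_bump_nonzero: "box_bump n a b x \<noteq> 0 \<longleftrightarrow> x \<in> box a b"
proof -
  have "step (real (Suc n) * t + (- (real (Suc n) * a))) \<noteq> 0 \<longleftrightarrow> a < t"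
    "step (- real (Suc n) * t + real (Suc n) * b) \<noteq> 0 \<longleftrightarrow> t < b" for a t b
  proof -
    have "real (Suc n) * t + (- (real (Suc n) * a)) = real (Suc n) * (t - a)" "- real (Suc n) * t + real (Suc n) * b = real (Suc n) * (b - t)"
      by (simp_all add: algebra_simps)
    then show "step (real (Suc n) * t + (- (real (Suc n) * a))) \<noteq> 0 \<longleftrightarrow> a < t"
    "step (- real (Suc n) * t + real (Suc n) * b) \<noteq> 0 \<longleftrightarrow> t < b"
      by (simp_all add: step_eq zero_less_mult_iff del: of_nat_Suc)
  qed
  then show ?thesis
    unfolding box_bump_def by (simp add: mem_box_cart del: of_nat_Suc)
qed

lemma test_function_box_bump:
  assumes "cbox a b \<subseteq> \<Omega>"
  shows "test_function \<Omega> (box_bump n a b)"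
proof -
  have "Ck m (box_bump n a b)" for m
    unfolding box_bump_def by (intro Ck_prod Ck_mult Ck_step) auto
  moreover have "closure {x. box_bump n a b x \<noteq> 0} \<subseteq> cbox a b"
    unfolding box_bump_nonzero Collect_mem_eq by (rule closure_minimal[OF box_subset_cbox closed_cbox])
  ultimately show ?thesis
    using assms compact_Int_closed[OF compact_cbox[of a b] closed_closure, of "{x. box_bump n a b x \<noteq> 0}"]
    unfolding test_function_def by (auto simp: Int_absorb1)
qed

lemma box_bump_tendsto: "(\<lambda>n. box_bump n a b x) \<longlonglongrightarrow> indicator (box a b) x"
proof (cases "x \<in> box a b")
  case True
  have *: "(\<lambda>n. step (real (Suc n) * d)) \<longlonglongrightarrow> 1" if "d > 0" for d
  proof -
    have "(\<lambda>n. - (inverse (real (Suc n)) * (1 / d))) \<longlonglongrightarrow> - (0 * (1 / d))"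
      by (intro tendsto_intros LIMSEQ_inverse_real_of_nat)
    then have "(\<lambda>n. exp (- (inverse (real (Suc n)) * (1 / d)))) \<longlonglongrightarrow> exp (- (0 * (1 / d)))"
      by (rule tendsto_exp)
    moreover have "step (real (Suc n) * d) = exp (- (inverse (real (Suc n)) * (1 / d)))" for n
      using that by (simp add: step_eq inverse_eq_divide)
    ultimately show ?thesis by simp
  qed
  have "(\<lambda>n. \<Prod>i\<in>UNIV. step (real (Suc n) * (x $ i - a $ i)) * step (real (Suc n) * (b $ i - x $ i))) \<longlonglongrightarrow> (\<Prod>i\<in>(UNIV::'a set). 1 * 1)"
    using True by (intro tendsto_prod tendsto_mult *) (auto simp: mem_box_cart)
  moreover have "box_bump n a b x = (\<Prod>i\<in>UNIV. step (real (Suc n) * (x $ i - a $ i)) * step (real (Suc n) * (b $ i - x $ i)))" for n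
    unfolding box_bump_def by (simp add: algebra_simps)
  ultimately show ?thesis using True by simp
next
  case False then show ?thesis using box_bump_nonzero[of _ a b x] by simp
qed

section \<open>Uniqueness of weak derivatives\<close>

text \<open>Boxes form an intersection-stable generator of the Borel sets, so the integral over
  every Borel set vanishes, and a density with this property is zero almost everywhere.\<close>

lemma AE_eq_0_of_box_integrals:
  fixes F :: "'a::euclidean_space \<Rightarrow> real"
  assumes F: "integrable lebesgue F"
    and box: "\<And>a b. (LINT x|lebesgue. indicator (box a b) x * F x) = 0"
  shows "AE x in lebesgue. F x = 0"
proof -
  obtain f where f[measurable]: "f \<in> borel_measurable lborel" and eq: "AE x in lborel. F x = f x"
    using completion_ex_borel_measurable_real[OF borel_measurable_integrable[OF F]] by auto
  have eq': "AE x in lebesgue. F x = f x" using eq by (rule AE_completion)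
  have "integrable lebesgue f"
    using F eq' by (subst integrable_cong_AE[symmetric]) (auto intro: borel_measurable_integrable measurable_completion)
  then have int: "integrable lborel f" by (simp add: integrable_completion)
  have 0: "set_lebesgue_integral lborel A f = 0" if "A \<in> sets lborel" for A
  proof -
    have setint: "set_integrable lborel X f" if "X \<in> sets borel" for X
      using integrable_mult_indicator[of X lborel f] int that by (simp add: set_integrable_def)
    let ?E = "range (\<lambda>(a, b). box a b :: 'a set)"
    have basic: "set_lebesgue_integral lborel (box a b) f = 0" for a b
    proof -
      have "set_lebesgue_integral lborel (box a b) f = (LINT x|lebesgue. indicator (box a b) x * f x)"
        by (simp add: set_lebesgue_integral_def integral_completion)
      also have "\<dots> = (LINT x|lebesgue. indicator (box a b) x * F x)"
      proof (rule integral_cong_AE)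
        show "AE x in lebesgue. indicator (box a b) x * f x = indicator (box a b) x * F x"
          using eq' by eventually_elim simp
        show "(\<lambda>x. indicator (box a b) x * f x) \<in> borel_measurable lebesgue"
          by (rule measurable_completion) simp
        have "indicator (box a b) \<in> borel_measurable lebesgue" by (rule measurable_completion) simp
        then show "(\<lambda>x. indicator (box a b) x * F x) \<in> borel_measurable lebesgue"
          using borel_measurable_integrable[OF F] by (rule borel_measurable_times)
      qed
      finally show ?thesis using box by simp
    qed
    \<comment> \<open>The induction step for complements requires the integral over the whole space,
      which is exhausted by growing boxes.\<close>
    have UNIV: "set_lebesgue_integral lborel UNIV f = 0"
    proof -
      let ?A = "\<lambda>n::nat. box (- (real n *\<^sub>R One)) (real n *\<^sub>R One) :: 'a set"
      have "(\<lambda>n. set_lebesgue_integral lborel (?A n) f) \<longlonglongrightarrow> set_lebesgue_integral lborel (\<Union>n. ?A n) f"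
      proof (rule set_integral_cont_up)
        show "incseq ?A"
        proof (rule incseq_SucI, rule subsetI)
          fix n x assume x: "x \<in> ?A n"
          have "- real (Suc n) < x \<bullet> b \<and> x \<bullet> b < real (Suc n)" if "b \<in> Basis" for b
          proof -
            have "- real n < x \<bullet> b" "x \<bullet> b < real n" using x that by (auto simp: mem_box)
            then show ?thesis by simp
          qed
          then show "x \<in> ?A (Suc n)" by (simp add: mem_box)
        qed
      qed (auto intro: setint)
      then show ?thesis unfolding basic UN_box_eq_UNIV by (simp add: LIMSEQ_const_iff)
    qed
    have "Int_stable ?E" "?E \<subseteq> Pow UNIV" by (auto simp: Int_stable_def box_Int_box)
    moreover have "A \<in> sigma_sets UNIV ?E" using that by (simp add: borel_eq_box)
    ultimately show ?thesis
    proof (induction rule: sigma_sets_induct_disjoint)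
      case (basic A) then show ?case using \<open>\<And>a b. set_lebesgue_integral lborel (box a b) f = 0\<close> by auto
    next
      case empty show ?case by (simp add: set_lebesgue_integral_def)
    next
      case (compl A)
      then have A: "A \<in> sets borel" by (simp add: borel_eq_box)
      have "set_lebesgue_integral lborel (A \<union> (UNIV - A)) f =
        set_lebesgue_integral lborel A f + set_lebesgue_integral lborel (UNIV - A) f"
        using A by (intro set_integral_Un setint) auto
      then show ?case using compl UNIV by simp
    next
      case (union A)
      then have "A i \<in> sets borel" for i by (auto simp: borel_eq_box)
      then have "set_lebesgue_integral lborel (\<Union>i. A i) f = (\<Sum>i. set_lebesgue_integral lborel (A i) f)"
        using union by (intro lebesgue_integral_countable_add setint) (auto simp: disjoint_family_on_def)
      then show ?case using union by simp
    qed
  qed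
  have "AE x in lborel. f x = 0" by (rule sigma_finite_measure.density_zero[OF lborel.sigma_finite_measure_axioms int 0])
  then have "AE x in lebesgue. f x = 0" by (rule AE_completion)
  then show ?thesis using eq' by eventually_elim simp
qed

text \<open>An open set is a countable union of closed boxes, and each of them differs from its open
  box by a null set.\<close>

lemma AE_open_of_cboxes:
  fixes \<Omega> :: "'a::euclidean_space set"
  assumes "open \<Omega>" and "\<And>a b. cbox a b \<subseteq> \<Omega> \<Longrightarrow> AE x in lebesgue. x \<in> box a b \<longrightarrow> P x"
  shows "AE x in lebesgue. x \<in> \<Omega> \<longrightarrow> P x"
proof -
  obtain \<D> where \<D>: "countable \<D>" "\<D> \<subseteq> Pow \<Omega>" "\<And>X. X \<in> \<D> \<Longrightarrow> \<exists>a b. X = cbox a b" "\<Union>\<D> = \<Omega>"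
    by (rule open_countable_Union_open_cbox[OF assms(1)]) blast
  have "AE x in lebesgue. x \<in> X \<longrightarrow> P x" if "X \<in> \<D>" for X
  proof -
    from \<D>(3)[OF that] obtain a b where X: "X = cbox a b" by blast
    have "negligible (cbox a b - box a b)" by (rule negligible_frontier_interval)
    then have "AE x in lebesgue. x \<notin> cbox a b - box a b"
      unfolding negligible_iff_null_sets by (rule AE_not_in)
    moreover have "AE x in lebesgue. x \<in> box a b \<longrightarrow> P x" using \<D>(2) that X by (intro assms(2)) auto
    ultimately show ?thesis unfolding X by eventually_elim auto
  qed
  then have "AE x in lebesgue. \<forall>X\<in>\<D>. x \<in> X \<longrightarrow> P x" using \<D>(1) by (subst AE_ball_countable) blast+
  then show ?thesis using \<D>(4) by (auto elim: eventually_mono)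
qed

lemma test_function_continuous: "test_function \<Omega> \<phi> \<Longrightarrow> continuous_on UNIV \<phi>"
  unfolding test_function_def using Ck.simps(1) by blast

lemma test_function_C1: "test_function \<Omega> \<phi> \<Longrightarrow> Ck (Suc 0) \<phi>"
  unfolding test_function_def by blast

lemma test_function_differentiable: "test_function \<Omega> \<phi> \<Longrightarrow> \<phi> differentiable (at x)"
  using test_function_C1[of \<Omega> \<phi>] by simp

lemma test_function_partial_continuous: "test_function \<Omega> \<phi> \<Longrightarrow> continuous_on UNIV (partial_deriv i \<phi>)"
  using test_function_C1[of \<Omega> \<phi>] by simp

lemma test_function_nz: "test_function \<Omega> \<phi> \<Longrightarrow> \<phi> x \<noteq> 0 \<Longrightarrow> x \<in> \<Omega>"
  unfolding test_function_def using closure_subset[of "{x. \<phi> x \<noteq> 0}"] by blast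

lemma test_function_mono: "test_function \<Omega> \<phi> \<Longrightarrow> \<Omega> \<subseteq> \<Omega>' \<Longrightarrow> test_function \<Omega>' \<phi>"
  unfolding test_function_def by blast

lemma test_function_partial_zero:
  assumes "test_function \<Omega> \<phi>" "x \<notin> closure {x. \<phi> x \<noteq> 0}"
  shows "partial_deriv i \<phi> x = 0"
proof -
  let ?K = "closure {x. \<phi> x \<noteq> 0}"
  have "(\<phi> has_derivative (\<lambda>h. 0)) (at x)"
  proof (rule has_derivative_transform_within_open[OF has_derivative_const])
    show "open (- ?K)" by (simp add: open_Compl)
    show "x \<in> - ?K" using assms(2) by simp
    fix y assume "y \<in> - ?K"
    then have "y \<notin> {x. \<phi> x \<noteq> 0}" using closure_subset[of "{x. \<phi> x \<noteq> 0}"] by blast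
    then show "0 = \<phi> y" by simp
  qed
  then show ?thesis by (rule partial_derivI)
qed

lemma test_function_partial_nz: "test_function \<Omega> \<phi> \<Longrightarrow> partial_deriv i \<phi> x \<noteq> 0 \<Longrightarrow> x \<in> \<Omega>"
  using test_function_partial_zero[of \<Omega> \<phi> x i] unfolding test_function_def by blast

lemma test_function_bounds:
  assumes "test_function \<Omega> \<phi>"
  obtains B R where "\<And>x. \<bar>\<phi> x\<bar> \<le> B" "\<And>x i. \<bar>partial_deriv i \<phi> x\<bar> \<le> B"
    "\<And>x. norm x > R \<Longrightarrow> \<phi> x = 0" "\<And>x i. norm x > R \<Longrightarrow> partial_deriv i \<phi> x = 0"
proof -
  let ?K = "closure {x. \<phi> x \<noteq> 0}"
  have K: "compact ?K" using assms by (simp add: test_function_def)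
  obtain R where R: "\<And>x. x \<in> ?K \<Longrightarrow> norm x \<le> R" using compact_imp_bounded[OF K] by (auto simp: bounded_iff)
  have bdd: "\<exists>B. \<forall>x. \<bar>f x\<bar> \<le> B" if "continuous_on UNIV f" "\<And>x. x \<notin> ?K \<Longrightarrow> f x = 0" for f :: "real^'a \<Rightarrow> real"
  proof -
    have "compact (f ` ?K)" by (intro compact_continuous_image K continuous_on_subset[OF that(1)]) auto
    obtain B where "\<And>x. x \<in> ?K \<Longrightarrow> \<bar>f x\<bar> \<le> B" using compact_imp_bounded[OF \<open>compact (f ` ?K)\<close>] by (auto simp: bounded_iff)
    then have "\<bar>f x\<bar> \<le> max B 0" for x using that(2)[of x] by (cases "x \<in> ?K") (auto simp: le_max_iff_disj)
    then show ?thesis by blast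
  qed
  have "x \<notin> ?K \<Longrightarrow> \<phi> x = 0" for x using closure_subset[of "{x. \<phi> x \<noteq> 0}"] by blast
  then obtain B0 where B0: "\<And>x. \<bar>\<phi> x\<bar> \<le> B0" using bdd[OF test_function_continuous[OF assms]] by blast
  have "\<exists>B. \<forall>x. \<bar>partial_deriv i \<phi> x\<bar> \<le> B" for i
    using test_function_partial_zero[OF assms] by (intro bdd test_function_partial_continuous[OF assms]) auto
  then obtain B1 where B1: "\<And>i x. \<bar>partial_deriv i \<phi> x\<bar> \<le> B1 i" by metis
  define B where "B = \<bar>B0\<bar> + (\<Sum>i\<in>UNIV. \<bar>B1 i\<bar>)"
  show ?thesis
  proof (rule that[of B R])
    fix x i
    have s: "0 \<le> (\<Sum>i\<in>UNIV. \<bar>B1 i\<bar>)" by (intro sum_nonneg) auto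
    show "\<bar>\<phi> x\<bar> \<le> B" using B0[of x] s unfolding B_def by linarith
    have "\<bar>B1 i\<bar> \<le> (\<Sum>i\<in>UNIV. \<bar>B1 i\<bar>)" by (rule member_le_sum) auto
    then show "\<bar>partial_deriv i \<phi> x\<bar> \<le> B" using B1[of i x] unfolding B_def by linarith
    show "norm x > R \<Longrightarrow> partial_deriv i \<phi> x = 0" using R[of x] test_function_partial_zero[OF assms, of x i] by force
    show "norm x > R \<Longrightarrow> \<phi> x = 0" using R[of x] closure_subset[of "{x. \<phi> x \<noteq> 0}"] by force
  qed
qed

lemma integral_lebesgue_on_zero_outside:
  fixes f :: "'a::euclidean_space \<Rightarrow> real"
  assumes "S \<in> sets lebesgue" "\<And>x. x \<notin> S \<Longrightarrow> f x = 0"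
  shows "(LINT x|lebesgue_on S. f x) = (LINT x|lebesgue. f x)"
    and "integrable (lebesgue_on S) f \<longleftrightarrow> integrable lebesgue f"
proof -
  have eq: "(\<lambda>x. indicator S x * f x) = f" using assms(2) by (auto simp: fun_eq_iff indicator_def of_bool_def)
  show "(LINT x|lebesgue_on S. f x) = (LINT x|lebesgue. f x)"
    using assms(1) by (simp add: integral_restrict_space eq)
  show "integrable (lebesgue_on S) f \<longleftrightarrow> integrable lebesgue f"
    using assms(1) by (simp add: integrable_restrict_space eq)
qed

lemma borel_measurable_lebesgue_onI:
  "f \<in> borel_measurable borel \<Longrightarrow> f \<in> borel_measurable (lebesgue_on S)"
  by (intro measurable_restrict_space1 borel_measurable_lebesgueI)

context
  fixes \<Omega> :: "(real^'n) set"
  assumes open\<Omega>: "open \<Omega>"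
begin

lemma \<Omega>_sets: "\<Omega> \<in> sets lebesgue" using open\<Omega> by auto

lemma test_function_L2:
  assumes "test_function \<Omega> \<phi>"
  shows "L2_on \<Omega> \<phi>" "L2_on \<Omega> (partial_deriv i \<phi>)"
proof -
  obtain B R where B: "\<And>x. \<bar>\<phi> x\<bar> \<le> B" "\<And>x i. \<bar>partial_deriv i \<phi> x\<bar> \<le> B"
    "\<And>x. norm x > R \<Longrightarrow> \<phi> x = 0" "\<And>x i. norm x > R \<Longrightarrow> partial_deriv i \<phi> x = 0"
    using test_function_bounds[OF assms] by metis
  have L2: "L2_on \<Omega> f" if "continuous_on UNIV f" "\<And>x. \<bar>f x\<bar> \<le> B" "\<And>x. norm x > R \<Longrightarrow> f x = 0" "\<And>x. x \<notin> \<Omega> \<Longrightarrow> f x = 0" for f :: "real^'n \<Rightarrow> real"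
  proof -
    have m: "f \<in> borel_measurable borel" using that(1) by (rule borel_measurable_continuous_onI)
    have "integrable lebesgue (\<lambda>x. (norm (f x))\<^sup>2)"
    proof (rule integrable_lebesgue_bounded[where B = "B\<^sup>2" and R = R])
      show "(\<lambda>x. (norm (f x))\<^sup>2) \<in> borel_measurable lebesgue" using m by (intro borel_measurable_lebesgueI) measurable
      show "norm ((norm (f x))\<^sup>2) \<le> B\<^sup>2" for x using that(2)[of x] by (simp add: power2_le_iff_abs_le abs_le_square_iff[symmetric])
    qed (use that in auto)
    then show ?thesis
      using m integral_lebesgue_on_zero_outside(2)[OF \<Omega>_sets, of "\<lambda>x. (norm (f x))\<^sup>2"] that(4)
      by (simp add: L2_on_def borel_measurable_lebesgue_onI)
  qed
  have "\<phi> x = 0" "partial_deriv i \<phi> x = 0" if "x \<notin> \<Omega>" for x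
    using test_function_nz[OF assms] test_function_partial_nz[OF assms] that by blast+
  then show "L2_on \<Omega> \<phi>" "L2_on \<Omega> (partial_deriv i \<phi>)"
    using B by (intro L2 test_function_continuous[OF assms] test_function_partial_continuous[OF assms]; blast)+
qed

lemma L2_component: "L2_on \<Omega> v \<Longrightarrow> L2_on \<Omega> (\<lambda>x. (v x :: real^'m) $ i)"
  unfolding L2_on_def
proof (elim conjE, intro conjI)
  assume v: "v \<in> borel_measurable (lebesgue_on \<Omega>)" "integrable (lebesgue_on \<Omega>) (\<lambda>x. (norm (v x))\<^sup>2)"
  show m: "(\<lambda>x. v x $ i) \<in> borel_measurable (lebesgue_on \<Omega>)"
    unfolding cart_eq_inner_axis using v(1) by measurable
  show "integrable (lebesgue_on \<Omega>) (\<lambda>x. (norm (v x $ i))\<^sup>2)"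
  proof (rule Bochner_Integration.integrable_bound[OF v(2)])
    show "(\<lambda>x. (norm (v x $ i))\<^sup>2) \<in> borel_measurable (lebesgue_on \<Omega>)" using m by measurable
    have "(norm (v x $ i))\<^sup>2 \<le> (norm (v x))\<^sup>2" for x
      using component_le_norm_cart[of "v x" i] by (intro power_mono) auto
    then show "AE x in lebesgue_on \<Omega>. norm ((norm (v x $ i))\<^sup>2) \<le> norm ((norm (v x))\<^sup>2)" by simp
  qed
qed

lemma L2_component2: "L2_on \<Omega> G \<Longrightarrow> L2_on \<Omega> (\<lambda>x. (G x :: real^'m^'k) $ i $ j)"
  unfolding L2_on_def
proof (elim conjE, intro conjI)
  assume v: "G \<in> borel_measurable (lebesgue_on \<Omega>)" "integrable (lebesgue_on \<Omega>) (\<lambda>x. (norm (G x))\<^sup>2)"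
  have "(\<lambda>A :: real^'m^'k. A $ i $ j) \<in> borel_measurable borel"
    by (intro borel_measurable_continuous_onI continuous_intros)
  from measurable_compose[OF v(1) this] show m: "(\<lambda>x. G x $ i $ j) \<in> borel_measurable (lebesgue_on \<Omega>)" .
  have "\<bar>A $ i $ j\<bar> \<le> norm A" for A :: "real^'m^'k"
    by (rule order_trans[OF component_le_norm_cart Finite_Cartesian_Product.norm_nth_le])
  then have le: "(norm (G x $ i $ j))\<^sup>2 \<le> (norm (G x))\<^sup>2" for x
    by (intro power_mono) auto
  show "integrable (lebesgue_on \<Omega>) (\<lambda>x. (norm (G x $ i $ j))\<^sup>2)"
  proof (rule Bochner_Integration.integrable_bound[OF v(2)])
    show "(\<lambda>x. (norm (G x $ i $ j))\<^sup>2) \<in> borel_measurable (lebesgue_on \<Omega>)" using m by measurable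
    show "AE x in lebesgue_on \<Omega>. norm ((norm (G x $ i $ j))\<^sup>2) \<le> norm ((norm (G x))\<^sup>2)" using le by simp
  qed
qed

text \<open>Bump functions converge to the indicator of a box inside \<Omega> and are dominated by
  it, so f integrates to 0 over all such boxes. The criterion on box integrals is then applied to f
  cut off to one fixed box.\<close>

lemma AE_zero_of_test_functions:
  fixes f :: "real^'n \<Rightarrow> real"
  assumes f: "L2_on \<Omega> f" and 0: "\<And>\<phi>. test_function \<Omega> \<phi> \<Longrightarrow> (LINT x|lebesgue_on \<Omega>. f x * \<phi> x) = 0"
  shows "AE x in lebesgue_on \<Omega>. f x = 0"
proof -
  have "AE x in lebesgue. x \<in> box a b \<longrightarrow> f x = 0" if ab: "cbox a b \<subseteq> \<Omega>" for a b
  proof -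
    have sub: "box c d \<subseteq> \<Omega> \<and> cbox c d \<subseteq> \<Omega>" if "box c d \<subseteq> box a b" "box c d \<noteq> {}" for c d
      using closure_mono[OF that(1)] that ab box_subset_cbox[of a b] closure_box[of c d] by (metis closure_box empty_subsetI order_trans subset_empty box_subset_cbox)
    have L2ind: "L2_on \<Omega> (indicator (box c d) :: _ \<Rightarrow> real)" for c d
    proof -
      have "\<Omega> \<inter> box c d \<in> lmeasurable"
        using \<Omega>_sets by (intro bounded_set_imp_lmeasurable bounded_Int disjI2 bounded_box sets.Int) auto
      then have "integrable lebesgue (indicator (\<Omega> \<inter> box c d) :: _ \<Rightarrow> real)"
        by (simp add: lmeasurable_iff_integrable)
      then have "integrable (lebesgue_on \<Omega>) (indicator (box c d) :: _ \<Rightarrow> real)"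
        using \<Omega>_sets by (simp add: integrable_restrict_space indicator_inter_arith[symmetric])
      moreover have "(norm (indicator (box c d) x :: real))\<^sup>2 = indicator (box c d) x" for x
        by (simp add: indicator_def)
      ultimately show ?thesis by (simp add: L2_on_def borel_measurable_lebesgue_onI)
    qed
    have int: "integrable (lebesgue_on \<Omega>) (\<lambda>x. indicator (box c d) x * f x)" for c d
      using L2_inner_integrable[OF \<Omega>_sets L2ind f] by simp
    have zero: "(LINT x|lebesgue_on \<Omega>. indicator (box c d) x * f x) = 0" if "box c d \<subseteq> box a b" for c d
    proof (cases "box c d = {}")
      case False
      with sub that have cd: "cbox c d \<subseteq> \<Omega>" by blast
      have "(\<lambda>n. LINT x|lebesgue_on \<Omega>. f x * box_bump n c d x) \<longlonglongrightarrow> (LINT x|lebesgue_on \<Omega>. indicator (box c d) x * f x)"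
      proof (rule integral_dominated_convergence)
        show "integrable (lebesgue_on \<Omega>) (\<lambda>x. \<bar>indicator (box c d) x * f x\<bar>)" using int by auto
        show "(\<lambda>x. f x * box_bump n c d x) \<in> borel_measurable (lebesgue_on \<Omega>)" for n
          using f test_function_L2(1)[OF test_function_box_bump[OF cd]] unfolding L2_on_def
          by (intro borel_measurable_times) blast+
        show "AE x in lebesgue_on \<Omega>. (\<lambda>n. f x * box_bump n c d x) \<longlonglongrightarrow> indicator (box c d) x * f x"
          using tendsto_mult[OF tendsto_const box_bump_tendsto] by (intro AE_I2) (simp add: mult.commute)
        show "AE x in lebesgue_on \<Omega>. norm (f x * box_bump n c d x) \<le> \<bar>indicator (box c d) x * f x\<bar>" for n
        proof (rule AE_I2)
          fix x show "norm (f x * box_bump n c d x) \<le> \<bar>indicator (box c d) x * f x\<bar>"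
            using box_bump_bounds[of n c d x] box_bump_nonzero[of n c d x]
            by (cases "x \<in> box c d") (auto simp: abs_mult mult_left_le)
        qed
      qed (use int in blast)
      then show ?thesis using 0[OF test_function_box_bump[OF cd]] by (simp add: LIMSEQ_const_iff)
    qed simp
    \<comment> \<open>A box that leaves \<open>box a b\<close>, and possibly \<Omega>, is
      intersected with \<open>box a b\<close>; the intersection is again a box.\<close>
    have eqint: "(LINT x|lebesgue. indicator (box c d) x * (indicator (box a b) x * f x)) = 0" for c d
    proof -
      obtain c' d' where cd: "box c d \<inter> box a b = box c' d'" by (auto simp: box_Int_box)
      have e: "(\<lambda>x. indicator (box c d) x * (indicator (box a b) x * f x)) = (\<lambda>x. indicator (box c' d') x * f x)"
        by (rule ext) (simp add: cd[symmetric] indicator_inter_arith)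
      have "(LINT x|lebesgue_on \<Omega>. indicator (box c' d') x * f x) = (LINT x|lebesgue. indicator (box c' d') x * f x)"
        using cd ab box_subset_cbox[of a b] by (intro integral_lebesgue_on_zero_outside \<Omega>_sets) (auto simp: indicator_def)
      moreover have "box c' d' \<subseteq> box a b" using cd by blast
      ultimately show ?thesis unfolding e using zero by metis
    qed
    have "integrable lebesgue (\<lambda>x. indicator (box a b) x * f x)"
      using int[of a b] integral_lebesgue_on_zero_outside(2)[OF \<Omega>_sets, of "\<lambda>x. indicator (box a b) x * f x"]
        ab box_subset_cbox[of a b] by (auto simp: indicator_def)
    from AE_eq_0_of_box_integrals[OF this eqint] show ?thesis
      by eventually_elim (auto simp: indicator_def split: if_splits)
  qed
  then have "AE x in lebesgue. x \<in> \<Omega> \<longrightarrow> f x = 0" by (rule AE_open_of_cboxes[OF open\<Omega>])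
  then show ?thesis using \<Omega>_sets by (simp add: AE_restrict_space_iff)
qed

text \<open>This makes the arbitrary choice in \<open>weak_jacobian\<close> harmless: any weak
  Jacobian that is known explicitly yields the same norms and integrals.\<close>

lemma weak_jacobian_unique:
  assumes "has_weak_jacobian \<Omega> v G" "has_weak_jacobian \<Omega> v G'"
  shows "AE x in lebesgue_on \<Omega>. G x = G' x"
proof -
  have L2: "L2_on \<Omega> G" "L2_on \<Omega> G'" using assms by (auto simp: has_weak_jacobian_def)
  have "AE x in lebesgue_on \<Omega>. G x $ i $ j + (-1) *\<^sub>R G' x $ i $ j = 0" for i j
  proof (rule AE_zero_of_test_functions)
    have L2c: "L2_on \<Omega> (\<lambda>x. G x $ i $ j)" "L2_on \<Omega> (\<lambda>x. G' x $ i $ j)" using L2 by (auto intro: L2_component2)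
    show "L2_on \<Omega> (\<lambda>x. G x $ i $ j + (-1) *\<^sub>R G' x $ i $ j)" by (intro L2_on_lincomb \<Omega>_sets L2c)
    fix \<phi> assume \<phi>: "test_function \<Omega> \<phi>"
    have "(LINT x|lebesgue_on \<Omega>. v x $ i * partial_deriv j \<phi> x) = - (LINT x|lebesgue_on \<Omega>. G x $ i $ j * \<phi> x)"
      "(LINT x|lebesgue_on \<Omega>. v x $ i * partial_deriv j \<phi> x) = - (LINT x|lebesgue_on \<Omega>. G' x $ i $ j * \<phi> x)"
      using assms \<phi> unfolding has_weak_jacobian_def by blast+
    then have "(LINT x|lebesgue_on \<Omega>. G x $ i $ j * \<phi> x) = (LINT x|lebesgue_on \<Omega>. G' x $ i $ j * \<phi> x)"
      by linarith
    moreover have "integrable (lebesgue_on \<Omega>) (\<lambda>x. G x $ i $ j * \<phi> x)" "integrable (lebesgue_on \<Omega>) (\<lambda>x. G' x $ i $ j * \<phi> x)"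
      using L2_inner_integrable[OF \<Omega>_sets L2c(1) test_function_L2(1)[OF \<phi>]] L2_inner_integrable[OF \<Omega>_sets L2c(2) test_function_L2(1)[OF \<phi>]] by auto
    ultimately show "(LINT x|lebesgue_on \<Omega>. (G x $ i $ j + (-1) *\<^sub>R G' x $ i $ j) * \<phi> x) = 0"
      by (simp add: algebra_simps)
  qed
  then have "AE x in lebesgue_on \<Omega>. \<forall>i\<in>UNIV. \<forall>j\<in>UNIV. G x $ i $ j + (-1) *\<^sub>R G' x $ i $ j = 0"
    by (intro AE_finite_allI) auto
  then show ?thesis by eventually_elim (simp add: vec_eq_iff)
qed

lemma has_weak_jacobian_weak_jacobian: "v \<in> H1 \<Omega> \<Longrightarrow> has_weak_jacobian \<Omega> v (weak_jacobian \<Omega> v)"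
  unfolding H1_def weak_jacobian_def by (auto intro: someI[of "has_weak_jacobian \<Omega> v"])

lemma H1_L2: "v \<in> H1 \<Omega> \<Longrightarrow> L2_on \<Omega> v" "v \<in> H1 \<Omega> \<Longrightarrow> L2_on \<Omega> (weak_jacobian \<Omega> v)"
  using has_weak_jacobian_weak_jacobian by (auto simp: H1_def has_weak_jacobian_def)

lemma has_weak_jacobian_lincomb:
  assumes u: "L2_on \<Omega> u" "has_weak_jacobian \<Omega> u G" and v: "L2_on \<Omega> v" "has_weak_jacobian \<Omega> v G'"
  shows "has_weak_jacobian \<Omega> (\<lambda>x. u x + a *\<^sub>R v x) (\<lambda>x. G x + a *\<^sub>R G' x)"
  unfolding has_weak_jacobian_def
proof (intro conjI allI impI)
  have L2: "L2_on \<Omega> G" "L2_on \<Omega> G'" using u v by (auto simp: has_weak_jacobian_def)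
  then show "L2_on \<Omega> (\<lambda>x. G x + a *\<^sub>R G' x)" by (intro L2_on_lincomb \<Omega>_sets)
  fix \<phi> i j assume \<phi>: "test_function \<Omega> \<phi>"
  have lin: "(LINT x|lebesgue_on \<Omega>. (f x + a * g x) * h x) = (LINT x|lebesgue_on \<Omega>. f x * h x) + a * (LINT x|lebesgue_on \<Omega>. g x * h x)"
    if "L2_on \<Omega> f" "L2_on \<Omega> g" "L2_on \<Omega> h" for f g h :: "real^'n \<Rightarrow> real"
    using L2_inner_lincomb(2)[OF \<Omega>_sets that, of a] by (simp add: L2_inner_def)
  show "(LINT x|lebesgue_on \<Omega>. (u x + a *\<^sub>R v x) $ i * partial_deriv j \<phi> x) =
      - (LINT x|lebesgue_on \<Omega>. (G x + a *\<^sub>R G' x) $ i $ j * \<phi> x)"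
    using u(2) v(2) \<phi>
    by (simp add: lin L2_component[OF u(1)] L2_component[OF v(1)] L2_component2[OF L2(1)] L2_component2[OF L2(2)]
      test_function_L2[OF \<phi>] has_weak_jacobian_def)
qed

lemma H1_lincomb: "u \<in> H1 \<Omega> \<Longrightarrow> v \<in> H1 \<Omega> \<Longrightarrow> (\<lambda>x. u x + a *\<^sub>R v x) \<in> H1 \<Omega>"
  using has_weak_jacobian_lincomb[of u _ v _ a] L2_on_lincomb[OF \<Omega>_sets, of u v a] unfolding H1_def by blast

lemma weak_jacobian_lincomb:
  assumes "u \<in> H1 \<Omega>" "v \<in> H1 \<Omega>"
  shows "AE x in lebesgue_on \<Omega>. weak_jacobian \<Omega> (\<lambda>x. u x + a *\<^sub>R v x) x = weak_jacobian \<Omega> u x + a *\<^sub>R weak_jacobian \<Omega> v x"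
  using assms by (intro weak_jacobian_unique[OF has_weak_jacobian_weak_jacobian has_weak_jacobian_lincomb] H1_lincomb H1_L2 has_weak_jacobian_weak_jacobian)

lemma weak_jacobian_AE_eq: "L2_on \<Omega> v \<Longrightarrow> has_weak_jacobian \<Omega> v G \<Longrightarrow> v \<in> H1 \<Omega> \<and> (AE x in lebesgue_on \<Omega>. weak_jacobian \<Omega> v x = G x)"
  using weak_jacobian_unique[OF has_weak_jacobian_weak_jacobian, of v G] by (auto simp: H1_def)

definition H1_inner :: "(real^'n \<Rightarrow> real^'n) \<Rightarrow> (real^'n \<Rightarrow> real^'n) \<Rightarrow> real" where
  "H1_inner u v = L2_inner \<Omega> u v + L2_inner \<Omega> (weak_jacobian \<Omega> u) (weak_jacobian \<Omega> v)"

lemma H1_norm_sq: "(H1_norm \<Omega> v)\<^sup>2 = H1_inner v v" "0 \<le> H1_norm \<Omega> v" "0 \<le> H1_inner v v"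
  by (auto simp: H1_norm_def H1_inner_def L2_norm_nonneg[OF \<Omega>_sets])

lemma H1_inner_self_lincomb:
  assumes "u \<in> H1 \<Omega>" "v \<in> H1 \<Omega>"
  shows "H1_inner (\<lambda>x. u x + a *\<^sub>R v x) (\<lambda>x. u x + a *\<^sub>R v x) = H1_inner u u + 2 * a * H1_inner u v + a\<^sup>2 * H1_inner v v"
proof -
  let ?G = "weak_jacobian \<Omega> (\<lambda>x. u x + a *\<^sub>R v x)" and ?G' = "\<lambda>x. weak_jacobian \<Omega> u x + a *\<^sub>R weak_jacobian \<Omega> v x"
  have L: "L2_on \<Omega> ?G" "L2_on \<Omega> ?G'" using assms by (auto intro!: H1_L2 H1_lincomb L2_on_lincomb \<Omega>_sets)
  have "L2_inner \<Omega> ?G ?G = L2_inner \<Omega> ?G' ?G'"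
    using weak_jacobian_lincomb[OF assms, of a] by (intro L2_inner_cong_AE \<Omega>_sets L)
  then show ?thesis
    using assms by (simp add: H1_inner_def L2_inner_self_lincomb[OF \<Omega>_sets] H1_L2 algebra_simps)
qed

lemma H1_norm_lincomb_le:
  assumes "u \<in> H1 \<Omega>" "v \<in> H1 \<Omega>"
  shows "H1_norm \<Omega> (\<lambda>x. u x + a *\<^sub>R v x) \<le> H1_norm \<Omega> u + \<bar>a\<bar> * H1_norm \<Omega> v"
proof (rule power2_le_imp_le)
  have "\<bar>H1_inner u v\<bar> \<le> sqrt (H1_inner u u) * sqrt (H1_inner v v)"
  proof (rule abs_le_sqrt_mult)
    fix t show "0 \<le> H1_inner u u + 2 * t * H1_inner u v + t\<^sup>2 * H1_inner v v"
      using H1_norm_sq(3)[of "\<lambda>x. u x + t *\<^sub>R v x"] H1_inner_self_lincomb[OF assms, of t] by simp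
  qed
  then have CS: "\<bar>H1_inner u v\<bar> \<le> H1_norm \<Omega> u * H1_norm \<Omega> v"
    by (simp add: H1_norm_sq(1)[symmetric] H1_norm_sq(2))
  have "a * H1_inner u v \<le> \<bar>a\<bar> * \<bar>H1_inner u v\<bar>" by (metis abs_ge_self abs_mult)
  also have "\<dots> \<le> \<bar>a\<bar> * (H1_norm \<Omega> u * H1_norm \<Omega> v)" using CS by (intro mult_left_mono) auto
  finally show "(H1_norm \<Omega> (\<lambda>x. u x + a *\<^sub>R v x))\<^sup>2 \<le> (H1_norm \<Omega> u + \<bar>a\<bar> * H1_norm \<Omega> v)\<^sup>2"
    unfolding H1_norm_sq(1) H1_inner_self_lincomb[OF assms] by (simp add: power2_sum power_mult_distrib H1_norm_sq(1) algebra_simps)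
qed (auto simp: H1_norm_sq)

lemma H1_norm_eq:
  assumes "L2_on \<Omega> v" "has_weak_jacobian \<Omega> v G"
  shows "(H1_norm \<Omega> v)\<^sup>2 = (L2_norm \<Omega> v)\<^sup>2 + (L2_norm \<Omega> G)\<^sup>2"
proof -
  have *: "v \<in> H1 \<Omega>" "AE x in lebesgue_on \<Omega>. weak_jacobian \<Omega> v x = G x" using weak_jacobian_AE_eq[OF assms] by auto
  then have "L2_inner \<Omega> (weak_jacobian \<Omega> v) (weak_jacobian \<Omega> v) = L2_inner \<Omega> G G"
    using assms by (intro L2_inner_cong_AE \<Omega>_sets H1_L2) (auto simp: has_weak_jacobian_def)
  then show ?thesis by (simp add: H1_norm_sq H1_inner_def L2_norm_nonneg[OF \<Omega>_sets])
qed

end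

section \<open>The divergence theorem for piecewise smooth vector fields\<close>

text \<open>The i-th component is differentiated in direction i. The jump terms, weighted with the
  components of \<nu>, add up to the normal component of the jump, so a purely tangential jump
  leaves no trace in the formula.\<close>

theorem divergence_theorem_piecewise:
  fixes HH :: "(real^'n) set set" and \<nu> :: "(real^'n) set \<Rightarrow> real^'n" and c :: "(real^'n) set \<Rightarrow> real"
    and f :: "real^'n \<Rightarrow> real^'n" and f' :: "real^'n \<Rightarrow> real^'n \<Rightarrow> real^'n"
  assumes fin: "finite HH"
    and unit: "\<And>H. H \<in> HH \<Longrightarrow> norm (\<nu> H) = 1"
    and hyp: "\<And>H. H \<in> HH \<Longrightarrow> H = {x. \<nu> H \<bullet> x = c H}"
    and f: "f \<in> borel_measurable borel" and f': "\<And>i. (\<lambda>x. f' x (axis i 1) $ i) \<in> borel_measurable borel"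
    and bound: "\<And>x. norm (f x) \<le> M" "\<And>x i. \<bar>f' x (axis i 1) $ i\<bar> \<le> M"
    and support: "\<And>x. norm x > R \<Longrightarrow> f x = 0" "\<And>x i. norm x > R \<Longrightarrow> f' x (axis i 1) $ i = 0"
    and deriv: "\<And>x. x \<notin> \<Union>HH \<Longrightarrow> (f has_derivative f' x) (at x)"
    and jump: "\<And>H x. H \<in> HH \<Longrightarrow> x \<in> H \<Longrightarrow> x \<notin> \<Union>(HH - {H}) \<Longrightarrow>
      ((\<lambda>t. f (x + t *\<^sub>R \<nu> H) - f (x - t *\<^sub>R \<nu> H)) \<longlongrightarrow> j H x) (at_right 0)"
  shows "(LINT x|lebesgue. (\<Sum>i\<in>UNIV. f' x (axis i 1) $ i)) =
      - (\<Sum>H\<in>HH. LINT y|lebesgue. indicator {y. \<bar>\<nu> H \<bullet> y - c H\<bar> \<le> 1/2} y * (\<nu> H \<bullet> j H (hyperplane_proj \<nu> c H y)))"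
    and "\<And>H. H \<in> HH \<Longrightarrow> integrable lebesgue (\<lambda>y. indicator {y. \<bar>\<nu> H \<bullet> y - c H\<bar> \<le> 1/2} y * (\<nu> H \<bullet> j H (hyperplane_proj \<nu> c H y)))"
proof -
  have [measurable]: "(\<lambda>x. f x $ i) \<in> borel_measurable borel" for i
    using f unfolding cart_eq_inner_axis by measurable
  have fb: "\<bar>f x $ i\<bar> \<le> M" for x i using bound(1)[of x] component_le_norm_cart[of "f x" i] by linarith
  have der: "((\<lambda>t. f (x + t *\<^sub>R axis i 1) $ i) has_real_derivative f' x (axis i 1) $ i) (at 0)" if "x \<notin> \<Union>HH" for x i
  proof -
    have line: "((\<lambda>t. x + t *\<^sub>R axis i 1) has_derivative (\<lambda>t. t *\<^sub>R axis i 1)) (at 0)"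
      by (auto intro!: derivative_eq_intros)
    have "(f has_derivative f' x) (at (x + 0 *\<^sub>R axis i 1))" using deriv[OF that] by simp
    from has_derivative_compose[OF line this]
    have 1: "((\<lambda>t. f (x + t *\<^sub>R axis i 1)) has_derivative (\<lambda>t. f' x (t *\<^sub>R axis i 1))) (at 0)" .
    from has_derivative_compose[OF this bounded_linear_imp_has_derivative[OF bounded_linear_vec_nth[of i]]]
    have "((\<lambda>t. f (x + t *\<^sub>R axis i 1) $ i) has_derivative (\<lambda>t. f' x (t *\<^sub>R axis i 1) $ i)) (at 0)" .
    moreover have "f' x (t *\<^sub>R axis i 1) = t *\<^sub>R f' x (axis i 1)" for t
      using has_derivative_linear[OF deriv[OF that]] by (rule linear_scale)
    ultimately show ?thesis
      by (simp add: has_field_derivative_def mult_commute_abs)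
  qed
  have jmp: "((\<lambda>t. f (x + t *\<^sub>R \<nu> H) $ i - f (x - t *\<^sub>R \<nu> H) $ i) \<longlongrightarrow> j H x $ i) (at_right 0)"
    if "H \<in> HH" "x \<in> H" "x \<notin> \<Union>(HH - {H})" for H x i
    using tendsto_vec_nth[OF jump[OF that], of i] by simp
  note ctx = fin unit hyp \<open>\<And>i. (\<lambda>x. f x $ i) \<in> borel_measurable borel\<close> f' fb bound(2)
  let ?J = "\<lambda>H i. LINT y|lebesgue. indicator {y. \<bar>\<nu> H \<bullet> y - c H\<bar> \<le> 1/2} y * j H (hyperplane_proj \<nu> c H y) $ i"
  have D: "(LINT x|lebesgue. f' x (axis i 1) $ i) = - (\<Sum>H\<in>HH. (\<nu> H \<bullet> axis i 1) * ?J H i)" for i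
    by (rule integral_directional_derivative[where j = "\<lambda>H x. j H x $ i" and M = M and R = R and g = "\<lambda>x. f x $ i"
      and dg = "\<lambda>x. f' x (axis i 1) $ i" and e = "axis i 1"])
      (fact ctx | fact der | fact jmp | simp add: support)+
  have I: "integrable lebesgue (\<lambda>y. indicator {y. \<bar>\<nu> H \<bullet> y - c H\<bar> \<le> 1/2} y * j H (hyperplane_proj \<nu> c H y) $ i)" if "H \<in> HH" for H i
    by (rule jump_integrable[where j = "\<lambda>x. j H x $ i" and M = M and R = R and g = "\<lambda>x. f x $ i"
      and dg = "\<lambda>x. f' x (axis i 1) $ i" and e = "axis i 1" and HH = HH])
      (fact ctx | fact der | fact jmp | fact that | rule jmp[OF that] | simp add: support)+
  have eq: "indicator {y. \<bar>\<nu> H \<bullet> y - c H\<bar> \<le> 1/2} y * (\<nu> H \<bullet> j H (hyperplane_proj \<nu> c H y)) =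
    (\<Sum>i\<in>UNIV. \<nu> H $ i * (indicator {y. \<bar>\<nu> H \<bullet> y - c H\<bar> \<le> 1/2} y * j H (hyperplane_proj \<nu> c H y) $ i))" for H y
  proof -
    have "\<nu> H \<bullet> w = (\<Sum>i\<in>UNIV. \<nu> H $ i * w $ i)" for w by (simp add: inner_vec_def)
    from this[of "j H (hyperplane_proj \<nu> c H y)"] show ?thesis by (simp only: sum_distrib_left mult.left_commute)
  qed
  have eqI: "(LINT y|lebesgue. indicator {y. \<bar>\<nu> H \<bullet> y - c H\<bar> \<le> 1/2} y * (\<nu> H \<bullet> j H (hyperplane_proj \<nu> c H y))) = (\<Sum>i\<in>UNIV. \<nu> H $ i * ?J H i)"
    if "H \<in> HH" for H
    unfolding eq using I[OF that] by (subst Bochner_Integration.integral_sum) auto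
  have int: "integrable lebesgue (\<lambda>x. f' x (axis i 1) $ i)" for i
    by (rule integrable_lebesgue_bounded[where B = M and R = R]) (use bound support in \<open>auto intro: borel_measurable_lebesgueI f'\<close>)
  have "(LINT x|lebesgue. (\<Sum>i\<in>UNIV. f' x (axis i 1) $ i)) = (\<Sum>i\<in>UNIV. - (\<Sum>H\<in>HH. \<nu> H $ i * ?J H i))"
    using int by (simp add: Bochner_Integration.integral_sum D inner_axis)
  also have "\<dots> = - (\<Sum>H\<in>HH. \<Sum>i\<in>UNIV. \<nu> H $ i * ?J H i)"
    by (simp add: sum_negf sum.swap[of _ HH])
  also have "\<dots> = - (\<Sum>H\<in>HH. LINT y|lebesgue. indicator {y. \<bar>\<nu> H \<bullet> y - c H\<bar> \<le> 1/2} y * (\<nu> H \<bullet> j H (hyperplane_proj \<nu> c H y)))"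
    by (intro arg_cong[of _ _ uminus] sum.cong refl eqI[symmetric])
  finally show "(LINT x|lebesgue. (\<Sum>i\<in>UNIV. f' x (axis i 1) $ i)) =
      - (\<Sum>H\<in>HH. LINT y|lebesgue. indicator {y. \<bar>\<nu> H \<bullet> y - c H\<bar> \<le> 1/2} y * (\<nu> H \<bullet> j H (hyperplane_proj \<nu> c H y)))" .
  show "\<And>H. H \<in> HH \<Longrightarrow> integrable lebesgue (\<lambda>y. indicator {y. \<bar>\<nu> H \<bullet> y - c H\<bar> \<le> 1/2} y * (\<nu> H \<bullet> j H (hyperplane_proj \<nu> c H y)))"
    unfolding eq using I by auto
qed

section \<open>Facets of simplices\<close>

lemma simplex_interior:
  fixes K :: "(real^'n) set"
  assumes "int CARD('n) simplex K"
  shows "interior K \<noteq> {}" "closure (interior K) = K" "convex K" "compact K" "closed K"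
    "frontier K = \<Union>{F. F facet_of K}" "finite {F. F facet_of K}"
proof -
  show K: "convex K" "compact K" "closed K"
    using assms by (auto intro: convex_simplex compact_simplex closed_simplex)
  have dim: "aff_dim K = DIM(real^'n)" using aff_dim_simplex[OF assms] by simp
  show int: "interior K \<noteq> {}"
  proof -
    have "K \<noteq> {}" using dim by auto
    moreover have "rel_interior K = interior K"
      using dim by (intro rel_interior_interior) (simp add: aff_dim_eq_full[symmetric])
    ultimately show ?thesis using rel_interior_eq_empty[OF K(1)] by simp
  qed
  show "closure (interior K) = K" using convex_closure_interior[OF K(1) int] K(3) by simp
  have "rel_frontier K = frontier K" using int by (simp add: rel_frontier_nonempty_interior)
  then show "frontier K = \<Union>{F. F facet_of K}"
    using rel_frontier_of_polyhedron[OF simplex_imp_polyhedron[OF assms]] by simp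
  show "finite {F. F facet_of K}"
    by (rule finite_polyhedron_facets[OF simplex_imp_polyhedron[OF assms]])
qed

text \<open>On a hyperplane the value is the same for every point that may be chosen. It is the
  offset belonging to the normal selected by \<open>face_normal\<close>, whatever the sign of that
  normal.\<close>

definition hcst :: "(real^'n) set \<Rightarrow> real" where
  "hcst H = face_normal H \<bullet> (SOME p. p \<in> H)"

lemma hyperplane_face_normal:
  fixes a :: "real^'n"
  assumes a: "a \<noteq> 0" and H: "H = {x. a \<bullet> x = b}"
  shows "norm (face_normal H) = 1" "H = {x. face_normal H \<bullet> x = hcst H}"
proof -
  define p0 where "p0 = (b / (a \<bullet> a)) *\<^sub>R a"
  have p0: "p0 \<in> H" using a by (simp add: H p0_def)
  let ?P = "\<lambda>\<nu>. norm \<nu> = 1 \<and> (\<forall>x\<in>H. \<forall>y\<in>H. (x - y) \<bullet> \<nu> = 0)"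
  have "?P (a /\<^sub>R norm a)" using a by (auto simp: H inner_diff_right inner_commute[of _ a])
  then have P: "?P (face_normal H)" unfolding face_normal_def by (rule someI)
  then show unit: "norm (face_normal H) = 1" by blast
  define \<nu> where "\<nu> = face_normal H"
  have \<nu>: "norm \<nu> = 1" "\<And>x y. x \<in> H \<Longrightarrow> y \<in> H \<Longrightarrow> (x - y) \<bullet> \<nu> = 0" using P by (auto simp: \<nu>_def)
  \<comment> \<open>The part of \<nu> orthogonal to a. Moving along it stays in \<open>H\<close>,
    where \<nu> is constant, so it vanishes and \<nu> is a multiple of a.\<close>
  define w where "w = \<nu> - ((a \<bullet> \<nu>) / (a \<bullet> a)) *\<^sub>R a"
  have aw: "a \<bullet> w = 0" using a by (simp add: w_def inner_diff_right)
  then have "p0 + w \<in> H" using p0 by (simp add: H inner_add_right)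
  from \<nu>(2)[OF this p0] have "w \<bullet> \<nu> = 0" by simp
  then have "w \<bullet> w = 0" using aw by (simp add: w_def inner_diff_right inner_commute)
  then have k: "\<nu> = ((a \<bullet> \<nu>) / (a \<bullet> a)) *\<^sub>R a" by (simp add: w_def)
  define s where "s = (a \<bullet> \<nu>) / (a \<bullet> a)"
  have s: "\<nu> = s *\<^sub>R a" using k by (simp add: s_def)
  then have "s \<noteq> 0" using \<nu>(1) by auto
  define q where "q = (SOME p. p \<in> H)"
  have q: "q \<in> H" unfolding q_def using p0 by (rule someI)
  have "hcst H = \<nu> \<bullet> q" by (simp add: hcst_def q_def \<nu>_def)
  then have "hcst H = s * b" using q s by (simp add: H)
  then show "H = {x. face_normal H \<bullet> x = hcst H}"
    unfolding \<nu>_def[symmetric] using \<open>s \<noteq> 0\<close> s by (auto simp: H)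
qed

lemma facet_hyperplane:
  fixes K :: "(real^'n) set"
  assumes K: "int CARD('n) simplex K" and F: "F facet_of K"
  shows "norm (face_normal F) = 1"
    and "affine hull F = {x. face_normal F \<bullet> x = hcst (affine hull F)}"
    and "face_normal (affine hull F) = face_normal F"
    and "F = affine hull F \<inter> K" and "F \<inter> interior K = {}" and "convex F" and "compact F" and "F \<noteq> {}" and "F \<subseteq> K"
proof -
  have "aff_dim F = DIM(real^'n) - 1"
    using F aff_dim_simplex[OF K] by (simp add: facet_of_def)
  then obtain a b where ab: "a \<noteq> 0" "affine hull F = {x. a \<bullet> x = b}" using aff_dim_eq_hyperplane by blast
  note hyp = hyperplane_face_normal[OF ab]
  \<comment> \<open>Orthogonality to F and to its affine hull are the same condition, hence
    \<open>SOME\<close> selects the same vector for both.\<close>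
  have "(\<forall>x\<in>F. \<forall>y\<in>F. (x - y) \<bullet> \<nu> = 0) \<longleftrightarrow> (\<forall>x\<in>affine hull F. \<forall>y\<in>affine hull F. (x - y) \<bullet> \<nu> = 0)" for \<nu>
  proof
    assume *: "\<forall>x\<in>F. \<forall>y\<in>F. (x - y) \<bullet> \<nu> = 0"
    obtain p where p: "p \<in> F" using F by (auto simp: facet_of_def)
    have "F \<subseteq> {x. \<nu> \<bullet> x = \<nu> \<bullet> p}"
    proof
      fix x assume "x \<in> F"
      then have "(x - p) \<bullet> \<nu> = 0" using * p by blast
      then show "x \<in> {x. \<nu> \<bullet> x = \<nu> \<bullet> p}" by (simp add: inner_diff_left inner_diff_right inner_commute)
    qed
    then have "affine hull F \<subseteq> {x. \<nu> \<bullet> x = \<nu> \<bullet> p}" by (rule hull_minimal) (rule affine_hyperplane)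
    then have a: "\<nu> \<bullet> x = \<nu> \<bullet> p" if "x \<in> affine hull F" for x using that by blast
    show "\<forall>x\<in>affine hull F. \<forall>y\<in>affine hull F. (x - y) \<bullet> \<nu> = 0"
    proof (intro ballI)
      fix x y assume "x \<in> affine hull F" "y \<in> affine hull F"
      from a[OF this(1)] a[OF this(2)] have "\<nu> \<bullet> x = \<nu> \<bullet> y" by simp
      then show "(x - y) \<bullet> \<nu> = 0" by (simp add: inner_diff_left inner_diff_right inner_commute)
    qed
  next
    assume "\<forall>x\<in>affine hull F. \<forall>y\<in>affine hull F. (x - y) \<bullet> \<nu> = 0"
    then show "\<forall>x\<in>F. \<forall>y\<in>F. (x - y) \<bullet> \<nu> = 0" using hull_subset[of F affine] by blast
  qed
  then show eq: "face_normal (affine hull F) = face_normal F" by (simp add: face_normal_def)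
  show "norm (face_normal F) = 1" "affine hull F = {x. face_normal F \<bullet> x = hcst (affine hull F)}"
    using hyp unfolding eq by blast+
  have face: "F face_of K" using F by (rule facet_of_imp_face_of)
  show "F = affine hull F \<inter> K"
    using face_of_imp_eq_affine_Int[OF convex_simplex[OF K] face] .
  have "F \<noteq> K" using F by (auto simp: facet_of_def)
  then show "F \<inter> interior K = {}" using face_of_disjoint_interior[OF face] by blast
  show "convex F" "compact F"
    using face face_of_imp_convex face_of_imp_compact convex_simplex[OF K] compact_simplex[OF K] by blast+
  show "F \<noteq> {}" "F \<subseteq> K" using F by (auto simp: facet_of_def facet_of_imp_subset dest: face_of_imp_subset)
qed

text \<open>One hyperplane may carry facets of many elements. This family counts it once, whereas
  the stabilization form counts every pair of an element and a facet.\<close>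

definition hyps :: "(real^'n) set set \<Rightarrow> (real^'n) set set" where
  "hyps T = (\<lambda>F. affine hull F) ` (\<Union>K\<in>T. {F. F facet_of K})"

lemma hypsI: "K \<in> T \<Longrightarrow> F facet_of K \<Longrightarrow> affine hull F \<in> hyps T"
  by (auto simp: hyps_def)

abbreviation hproj :: "(real^'n) set \<Rightarrow> real^'n \<Rightarrow> real^'n" where
  "hproj \<equiv> hyperplane_proj face_normal hcst"

abbreviation slab :: "(real^'n) set \<Rightarrow> (real^'n) set" where
  "slab H \<equiv> {y. \<bar>face_normal H \<bullet> y - hcst H\<bar> \<le> 1/2}"

text \<open>The prism over F is the part of the slab around H that projects into F, and there the
  closest point of F is the orthogonal projection to H. This gives face integrals the shape in which
  the divergence theorem delivers its jump terms.\<close>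

lemma face_integral_eq:
  fixes K :: "(real^'n) set"
  assumes K: "int CARD('n) simplex K" and F: "F facet_of K" and H: "H = affine hull F"
  shows "face_integral F f = (LINT y|lebesgue. indicator (slab H) y * (indicator F (hproj H y) * f (hproj H y)))"
    and "face_integral F f = (LINT y|lebesgue_on {y \<in> slab H. hproj H y \<in> F}. f (hproj H y))"
    and "{y \<in> slab H. hproj H y \<in> F} \<in> sets lebesgue" and "bounded {y \<in> slab H. hproj H y \<in> F}"
proof -
  note fh = facet_hyperplane[OF K F]
  let ?\<nu> = "face_normal F"
  have \<nu>: "face_normal H = ?\<nu>" "norm ?\<nu> = 1" "?\<nu> \<bullet> ?\<nu> = 1" and Heq: "\<And>x. x \<in> H \<longleftrightarrow> ?\<nu> \<bullet> x = hcst H"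
    using fh(1-3) by (auto simp: H norm_eq_1)
  have FH: "F \<subseteq> H" unfolding H by (rule hull_subset)
  let ?P = "{y \<in> slab H. hproj H y \<in> F}"
  have P: "{x + t *\<^sub>R face_normal F |x t. x \<in> F \<and> \<bar>t\<bar> \<le> 1/2} = ?P"
  proof (intro set_eqI iffI)
    fix y assume "y \<in> {x + t *\<^sub>R face_normal F |x t. x \<in> F \<and> \<bar>t\<bar> \<le> 1/2}"
    then obtain x t where xt: "y = x + t *\<^sub>R ?\<nu>" "x \<in> F" "\<bar>t\<bar> \<le> 1/2" by blast
    have "?\<nu> \<bullet> y - hcst H = t" using xt FH Heq[of x] \<nu>(3) by (auto simp: inner_add_right)
    moreover from this have "hproj H y = x" unfolding hyperplane_proj_def \<nu>(1) by (simp only: xt(1)) simp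
    ultimately show "y \<in> ?P" using xt(2,3) by (simp add: \<nu>(1))
  next
    fix y assume "y \<in> ?P"
    then show "y \<in> {x + t *\<^sub>R face_normal F |x t. x \<in> F \<and> \<bar>t\<bar> \<le> 1/2}"
      by (intro CollectI exI[of _ "hproj H y"] exI[of _ "?\<nu> \<bullet> y - hcst H"]) (simp add: hyperplane_proj_def \<nu>(1))
  qed
  have closest: "closest_point F y = hproj H y" if "y \<in> ?P" for y
  proof (rule closest_point_unique[symmetric])
    show "convex F" "closed F" "hproj H y \<in> F" using fh that by (auto simp: compact_imp_closed)
    show "\<forall>z\<in>F. dist y (hproj H y) \<le> dist y z"
    proof
      fix z assume "z \<in> F"
      let ?s = "?\<nu> \<bullet> y - hcst H"
      have "?\<nu> \<bullet> (y - z) = ?s" using \<open>z \<in> F\<close> FH Heq[of z] by (auto simp: inner_diff_right)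
      then have "\<bar>?s\<bar> \<le> norm ?\<nu> * norm (y - z)" by (metis Cauchy_Schwarz_ineq2)
      then show "dist y (hproj H y) \<le> dist y z" using \<nu> by (simp add: dist_norm hyperplane_proj_def)
    qed
  qed
  have contp: "continuous_on UNIV (hproj H)" unfolding hyperplane_proj_def by (intro continuous_intros)
  have "closed {y. \<bar>face_normal H \<bullet> y - hcst H\<bar> \<le> 1/2}" by (intro closed_Collect_le continuous_intros)
  moreover have "closed (hproj H -` F)" using contp fh(7) by (simp add: closed_vimage compact_imp_closed)
  ultimately have "closed (slab H \<inter> hproj H -` F)" by (rule closed_Int)
  moreover have "slab H \<inter> hproj H -` F = ?P" by auto
  ultimately have "closed ?P" by simp
  then show sets: "?P \<in> sets lebesgue" by auto
  obtain B where B: "\<And>x. x \<in> F \<Longrightarrow> norm x \<le> B" using compact_imp_bounded[OF fh(7)] by (auto simp: bounded_iff)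
  show "bounded ?P"
  proof (rule boundedI)
    fix y assume "y \<in> ?P"
    then have "norm (hproj H y) \<le> B" "\<bar>face_normal H \<bullet> y - hcst H\<bar> \<le> 1/2" using B by auto
    moreover have "y = hproj H y + (face_normal H \<bullet> y - hcst H) *\<^sub>R ?\<nu>" by (simp add: hyperplane_proj_def \<nu>(1))
    ultimately show "norm y \<le> B + 1/2"
      using norm_triangle_ineq[of "hproj H y" "(face_normal H \<bullet> y - hcst H) *\<^sub>R ?\<nu>"] \<nu>(2) by simp
  qed
  have "face_integral F f = (LINT y|lebesgue_on ?P. f (closest_point F y))"
    by (simp only: face_integral_def P)
  also have "\<dots> = (LINT y|lebesgue_on ?P. f (hproj H y))"
    by (rule Bochner_Integration.integral_cong) (simp_all add: space_restrict_space closest)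
  finally show eq: "face_integral F f = (LINT y|lebesgue_on ?P. f (hproj H y))" .
  also have "\<dots> = (LINT y|lebesgue. indicator ?P y *\<^sub>R f (hproj H y))"
    using sets by (intro integral_restrict_space) simp
  also have "\<dots> = (LINT y|lebesgue. indicator (slab H) y * (indicator F (hproj H y) * f (hproj H y)))"
    by (rule Bochner_Integration.integral_cong) (auto simp: indicator_def)
  finally show "face_integral F f = (LINT y|lebesgue. indicator (slab H) y * (indicator F (hproj H y) * f (hproj H y)))" .
qed

section \<open>Elements and the arrangement of their facet hyperplanes\<close>

locale simplicial =
  fixes T :: "(real^'n) set set"
  assumes finT: "finite T" and simT: "\<And>K. K \<in> T \<Longrightarrow> int CARD('n) simplex K"
begin

lemma finite_hyps: "finite (hyps T)"
  using finT simT simplex_interior(7) by (auto simp: hyps_def)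

lemma hypsE:
  assumes "H \<in> hyps T"
  obtains K F where "K \<in> T" "F facet_of K" "H = affine hull F"
  using assms unfolding hyps_def by blast

lemma hyps_unit: "H \<in> hyps T \<Longrightarrow> norm (face_normal H) = 1"
  by (elim hypsE) (simp add: facet_hyperplane(1,3)[OF simT])

lemma hyps_eq:
  assumes "H \<in> hyps T" shows "H = {x. face_normal H \<bullet> x = hcst H}"
proof -
  obtain K F where KF: "K \<in> T" "F facet_of K" "H = affine hull F" using assms by (rule hypsE)
  have "face_normal H = face_normal F" using facet_hyperplane(3)[OF simT[OF KF(1)] KF(2)] KF(3) by simp
  moreover have "H = {x. face_normal F \<bullet> x = hcst H}"
    using facet_hyperplane(2)[OF simT[OF KF(1)] KF(2)] unfolding KF(3) .
  ultimately show ?thesis by metis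
qed

lemma hyps_mem: "H \<in> hyps T \<Longrightarrow> x \<in> H \<longleftrightarrow> face_normal H \<bullet> x = hcst H"
  using hyps_eq by blast

lemma frontier_subset_hyps: "K \<in> T \<Longrightarrow> frontier K \<subseteq> \<Union>(hyps T)"
  using simplex_interior(6)[OF simT, of K] hypsI[of K T] hull_subset[of _ affine] by blast

lemma closed_hyps:
  assumes "H \<in> hyps T" shows "closed H"
  using closed_hyperplane hyps_eq[OF assms, symmetric] by (rule back_subst)

text \<open>The hyperplanes contain the frontiers of all elements, and a connected set that avoids
  the frontier of K cannot meet both K and its complement.\<close>

lemma cell_dichotomy:
  assumes "connected S" "S \<inter> \<Union>(hyps T) = {}" "K \<in> T"
  shows "S \<subseteq> interior K \<or> S \<inter> K = {}"
proof (rule ccontr)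
  assume *: "\<not> ?thesis"
  have fr: "S \<inter> frontier K = {}" using assms frontier_subset_hyps by blast
  then have "S \<inter> K = {} \<or> S - K = {}" using connected_Int_frontier[OF assms(1), of K] by blast
  moreover have "K \<subseteq> interior K \<union> frontier K" using closure_subset by (auto simp: frontier_def)
  ultimately show False using * fr by blast
qed

lemma ball_off_hyps:
  assumes "x \<notin> \<Union>(hyps T)"
  obtains r where "r > 0" "ball x r \<inter> \<Union>(hyps T) = {}"
proof -
  have "open (- \<Union>(hyps T))" using finite_hyps closed_hyps by (intro open_Compl closed_Union) auto
  moreover have "x \<in> - \<Union>(hyps T)" using assms by simp
  ultimately obtain r where "r > 0" "ball x r \<subseteq> - \<Union>(hyps T)" by (rule openE)
  then show ?thesis using that by blast
qed

text \<open>The two open half-balls at x are convex and meet no hyperplane, so each lies inside or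
  outside any given element. The sign of s selects the half-ball.\<close>

lemma sides_off_hyps:
  assumes H: "H \<in> hyps T" and x: "x \<in> H" "x \<notin> \<Union>(hyps T - {H})"
  obtains r where "r > 0"
    "\<And>s K. K \<in> T \<Longrightarrow> {y \<in> ball x r. 0 < s * (face_normal H \<bullet> y - hcst H)} \<subseteq> interior K \<or>
      {y \<in> ball x r. 0 < s * (face_normal H \<bullet> y - hcst H)} \<inter> K = {}"
    "\<And>t. 0 < t \<Longrightarrow> t < r \<Longrightarrow> x + t *\<^sub>R face_normal H \<in> {y \<in> ball x r. 0 < 1 * (face_normal H \<bullet> y - hcst H)}"
    "\<And>t. 0 < t \<Longrightarrow> t < r \<Longrightarrow> x - t *\<^sub>R face_normal H \<in> {y \<in> ball x r. 0 < (-1) * (face_normal H \<bullet> y - hcst H)}"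
proof -
  let ?\<nu> = "face_normal H"
  have "open (- \<Union>(hyps T - {H}))" using finite_hyps closed_hyps by (intro open_Compl closed_Union) auto
  moreover have "x \<in> - \<Union>(hyps T - {H})" using x(2) by simp
  ultimately obtain r where r: "r > 0" "ball x r \<subseteq> - \<Union>(hyps T - {H})" by (rule openE)
  have \<nu>: "norm ?\<nu> = 1" "?\<nu> \<bullet> ?\<nu> = 1" using hyps_unit[OF H] by (auto simp: norm_eq_1)
  show ?thesis
  proof (rule that[OF r(1)])
    fix s K assume K: "K \<in> T"
    let ?S = "{y \<in> ball x r. 0 < s * (?\<nu> \<bullet> y - hcst H)}"
    have "?S = ball x r \<inter> {y. s * hcst H < (s *\<^sub>R ?\<nu>) \<bullet> y}" by (auto simp: algebra_simps)
    moreover have "convex {y. s * hcst H < (s *\<^sub>R ?\<nu>) \<bullet> y}" using convex_halfspace_gt[of "s * hcst H" "s *\<^sub>R ?\<nu>"] .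
    ultimately have "convex ?S" by (simp add: convex_Int)
    then have "connected ?S" by (rule convex_connected)
    moreover have "?S \<inter> \<Union>(hyps T) = {}" using r(2) hyps_mem[OF H] by fastforce
    ultimately show "?S \<subseteq> interior K \<or> ?S \<inter> K = {}" using K by (rule cell_dichotomy)
  next
    have xH: "?\<nu> \<bullet> x = hcst H" using x(1) hyps_mem[OF H] by blast
    fix t :: real assume t: "0 < t" "t < r"
    show "x + t *\<^sub>R ?\<nu> \<in> {y \<in> ball x r. 0 < 1 * (?\<nu> \<bullet> y - hcst H)}"
      using t \<nu> xH by (simp add: dist_norm inner_add_right)
    show "x - t *\<^sub>R ?\<nu> \<in> {y \<in> ball x r. 0 < (-1) * (?\<nu> \<bullet> y - hcst H)}"
      using t \<nu> xH by (simp add: dist_norm inner_diff_right)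
  qed
qed

end

section \<open>A trace inequality\<close>

lemma Ck1_facts:
  assumes "Ck (Suc 0) \<phi>"
  shows "\<phi> differentiable (at x)" "continuous_on UNIV \<phi>" "continuous_on UNIV (partial_deriv i \<phi>)"
    "(\<phi> has_derivative frechet_derivative \<phi> (at x)) (at x)" "partial_deriv i \<phi> x = frechet_derivative \<phi> (at x) (axis i 1)"
proof -
  show d: "\<phi> differentiable (at x)" "continuous_on UNIV (partial_deriv i \<phi>)" using assms by auto
  show "(\<phi> has_derivative frechet_derivative \<phi> (at x)) (at x)" using d(1) by (rule has_derivative_frechet)
  show "continuous_on UNIV \<phi>" using Ck_Suc_imp[OF assms] by simp
  show "partial_deriv i \<phi> x = frechet_derivative \<phi> (at x) (axis i 1)" by (simp add: partial_deriv_def)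
qed

text \<open>Otherwise the segment between the two interior points would cross H in the interior of
  K, although points of H in K belong to the facet.\<close>

lemma simplex_side:
  fixes K :: "(real^'n) set"
  assumes K: "int CARD('n) simplex K" and H: "H \<in> hyps {K}" and z: "z \<in> interior K" and w: "w \<in> interior K"
  shows "(face_normal H \<bullet> z - hcst H) * (face_normal H \<bullet> w - hcst H) > 0"
proof (rule ccontr)
  assume *: "\<not> ?thesis"
  interpret simplicial "{K}" by standard (use K in auto)
  obtain F where F: "F facet_of K" "H = affine hull F" using hypsE[OF H] by blast
  note fh = facet_hyperplane[OF K F(1)]
  have int: "x \<notin> H" if "x \<in> interior K" for x
  proof
    assume "x \<in> H"
    then have "x \<in> F" using fh(4) F(2) that interior_subset[of K] by blast
    then show False using fh(5) that by blast
  qed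
  define a where "a = face_normal H \<bullet> z - hcst H"
  define b where "b = face_normal H \<bullet> w - hcst H"
  have nz: "a \<noteq> 0" "b \<noteq> 0" using int z w hyps_mem[OF H] by (auto simp: a_def b_def)
  have ab: "a * b < 0" using * nz by (simp add: a_def[symmetric] b_def[symmetric] not_less order_le_less)
  \<comment> \<open>The zero, on the segment from z to w, of the affine function that defines
    H.\<close>
  define t where "t = a / (a - b)"
  have "a - b \<noteq> 0" using ab by (auto simp: mult_less_0_iff)
  have t: "0 \<le> t" "t \<le> 1" using ab by (auto simp: t_def mult_less_0_iff divide_simps)
  have "(1 - t) *\<^sub>R z + t *\<^sub>R w \<in> interior K"
    using convex_interior[OF simplex_interior(3)[OF K]] z w t by (simp add: convex_def)
  moreover have "face_normal H \<bullet> ((1 - t) *\<^sub>R z + t *\<^sub>R w) - hcst H = (1 - t) * a + t * b"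
    by (simp add: inner_add_right a_def b_def algebra_simps)
  moreover have "(1 - t) * a + t * b = 0" using \<open>a - b \<noteq> 0\<close> by (simp add: t_def field_simps)
  ultimately show False using int hyps_mem[OF H] by auto
qed

text \<open>If H were closer than \<rho>, the foot of the perpendicular from z would be an interior
  point of K on H, against \<open>simplex_side\<close>.\<close>

lemma simplex_inradius:
  fixes K :: "(real^'n) set"
  assumes K: "int CARD('n) simplex K" and H: "H \<in> hyps {K}" and z: "cball z \<rho> \<subseteq> K" and \<rho>: "\<rho> > 0"
  shows "\<rho> \<le> \<bar>face_normal H \<bullet> z - hcst H\<bar>" "z \<in> interior K"
proof -
  interpret simplicial "{K}" by standard (use K in auto)
  have b: "ball z \<rho> \<subseteq> interior K" using z by (meson ball_subset_cball interior_maximal open_ball order_trans)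
  then show zi: "z \<in> interior K" using \<rho> by auto
  show "\<rho> \<le> \<bar>face_normal H \<bullet> z - hcst H\<bar>"
  proof (rule ccontr)
    assume *: "\<not> ?thesis"
    let ?s = "face_normal H \<bullet> z - hcst H"
    have \<nu>: "norm (face_normal H) = 1" using hyps_unit[OF H] .
    have "z - ?s *\<^sub>R face_normal H \<in> interior K" using * \<nu> b by (auto simp: dist_norm)
    from simplex_side[OF K H zi this] \<nu> show False
      by (simp add: inner_diff_right norm_eq_1)
  qed
qed

text \<open>The divergence theorem for the field (\<phi> x)^2 (x - z) on K, extended by zero. On a
  facet the outward normal component of x - z is the distance of z from its hyperplane, which is at
  least \<rho>; the divergence is estimated by Young's inequality with weight h.\<close>

lemma trace_inequality:
  fixes K :: "(real^'n) set" and \<phi> :: "real^'n \<Rightarrow> real"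
  assumes K: "int CARD('n) simplex K" and z: "cball z \<rho> \<subseteq> K" and \<rho>: "\<rho> > 0"
    and h: "diameter K \<le> h" "h > 0" and \<phi>: "Ck (Suc 0) \<phi>"
  shows "\<rho> * (\<Sum>F | F facet_of K. face_integral F (\<lambda>x. (\<phi> x)\<^sup>2)) \<le>
     (LINT x|lebesgue. indicator K x * (real (CARD('n) + 1) * (\<phi> x)\<^sup>2 + h\<^sup>2 * (\<Sum>i\<in>UNIV. (partial_deriv i \<phi> x)\<^sup>2)))"
proof -
  interpret simplicial "{K}" by standard (use K in auto)
  note sK = simplex_interior[OF K]
  note C1 = Ck1_facts[OF \<phi>]
  have [measurable]: "K \<in> sets borel" "interior K \<in> sets borel" using sK(5) by auto
  have [measurable]: "\<phi> \<in> borel_measurable borel" "partial_deriv i \<phi> \<in> borel_measurable borel" for i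
    using C1(2,3) by (auto intro: borel_measurable_continuous_onI)
  define f where "f x = indicator K x *\<^sub>R ((\<phi> x)\<^sup>2 *\<^sub>R (x - z))" for x
  define f' where "f' x v = (if x \<in> interior K then (\<phi> x)\<^sup>2 *\<^sub>R v + (2 * \<phi> x * frechet_derivative \<phi> (at x) v) *\<^sub>R (x - z) else 0)" for x v
  have f'_eq: "f' x (axis i 1) $ i = indicator (interior K) x * ((\<phi> x)\<^sup>2 + 2 * \<phi> x * partial_deriv i \<phi> x * (x - z) $ i)" for x i
    by (simp add: f'_def C1(5) axis_def)
  have bdd: "\<exists>B. \<forall>x\<in>K. \<bar>g x\<bar> \<le> B" if "continuous_on UNIV g" for g :: "real^'n \<Rightarrow> real"
    using compact_imp_bounded[OF compact_continuous_image[OF continuous_on_subset[OF that] sK(4)]] by (auto simp: bounded_iff)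
  have "continuous_on UNIV (\<lambda>x. norm ((\<phi> x)\<^sup>2 *\<^sub>R (x - z)))" by (intro continuous_intros C1(2))
  from bdd[OF this] obtain B0 where B0: "\<And>x. x \<in> K \<Longrightarrow> norm ((\<phi> x)\<^sup>2 *\<^sub>R (x - z)) \<le> B0" by auto
  have "continuous_on UNIV (\<lambda>x. (\<phi> x)\<^sup>2 + 2 * \<phi> x * partial_deriv i \<phi> x * (x - z) $ i)" for i
    by (intro continuous_intros C1(2,3))
  from bdd[OF this] obtain B1 where B1: "\<And>x i. x \<in> K \<Longrightarrow> \<bar>(\<phi> x)\<^sup>2 + 2 * \<phi> x * partial_deriv i \<phi> x * (x - z) $ i\<bar> \<le> B1 i" by metis
  define M where "M = \<bar>B0\<bar> + (\<Sum>i\<in>UNIV. \<bar>B1 i\<bar>)"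
  have sB: "\<bar>B1 i\<bar> \<le> (\<Sum>i\<in>UNIV. \<bar>B1 i\<bar>)" for i by (rule member_le_sum) auto
  have M: "\<bar>B0\<bar> \<le> M" "\<bar>B1 i\<bar> \<le> M" "0 \<le> M" for i
    using sB[of i] unfolding M_def by (auto intro!: sum_nonneg add_nonneg_nonneg)
  obtain R where R: "\<And>x. x \<in> K \<Longrightarrow> norm x \<le> R" using compact_imp_bounded[OF sK(4)] by (auto simp: bounded_iff)
  \<comment> \<open>The sign tells on which side of H the simplex lies. The field is zero on the
    other side, so the jump is the boundary value with this sign.\<close>
  define j where "j H x = (if x \<in> K then sgn (face_normal H \<bullet> z - hcst H) *\<^sub>R ((\<phi> x)\<^sup>2 *\<^sub>R (x - z)) else 0)" for H x
  have zi: "z \<in> interior K" using z \<rho> by (meson ball_subset_cball interior_maximal open_ball order_trans centre_in_ball subsetD)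
  have fcont: "isCont (\<lambda>x. (\<phi> x)\<^sup>2 *\<^sub>R (x - z)) x" for x
    using C1(2) by (intro continuous_intros) (simp add: continuous_on_eq_continuous_at)
  have jump: "((\<lambda>t. f (x + t *\<^sub>R face_normal H) - f (x - t *\<^sub>R face_normal H)) \<longlongrightarrow> j H x) (at_right 0)"
    if H: "H \<in> hyps {K}" and x: "x \<in> H" "x \<notin> \<Union>(hyps {K} - {H})" for H x
  proof -
    let ?\<nu> = "face_normal H"
    let ?\<sigma> = "sgn (?\<nu> \<bullet> z - hcst H)"
    have \<nu>: "norm ?\<nu> = 1" using hyps_unit[OF H] .
    have nz: "?\<nu> \<bullet> z - hcst H \<noteq> 0" using simplex_side[OF K H zi zi] by auto
    obtain r where r: "r > 0"
      and side: "\<And>s. {y \<in> ball x r. 0 < s * (?\<nu> \<bullet> y - hcst H)} \<subseteq> interior K \<or> {y \<in> ball x r. 0 < s * (?\<nu> \<bullet> y - hcst H)} \<inter> K = {}"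
      and plus: "\<And>t. 0 < t \<Longrightarrow> t < r \<Longrightarrow> x + t *\<^sub>R ?\<nu> \<in> {y \<in> ball x r. 0 < 1 * (?\<nu> \<bullet> y - hcst H)}"
      and minus: "\<And>t. 0 < t \<Longrightarrow> t < r \<Longrightarrow> x - t *\<^sub>R ?\<nu> \<in> {y \<in> ball x r. 0 < (-1) * (?\<nu> \<bullet> y - hcst H)}"
      by (rule sides_off_hyps[OF H x]) blast
    have lim: "((\<lambda>t. x + (s * t) *\<^sub>R ?\<nu>) \<longlongrightarrow> x) (at_right 0)" for s
      by (rule tendsto_eq_intros refl | simp)+
    have ev: "\<forall>\<^sub>F t in at_right 0. 0 < t \<and> t < r"
      using eventually_at_right_less[of "0::real"] eventually_at_rightI[of 0 r "\<lambda>t. t < r"] r by (auto intro: eventually_conj)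
    show ?thesis
    proof (cases "x \<in> K")
      case False
      have out: "{y \<in> ball x r. 0 < s * (?\<nu> \<bullet> y - hcst H)} \<inter> K = {} \<or> True" for s by simp
      have "open (- K)" using sK(5) by (simp add: open_Compl)
      have ne: "\<forall>\<^sub>F t in at_right 0. x + (s * t) *\<^sub>R ?\<nu> \<in> - K" for s
        by (rule topological_tendstoD[OF lim \<open>open (- K)\<close>]) (use False in simp)
      have "\<forall>\<^sub>F t in at_right 0. f (x + t *\<^sub>R ?\<nu>) - f (x - t *\<^sub>R ?\<nu>) = 0"
        using ne[of 1] ne[of "-1"] by eventually_elim (simp add: f_def)
      then show ?thesis using False by (simp add: j_def tendsto_eventually)
    next
      case True
      \<comment> \<open>Points on the segment from x towards z are interior to K. Those close to x
        show that the half-ball on the side of z meets K, hence lies in its interior.\<close>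
      have in\<sigma>: "{y \<in> ball x r. 0 < ?\<sigma> * (?\<nu> \<bullet> y - hcst H)} \<subseteq> interior K"
      proof -
        define e where "e = min 1 (r / (2 * (norm (x - z) + 1)))"
        have "0 < r / (2 * (norm (x - z) + 1))" using r by (intro divide_pos_pos) (auto intro: add_nonneg_pos)
        then have e: "0 < e" "e \<le> 1" by (auto simp: e_def)
        have "e * norm (x - z) \<le> r / (2 * (norm (x - z) + 1)) * norm (x - z)" by (intro mult_right_mono) (auto simp: e_def)
        also have "\<dots> < r" using r by (simp add: divide_simps) (smt (verit) mult_nonneg_nonneg norm_ge_zero)
        finally have "x - e *\<^sub>R (x - z) \<in> ball x r" using e by (simp add: dist_norm)
        moreover have yi: "x - e *\<^sub>R (x - z) \<in> interior K"
          using mem_interior_convex_shrink[OF sK(3) zi True e] .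
        moreover have "?\<nu> \<bullet> x = hcst H" using x(1) hyps_mem[OF H] by blast
        then have "?\<nu> \<bullet> (x - e *\<^sub>R (x - z)) - hcst H = e * (?\<nu> \<bullet> z - hcst H)"
          by (simp add: inner_diff_right algebra_simps)
        then have "0 < ?\<sigma> * (?\<nu> \<bullet> (x - e *\<^sub>R (x - z)) - hcst H)" using e nz
          by (simp add: mult.left_commute[of _ e] zero_less_mult_iff sgn_if)
        ultimately show ?thesis using side[of ?\<sigma>] interior_subset[of K] by blast
      qed
      have out: "{y \<in> ball x r. 0 < - ?\<sigma> * (?\<nu> \<bullet> y - hcst H)} \<inter> K = {}"
      proof (rule ccontr)
        assume "\<not> ?thesis"
        then obtain y where y: "y \<in> ball x r" "0 < - ?\<sigma> * (?\<nu> \<bullet> y - hcst H)" "y \<in> interior K"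
          using side[of "- ?\<sigma>"] by blast
        from simplex_side[OF K H zi y(3)] y(2) nz show False
          by (auto simp: sgn_if zero_less_mult_iff split: if_splits)
      qed
      have lim': "((\<lambda>t. (\<phi> (x + (s * t) *\<^sub>R ?\<nu>))\<^sup>2 *\<^sub>R ((x + (s * t) *\<^sub>R ?\<nu>) - z)) \<longlongrightarrow> (\<phi> x)\<^sup>2 *\<^sub>R (x - z)) (at_right 0)" for s
        by (rule isCont_tendsto_compose[OF fcont lim])
      show ?thesis
      proof (cases "?\<nu> \<bullet> z - hcst H > 0")
        case True
        then have \<sigma>: "?\<sigma> = 1" by simp
        have "\<forall>\<^sub>F t in at_right 0. (\<phi> (x + (1 * t) *\<^sub>R ?\<nu>))\<^sup>2 *\<^sub>R ((x + (1 * t) *\<^sub>R ?\<nu>) - z) = f (x + t *\<^sub>R ?\<nu>) - f (x - t *\<^sub>R ?\<nu>)"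
          using ev
        proof eventually_elim
          case (elim t)
          have "x + t *\<^sub>R ?\<nu> \<in> K" using plus[of t] elim in\<sigma> interior_subset[of K] unfolding \<sigma> by blast
          moreover have "x - t *\<^sub>R ?\<nu> \<notin> K" using minus[of t] elim out unfolding \<sigma> by blast
          ultimately show ?case by (simp add: f_def)
        qed
        from Lim_transform_eventually[OF lim'[of 1] this] show ?thesis
          using \<open>x \<in> K\<close> \<sigma> by (simp add: j_def)
      next
        case False
        then have \<sigma>: "?\<sigma> = -1" using nz by (simp add: sgn_if)
        have "\<forall>\<^sub>F t in at_right 0. - ((\<phi> (x + ((-1) * t) *\<^sub>R ?\<nu>))\<^sup>2 *\<^sub>R ((x + ((-1) * t) *\<^sub>R ?\<nu>) - z)) = f (x + t *\<^sub>R ?\<nu>) - f (x - t *\<^sub>R ?\<nu>)"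
          using ev
        proof eventually_elim
          case (elim t)
          have "x - t *\<^sub>R ?\<nu> \<in> K" using minus[of t] elim in\<sigma> interior_subset[of K] unfolding \<sigma> by blast
          moreover have "x + t *\<^sub>R ?\<nu> \<in> {y \<in> ball x r. 0 < - ?\<sigma> * (?\<nu> \<bullet> y - hcst H)}"
            using plus[of t] elim unfolding \<sigma> by simp
          then have "x + t *\<^sub>R ?\<nu> \<notin> K" using out by blast
          ultimately show ?case by (simp add: f_def)
        qed
        from Lim_transform_eventually[OF tendsto_minus[OF lim'[of "-1"]] this] show ?thesis
          using \<open>x \<in> K\<close> \<sigma> by (simp add: j_def)
      qed
    qed
  qed
  have deriv: "(f has_derivative f' x) (at x)" if x: "x \<notin> \<Union>(hyps {K})" for x
  proof -
    obtain r where r: "r > 0" "ball x r \<inter> \<Union>(hyps {K}) = {}" using ball_off_hyps[OF x] by blast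
    have "ball x r \<subseteq> interior K \<or> ball x r \<inter> K = {}" by (rule cell_dichotomy[OF _ r(2)]) auto
    then show ?thesis
    proof
      assume sub: "ball x r \<subseteq> interior K"
      have "((\<lambda>x. (\<phi> x)\<^sup>2 *\<^sub>R (x - z)) has_derivative f' x) (at x)"
      proof -
        have "((\<lambda>x. (\<phi> x)\<^sup>2) has_derivative (\<lambda>v. 2 * \<phi> x * frechet_derivative \<phi> (at x) v)) (at x)"
          using has_derivative_power[OF C1(4), of 2 x] by (simp add: mult_ac)
        moreover have "((\<lambda>x. x - z) has_derivative (\<lambda>v. v)) (at x)" by (auto intro!: derivative_eq_intros)
        ultimately have "((\<lambda>x. (\<phi> x)\<^sup>2 *\<^sub>R (x - z)) has_derivative
          (\<lambda>v. (\<phi> x)\<^sup>2 *\<^sub>R v + (2 * \<phi> x * frechet_derivative \<phi> (at x) v) *\<^sub>R (x - z))) (at x)"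
          by (rule has_derivative_scaleR)
        moreover have "x \<in> interior K" using sub r(1) centre_in_ball by blast
        then have "f' x = (\<lambda>v. (\<phi> x)\<^sup>2 *\<^sub>R v + (2 * \<phi> x * frechet_derivative \<phi> (at x) v) *\<^sub>R (x - z))"
          by (intro ext) (simp add: f'_def)
        ultimately show ?thesis by simp
      qed
      then show ?thesis
      proof (rule has_derivative_transform_within_open)
        show "(\<phi> y)\<^sup>2 *\<^sub>R (y - z) = f y" if "y \<in> ball x r" for y
          using that sub interior_subset[of K] by (auto simp: f_def indicator_def subset_iff)
      qed (use r(1) in auto)
    next
      assume dis: "ball x r \<inter> K = {}"
      have "x \<notin> interior K" using dis r(1) interior_subset[of K] centre_in_ball[of x r] by blast
      then have "f' x = (\<lambda>v. 0)" by (auto simp: f'_def)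
      moreover have "(f has_derivative (\<lambda>v. 0)) (at x)"
      proof (rule has_derivative_transform_within_open[OF has_derivative_const])
        show "0 = f y" if "y \<in> ball x r" for y
        proof -
          have "y \<notin> K" using that dis by blast
          then show ?thesis by (simp add: f_def)
        qed
      qed (use r(1) in auto)
      ultimately show ?thesis by simp
    qed
  qed
  have f_meas: "f \<in> borel_measurable borel" unfolding f_def by measurable
  have f'_meas: "(\<lambda>x. f' x (axis i 1) $ i) \<in> borel_measurable borel" for i
    unfolding f'_eq cart_eq_inner_axis[of "_ - z"] by measurable
  have D: "(LINT x|lebesgue. (\<Sum>i\<in>UNIV. f' x (axis i 1) $ i)) =
      - (\<Sum>H\<in>hyps {K}. LINT y|lebesgue. indicator (slab H) y * (face_normal H \<bullet> j H (hproj H y)))"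
  proof (rule divergence_theorem_piecewise(1)[where f = f and M = M and R = R])
    show "norm (f x) \<le> M" for x using B0[of x] M by (auto simp: f_def indicator_def)
    show "\<bar>f' x (axis i 1) $ i\<bar> \<le> M" for x i
      using B1[of x i] M(2)[of i] M(3) interior_subset[of K] unfolding f'_eq
      by (auto simp: indicator_def)
    show "norm x > R \<Longrightarrow> f x = 0" for x using R[of x] by (auto simp: f_def indicator_def)
    show "norm x > R \<Longrightarrow> f' x (axis i 1) $ i = 0" for x i
      using R[of x] interior_subset[of K] unfolding f'_eq by (auto simp: indicator_def)
  qed (fact finite_hyps hyps_unit hyps_eq f_meas f'_meas deriv jump)+
  \<comment> \<open>As x lies on H, the component of x - z along the normal is minus the signed
    distance of z.\<close>
  have jump_eq: "face_normal H \<bullet> j H x = - (indicator K x * \<bar>face_normal H \<bullet> z - hcst H\<bar> * (\<phi> x)\<^sup>2)" if "H \<in> hyps {K}" "x \<in> H" for H x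
  proof -
    have "face_normal H \<bullet> x = hcst H" using that hyps_mem by blast
    then show ?thesis by (simp add: j_def inner_diff_right abs_sgn[of "face_normal H \<bullet> z - hcst H"] algebra_simps)
  qed
  have projin: "hproj H y \<in> H" if "H \<in> hyps {K}" for H y
  proof -
    have "face_normal H \<bullet> face_normal H = 1" using hyps_unit[OF that] by (simp add: norm_eq_1)
    then have "face_normal H \<bullet> hproj H y = hcst H" by (simp add: hyperplane_proj_def inner_diff_right)
    then show ?thesis using hyps_mem[OF that] by blast
  qed
  have "\<rho> * (\<Sum>F | F facet_of K. face_integral F (\<lambda>x. (\<phi> x)\<^sup>2)) \<le> (LINT x|lebesgue. (\<Sum>i\<in>UNIV. f' x (axis i 1) $ i))"
  proof -
    \<comment> \<open>A facet is recovered as the intersection of its hyperplane with K, so for a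
      single simplex a sum over hyperplanes is a sum over facets.\<close>
    have inj: "inj_on (\<lambda>F. affine hull F) {F. F facet_of K}"
    proof (rule inj_onI, unfold mem_Collect_eq)
      fix F F' assume FF: "F facet_of K" "F' facet_of K" and eq: "affine hull F = affine hull F'"
      have "F = affine hull F \<inter> K" by (rule facet_hyperplane(4)[OF K FF(1)])
      also have "\<dots> = affine hull F' \<inter> K" by (simp only: eq)
      also have "\<dots> = F'" by (rule facet_hyperplane(4)[OF K FF(2), symmetric])
      finally show "F = F'" .
    qed
    have hy: "hyps {K} = (\<lambda>F. affine hull F) ` {F. F facet_of K}" by (simp add: hyps_def)
    have "(LINT x|lebesgue. (\<Sum>i\<in>UNIV. f' x (axis i 1) $ i)) = (\<Sum>F | F facet_of K.
       - (LINT y|lebesgue. indicator (slab (affine hull F)) y * (face_normal (affine hull F) \<bullet> j (affine hull F) (hproj (affine hull F) y))))"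
      unfolding D unfolding hy by (subst sum.reindex[OF inj]) (simp add: sum_negf)
    also have "\<dots> \<ge> (\<Sum>F | F facet_of K. \<rho> * face_integral F (\<lambda>x. (\<phi> x)\<^sup>2))"
    proof (rule sum_mono)
      fix F assume "F \<in> {F. F facet_of K}"
      then have F: "F facet_of K" by simp
      define H where "H = affine hull F"
      have H: "H \<in> hyps {K}" using hypsI[of K "{K}" F] F by (simp add: H_def)
      let ?d = "\<bar>face_normal H \<bullet> z - hcst H\<bar>"
      have "indicator (slab H) y * (face_normal H \<bullet> j H (hproj H y)) =
         - ?d * (indicator (slab H) y * (indicator F (hproj H y) * (\<phi> (hproj H y))\<^sup>2))" for y
      proof -
        have "indicator K (hproj H y) = (indicator F (hproj H y) :: real)"
          using facet_hyperplane(4)[OF K F] projin[OF H, of y] unfolding H_def[symmetric] by (auto simp: indicator_def)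
        then show ?thesis unfolding jump_eq[OF H projin[OF H]] by simp
      qed
      then have "(LINT y|lebesgue. indicator (slab H) y * (face_normal H \<bullet> j H (hproj H y))) = - ?d * face_integral F (\<lambda>x. (\<phi> x)\<^sup>2)"
        unfolding face_integral_eq(1)[OF K F H_def] by simp
      moreover have "0 \<le> face_integral F (\<lambda>x. (\<phi> x)\<^sup>2)"
        unfolding face_integral_def by (rule integral_nonneg_AE) simp
      moreover have "\<rho> \<le> ?d" by (rule simplex_inradius(1)[OF K H z \<rho>])
      ultimately show "\<rho> * face_integral F (\<lambda>x. (\<phi> x)\<^sup>2) \<le> - (LINT y|lebesgue. indicator (slab (affine hull F)) y *
          (face_normal (affine hull F) \<bullet> j (affine hull F) (hproj (affine hull F) y)))"
        unfolding H_def[symmetric] by (simp add: mult_right_mono)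
    qed
    finally show ?thesis by (simp add: sum_distrib_left)
  qed
  also have "\<dots> \<le> (LINT x|lebesgue. indicator K x * (real (CARD('n) + 1) * (\<phi> x)\<^sup>2 + h\<^sup>2 * (\<Sum>i\<in>UNIV. (partial_deriv i \<phi> x)\<^sup>2)))"
  proof (rule integral_mono')
    let ?G = "\<lambda>x. real (CARD('n) + 1) * (\<phi> x)\<^sup>2 + h\<^sup>2 * (\<Sum>i\<in>UNIV. (partial_deriv i \<phi> x)\<^sup>2)"
    have G: "0 \<le> ?G x" for x by (intro add_nonneg_nonneg mult_nonneg_nonneg sum_nonneg) auto
    have "continuous_on UNIV ?G" by (intro continuous_intros C1(2,3))
    from bdd[OF this] obtain B2 where B2: "\<And>x. x \<in> K \<Longrightarrow> \<bar>?G x\<bar> \<le> B2" by auto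
    show "integrable lebesgue (\<lambda>x. indicator K x * ?G x)"
    proof (rule integrable_lebesgue_bounded[where B = "\<bar>B2\<bar>" and R = R])
      show "norm (indicator K x * ?G x) \<le> \<bar>B2\<bar>" for x using B2[of x] by (cases "x \<in> K") auto
      show "norm x > R \<Longrightarrow> indicator K x * ?G x = 0" for x using R[of x] by (auto simp: indicator_def)
    qed (intro borel_measurable_lebesgueI, measurable)
    show "0 \<le> indicator K x * ?G x" for x using G by (simp add: indicator_def)
    show "(\<Sum>i\<in>UNIV. f' x (axis i 1) $ i) \<le> indicator K x * ?G x" for x
    proof (cases "x \<in> interior K")
      case True
      then have xK: "x \<in> K" "z \<in> K" using interior_subset zi by blast+
      have "norm (x - z) \<le> h"
        using diameter_bounded_bound[OF compact_imp_bounded[OF sK(4)] xK] h by (simp add: dist_norm)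
      then have n: "(\<Sum>i\<in>UNIV. ((x - z) $ i)\<^sup>2) \<le> h\<^sup>2"
        using power_mono[of "norm (x - z)" h 2] by (simp add: norm_vec_def L2_set_def sum_nonneg)
      \<comment> \<open>With the weight h the squares of the components of (x - z)/h add up to at
        most 1, which is the summand 1 in \<open>CARD('n) + 1\<close>.\<close>
      have "2 * \<phi> x * partial_deriv i \<phi> x * (x - z) $ i \<le> h\<^sup>2 * (partial_deriv i \<phi> x)\<^sup>2 + (\<phi> x)\<^sup>2 * ((x - z) $ i)\<^sup>2 / h\<^sup>2" for i
        using sum_squares_bound[of "h * partial_deriv i \<phi> x" "\<phi> x * (x - z) $ i / h"] h(2)
        by (simp add: power_mult_distrib power_divide mult_ac)
      then have "(\<Sum>i\<in>UNIV. f' x (axis i 1) $ i) \<le> (\<Sum>i\<in>UNIV. (\<phi> x)\<^sup>2 + (h\<^sup>2 * (partial_deriv i \<phi> x)\<^sup>2 + (\<phi> x)\<^sup>2 * ((x - z) $ i)\<^sup>2 / h\<^sup>2))"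
        using True by (intro sum_mono) (simp add: f'_eq)
      also have "\<dots> = real CARD('n) * (\<phi> x)\<^sup>2 + h\<^sup>2 * (\<Sum>i\<in>UNIV. (partial_deriv i \<phi> x)\<^sup>2) + (\<phi> x)\<^sup>2 / h\<^sup>2 * (\<Sum>i\<in>UNIV. ((x - z) $ i)\<^sup>2)"
        by (simp add: sum.distrib sum_distrib_left)
      also have "(\<phi> x)\<^sup>2 / h\<^sup>2 * (\<Sum>i\<in>UNIV. ((x - z) $ i)\<^sup>2) \<le> (\<phi> x)\<^sup>2 / h\<^sup>2 * h\<^sup>2"
        using n by (intro mult_left_mono) auto
      finally show ?thesis using xK h(2) by (simp add: algebra_simps)
    next
      case False
      then show ?thesis using G[of x] by (simp add: f'_eq indicator_def)
    qed
  qed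
  finally show ?thesis .
qed

section \<open>Piecewise constant functions and their jumps\<close>

locale simplicial_partition = simplicial T for T :: "(real^'n) set set" +
  assumes disjT: "\<And>K K'. K \<in> T \<Longrightarrow> K' \<in> T \<Longrightarrow> K \<noteq> K' \<Longrightarrow> interior K \<inter> interior K' = {}"
begin

text \<open>The defining conditions of \<open>Q_h\<close> apart from the one on the mean
  value.\<close>

definition pwc :: "(real^'n \<Rightarrow> real) \<Rightarrow> bool" where
  "pwc q \<longleftrightarrow> (\<forall>K\<in>T. \<exists>c. \<forall>x\<in>interior K. q x = c) \<and> (\<forall>x. x \<notin> (\<Union>K\<in>T. interior K) \<longrightarrow> q x = 0)"

definition val :: "(real^'n \<Rightarrow> real) \<Rightarrow> (real^'n) set \<Rightarrow> real" where
  "val q K = q (SOME x. x \<in> interior K)"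

lemma pwc_val: "pwc q \<Longrightarrow> K \<in> T \<Longrightarrow> x \<in> interior K \<Longrightarrow> q x = val q K"
  unfolding pwc_def val_def by (metis someI)

lemma pwc_zero: "pwc q \<Longrightarrow> (\<And>K. K \<in> T \<Longrightarrow> x \<notin> interior K) \<Longrightarrow> q x = 0"
  unfolding pwc_def by blast

lemma pwc_eq:
  assumes q: "pwc q"
  shows "q x = (\<Sum>K\<in>T. val q K * indicator (interior K) x)"
proof (cases "\<exists>K\<in>T. x \<in> interior K")
  case True
  then obtain K where K: "K \<in> T" "x \<in> interior K" by blast
  have "val q K' * indicator (interior K') x = 0" if "K' \<in> T - {K}" for K'
    using that K disjT[of K K'] by (auto simp: indicator_def)
  then have "(\<Sum>K'\<in>T - {K}. val q K' * indicator (interior K') x) = 0" by (rule sum.neutral[OF ballI])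
  then have "(\<Sum>K\<in>T. val q K * indicator (interior K) x) = val q K * indicator (interior K) x"
    using sum.remove[OF finT K(1), of "\<lambda>K. val q K * indicator (interior K) x"] by simp
  then show ?thesis using K pwc_val[OF q K] by simp
next
  case False
  then show ?thesis using pwc_zero[OF q, of x] by (simp add: indicator_def)
qed

lemma pwc_borel:
  assumes q: "pwc q" shows "q \<in> borel_measurable borel"
proof -
  have "(\<lambda>x. \<Sum>K\<in>T. val q K * indicator (interior K) x) \<in> borel_measurable borel"
    by (intro borel_measurable_sum borel_measurable_times borel_measurable_const borel_measurable_indicator) auto
  moreover have "(\<lambda>x. \<Sum>K\<in>T. val q K * indicator (interior K) x) = q"
    by (rule ext) (rule pwc_eq[OF q, symmetric])
  ultimately show ?thesis by (rule back_subst)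
qed

lemma pwc_lincomb:
  assumes p: "pwc p" and q: "pwc q" shows "pwc (\<lambda>x. p x + a * q x)"
  unfolding pwc_def
proof (intro conjI ballI allI impI)
  fix K assume K: "K \<in> T"
  have "p x + a * q x = val p K + a * val q K" if "x \<in> interior K" for x
    using pwc_val[OF p K that] pwc_val[OF q K that] by simp
  then show "\<exists>c. \<forall>x\<in>interior K. p x + a * q x = c" by blast
next
  fix x assume "x \<notin> (\<Union>K\<in>T. interior K)"
  then have "p x = 0" "q x = 0" using pwc_zero[OF p, of x] pwc_zero[OF q, of x] by blast+
  then show "p x + a * q x = 0" by simp
qed

lemma pwc_bounds:
  assumes q: "pwc q"
  obtains B R where "\<And>x. \<bar>q x\<bar> \<le> B" "\<And>x. norm x > R \<Longrightarrow> q x = 0" "0 \<le> B"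
proof -
  have "bounded (\<Union>T)" using finT simT simplex_interior(4) compact_imp_bounded by (intro bounded_Union) auto
  then obtain R where R: "\<And>x. x \<in> \<Union>T \<Longrightarrow> norm x \<le> R" by (auto simp: bounded_iff)
  show ?thesis
  proof (rule that[of "\<Sum>K\<in>T. \<bar>val q K\<bar>" R])
    fix x
    have "\<bar>\<Sum>K\<in>T. val q K * indicator (interior K) x\<bar> \<le> (\<Sum>K\<in>T. \<bar>val q K\<bar>)"
      by (rule order_trans[OF sum_abs sum_mono]) (simp add: abs_mult indicator_def)
    then show "\<bar>q x\<bar> \<le> (\<Sum>K\<in>T. \<bar>val q K\<bar>)" using pwc_eq[OF q, of x] by simp
    show "norm x > R \<Longrightarrow> q x = 0" using R[of x] interior_subset by (intro pwc_zero[OF q]) force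
  qed (auto intro: sum_nonneg)
qed

definition good :: "(real^'n) set \<Rightarrow> real^'n \<Rightarrow> bool" where
  "good H x \<longleftrightarrow> x \<in> H \<and> x \<notin> \<Union>(hyps T - {H})"

lemma hproj_mem:
  assumes "H \<in> hyps T" shows "hproj H y \<in> H"
proof -
  have "face_normal H \<bullet> face_normal H = 1" using hyps_unit[OF assms] by (simp add: norm_eq_1)
  then have "face_normal H \<bullet> hproj H y = hcst H" by (simp add: hyperplane_proj_def inner_diff_right)
  then show ?thesis using hyps_mem[OF assms] by blast
qed

lemma AE_good:
  assumes "H \<in> hyps T" shows "AE y in lebesgue. good H (hproj H y)"
proof -
  have "AE y in lebesgue. face_normal H \<bullet> y \<noteq> hcst H \<and> y - (face_normal H \<bullet> y - hcst H) *\<^sub>R face_normal H \<notin> \<Union>(hyps T - {H})"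
    by (rule AE_projection_not_in_others[where g = "\<lambda>_. 0" and dg = "\<lambda>_. 0" and M = 0 and R = 0 and e = 0])
      (fact finite_hyps hyps_unit hyps_eq assms | simp)+
  then show ?thesis
    by eventually_elim (use hproj_mem[OF assms] in \<open>simp add: good_def hyperplane_proj_def\<close>)
qed

text \<open>On each half-ball q has the value of the element that contains it, or 0 if there is
  none. If the two values differ, x lies on a facet of some element, and as x is on no other
  hyperplane, that facet spans H.\<close>

lemma pwc_sides:
  assumes q: "pwc q" and H: "H \<in> hyps T" and x: "good H x"
  obtains qp qm r where "r > 0" "\<And>t. 0 < t \<Longrightarrow> t < r \<Longrightarrow> q (x + t *\<^sub>R face_normal H) = qp"
    "\<And>t. 0 < t \<Longrightarrow> t < r \<Longrightarrow> q (x - t *\<^sub>R face_normal H) = qm"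
    "qp = 0 \<or> (\<exists>K\<in>T. x \<in> K \<and> qp = val q K)" "qm = 0 \<or> (\<exists>K\<in>T. x \<in> K \<and> qm = val q K)"
    "qp \<noteq> qm \<Longrightarrow> \<exists>K F. K \<in> T \<and> F facet_of K \<and> affine hull F = H \<and> x \<in> F"
proof -
  let ?\<nu> = "face_normal H"
  have xx: "x \<in> H" "x \<notin> \<Union>(hyps T - {H})" using x by (auto simp: good_def)
  obtain r where r: "r > 0"
    and side: "\<And>s K. K \<in> T \<Longrightarrow> {y \<in> ball x r. 0 < s * (?\<nu> \<bullet> y - hcst H)} \<subseteq> interior K \<or> {y \<in> ball x r. 0 < s * (?\<nu> \<bullet> y - hcst H)} \<inter> K = {}"
    and plus: "\<And>t. 0 < t \<Longrightarrow> t < r \<Longrightarrow> x + t *\<^sub>R ?\<nu> \<in> {y \<in> ball x r. 0 < 1 * (?\<nu> \<bullet> y - hcst H)}"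
    and minus: "\<And>t. 0 < t \<Longrightarrow> t < r \<Longrightarrow> x - t *\<^sub>R ?\<nu> \<in> {y \<in> ball x r. 0 < (-1) * (?\<nu> \<bullet> y - hcst H)}"
    by (rule sides_off_hyps[OF H xx]) blast
  have lim: "((\<lambda>t. x + (s * t) *\<^sub>R ?\<nu>) \<longlongrightarrow> x) (at_right 0)" for s
    by (rule tendsto_eq_intros refl | simp)+
  have ev: "\<forall>\<^sub>F t in at_right 0. 0 < t \<and> t < r"
    using eventually_at_right_less[of "0::real"] eventually_at_rightI[of 0 r "\<lambda>t. t < r"] r by (auto intro: eventually_conj)
  have inK: "x \<in> K" if K: "K \<in> T" and "\<And>t. 0 < t \<Longrightarrow> t < r \<Longrightarrow> x + (s * t) *\<^sub>R ?\<nu> \<in> K" for K s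
  proof (rule Lim_in_closed_set[OF _ _ _ lim[of s]])
    show "closed K" using simT[OF K] by (rule simplex_interior(5))
    show "\<forall>\<^sub>F t in at_right 0. x + (s * t) *\<^sub>R ?\<nu> \<in> K" using ev by eventually_elim (use that in auto)
  qed simp
  have one: "\<exists>v. (\<forall>y\<in>{y \<in> ball x r. 0 < s * (?\<nu> \<bullet> y - hcst H)}. q y = v) \<and>
      (v = 0 \<or> (\<exists>K\<in>T. x \<in> K \<and> v = val q K \<and> {y \<in> ball x r. 0 < s * (?\<nu> \<bullet> y - hcst H)} \<subseteq> interior K))"
    if s: "s = 1 \<or> s = -1" for s
  proof (cases "\<exists>K\<in>T. {y \<in> ball x r. 0 < s * (?\<nu> \<bullet> y - hcst H)} \<subseteq> interior K")
    case True
    then obtain K where K: "K \<in> T" "{y \<in> ball x r. 0 < s * (?\<nu> \<bullet> y - hcst H)} \<subseteq> interior K" by blast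
    have "x + (s * t) *\<^sub>R ?\<nu> \<in> K" if "0 < t" "t < r" for t
      using s
    proof
      assume s: "s = 1"
      have "x + t *\<^sub>R ?\<nu> \<in> K" using plus[OF that] K(2) interior_subset[of K] unfolding s by blast
      then show ?thesis by (simp add: s)
    next
      assume s: "s = -1"
      have "x - t *\<^sub>R ?\<nu> \<in> K" using minus[OF that] K(2) interior_subset[of K] unfolding s by blast
      then show ?thesis by (simp add: s)
    qed
    then have "x \<in> K" by (rule inK[OF K(1)])
    then show ?thesis using K pwc_val[OF q K(1)] by (intro exI[of _ "val q K"]) blast
  next
    case False
    then have "\<And>K. K \<in> T \<Longrightarrow> {y \<in> ball x r. 0 < s * (?\<nu> \<bullet> y - hcst H)} \<inter> K = {}" using side by blast
    then have "q y = 0" if "y \<in> {y \<in> ball x r. 0 < s * (?\<nu> \<bullet> y - hcst H)}" for y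
      using that interior_subset by (intro pwc_zero[OF q]) blast
    then show ?thesis by blast
  qed
  obtain qp where qp: "\<And>y. y \<in> {y \<in> ball x r. 0 < 1 * (?\<nu> \<bullet> y - hcst H)} \<Longrightarrow> q y = qp"
    "qp = 0 \<or> (\<exists>K\<in>T. x \<in> K \<and> qp = val q K \<and> {y \<in> ball x r. 0 < 1 * (?\<nu> \<bullet> y - hcst H)} \<subseteq> interior K)"
    using one[of 1] by blast
  obtain qm where qm: "\<And>y. y \<in> {y \<in> ball x r. 0 < (-1) * (?\<nu> \<bullet> y - hcst H)} \<Longrightarrow> q y = qm"
    "qm = 0 \<or> (\<exists>K\<in>T. x \<in> K \<and> qm = val q K \<and> {y \<in> ball x r. 0 < (-1) * (?\<nu> \<bullet> y - hcst H)} \<subseteq> interior K)"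
    using one[of "-1"] by blast
  have "\<exists>K F. K \<in> T \<and> F facet_of K \<and> affine hull F = H \<and> x \<in> F" if ne: "qp \<noteq> qm"
  proof -
    have "\<exists>K s. K \<in> T \<and> x \<in> K \<and> {y \<in> ball x r. 0 < s * (?\<nu> \<bullet> y - hcst H)} \<subseteq> interior K \<and> (s = 1 \<or> s = -1)"
    proof (cases "qp = 0")
      case True
      then have "qm \<noteq> 0" using ne by simp
      then obtain K where "K \<in> T" "x \<in> K" "{y \<in> ball x r. 0 < (-1) * (?\<nu> \<bullet> y - hcst H)} \<subseteq> interior K" using qm(2) by blast
      then show ?thesis by blast
    next
      case False
      then obtain K where "K \<in> T" "x \<in> K" "{y \<in> ball x r. 0 < 1 * (?\<nu> \<bullet> y - hcst H)} \<subseteq> interior K" using qp(2) by blast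
      then show ?thesis by blast
    qed
    then obtain K s where K: "K \<in> T" "x \<in> K" "{y \<in> ball x r. 0 < s * (?\<nu> \<bullet> y - hcst H)} \<subseteq> interior K" "s = 1 \<or> s = -1" by blast
    \<comment> \<open>Otherwise both sides near x would lie in K and q would have the same value on
      them.\<close>
    have "x \<notin> interior K"
    proof
      assume "x \<in> interior K"
      have "\<forall>\<^sub>F t in at_right 0. x + (s * t) *\<^sub>R ?\<nu> \<in> interior K" for s
        by (rule topological_tendstoD[OF lim open_interior \<open>x \<in> interior K\<close>])
      from eventually_conj[OF ev eventually_conj[OF this[of 1] this[of "-1"]]]
      obtain t where t: "0 < t" "t < r" "x + t *\<^sub>R ?\<nu> \<in> interior K" "x - t *\<^sub>R ?\<nu> \<in> interior K"
        using eventually_happens'[of "at_right (0::real)"] by force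
      have "q (x + t *\<^sub>R ?\<nu>) = qp" "q (x - t *\<^sub>R ?\<nu>) = qm" using qp(1)[OF plus[OF t(1,2)]] qm(1)[OF minus[OF t(1,2)]] by auto
      moreover have "q (x + t *\<^sub>R ?\<nu>) = val q K" "q (x - t *\<^sub>R ?\<nu>) = val q K" using t pwc_val[OF q K(1)] by auto
      ultimately show False using ne by simp
    qed
    then have "x \<in> frontier K" using K(2) closure_subset by (auto simp: frontier_def)
    then obtain F where F: "F facet_of K" "x \<in> F" using simplex_interior(6)[OF simT[OF K(1)]] by blast
    have "x \<in> affine hull F" using F(2) hull_subset[of F affine] by blast
    then have "affine hull F = H" using hypsI[OF K(1) F(1)] xx(2) by blast
    then show ?thesis using K F by blast
  qed
  note facet = this
  show ?thesis
  proof (rule that[OF r])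
    show "q (x + t *\<^sub>R ?\<nu>) = qp" if "0 < t" "t < r" for t by (rule qp(1)[OF plus[OF that]])
    show "q (x - t *\<^sub>R ?\<nu>) = qm" if "0 < t" "t < r" for t by (rule qm(1)[OF minus[OF that]])
    show "qp = 0 \<or> (\<exists>K\<in>T. x \<in> K \<and> qp = val q K)" using qp(2) by blast
    show "qm = 0 \<or> (\<exists>K\<in>T. x \<in> K \<and> qm = val q K)" using qm(2) by blast
  qed (rule facet)
qed

definition sides_at :: "(real^'n \<Rightarrow> real) \<Rightarrow> (real^'n) set \<Rightarrow> real^'n \<Rightarrow> real \<Rightarrow> real \<Rightarrow> real \<Rightarrow> bool" where
  "sides_at q H x qp qm r \<longleftrightarrow> r > 0 \<and> (\<forall>t. 0 < t \<longrightarrow> t < r \<longrightarrow> q (x + t *\<^sub>R face_normal H) = qp) \<and>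
    (\<forall>t. 0 < t \<longrightarrow> t < r \<longrightarrow> q (x - t *\<^sub>R face_normal H) = qm) \<and>
    (qp = 0 \<or> (\<exists>K\<in>T. x \<in> K \<and> qp = val q K)) \<and> (qm = 0 \<or> (\<exists>K\<in>T. x \<in> K \<and> qm = val q K)) \<and>
    (qp \<noteq> qm \<longrightarrow> (\<exists>K F. K \<in> T \<and> F facet_of K \<and> affine hull F = H \<and> x \<in> F))"

lemma sides_at_ex:
  assumes "pwc q" "H \<in> hyps T" "good H x"
  shows "\<exists>qp qm r. sides_at q H x qp qm r"
proof (rule pwc_sides[OF assms])
  fix r qp qm :: real
  assume "r > 0" "\<And>t. 0 < t \<Longrightarrow> t < r \<Longrightarrow> q (x + t *\<^sub>R face_normal H) = qp"
    "\<And>t. 0 < t \<Longrightarrow> t < r \<Longrightarrow> q (x - t *\<^sub>R face_normal H) = qm"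
    "qp = 0 \<or> (\<exists>K\<in>T. x \<in> K \<and> qp = val q K)" "qm = 0 \<or> (\<exists>K\<in>T. x \<in> K \<and> qm = val q K)"
    "qp \<noteq> qm \<Longrightarrow> \<exists>K F. K \<in> T \<and> F facet_of K \<and> affine hull F = H \<and> x \<in> F"
  then have "sides_at q H x qp qm r"
    unfolding sides_at_def by (intro conjI allI impI) assumption+
  then show ?thesis by (intro exI)
qed

lemma sides_atD:
  assumes "sides_at q H x qp qm r"
  shows "r > 0" "\<And>t. 0 < t \<Longrightarrow> t < r \<Longrightarrow> q (x + t *\<^sub>R face_normal H) = qp"
    "\<And>t. 0 < t \<Longrightarrow> t < r \<Longrightarrow> q (x - t *\<^sub>R face_normal H) = qm"
    "qp = 0 \<or> (\<exists>K\<in>T. x \<in> K \<and> qp = val q K)" "qm = 0 \<or> (\<exists>K\<in>T. x \<in> K \<and> qm = val q K)"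
    "qp \<noteq> qm \<Longrightarrow> \<exists>K F. K \<in> T \<and> F facet_of K \<and> affine hull F = H \<and> x \<in> F"
  using assms unfolding sides_at_def by (elim conjE; simp)+

text \<open>\<open>jump\<close> subtracts the value ahead in the direction of \<nu>, the divergence
  theorem the value behind; hence the sign in the second claim.\<close>

lemma jump_sides:
  assumes r: "r > 0" and "\<And>t. 0 < t \<Longrightarrow> t < r \<Longrightarrow> q (x + t *\<^sub>R \<nu>) = qp" "\<And>t. 0 < t \<Longrightarrow> t < r \<Longrightarrow> q (x - t *\<^sub>R \<nu>) = qm"
  shows "jump \<nu> q x = qm - qp" "((\<lambda>t. q (x + t *\<^sub>R \<nu>) - q (x - t *\<^sub>R \<nu>)) \<longlongrightarrow> - jump \<nu> q x) (at_right 0)"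
proof -
  have ev: "\<forall>\<^sub>F t in at_right 0. 0 < t \<and> t < r"
    using eventually_at_right_less[of "0::real"] eventually_at_rightI[of 0 r "\<lambda>t. t < r"] r by (auto intro: eventually_conj)
  have p: "((\<lambda>t. q (x + t *\<^sub>R \<nu>)) \<longlongrightarrow> qp) (at_right 0)" "((\<lambda>t. q (x - t *\<^sub>R \<nu>)) \<longlongrightarrow> qm) (at_right 0)"
    using ev assms by (auto intro!: tendsto_eventually elim!: eventually_mono)
  have ne: "at_right (0::real) \<noteq> bot" by simp
  show j: "jump \<nu> q x = qm - qp"
    unfolding jump_def using tendsto_Lim[OF ne p(1)] tendsto_Lim[OF ne p(2)] by simp
  show "((\<lambda>t. q (x + t *\<^sub>R \<nu>) - q (x - t *\<^sub>R \<nu>)) \<longlongrightarrow> - jump \<nu> q x) (at_right 0)"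
    using tendsto_diff[OF p] by (simp add: j)
qed

lemma jump_lincomb:
  assumes p: "pwc p" and q: "pwc q" and H: "H \<in> hyps T" and x: "good H x"
  shows "jump (face_normal H) (\<lambda>x. p x + a * q x) x = jump (face_normal H) p x + a * jump (face_normal H) q x"
proof -
  obtain pp pm r where sP: "sides_at p H x pp pm r" using sides_at_ex[OF p H x] by blast
  obtain qp qm r' where sQ: "sides_at q H x qp qm r'" using sides_at_ex[OF q H x] by blast
  note P = sides_atD(1-3)[OF sP] and Q = sides_atD(1-3)[OF sQ]
  have "jump (face_normal H) (\<lambda>x. p x + a * q x) x = (pm + a * qm) - (pp + a * qp)"
    by (rule jump_sides(1)[where r = "min r r'"]) (use P Q in auto)
  moreover have "jump (face_normal H) p x = pm - pp" by (rule jump_sides(1)[OF P])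
  moreover have "jump (face_normal H) q x = qm - qp" by (rule jump_sides(1)[OF Q])
  ultimately show ?thesis by (simp only:) (simp add: algebra_simps)
qed

lemma jump_facet:
  assumes q: "pwc q" and H: "H \<in> hyps T" and x: "good H x" and nz: "jump (face_normal H) q x \<noteq> 0"
  obtains K F where "K \<in> T" "F facet_of K" "affine hull F = H" "x \<in> F"
proof -
  obtain qp qm r where sQ: "sides_at q H x qp qm r" using sides_at_ex[OF q H x] by blast
  note Q = sides_atD[OF sQ]
  show ?thesis using nz jump_sides(1)[where q = q and x = x and \<nu> = "face_normal H", OF Q(1-3)] Q(6) that by auto
qed

text \<open>Both one-sided values are 0 or belong to elements that contain x, so the square of
  either is bounded by the whole sum. The constant comes from (a - b)^2 \<le> 2 a^2 + 2 b^2.\<close>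

lemma jump_bound:
  assumes q: "pwc q" and H: "H \<in> hyps T" and x: "good H x"
  shows "(jump (face_normal H) q x)\<^sup>2 \<le> 4 * (\<Sum>K | K \<in> T \<and> x \<in> K. (val q K)\<^sup>2)"
proof -
  obtain qp qm r where sQ: "sides_at q H x qp qm r" using sides_at_ex[OF q H x] by blast
  note Q = sides_atD[OF sQ]
  let ?S = "\<Sum>K | K \<in> T \<and> x \<in> K. (val q K)\<^sup>2"
  have le: "v\<^sup>2 \<le> ?S" if "v = 0 \<or> (\<exists>K\<in>T. x \<in> K \<and> v = val q K)" for v
  proof (cases "v = 0")
    case True then show ?thesis by (simp add: sum_nonneg)
  next
    case False
    with that obtain K where "K \<in> T" "x \<in> K" "v = val q K" by blast
    moreover have "(val q K)\<^sup>2 \<le> ?S" by (rule member_le_sum) (use \<open>K \<in> T\<close> \<open>x \<in> K\<close> finT in auto)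
    ultimately show ?thesis by simp
  qed
  have "(qm - qp)\<^sup>2 \<le> 2 * qm\<^sup>2 + 2 * qp\<^sup>2" using sum_squares_bound[of qm "-qp"] by (simp add: power2_diff)
  also have "\<dots> \<le> 4 * ?S" using le[OF Q(4)] le[OF Q(5)] by simp
  finally show ?thesis using jump_sides(1)[where q = q and x = x and \<nu> = "face_normal H", OF Q(1-3)] by simp
qed

text \<open>The divergence theorem for the product of q and w, in which only q jumps. As q is 0
  outside the mesh, boundary facets contribute as well; they drop out once w vanishes there.\<close>

lemma integral_pwc_divergence:
  fixes w :: "real^'n \<Rightarrow> real^'n"
  assumes q: "pwc q" and w: "\<And>i. Ck (Suc 0) (\<lambda>x. w x $ i)"
    and B: "\<And>x. norm (w x) \<le> B" "\<And>x i. \<bar>partial_deriv i (\<lambda>x. w x $ i) x\<bar> \<le> B"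
  shows "(LINT x|lebesgue. q x * (\<Sum>i\<in>UNIV. partial_deriv i (\<lambda>x. w x $ i) x)) =
      (\<Sum>H\<in>hyps T. LINT y|lebesgue. indicator (slab H) y * (jump (face_normal H) q (hproj H y) * (face_normal H \<bullet> w (hproj H y))))"
    and "\<And>H. H \<in> hyps T \<Longrightarrow> integrable lebesgue (\<lambda>y. indicator (slab H) y * (jump (face_normal H) q (hproj H y) * (face_normal H \<bullet> w (hproj H y))))"
proof -
  obtain Bq R where Bq: "\<And>x. \<bar>q x\<bar> \<le> Bq" "\<And>x. norm x > R \<Longrightarrow> q x = 0" "0 \<le> Bq" using pwc_bounds[OF q] by metis
  note C1 = Ck1_facts[OF w]
  have [measurable]: "q \<in> borel_measurable borel" using q by (rule pwc_borel)
  have [measurable]: "partial_deriv i (\<lambda>x. w x $ i) \<in> borel_measurable borel" for i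
    using C1(3) by (rule borel_measurable_continuous_onI)
  have "continuous_on UNIV (\<lambda>x. \<chi> i. w x $ i)" by (intro continuous_on_vec_lambda C1(2))
  then have wcont: "continuous_on UNIV w" by simp
  then have [measurable]: "w \<in> borel_measurable borel" by (rule borel_measurable_continuous_onI)
  define f where "f x = q x *\<^sub>R w x" for x
  define f' where "f' x v = (\<chi> i. q x * frechet_derivative (\<lambda>x. w x $ i) (at x) v)" for x v
  have f'_eq: "f' x (axis i 1) $ i = q x * partial_deriv i (\<lambda>x. w x $ i) x" for x i
    by (simp add: f'_def C1(5))
  define j where "j H x = - jump (face_normal H) q x *\<^sub>R w x" for H x
  have B0: "0 \<le> B" using B(1)[of 0] norm_ge_zero order_trans by blast
  have jump: "((\<lambda>t. f (x + t *\<^sub>R face_normal H) - f (x - t *\<^sub>R face_normal H)) \<longlongrightarrow> j H x) (at_right 0)"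
    if H: "H \<in> hyps T" and x: "x \<in> H" "x \<notin> \<Union>(hyps T - {H})" for H x
  proof -
    let ?\<nu> = "face_normal H"
    have "good H x" using x by (simp add: good_def)
    then obtain qp qm r where sQ: "sides_at q H x qp qm r" using sides_at_ex[OF q H] by blast
    note Q = sides_atD(1-3)[OF sQ]
    have lim: "((\<lambda>t. x + (s * t) *\<^sub>R ?\<nu>) \<longlongrightarrow> x) (at_right 0)" for s
      by (rule tendsto_eq_intros refl | simp)+
    have wl: "((\<lambda>t. w (x + (s * t) *\<^sub>R ?\<nu>)) \<longlongrightarrow> w x) (at_right 0)" for s
      using wcont by (intro isCont_tendsto_compose[OF _ lim]) (simp add: continuous_on_eq_continuous_at)
    have l1: "((\<lambda>t. qp *\<^sub>R w (x + (1 * t) *\<^sub>R ?\<nu>) - qm *\<^sub>R w (x + ((-1) * t) *\<^sub>R ?\<nu>)) \<longlongrightarrow> qp *\<^sub>R w x - qm *\<^sub>R w x) (at_right 0)"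
      by (intro tendsto_intros wl)
    have l2: "\<forall>\<^sub>F t in at_right 0. qp *\<^sub>R w (x + (1 * t) *\<^sub>R ?\<nu>) - qm *\<^sub>R w (x + ((-1) * t) *\<^sub>R ?\<nu>) = f (x + t *\<^sub>R ?\<nu>) - f (x - t *\<^sub>R ?\<nu>)"
    proof -
      have ev: "\<forall>\<^sub>F t in at_right 0. 0 < t \<and> t < r"
        using eventually_at_right_less[of "0::real"] eventually_at_rightI[of 0 r "\<lambda>t. t < r"] Q(1) by (auto intro: eventually_conj)
      then show ?thesis by eventually_elim (simp add: f_def Q)
    qed
    have l3: "qp *\<^sub>R w x - qm *\<^sub>R w x = j H x"
    proof -
      have "jump ?\<nu> q x = qm - qp" by (rule jump_sides(1)[OF Q])
      then have "j H x = - (qm - qp) *\<^sub>R w x" by (simp only: j_def)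
      also have "\<dots> = qp *\<^sub>R w x - qm *\<^sub>R w x" by (simp add: scaleR_left_diff_distrib)
      finally show ?thesis by simp
    qed
    show ?thesis using Lim_transform_eventually[OF l1 l2] unfolding l3 .
  qed
  have deriv: "(f has_derivative f' x) (at x)" if x: "x \<notin> \<Union>(hyps T)" for x
  proof -
    obtain r where r: "r > 0" "ball x r \<inter> \<Union>(hyps T) = {}" using ball_off_hyps[OF x] by blast
    have dich: "ball x r \<subseteq> interior K \<or> ball x r \<inter> K = {}" if "K \<in> T" for K by (rule cell_dichotomy[OF _ r(2) that]) auto
    have const: "q x = q y" if y: "y \<in> ball x r" for y
    proof (cases "\<exists>K\<in>T. ball x r \<subseteq> interior K")
      case True
      then obtain K where "K \<in> T" "ball x r \<subseteq> interior K" by blast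
      moreover have "x \<in> ball x r" using r(1) by simp
      ultimately have "q x = val q K" "q y = val q K" using y by (blast intro: pwc_val[OF q])+
      then show ?thesis by simp
    next
      case False
      then have "z \<notin> interior K" if "K \<in> T" "z \<in> ball x r" for K z using dich[OF that(1)] that interior_subset[of K] by blast
      then have "q z = 0" if "z \<in> ball x r" for z using that by (intro pwc_zero[OF q]) blast
      then show ?thesis using y r(1) by simp
    qed
    have "(w has_derivative (\<lambda>v. \<chi> i. frechet_derivative (\<lambda>x. w x $ i) (at x) v)) (at x)"
      unfolding has_derivative_componentwise_within[of w]
      using C1(4) by (auto simp: Basis_vec_def inner_axis)
    from has_derivative_scaleR_right[OF this, of "q x"]
    have "((\<lambda>y. q x *\<^sub>R w y) has_derivative f' x) (at x)"
      unfolding f'_def by (rule has_derivative_eq_rhs) (auto simp: vec_eq_iff)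
    then show ?thesis
    proof (rule has_derivative_transform_within_open)
      show "q x *\<^sub>R w y = f y" if "y \<in> ball x r" for y using const[OF that] by (simp add: f_def)
    qed (use r(1) in auto)
  qed
  have f_meas: "f \<in> borel_measurable borel" unfolding f_def by measurable
  have f'_meas: "(\<lambda>x. f' x (axis i 1) $ i) \<in> borel_measurable borel" for i
    unfolding f'_eq by measurable
  have b1: "norm (f x) \<le> Bq * B" for x
    using Bq B(1)[of x] B0 by (auto simp: f_def intro!: mult_mono)
  have b2: "\<bar>f' x (axis i 1) $ i\<bar> \<le> Bq * B" for x i
    using Bq B(2)[of i x] B0 unfolding f'_eq abs_mult by (intro mult_mono) auto
  have s: "norm x > R \<Longrightarrow> f x = 0" "norm x > R \<Longrightarrow> f' x (axis i 1) $ i = 0" for x i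
    unfolding f'_eq f_def using Bq(2)[of x] by auto
  have D: "(LINT x|lebesgue. (\<Sum>i\<in>UNIV. f' x (axis i 1) $ i)) =
      - (\<Sum>H\<in>hyps T. LINT y|lebesgue. indicator (slab H) y * (face_normal H \<bullet> j H (hproj H y)))"
    by (rule divergence_theorem_piecewise(1)[where f = f and M = "Bq * B" and R = R])
      (fact finite_hyps hyps_unit hyps_eq f_meas f'_meas deriv jump b1 b2 s)+
  have I: "integrable lebesgue (\<lambda>y. indicator (slab H) y * (face_normal H \<bullet> j H (hproj H y)))" if "H \<in> hyps T" for H
    by (rule divergence_theorem_piecewise(2)[where f = f and M = "Bq * B" and R = R and HH = "hyps T" and f' = f'])
      (fact finite_hyps hyps_unit hyps_eq f_meas f'_meas deriv jump b1 b2 s that)+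
  have je: "indicator (slab H) y * (face_normal H \<bullet> j H z) = - (indicator (slab H) y * (jump (face_normal H) q z * (face_normal H \<bullet> w z)))" for H y z
    by (simp add: j_def)
  show "(LINT x|lebesgue. q x * (\<Sum>i\<in>UNIV. partial_deriv i (\<lambda>x. w x $ i) x)) =
      (\<Sum>H\<in>hyps T. LINT y|lebesgue. indicator (slab H) y * (jump (face_normal H) q (hproj H y) * (face_normal H \<bullet> w (hproj H y))))"
    using D unfolding je f'_eq by (simp add: sum_distrib_left sum_negf)
  show "integrable lebesgue (\<lambda>y. indicator (slab H) y * (jump (face_normal H) q (hproj H y) * (face_normal H \<bullet> w (hproj H y))))"
    if "H \<in> hyps T" for H using I[OF that] unfolding je by simp
qed

text \<open>The constant field equal to the normal isolates the jump, whose integrability is then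
  part of the divergence theorem.\<close>

lemma jump_integrable_slab:
  assumes q: "pwc q" and H: "H \<in> hyps T"
  shows "integrable lebesgue (\<lambda>y. indicator (slab H) y * jump (face_normal H) q (hproj H y))"
proof -
  have "face_normal H \<bullet> face_normal H = 1" "norm (face_normal H) = 1" using hyps_unit[OF H] by (auto simp: norm_eq_1)
  moreover have "partial_deriv i (\<lambda>x :: real^'n. a) = (\<lambda>x. 0)" for i a
    by (rule ext) (simp add: partial_derivI[OF has_derivative_const])
  ultimately show ?thesis
    using integral_pwc_divergence(2)[OF q, of "\<lambda>_. face_normal H" 1, OF _ _ _ H] by (simp add: Ck_const del: Ck.simps)
qed

end

section \<open>Quasi-uniform meshes and the jump form\<close>

text \<open>A chord of length 2\<rho> through z, parallel to F, is carried into F by the central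
  projection from the opposite vertex u, which does not shorten it. Directions parallel to F exist
  because the dimension is at least 2.\<close>

lemma facet_diameter:
  fixes K :: "(real^'n) set"
  assumes K: "int CARD('n) simplex K" and F: "F facet_of K" and z: "cball z \<rho> \<subseteq> K" and \<rho>: "\<rho> > 0"
    and dim: "CARD('n) \<ge> 2"
  shows "2 * \<rho> \<le> diameter F"
proof -
  note fh = facet_hyperplane[OF K F]
  let ?\<nu> = "face_normal F" and ?c = "hcst (affine hull F)"
  obtain C where C: "\<not> affine_dependent C" "K = convex hull C" using K by (auto simp: simplex_def)
  have "F \<noteq> {} \<and> (\<exists>u. u \<in> C \<and> F = convex hull (C - {u}))"
    using facet_of_convex_hull_affine_independent[OF C(1), of F] F unfolding C(2) by blast
  then obtain u where u: "u \<in> C" "F = convex hull (C - {u})" "F \<noteq> {}" by blast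
  have KF: "K = convex hull (insert u (C - {u}))" using C(2) u(1) by (simp add: insert_absorb)
  have ne: "C - {u} \<noteq> {}" using u by auto
  have onF: "?\<nu> \<bullet> x = ?c" if "x \<in> F" for x
    using fh(2) hull_subset[of F affine] that by blast
  have decomp: "\<exists>s f. x = (1 - s) *\<^sub>R u + s *\<^sub>R f \<and> f \<in> F \<and> 0 \<le> s \<and> s \<le> 1" if "x \<in> K" for x
  proof -
    from that have "\<exists>a\<ge>0. \<exists>b\<ge>0. \<exists>f. a + b = 1 \<and> f \<in> convex hull (C - {u}) \<and> x = a *\<^sub>R u + b *\<^sub>R f"
      unfolding KF convex_hull_insert[OF ne] by simp
    then obtain a b f where abf: "0 \<le> a" "0 \<le> b" "a + b = 1" "f \<in> convex hull (C - {u})" "x = a *\<^sub>R u + b *\<^sub>R f"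
      by blast
    then have "a = 1 - b" "b \<le> 1" by auto
    then show ?thesis using abf u(2) by blast
  qed
  have zK: "z \<in> K" "z \<in> interior K"
  proof -
    show "z \<in> K" using z \<rho> by auto
    have "ball z \<rho> \<subseteq> interior K" using z by (meson ball_subset_cball interior_maximal open_ball order_trans)
    then show "z \<in> interior K" using \<rho> by auto
  qed
  have uc: "?\<nu> \<bullet> u \<noteq> ?c"
  proof
    assume uc: "?\<nu> \<bullet> u = ?c"
    obtain s f where "z = (1 - s) *\<^sub>R u + s *\<^sub>R f" "f \<in> F" using decomp[OF zK(1)] by blast
    then have "?\<nu> \<bullet> z = (1 - s) * ?c + s * ?c" using uc onF by (simp add: inner_add_right)
    then have "?\<nu> \<bullet> z = ?c" by (simp add: algebra_simps)
    then have "z \<in> affine hull F" using fh(2) by blast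
    then have "z \<in> F" using fh(4) zK(1) by blast
    then show False using fh(5) zK(2) by blast
  qed
  have "2 \<le> DIM(real^'n)" using dim by simp
  then obtain e :: "real^'n" where e: "e \<noteq> 0" "orthogonal ?\<nu> e" by (rule orthogonal_to_vector_exists)
  define d where "d = e /\<^sub>R norm e"
  have d: "norm d = 1" "?\<nu> \<bullet> d = 0" using e by (auto simp: d_def orthogonal_def)
  have "z + \<rho> *\<^sub>R d \<in> K" "z - \<rho> *\<^sub>R d \<in> K" using z d \<rho> by (auto simp: dist_norm subset_iff)
  then obtain s1 f1 s2 f2 where 1: "z + \<rho> *\<^sub>R d = (1 - s1) *\<^sub>R u + s1 *\<^sub>R f1" "f1 \<in> F" "0 \<le> s1" "s1 \<le> 1"
    and 2: "z - \<rho> *\<^sub>R d = (1 - s2) *\<^sub>R u + s2 *\<^sub>R f2" "f2 \<in> F"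
    using decomp by meson
  have e12: "?\<nu> \<bullet> (z + \<rho> *\<^sub>R d) = (1 - s1) * (?\<nu> \<bullet> u) + s1 * ?c" "?\<nu> \<bullet> (z - \<rho> *\<^sub>R d) = (1 - s2) * (?\<nu> \<bullet> u) + s2 * ?c"
    unfolding 1(1) 2(1) using onF[OF 1(2)] onF[OF 2(2)] by (simp_all add: inner_add_right)
  have e3: "?\<nu> \<bullet> (z + \<rho> *\<^sub>R d) = ?\<nu> \<bullet> (z - \<rho> *\<^sub>R d)" using d by (simp add: inner_add_right inner_diff_right)
  \<comment> \<open>Both ends of the chord have the same height over F, hence the same ratio of
    projection.\<close>
  from trans[OF trans[OF e12(1)[symmetric] e3] e12(2)]
  have "(s1 - s2) * (?\<nu> \<bullet> u - ?c) = 0" by (simp add: algebra_simps)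
  then have s: "s2 = s1" using uc by simp
  have "(z + \<rho> *\<^sub>R d) - (z - \<rho> *\<^sub>R d) = s1 *\<^sub>R (f1 - f2)"
    unfolding 1(1) 2(1) s by (simp add: algebra_simps)
  then have "(2 * \<rho>) *\<^sub>R d = s1 *\<^sub>R (f1 - f2)" by (simp add: scaleR_2[symmetric] scaleR_scaleR[symmetric] del: scaleR_scaleR)
  then have "norm ((2 * \<rho>) *\<^sub>R d) = norm (s1 *\<^sub>R (f1 - f2))" by simp
  then have "2 * \<rho> = s1 * norm (f1 - f2)" using d \<rho> 1 by simp
  also have "\<dots> \<le> 1 * norm (f1 - f2)" using 1 by (intro mult_right_mono) auto
  also have "norm (f1 - f2) \<le> diameter F"
    using diameter_bounded_bound[OF compact_imp_bounded[OF fh(7)] 1(2) 2(2)] by (simp add: dist_norm)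
  finally show ?thesis by simp
qed

locale quasi_uniform_mesh = simplicial_partition T for T :: "(real^'n) set set" +
  fixes h \<rho> :: real and \<Omega> :: "(real^'n) set"
  assumes h: "h > 0" and \<rho>: "\<rho> > 0" and diam: "\<And>K. K \<in> T \<Longrightarrow> diameter K \<le> h"
    and inball: "\<And>K. K \<in> T \<Longrightarrow> \<exists>z. cball z \<rho> \<subseteq> K" and dim2: "CARD('n) \<ge> 2" and open\<Omega>: "open \<Omega>"
begin

definition jint :: "(real^'n) set \<Rightarrow> (real^'n \<Rightarrow> real) \<Rightarrow> (real^'n \<Rightarrow> real) \<Rightarrow> real" where
  "jint F p q = face_integral F (\<lambda>x. indicator (- frontier \<Omega>) x *
       (diameter F * jump (face_normal F) p x * jump (face_normal F) q x))"

abbreviation facets :: "(real^'n) set \<Rightarrow> (real^'n) set set" where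
  "facets K \<equiv> {F. F facet_of K}"

lemma J_form_jint: "J_form \<Omega> T \<delta> p q = \<delta> * (\<Sum>K\<in>T. \<Sum>F\<in>facets K. jint F p q)"
  by (simp add: J_form_def jint_def)

lemma facet_hyps: "K \<in> T \<Longrightarrow> F facet_of K \<Longrightarrow> affine hull F \<in> hyps T"
  by (rule hypsI)

lemma facet_normal: "K \<in> T \<Longrightarrow> F facet_of K \<Longrightarrow> face_normal (affine hull F) = face_normal F"
  by (rule facet_hyperplane(3)[OF simT])

lemma diameter_facet: "K \<in> T \<Longrightarrow> F facet_of K \<Longrightarrow> 2 * \<rho> \<le> diameter F \<and> diameter F \<le> h"
proof (rule conjI)
  assume K: "K \<in> T" and F: "F facet_of K"
  obtain z where "cball z \<rho> \<subseteq> K" using inball[OF K] by blast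
  then show "2 * \<rho> \<le> diameter F" using facet_diameter[OF simT[OF K] F _ \<rho> dim2] by blast
  have "diameter F \<le> diameter K"
    by (rule diameter_subset[OF facet_of_imp_subset[OF F]]) (rule compact_imp_bounded[OF simplex_interior(4)[OF simT[OF K]]])
  then show "diameter F \<le> h" using diam[OF K] by simp
qed

text \<open>A crude quantity that depends on the mesh. It bounds the jumps for the sake of
  integrability and enters no estimate of the theorem.\<close>

definition vsum :: "(real^'n \<Rightarrow> real) \<Rightarrow> real" where
  "vsum q = (\<Sum>K\<in>T. (val q K)\<^sup>2)"

lemma AE_jump_bound:
  assumes q: "pwc q" and H: "H \<in> hyps T"
  shows "AE y in lebesgue. \<bar>jump (face_normal H) q (hproj H y)\<bar> \<le> 2 * sqrt (vsum q)"
  using AE_good[OF H]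
proof eventually_elim
  case (elim y)
  have "(jump (face_normal H) q (hproj H y))\<^sup>2 \<le> 4 * (\<Sum>K | K \<in> T \<and> hproj H y \<in> K. (val q K)\<^sup>2)"
    by (rule jump_bound[OF q H elim])
  also have "\<dots> \<le> 4 * vsum q" unfolding vsum_def using finT by (intro mult_left_mono sum_mono2) auto
  finally have "sqrt ((jump (face_normal H) q (hproj H y))\<^sup>2) \<le> sqrt (4 * vsum q)" by (rule real_sqrt_le_mono)
  then show ?case by (simp add: real_sqrt_mult)
qed

lemma integrable_on_prism:
  fixes g :: "real^'n \<Rightarrow> real" and B :: real
  assumes K: "K \<in> T" and F: "F facet_of K" and H: "H = affine hull F"
    and m: "(\<lambda>y. indicator (slab H) y * g y) \<in> borel_measurable lebesgue" and b: "AE y in lebesgue. \<bar>g y\<bar> \<le> B"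
  shows "integrable lebesgue (\<lambda>y. indicator (slab H) y * (indicator F (hproj H y) * g y))"
proof (rule Bochner_Integration.integrable_bound)
  note fi = face_integral_eq[OF simT[OF K] F H]
  let ?P = "{y \<in> slab H. hproj H y \<in> F}"
  have "?P \<in> lmeasurable" by (rule bounded_set_imp_lmeasurable[OF fi(4) fi(3)])
  then show "integrable lebesgue (\<lambda>y. B * indicator ?P y)"
    by (intro integrable_mult_right) (simp add: lmeasurable_iff_integrable)
  have eq: "indicator (slab H) y * (indicator F (hproj H y) * g y) = indicator ?P y * (indicator (slab H) y * g y)" for y
    by (auto simp: indicator_def)
  show "(\<lambda>y. indicator (slab H) y * (indicator F (hproj H y) * g y)) \<in> borel_measurable lebesgue"
    unfolding eq by (intro borel_measurable_times m borel_measurable_indicator fi(3))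
  show "AE y in lebesgue. norm (indicator (slab H) y * (indicator F (hproj H y) * g y)) \<le> norm (B * indicator ?P y)"
    using b by eventually_elim (auto simp: indicator_def)
qed

lemma hproj_measurable: "hproj H \<in> borel_measurable borel"
  unfolding hyperplane_proj_def by measurable

lemma jint_integrable:
  assumes K: "K \<in> T" and F: "F facet_of K" and H: "H = affine hull F" and p: "pwc p" and q: "pwc q"
  shows "integrable lebesgue (\<lambda>y. indicator (slab H) y * (indicator F (hproj H y) *
      (indicator (- frontier \<Omega>) (hproj H y) * (diameter F * jump (face_normal F) p (hproj H y) * jump (face_normal F) q (hproj H y)))))"
proof (rule integrable_on_prism[OF K F H])
  have Hh: "H \<in> hyps T" unfolding H by (rule facet_hyps[OF K F])
  have \<nu>: "face_normal H = face_normal F" unfolding H by (rule facet_normal[OF K F])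
  have mp: "(\<lambda>y. indicator (slab H) y * jump (face_normal F) p (hproj H y)) \<in> borel_measurable lebesgue"
    "(\<lambda>y. indicator (slab H) y * jump (face_normal F) q (hproj H y)) \<in> borel_measurable lebesgue"
    using jump_integrable_slab[OF p Hh] jump_integrable_slab[OF q Hh] unfolding \<nu> by (auto dest: borel_measurable_integrable)
  have "(\<lambda>y. indicator (- frontier \<Omega>) (hproj H y) :: real) \<in> borel_measurable borel"
    by (rule measurable_compose[OF hproj_measurable]) (auto intro!: borel_measurable_indicator)
  then have mi: "(\<lambda>y. diameter F * indicator (- frontier \<Omega>) (hproj H y)) \<in> borel_measurable lebesgue"
    by (intro borel_measurable_lebesgueI) simp
  have eq: "indicator (slab H) y * (indicator (- frontier \<Omega>) (hproj H y) * (diameter F * jump (face_normal F) p (hproj H y) * jump (face_normal F) q (hproj H y)))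
    = (diameter F * indicator (- frontier \<Omega>) (hproj H y)) * ((indicator (slab H) y * jump (face_normal F) p (hproj H y)) * (indicator (slab H) y * jump (face_normal F) q (hproj H y)))" for y
    by (simp add: indicator_def)
  show "(\<lambda>y. indicator (slab H) y * (indicator (- frontier \<Omega>) (hproj H y) * (diameter F * jump (face_normal F) p (hproj H y) * jump (face_normal F) q (hproj H y)))) \<in> borel_measurable lebesgue"
    unfolding eq by (intro borel_measurable_times mp mi)
  show "AE y in lebesgue. \<bar>indicator (- frontier \<Omega>) (hproj H y) * (diameter F * jump (face_normal F) p (hproj H y) * jump (face_normal F) q (hproj H y))\<bar>
      \<le> 1 * (h * (2 * sqrt (vsum p)) * (2 * sqrt (vsum q)))"
    using AE_jump_bound[OF p Hh] AE_jump_bound[OF q Hh] unfolding \<nu>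
  proof eventually_elim
    case (elim y)
    have "0 \<le> diameter F" "diameter F \<le> h" using diameter_facet[OF K F] \<rho> by auto
    then show ?case unfolding abs_mult using elim
      by (intro mult_mono) (auto simp: indicator_def vsum_def sum_nonneg)
  qed
qed

lemma jint_eq:
  assumes K: "K \<in> T" and F: "F facet_of K" and H: "H = affine hull F"
  shows "jint F p q = (LINT y|lebesgue. indicator (slab H) y * (indicator F (hproj H y) *
      (indicator (- frontier \<Omega>) (hproj H y) * (diameter F * jump (face_normal F) p (hproj H y) * jump (face_normal F) q (hproj H y)))))"
  unfolding jint_def by (rule face_integral_eq(1)[OF simT[OF K] F H])

lemma jint_lincomb:
  assumes K: "K \<in> T" and F: "F facet_of K" and p: "pwc p" and q: "pwc q" and q': "pwc q'"
  shows "jint F p (\<lambda>x. q x + a * q' x) = jint F p q + a * jint F p q'"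
proof -
  define H where "H = affine hull F"
  have Hh: "H \<in> hyps T" unfolding H_def by (rule facet_hyps[OF K F])
  have \<nu>: "face_normal H = face_normal F" unfolding H_def by (rule facet_normal[OF K F])
  note I = jint_integrable[OF K F H_def p]
  let ?g = "\<lambda>q y. indicator (slab H) y * (indicator F (hproj H y) *
      (indicator (- frontier \<Omega>) (hproj H y) * (diameter F * jump (face_normal F) p (hproj H y) * jump (face_normal F) q (hproj H y))))"
  have "(LINT y|lebesgue. ?g (\<lambda>x. q x + a * q' x) y) = (LINT y|lebesgue. ?g q y + a * ?g q' y)"
  proof (rule integral_cong_AE)
    show "?g (\<lambda>x. q x + a * q' x) \<in> borel_measurable lebesgue"
      by (rule borel_measurable_integrable[OF I[OF pwc_lincomb[OF q q']]])
    show "(\<lambda>y. ?g q y + a * ?g q' y) \<in> borel_measurable lebesgue"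
      using I[OF q] I[OF q'] by (intro borel_measurable_integrable Bochner_Integration.integrable_add integrable_mult_right)
    show "AE y in lebesgue. ?g (\<lambda>x. q x + a * q' x) y = ?g q y + a * ?g q' y"
      using AE_good[OF Hh]
    proof eventually_elim
      case (elim y)
      from jump_lincomb[OF q q' Hh elim, of a] show ?case unfolding \<nu> by (simp only:) (simp add: algebra_simps)
    qed
  qed
  also have "\<dots> = (LINT y|lebesgue. ?g q y) + a * (LINT y|lebesgue. ?g q' y)"
    by (subst Bochner_Integration.integral_add[OF I[OF q] integrable_mult_right[OF I[OF q']]]) simp
  finally show ?thesis unfolding jint_eq[OF K F H_def] .
qed

lemma jint_commute: "jint F p q = jint F q p"
  unfolding jint_def by (simp add: mult_ac)

lemma jint_nonneg: "K \<in> T \<Longrightarrow> F facet_of K \<Longrightarrow> 0 \<le> jint F q q"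
proof -
  assume "K \<in> T" "F facet_of K"
  then have "0 \<le> diameter F" using diameter_facet \<rho> by force
  then have "0 \<le> indicator (- frontier \<Omega>) x * (diameter F * jump (face_normal F) q x * jump (face_normal F) q x)" for x
    by (simp add: indicator_def mult.assoc)
  then show ?thesis unfolding jint_def face_integral_def by (intro integral_nonneg_AE AE_I2)
qed

lemma J_form_lincomb:
  assumes "pwc p" "pwc q" "pwc q'"
  shows "J_form \<Omega> T \<delta> p (\<lambda>x. q x + a * q' x) = J_form \<Omega> T \<delta> p q + a * J_form \<Omega> T \<delta> p q'"
proof -
  have "(\<Sum>K\<in>T. \<Sum>F\<in>facets K. jint F p (\<lambda>x. q x + a * q' x)) = (\<Sum>K\<in>T. \<Sum>F\<in>facets K. jint F p q + a * jint F p q')"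
    using assms by (intro sum.cong refl jint_lincomb) auto
  then show ?thesis unfolding J_form_jint by (simp add: sum.distrib sum_distrib_left[symmetric] algebra_simps)
qed

lemma J_form_commute: "J_form \<Omega> T \<delta> p q = J_form \<Omega> T \<delta> q p"
  unfolding J_form_jint by (simp add: jint_commute[of _ p q])

lemma J_form_nonneg: "0 \<le> \<delta> \<Longrightarrow> 0 \<le> J_form \<Omega> T \<delta> q q"
  unfolding J_form_jint by (intro mult_nonneg_nonneg sum_nonneg) (auto intro: jint_nonneg)

lemma trace_facets:
  assumes K: "K \<in> T" and \<phi>: "Ck (Suc 0) \<phi>"
  shows "(\<Sum>F\<in>facets K. face_integral F (\<lambda>x. (\<phi> x)\<^sup>2)) \<le>
     (LINT x|lebesgue. indicator K x * (real (CARD('n) + 1) * (\<phi> x)\<^sup>2 + h\<^sup>2 * (\<Sum>i\<in>UNIV. (partial_deriv i \<phi> x)\<^sup>2))) / \<rho>"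
proof -
  obtain z where "cball z \<rho> \<subseteq> K" using inball[OF K] by blast
  from trace_inequality[OF simT[OF K] this \<rho> diam[OF K] h \<phi>] show ?thesis
    using \<rho> by (simp add: field_simps)
qed

text \<open>The trace inequality for the constant function 1 bounds the surface of K by a multiple
  of its volume over \<rho>.\<close>

lemma facets_area:
  assumes K: "K \<in> T"
  shows "(\<Sum>F\<in>facets K. face_integral F (\<lambda>x. 1)) \<le> real (CARD('n) + 1) * measure lebesgue K / \<rho>"
proof -
  have p: "partial_deriv i (\<lambda>x :: real^'n. 1) x = 0" for i x by (simp add: partial_derivI[OF has_derivative_const])
  have "(LINT x|lebesgue. indicator K x * real (CARD('n) + 1)) = measure lebesgue K * real (CARD('n) + 1)"
    using simplex_interior(5)[OF simT[OF K]] by (subst integral_mult_left_zero) auto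
  then show ?thesis using trace_facets[OF K Ck_const[of _ 1]] by (simp add: p mult.commute)
qed

text \<open>K contains a ball of radius \<rho>, and the volumes of balls scale with the power
  \<open>CARD('n)\<close> of the radius.\<close>

lemma measure_ratio:
  fixes x :: "real^'n"
  assumes K: "K \<in> T"
  shows "measure lebesgue (cball x (2 * h)) \<le> (2 * h / \<rho>) ^ CARD('n) * measure lebesgue K"
proof -
  obtain z where z: "cball z \<rho> \<subseteq> K" using inball[OF K] by blast
  have "measure lebesgue (cball z \<rho>) \<le> measure lebesgue K"
    using z simplex_interior(4)[OF simT[OF K]] by (intro measure_mono_fmeasurable) (auto intro: lmeasurable_compact)
  moreover have "measure lebesgue (cball x (2 * h)) = unit_ball_vol (real CARD('n)) * (2 * h) ^ CARD('n)"
    "measure lebesgue (cball z \<rho>) = unit_ball_vol (real CARD('n)) * \<rho> ^ CARD('n)"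
    using content_cball[of "2 * h" x] content_cball[of \<rho> z] h \<rho> by auto
  ultimately show ?thesis using \<rho> h by (simp add: power_divide field_simps)
qed

lemma near_ball:
  assumes "K' \<in> T" "K \<in> T" "K' \<inter> K \<noteq> {}" "x \<in> K"
  shows "K' \<subseteq> cball x (2 * h)"
proof
  fix y assume y: "y \<in> K'"
  obtain w where w: "w \<in> K'" "w \<in> K" using assms(3) by blast
  have "dist y w \<le> h" "dist w x \<le> h"
    using diameter_bounded_bound[OF compact_imp_bounded[OF simplex_interior(4)[OF simT[OF assms(1)]]] y w(1)] diam[OF assms(1)]
      diameter_bounded_bound[OF compact_imp_bounded[OF simplex_interior(4)[OF simT[OF assms(2)]]] w(2) assms(4)] diam[OF assms(2)] by auto
  then show "y \<in> cball x (2 * h)" using dist_triangle[of y x w] by (simp add: dist_commute)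
qed

text \<open>Disjoint interiors confine the intersection to the two frontiers, and frontiers of
  convex sets are null.\<close>

lemma negligible_overlap:
  assumes "K \<in> T" "K' \<in> T" "K \<noteq> K'" shows "negligible (K \<inter> K')"
proof -
  have "K \<inter> K' \<subseteq> frontier K \<union> frontier K'"
    using disjT[OF assms] closure_subset by (auto simp: frontier_def)
  moreover have "negligible (frontier K)" "negligible (frontier K')"
    using assms simplex_interior(3)[OF simT] by (auto intro: negligible_convex_frontier)
  ultimately show ?thesis by (meson negligible_Un negligible_subset)
qed

lemma sum_measure_near:
  assumes X: "X \<subseteq> T" and sub: "\<And>K. K \<in> X \<Longrightarrow> K \<subseteq> cball x (2 * h)"
  shows "(\<Sum>K\<in>X. measure lebesgue K) \<le> measure lebesgue (cball x (2 * h))"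
proof -
  have fX: "finite X" using X finT by (rule finite_subset)
  have lm: "K \<in> lmeasurable" if "K \<in> X" for K
    using that X simplex_interior(4)[OF simT, of K] by (intro lmeasurable_compact) blast
  have "measure lebesgue (\<Union>K\<in>X. K) = (\<Sum>K\<in>X. measure lebesgue K)"
  proof (rule measure_negligible_finite_Union_image[OF fX lm])
    show "pairwise (\<lambda>K K'. negligible (K \<inter> K')) X"
      using X negligible_overlap unfolding pairwise_def by blast
  qed
  moreover have "measure lebesgue (\<Union>K\<in>X. K) \<le> measure lebesgue (cball x (2 * h))"
    using sub fX lm by (intro measure_mono_fmeasurable fmeasurableD[OF fmeasurable.finite_UN]) (auto intro: lmeasurable_compact)
  ultimately show ?thesis by simp
qed

text \<open>Comparison of volumes: the elements overlap in null sets, and each of them fills at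
  least a fixed fraction of the ball of radius 2h.\<close>

lemma overlap_card:
  assumes X: "X \<subseteq> T" and sub: "\<And>K. K \<in> X \<Longrightarrow> K \<subseteq> cball x (2 * h)"
  shows "real (card X) \<le> (2 * h / \<rho>) ^ CARD('n)"
proof -
  let ?m = "measure lebesgue (cball x (2 * h))"
  have m: "?m > 0" using content_cball_pos[of "2 * h" x] h by simp
  have "real (card X) * (?m / (2 * h / \<rho>) ^ CARD('n)) = (\<Sum>K\<in>X. ?m / (2 * h / \<rho>) ^ CARD('n))" by simp
  also have "\<dots> \<le> (\<Sum>K\<in>X. measure lebesgue K)"
    using measure_ratio X h \<rho> by (intro sum_mono) (auto simp: pos_divide_le_eq mult.commute)
  also have "\<dots> \<le> ?m" by (rule sum_measure_near[OF X sub])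
  finally show ?thesis using m h \<rho> by (simp add: field_simps)
qed

text \<open>An inverse inequality. The facet diameter, at most h, compensates the 1/\<rho> of the
  surface bound, so that the constant depends on h/\<rho> alone. Jumps are bounded by the values on
  neighbouring elements, all of which lie in a ball of radius 2h.\<close>

lemma J_form_le:
  assumes q: "pwc q" and \<delta>: "\<delta> \<ge> 0"
  shows "J_form \<Omega> T \<delta> q q \<le> \<delta> * (4 * h * real (CARD('n) + 1) / \<rho> * (2 * h / \<rho>) ^ CARD('n)) * (\<Sum>K\<in>T. (val q K)\<^sup>2 * measure lebesgue K)"
proof -
  let ?N = "\<lambda>K. {K' \<in> T. K' \<inter> K \<noteq> {}}"
  let ?Q = "\<lambda>K. \<Sum>K'\<in>?N K. (val q K')\<^sup>2"
  let ?n = "real (CARD('n) + 1)" and ?m = "measure lebesgue"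
  let ?c = "4 * h * ?n / \<rho>"
  have Q0: "0 \<le> ?Q K" for K by (intro sum_nonneg) auto
  have face: "jint F q q \<le> 4 * h * ?Q K * face_integral F (\<lambda>x. 1)" if K: "K \<in> T" and F: "F facet_of K" for K F
  proof -
    define H where "H = affine hull F"
    have Hh: "H \<in> hyps T" unfolding H_def by (rule facet_hyps[OF K F])
    have \<nu>: "face_normal H = face_normal F" unfolding H_def by (rule facet_normal[OF K F])
    have dF: "0 \<le> diameter F" "diameter F \<le> h" using diameter_facet[OF K F] \<rho> by auto
    have int1: "integrable lebesgue (\<lambda>y. indicator (slab H) y * (indicator F (hproj H y) * (4 * h * ?Q K)))"
    proof (rule integrable_on_prism[OF K F H_def, where B = "\<bar>4 * h * ?Q K\<bar>"])
      have "slab H \<in> sets borel" by (intro borel_closed closed_Collect_le continuous_intros)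
      then show "(\<lambda>y. indicator (slab H) y * (4 * h * ?Q K)) \<in> borel_measurable lebesgue"
        by (intro borel_measurable_lebesgueI borel_measurable_times borel_measurable_indicator) auto
    qed simp
    have "jint F q q \<le> (LINT y|lebesgue. indicator (slab H) y * (indicator F (hproj H y) * (4 * h * ?Q K)))"
      unfolding jint_eq[OF K F H_def]
    proof (rule integral_mono_AE[OF jint_integrable[OF K F H_def q q] int1])
      show "AE y in lebesgue. indicator (slab H) y * (indicator F (hproj H y) * (indicator (- frontier \<Omega>) (hproj H y) *
          (diameter F * jump (face_normal F) q (hproj H y) * jump (face_normal F) q (hproj H y)))) \<le>
          indicator (slab H) y * (indicator F (hproj H y) * (4 * h * ?Q K))"
        using AE_good[OF Hh]
      proof eventually_elim
        case (elim y)
        let ?j = "jump (face_normal F) q (hproj H y)"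
        show ?case
        proof (cases "hproj H y \<in> F")
          case True
          then have xK: "hproj H y \<in> K" using facet_of_imp_subset[OF F] by blast
          have "?j\<^sup>2 \<le> 4 * (\<Sum>K' | K' \<in> T \<and> hproj H y \<in> K'. (val q K')\<^sup>2)" using jump_bound[OF q Hh elim] unfolding \<nu> .
          also have "\<dots> \<le> 4 * ?Q K" using xK finT by (intro mult_left_mono sum_mono2) auto
          finally have j: "?j\<^sup>2 \<le> 4 * ?Q K" .
          have "diameter F * (?j * ?j) \<le> h * (4 * ?Q K)"
            by (rule mult_mono) (use j h dF in \<open>simp_all add: power2_eq_square\<close>)
          then have "diameter F * ?j * ?j \<le> h * (4 * ?Q K)" by (simp only: mult.assoc)
          moreover have "0 \<le> diameter F * ?j * ?j" using dF by (simp add: mult.assoc)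
          ultimately show ?thesis using Q0[of K] h by (simp add: indicator_def mult_ac)
        qed simp
      qed
    qed
    also have "\<dots> = 4 * h * ?Q K * (LINT y|lebesgue. indicator (slab H) y * (indicator F (hproj H y) * 1))"
      by (subst integral_mult_right_zero[symmetric]) (simp add: mult_ac)
    also have "\<dots> = 4 * h * ?Q K * face_integral F (\<lambda>x. 1)"
      unfolding face_integral_eq(1)[OF simT[OF K] F H_def] ..
    finally show ?thesis .
  qed
  have "(\<Sum>K\<in>T. \<Sum>F\<in>facets K. jint F q q) \<le> (\<Sum>K\<in>T. \<Sum>F\<in>facets K. 4 * h * ?Q K * face_integral F (\<lambda>x. 1))"
    using face by (intro sum_mono) auto
  also have "\<dots> = (\<Sum>K\<in>T. 4 * h * ?Q K * (\<Sum>F\<in>facets K. face_integral F (\<lambda>x. 1)))" by (simp add: sum_distrib_left)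
  also have "\<dots> \<le> (\<Sum>K\<in>T. 4 * h * ?Q K * (?n * ?m K / \<rho>))"
    using facets_area Q0 h by (intro sum_mono mult_left_mono) auto
  also have "\<dots> = ?c * (\<Sum>K\<in>T. \<Sum>K'\<in>?N K. (val q K')\<^sup>2 * ?m K)"
  proof -
    have ring: "4 * h * Q * (n * m / \<rho>) = (4 * h * n / \<rho>) * (Q * m)" for Q n m :: real by simp
    show ?thesis unfolding ring sum_distrib_left[symmetric] sum_distrib_right ..
  qed
  \<comment> \<open>The sum is reordered by the element whose value of q occurs; this collects the
    measures of its neighbours.\<close>
  also have "(\<Sum>K\<in>T. \<Sum>K'\<in>?N K. (val q K')\<^sup>2 * ?m K) = (\<Sum>K'\<in>T. \<Sum>K | K \<in> T \<and> K' \<inter> K \<noteq> {}. (val q K')\<^sup>2 * ?m K)"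
    by (rule sum.swap_restrict[OF finT finT])
  also have "\<dots> = (\<Sum>K'\<in>T. (val q K')\<^sup>2 * (\<Sum>K | K \<in> T \<and> K' \<inter> K \<noteq> {}. ?m K))" by (simp add: sum_distrib_left)
  also have "?c * \<dots> \<le> ?c * (\<Sum>K'\<in>T. (val q K')\<^sup>2 * ((2 * h / \<rho>) ^ CARD('n) * ?m K'))"
  proof (intro mult_left_mono sum_mono)
    fix K' assume K': "K' \<in> T"
    obtain x where x: "x \<in> K'" using simplex_interior(1)[OF simT[OF K']] interior_subset[of K'] by blast
    have "(\<Sum>K | K \<in> T \<and> K' \<inter> K \<noteq> {}. ?m K) \<le> ?m (cball x (2 * h))"
      using near_ball[OF _ K' _ x] by (intro sum_measure_near) blast+
    also have "\<dots> \<le> (2 * h / \<rho>) ^ CARD('n) * ?m K'" by (rule measure_ratio[OF K'])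
    finally show "(\<Sum>K | K \<in> T \<and> K' \<inter> K \<noteq> {}. ?m K) \<le> (2 * h / \<rho>) ^ CARD('n) * ?m K'" .
  qed (use h \<rho> in auto)
  also have "\<dots> = ?c * (2 * h / \<rho>) ^ CARD('n) * (\<Sum>K'\<in>T. (val q K')\<^sup>2 * ?m K')"
    unfolding mult.left_commute[of _ "(2 * h / \<rho>) ^ CARD('n)"] sum_distrib_left[symmetric] mult.assoc ..
  finally have "(\<Sum>K\<in>T. \<Sum>F\<in>facets K. jint F q q) \<le> ?c * (2 * h / \<rho>) ^ CARD('n) * (\<Sum>K'\<in>T. (val q K')\<^sup>2 * ?m K')" .
  from mult_left_mono[OF this \<delta>] show ?thesis unfolding J_form_jint by (simp add: mult.assoc)
qed

text \<open>A weighted Young inequality on each facet avoids the Cauchy--Schwarz inequality for sums over facets.\<close>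

lemma integral_divergence_le:
  fixes w :: "real^'n \<Rightarrow> real^'n"
  assumes q: "pwc q" and w: "\<And>i. Ck (Suc 0) (\<lambda>x. w x $ i)"
    and B: "\<And>x. norm (w x) \<le> B" "\<And>x i. \<bar>partial_deriv i (\<lambda>x. w x $ i) x\<bar> \<le> B"
    and supp: "\<And>x. x \<notin> \<Omega> \<Longrightarrow> w x = 0" and s: "s > 0"
  shows "\<bar>LINT x|lebesgue. q x * (\<Sum>i\<in>UNIV. partial_deriv i (\<lambda>x. w x $ i) x)\<bar> \<le>
     s / 2 * J_form \<Omega> T 1 q q + 1 / (4 * s * \<rho>\<^sup>2) *
     (\<Sum>K\<in>T. \<Sum>i\<in>UNIV. LINT x|lebesgue. indicator K x *
        (real (CARD('n) + 1) * (w x $ i)\<^sup>2 + h\<^sup>2 * (\<Sum>k\<in>UNIV. (partial_deriv k (\<lambda>x. w x $ i) x)\<^sup>2)))"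
proof -
  let ?j = "\<lambda>F x. jump (face_normal F) q x"
  let ?E1 = "\<lambda>F x. indicator (- frontier \<Omega>) x * (diameter F * ?j F x * ?j F x)"
  let ?P = "Sigma T facets"
  let ?b1 = "\<lambda>F y. indicator (slab (affine hull F)) y * (indicator F (hproj (affine hull F) y) * ?E1 F (hproj (affine hull F) y))"
  let ?b2 = "\<lambda>F y. indicator (slab (affine hull F)) y * (indicator F (hproj (affine hull F) y) * (norm (w (hproj (affine hull F) y)))\<^sup>2)"
  let ?b = "\<lambda>F y. s / 2 * ?b1 F y + 1 / (2 * s * diameter F) * ?b2 F y"
  let ?A = "\<lambda>H y. indicator (slab H) y * (?j H (hproj H y) * (face_normal H \<bullet> w (hproj H y)))"
  have finP: "finite ?P" using finT simplex_interior(7)[OF simT] by auto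
  have "continuous_on UNIV (\<lambda>x. \<chi> i. w x $ i)" by (intro continuous_on_vec_lambda Ck1_facts(2)[OF w])
  then have wcont: "continuous_on UNIV w" by simp
  have dF: "2 * \<rho> \<le> diameter F" if "(K, F) \<in> ?P" for K F using diameter_facet[of K F] that by auto
  have Ib1: "integrable lebesgue (?b1 F)" if "(K, F) \<in> ?P" for K F
    using that by (intro jint_integrable[OF _ _ refl q q]) auto
  have Ib2: "integrable lebesgue (?b2 F)" if KF: "(K, F) \<in> ?P" for K F
  proof (rule integrable_on_prism[of K F, OF _ _ refl, where B = "B\<^sup>2"])
    let ?H = "affine hull F"
    have sl: "slab ?H \<in> sets borel" by (intro borel_closed closed_Collect_le continuous_intros)
    have "(\<lambda>y. w (hproj ?H y)) \<in> borel_measurable borel"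
      by (rule measurable_compose[OF hproj_measurable borel_measurable_continuous_onI[OF wcont]])
    then have "(\<lambda>y. (norm (w (hproj ?H y)))\<^sup>2) \<in> borel_measurable borel" by measurable
    then show "(\<lambda>y. indicator (slab ?H) y * (norm (w (hproj ?H y)))\<^sup>2) \<in> borel_measurable lebesgue"
      using sl by (intro borel_measurable_lebesgueI borel_measurable_times borel_measurable_indicator) auto
    show "AE y in lebesgue. \<bar>(norm (w (hproj ?H y)))\<^sup>2\<bar> \<le> B\<^sup>2" using B(1) by (intro AE_I2) (simp add: power_mono)
  qed (use KF in auto)
  have Ib: "integrable lebesgue (?b F)" if "(K, F) \<in> ?P" for K F
    using Ib1[OF that] Ib2[OF that] by (intro Bochner_Integration.integrable_add integrable_mult_right)
  have b0: "0 \<le> ?b F y" if "(K, F) \<in> ?P" for K F y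
    using dF[OF that] \<rho> s by (simp add: indicator_def mult.assoc)
  \<comment> \<open>At almost every point with a nonzero jump \<open>jump_facet\<close> provides one
    facet on H through the point. Further facets on H through it only add nonnegative terms.\<close>
  have AH: "\<bar>LINT y|lebesgue. ?A H y\<bar> \<le> (\<Sum>p\<in>{p \<in> ?P. affine hull (snd p) = H}. LINT y|lebesgue. ?b (snd p) y)" if H: "H \<in> hyps T" for H
  proof -
    let ?PH = "{p \<in> ?P. affine hull (snd p) = H}"
    have IA: "integrable lebesgue (?A H)" by (rule integral_pwc_divergence(2)[OF q w B H])
    have "\<bar>LINT y|lebesgue. ?A H y\<bar> \<le> (LINT y|lebesgue. \<bar>?A H y\<bar>)" by (rule integral_abs_bound)
    also have "\<dots> \<le> (LINT y|lebesgue. (\<Sum>p\<in>?PH. ?b (snd p) y))"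
    proof (rule integral_mono_AE)
      show "integrable lebesgue (\<lambda>y. \<bar>?A H y\<bar>)" using IA by (rule integrable_abs)
      show "integrable lebesgue (\<lambda>y. \<Sum>p\<in>?PH. ?b (snd p) y)"
        using Ib by (intro Bochner_Integration.integrable_sum) auto
      show "AE y in lebesgue. \<bar>?A H y\<bar> \<le> (\<Sum>p\<in>?PH. ?b (snd p) y)"
        using AE_good[OF H]
      proof eventually_elim
        case (elim y)
        let ?x = "hproj H y"
        have nn: "0 \<le> (\<Sum>p\<in>?PH. ?b (snd p) y)" using b0 by (intro sum_nonneg) auto
        show ?case
        proof (cases "y \<in> slab H \<and> ?j H ?x \<noteq> 0 \<and> w ?x \<noteq> 0")
          case False
          then have "?A H y = 0" by (auto simp: indicator_def)
          then show ?thesis using nn by (simp only: abs_zero)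
        next
          case True
          then have nz: "?j H ?x \<noteq> 0" "w ?x \<noteq> 0" "y \<in> slab H" by blast+
          obtain K F where KF: "K \<in> T" "F facet_of K" "affine hull F = H" "?x \<in> F"
            by (rule jump_facet[OF q H elim nz(1)])
          have P: "(K, F) \<in> ?P" using KF by auto
          have \<nu>: "face_normal F = face_normal H" using facet_normal[OF KF(1,2)] KF(3) by simp
          \<comment> \<open>Here the boundary drops out: w vanishes off \<Omega>, so a contributing
            point is not on the frontier and the indicator in the jump form equals 1.\<close>
          have "?x \<in> \<Omega>" using supp nz(2) by blast
          then have nf: "?x \<notin> frontier \<Omega>" using open\<Omega> by (simp add: frontier_def interior_open)
          have d: "diameter F > 0" using dF[OF P] \<rho> by simp
          have "\<bar>?A H y\<bar> = \<bar>?j H ?x\<bar> * \<bar>face_normal H \<bullet> w ?x\<bar>" using nz(3) by (simp add: abs_mult)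
          also have "\<dots> \<le> \<bar>?j H ?x\<bar> * norm (w ?x)"
            using Cauchy_Schwarz_ineq2[of "face_normal H" "w ?x"] hyps_unit[OF H] by (intro mult_left_mono) auto
          also have "\<dots> \<le> s / 2 * (diameter F * (?j H ?x * ?j H ?x)) + 1 / (2 * s * diameter F) * (norm (w ?x))\<^sup>2"
          proof -
            \<comment> \<open>This weight in Young's inequality reproduces the factor
              \<open>diameter F\<close> of the stabilization in front of the squared jump.\<close>
            define a where "a = s * diameter F"
            have a: "a > 0" using s d by (simp add: a_def)
            have "0 \<le> (a * \<bar>?j H ?x\<bar> - norm (w ?x))\<^sup>2 / (2 * a)" using a by simp
            also have "\<dots> = a / 2 * (\<bar>?j H ?x\<bar> * \<bar>?j H ?x\<bar>) + 1 / (2 * a) * (norm (w ?x))\<^sup>2 - \<bar>?j H ?x\<bar> * norm (w ?x)"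
              using a by (simp add: power2_eq_square field_simps)
            finally show ?thesis unfolding a_def abs_mult_self_eq by (simp add: mult_ac)
          qed
          also have "\<dots> = ?b F y" unfolding KF(3) \<nu> using nz(3) KF(4) nf by (simp add: mult.assoc)
          also have "\<dots> = ?b (snd (K, F)) y" by simp
          also have "\<dots> \<le> (\<Sum>p\<in>?PH. ?b (snd p) y)"
          proof (rule member_le_sum)
            show "(K, F) \<in> ?PH" using P KF(3) by simp
            show "finite ?PH" using finP by simp
            show "0 \<le> ?b (snd p) y" if "p \<in> ?PH - {(K, F)}" for p using that b0[of "fst p" "snd p" y] by auto
          qed
          finally show ?thesis .
        qed
      qed
    qed
    also have "\<dots> = (\<Sum>p\<in>?PH. LINT y|lebesgue. ?b (snd p) y)"
      using Ib by (intro Bochner_Integration.integral_sum) auto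
    finally show ?thesis .
  qed
  have b_int: "(LINT y|lebesgue. ?b F y) \<le> s / 2 * jint F q q + 1 / (4 * s * \<rho>) * (\<Sum>i\<in>UNIV. face_integral F (\<lambda>x. (w x $ i)\<^sup>2))"
    if P: "(K, F) \<in> ?P" for K F
  proof -
    have K: "K \<in> T" and F: "F facet_of K" using P by auto
    note fi = face_integral_eq(1)[OF simT[OF K] F refl]
    have comp: "integrable lebesgue (\<lambda>y. indicator (slab (affine hull F)) y * (indicator F (hproj (affine hull F) y) * (w (hproj (affine hull F) y) $ i)\<^sup>2))" for i
    proof (rule integrable_on_prism[OF K F refl, where B = "B\<^sup>2"])
      let ?H = "affine hull F"
      have sl: "slab ?H \<in> sets borel" by (intro borel_closed closed_Collect_le continuous_intros)
      have "(\<lambda>y. w (hproj ?H y) $ i) \<in> borel_measurable borel"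
        by (rule measurable_compose[OF hproj_measurable borel_measurable_continuous_onI[OF Ck1_facts(2)[OF w]]])
      then have "(\<lambda>y. (w (hproj ?H y) $ i)\<^sup>2) \<in> borel_measurable borel" by measurable
      then show "(\<lambda>y. indicator (slab ?H) y * (w (hproj ?H y) $ i)\<^sup>2) \<in> borel_measurable lebesgue"
        using sl by (intro borel_measurable_lebesgueI borel_measurable_times borel_measurable_indicator) auto
      have "(w x $ i)\<^sup>2 \<le> B\<^sup>2" for x
        using order_trans[OF component_le_norm_cart B(1), of x i] by (simp add: abs_le_square_iff[symmetric])
      then show "AE y in lebesgue. \<bar>(w (hproj ?H y) $ i)\<^sup>2\<bar> \<le> B\<^sup>2" by simp
    qed
    have nsq: "(norm (v :: real^'n))\<^sup>2 = (\<Sum>i\<in>UNIV. (v $ i)\<^sup>2)" for v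
      by (simp add: norm_vec_def L2_set_def sum_nonneg)
    have b2: "(LINT y|lebesgue. ?b2 F y) = (\<Sum>i\<in>UNIV. face_integral F (\<lambda>x. (w x $ i)\<^sup>2))"
      unfolding fi nsq sum_distrib_left using comp by (intro Bochner_Integration.integral_sum) auto
    have nn: "0 \<le> (\<Sum>i\<in>UNIV. face_integral F (\<lambda>x. (w x $ i)\<^sup>2))"
      unfolding face_integral_def by (intro sum_nonneg integral_nonneg_AE AE_I2) simp
    have e: "(LINT y|lebesgue. ?b F y) = s / 2 * (LINT y|lebesgue. ?b1 F y) + 1 / (2 * s * diameter F) * (LINT y|lebesgue. ?b2 F y)"
      by (subst Bochner_Integration.integral_add[OF integrable_mult_right[OF Ib1[OF P]] integrable_mult_right[OF Ib2[OF P]]])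
        (simp only: integral_mult_right_zero)
    have b1: "(LINT y|lebesgue. ?b1 F y) = jint F q q" by (rule jint_eq[OF K F refl, symmetric])
    \<comment> \<open>A facet has diameter at least 2\<rho>, which explains the 4 in place of the
      2.\<close>
    have "1 / (2 * s * diameter F) \<le> 1 / (4 * s * \<rho>)"
      using dF[OF P] \<rho> s by (intro divide_left_mono) auto
    from mult_right_mono[OF this nn] show ?thesis
      unfolding e b1 b2 by (rule add_left_mono)
  qed
  have "\<bar>LINT x|lebesgue. q x * (\<Sum>i\<in>UNIV. partial_deriv i (\<lambda>x. w x $ i) x)\<bar> \<le> (\<Sum>H\<in>hyps T. \<bar>LINT y|lebesgue. ?A H y\<bar>)"
    unfolding integral_pwc_divergence(1)[OF q w B] by (rule sum_abs)
  also have "\<dots> \<le> (\<Sum>H\<in>hyps T. \<Sum>p\<in>{p \<in> ?P. affine hull (snd p) = H}. LINT y|lebesgue. ?b (snd p) y)"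
    by (intro sum_mono AH)
  \<comment> \<open>Every pair of an element and a facet belongs to exactly one hyperplane.\<close>
  also have "\<dots> = (\<Sum>p\<in>?P. LINT y|lebesgue. ?b (snd p) y)"
    by (rule sum.group[OF finP finite_hyps]) (auto intro: facet_hyps)
  also have "\<dots> \<le> (\<Sum>p\<in>?P. s / 2 * jint (snd p) q q + 1 / (4 * s * \<rho>) * (\<Sum>i\<in>UNIV. face_integral (snd p) (\<lambda>x. (w x $ i)\<^sup>2)))"
    using b_int by (intro sum_mono) auto
  also have "\<dots> = (\<Sum>K\<in>T. \<Sum>F\<in>facets K. s / 2 * jint F q q + 1 / (4 * s * \<rho>) * (\<Sum>i\<in>UNIV. face_integral F (\<lambda>x. (w x $ i)\<^sup>2)))"
    by (subst sum.Sigma[OF finT]) (use simplex_interior(7)[OF simT] in \<open>auto simp: case_prod_beta\<close>)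
  finally have main: "\<bar>LINT x|lebesgue. q x * (\<Sum>i\<in>UNIV. partial_deriv i (\<lambda>x. w x $ i) x)\<bar> \<le>
     (\<Sum>K\<in>T. \<Sum>F\<in>facets K. s / 2 * jint F q q + 1 / (4 * s * \<rho>) * (\<Sum>i\<in>UNIV. face_integral F (\<lambda>x. (w x $ i)\<^sup>2)))" .
  have split: "(\<Sum>K\<in>T. \<Sum>F\<in>facets K. s / 2 * jint F q q + 1 / (4 * s * \<rho>) * (\<Sum>i\<in>UNIV. face_integral F (\<lambda>x. (w x $ i)\<^sup>2))) =
     s / 2 * (\<Sum>K\<in>T. \<Sum>F\<in>facets K. jint F q q) + 1 / (4 * s * \<rho>) * (\<Sum>K\<in>T. \<Sum>F\<in>facets K. \<Sum>i\<in>UNIV. face_integral F (\<lambda>x. (w x $ i)\<^sup>2))"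
    by (simp only: sum.distrib sum_distrib_left)
  have swap: "(\<Sum>K\<in>T. \<Sum>F\<in>facets K. \<Sum>i\<in>UNIV. face_integral F (\<lambda>x. (w x $ i)\<^sup>2)) = (\<Sum>K\<in>T. \<Sum>i\<in>UNIV. \<Sum>F\<in>facets K. face_integral F (\<lambda>x. (w x $ i)\<^sup>2))"
    by (intro sum.cong refl sum.swap)
  let ?X = "\<lambda>K i. LINT x|lebesgue. indicator K x *
        (real (CARD('n) + 1) * (w x $ i)\<^sup>2 + h\<^sup>2 * (\<Sum>k\<in>UNIV. (partial_deriv k (\<lambda>x. w x $ i) x)\<^sup>2))"
  have "(\<Sum>K\<in>T. \<Sum>i\<in>UNIV. \<Sum>F\<in>facets K. face_integral F (\<lambda>x. (w x $ i)\<^sup>2)) \<le> (\<Sum>K\<in>T. \<Sum>i\<in>UNIV. ?X K i / \<rho>)"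
    by (intro sum_mono trace_facets[OF _ w])
  then have "1 / (4 * s * \<rho>) * (\<Sum>K\<in>T. \<Sum>i\<in>UNIV. \<Sum>F\<in>facets K. face_integral F (\<lambda>x. (w x $ i)\<^sup>2)) \<le> 1 / (4 * s * \<rho>) * (\<Sum>K\<in>T. \<Sum>i\<in>UNIV. ?X K i / \<rho>)"
    using s \<rho> by (intro mult_left_mono) auto
  from order_trans[OF main[unfolded split swap] add_left_mono[OF this]]
  have fin: "\<bar>LINT x|lebesgue. q x * (\<Sum>i\<in>UNIV. partial_deriv i (\<lambda>x. w x $ i) x)\<bar> \<le>
     s / 2 * (\<Sum>K\<in>T. \<Sum>F\<in>facets K. jint F q q) + 1 / (4 * s * \<rho>) * (\<Sum>K\<in>T. \<Sum>i\<in>UNIV. ?X K i / \<rho>)" .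
  have ring: "1 / (4 * s * \<rho>) * (\<Sum>K\<in>T. \<Sum>i\<in>UNIV. X K i / \<rho>) = 1 / (4 * s * \<rho>\<^sup>2) * (\<Sum>K\<in>T. \<Sum>i\<in>UNIV. X K i)" for X :: "(real^'n) set \<Rightarrow> 'n \<Rightarrow> real"
    by (simp add: sum_divide_distrib[symmetric] power2_eq_square)
  show ?thesis using fin unfolding ring J_form_jint mult_1 .
qed

end

section \<open>Test fields and piecewise linear fields\<close>

lemma integral_lebesgue_on_indicator:
  fixes f :: "'a::euclidean_space \<Rightarrow> real"
  assumes "S \<in> sets lebesgue"
  shows "(LINT x|lebesgue_on S. f x) = (LINT x|lebesgue. indicator S x * f x)"
    and "integrable (lebesgue_on S) f \<longleftrightarrow> integrable lebesgue (\<lambda>x. indicator S x * f x)"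
  using assms by (simp_all add: integral_restrict_space integrable_restrict_space)

lemma power2_norm_vec: "(norm (x :: 'b::real_normed_vector^'m))\<^sup>2 = (\<Sum>i\<in>UNIV. (norm (x $ i))\<^sup>2)"
  by (simp add: norm_vec_def L2_set_def sum_nonneg)

lemma L2_on_vecI:
  fixes f :: "real^'n \<Rightarrow> 'b::euclidean_space^'m"
  assumes f: "\<And>i. L2_on S (\<lambda>x. f x $ i)"
  shows "L2_on S f"
  unfolding L2_on_def
proof
  show "f \<in> borel_measurable (lebesgue_on S)"
  proof (rule borel_measurable_euclidean_space[THEN iffD2], rule ballI)
    fix b :: "'b^'m" assume "b \<in> Basis"
    then obtain i u where b: "b = axis i u" by (auto simp: Basis_vec_def)
    have "(\<lambda>x. f x $ i) \<in> borel_measurable (lebesgue_on S)" using f[of i] by (simp add: L2_on_def)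
    then show "(\<lambda>x. f x \<bullet> b) \<in> borel_measurable (lebesgue_on S)" by (simp add: b inner_axis)
  qed
  have "integrable (lebesgue_on S) (\<lambda>x. \<Sum>i\<in>UNIV. (norm (f x $ i))\<^sup>2)"
    using f by (intro Bochner_Integration.integrable_sum) (simp add: L2_on_def)
  then show "integrable (lebesgue_on S) (\<lambda>x. (norm (f x))\<^sup>2)" by (simp add: power2_norm_vec)
qed

lemma test_function_mult:
  assumes \<phi>: "test_function \<Omega> \<phi>" and \<psi>: "test_function \<Omega> \<psi>"
  shows "test_function \<Omega> (\<lambda>x. \<phi> x * \<psi> x)"
proof -
  have "{x. \<phi> x * \<psi> x \<noteq> 0} \<subseteq> {x. \<phi> x \<noteq> 0}" by auto
  then have "bounded {x. \<phi> x * \<psi> x \<noteq> 0}" "closure {x. \<phi> x * \<psi> x \<noteq> 0} \<subseteq> closure {x. \<phi> x \<noteq> 0}"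
    using \<phi> bounded_subset closure_mono unfolding test_function_def compact_closure by blast+
  moreover have "Ck m (\<lambda>x. \<phi> x * \<psi> x)" for m
    using \<phi> \<psi> unfolding test_function_def by (intro Ck_mult) blast+
  ultimately show ?thesis using \<phi> unfolding test_function_def compact_closure by blast
qed

lemma partial_deriv_line:
  fixes \<phi> :: "real^'n \<Rightarrow> real"
  assumes "\<phi> differentiable (at x)"
  shows "((\<lambda>t. \<phi> (x + t *\<^sub>R axis j 1)) has_real_derivative partial_deriv j \<phi> x) (at 0)"
proof -
  let ?D = "frechet_derivative \<phi> (at x)"
  have D: "(\<phi> has_derivative ?D) (at (x + 0 *\<^sub>R axis j 1))" using has_derivative_frechet[OF assms] by simp
  have "((\<lambda>t::real. x + t *\<^sub>R axis j 1) has_derivative (\<lambda>t. t *\<^sub>R axis j 1)) (at 0)"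
    by (auto intro!: derivative_eq_intros)
  from has_derivative_compose[OF this D]
  have "((\<lambda>t. \<phi> (x + t *\<^sub>R axis j 1)) has_derivative (\<lambda>t. ?D (t *\<^sub>R axis j 1))) (at 0)" .
  moreover have "?D (t *\<^sub>R axis j 1) = t * ?D (axis j 1)" for t
    using has_derivative_linear[OF has_derivative_frechet[OF assms]] by (simp add: linear_cmul)
  ultimately show ?thesis
    unfolding has_field_derivative_def partial_deriv_def by (simp add: mult.commute[of _ "?D (axis j 1)"])
qed

text \<open>The formula for directional derivatives with an empty family of hyperplanes.\<close>

lemma integral_partial_deriv_test_function:
  fixes \<phi> :: "real^'n \<Rightarrow> real"
  assumes \<phi>: "test_function \<Omega> \<phi>"
  shows "(LINT x|lebesgue. partial_deriv j \<phi> x) = 0"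
proof -
  obtain B R where B: "\<And>x. \<bar>\<phi> x\<bar> \<le> B" "\<And>x i. \<bar>partial_deriv i \<phi> x\<bar> \<le> B"
    "\<And>x. norm x > R \<Longrightarrow> \<phi> x = 0" "\<And>x i. norm x > R \<Longrightarrow> partial_deriv i \<phi> x = 0"
    using test_function_bounds[OF \<phi>] by metis
  have "(LINT x|lebesgue. partial_deriv j \<phi> x) =
    - (\<Sum>H\<in>({} :: (real^'n) set set). (0 \<bullet> (axis j 1 :: real^'n)) * (LINT y|lebesgue. indicator {y. \<bar>(0 :: real^'n) \<bullet> y - 0\<bar> \<le> 1/2} y * 0))"
    by (rule integral_directional_derivative[where HH="{}" and \<nu>="\<lambda>_. 0" and c="\<lambda>_. 0" and j="\<lambda>_ _. 0"
          and g=\<phi> and M=B and R=R and e="axis j 1"])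
      (use B in \<open>auto intro: borel_measurable_continuous_onI test_function_continuous[OF \<phi>]
         test_function_partial_continuous[OF \<phi>] partial_deriv_line test_function_differentiable[OF \<phi>]\<close>)
  then show ?thesis by simp
qed

lemma partial_deriv_mult:
  fixes \<phi> \<psi> :: "real^'n \<Rightarrow> real"
  assumes "\<phi> differentiable (at x)" "\<psi> differentiable (at x)"
  shows "partial_deriv j (\<lambda>x. \<phi> x * \<psi> x) x = \<phi> x * partial_deriv j \<psi> x + partial_deriv j \<phi> x * \<psi> x"
  unfolding partial_derivI[OF has_derivative_mult[OF assms[THEN has_derivative_frechet]]]
  by (simp add: partial_deriv_def)

definition field_jacobian :: "(real^'n \<Rightarrow> real^'n) \<Rightarrow> real^'n \<Rightarrow> real^'n^'n" where
  "field_jacobian \<phi> x = (\<chi> i j. partial_deriv j (\<lambda>x. \<phi> x $ i) x)"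

text \<open>The derivative of a product of two test functions integrates to 0, and the product rule
  turns this into the defining identity of the weak derivative.\<close>

lemma test_field_weak_jacobian:
  fixes \<phi> :: "real^'n \<Rightarrow> real^'n"
  assumes \<Omega>: "open \<Omega>" and \<phi>: "\<And>i. test_function \<Omega> (\<lambda>x. \<phi> x $ i)"
  shows "L2_on \<Omega> \<phi>" "has_weak_jacobian \<Omega> \<phi> (field_jacobian \<phi>)"
proof -
  note S = \<Omega>_sets[OF \<Omega>]
  show "L2_on \<Omega> \<phi>" by (rule L2_on_vecI) (rule test_function_L2(1)[OF \<Omega> \<phi>])
  show "has_weak_jacobian \<Omega> \<phi> (field_jacobian \<phi>)"
    unfolding has_weak_jacobian_def
  proof (intro conjI allI impI)
    show "L2_on \<Omega> (field_jacobian \<phi>)"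
      by (intro L2_on_vecI) (use test_function_L2(2)[OF \<Omega> \<phi>] in \<open>simp add: field_jacobian_def\<close>)
    fix \<psi> :: "real^'n \<Rightarrow> real" and i j assume \<psi>: "test_function \<Omega> \<psi>"
    let ?f = "\<lambda>x. \<phi> x $ i"
    have i1: "integrable (lebesgue_on \<Omega>) (\<lambda>x. ?f x * partial_deriv j \<psi> x)"
      using L2_inner_integrable[OF S test_function_L2(1)[OF \<Omega> \<phi>] test_function_L2(2)[OF \<Omega> \<psi>], of i j] by simp
    have i2: "integrable (lebesgue_on \<Omega>) (\<lambda>x. partial_deriv j ?f x * \<psi> x)"
      using L2_inner_integrable[OF S test_function_L2(2)[OF \<Omega> \<phi>] test_function_L2(1)[OF \<Omega> \<psi>], of j i] by simp
    have d: "partial_deriv j (\<lambda>x. ?f x * \<psi> x) x = ?f x * partial_deriv j \<psi> x + partial_deriv j ?f x * \<psi> x" for x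
      by (rule partial_deriv_mult) (use \<phi> \<psi> test_function_differentiable in blast)+
    have "0 = (LINT x|lebesgue. partial_deriv j (\<lambda>x. ?f x * \<psi> x) x)"
      by (rule integral_partial_deriv_test_function[OF test_function_mult[OF \<phi> \<psi>], symmetric])
    also have "\<dots> = (LINT x|lebesgue_on \<Omega>. partial_deriv j (\<lambda>x. ?f x * \<psi> x) x)"
      by (rule integral_lebesgue_on_zero_outside(1)[OF S, symmetric])
        (use test_function_partial_nz[OF test_function_mult[OF \<phi> \<psi>]] in blast)
    also have "\<dots> = (LINT x|lebesgue_on \<Omega>. ?f x * partial_deriv j \<psi> x) + (LINT x|lebesgue_on \<Omega>. partial_deriv j ?f x * \<psi> x)"
      unfolding d by (rule Bochner_Integration.integral_add[OF i1 i2])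
    finally show "(LINT x|lebesgue_on \<Omega>. \<phi> x $ i * partial_deriv j \<psi> x) =
        - (LINT x|lebesgue_on \<Omega>. field_jacobian \<phi> x $ i $ j * \<psi> x)"
      by (simp add: field_jacobian_def)
  qed
qed

section \<open>Piecewise linear fields as Sobolev functions\<close>

locale mesh_domain = quasi_uniform_mesh T h \<rho> \<Omega> for T :: "(real^'n) set set" and h \<rho> \<Omega> +
  assumes Union_T: "\<Union>T = closure \<Omega>" and interior_T: "interior (\<Union>T) = \<Omega>" and bounded\<Omega>: "bounded \<Omega>"
begin

lemmas S\<Omega> = \<Omega>_sets[OF open\<Omega>]

lemma AE_off_hyps: "AE x in lebesgue. x \<notin> \<Union>(hyps T)"
proof -
  have "AE x in lebesgue. \<forall>H\<in>hyps T. x \<notin> H"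
  proof (rule AE_finite_allI[OF finite_hyps])
    fix H assume H: "H \<in> hyps T"
    have "face_normal H \<noteq> 0" using hyps_unit[OF H] by auto
    then have "AE x in lebesgue. face_normal H \<bullet> x \<noteq> hcst H" by (intro AE_lebesgue_not_hyperplane) auto
    then show "AE x in lebesgue. x \<notin> H" using hyps_mem[OF H] by auto
  qed
  then show ?thesis by auto
qed

lemma interior_subset_\<Omega>: "K \<in> T \<Longrightarrow> interior K \<subseteq> \<Omega>"
  using interior_mono[of K "\<Union>T"] interior_T by blast

lemma off_hyps_cases:
  assumes "x \<notin> \<Union>(hyps T)"
  obtains K where "K \<in> T" "x \<in> interior K" | "\<And>K. K \<in> T \<Longrightarrow> x \<notin> K"
proof (cases "\<exists>K\<in>T. x \<in> K")
  case True
  then obtain K where K: "K \<in> T" "x \<in> K" by blast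
  have "x \<notin> frontier K" using frontier_subset_hyps[OF K(1)] assms by blast
  then have "x \<in> interior K" using K closure_subset[of K] by (auto simp: frontier_def)
  then show ?thesis using K that(1) by blast
next
  case False
  then show ?thesis using that(2) by blast
qed

definition Amat :: "(real^'n \<Rightarrow> real^'n) \<Rightarrow> (real^'n) set \<Rightarrow> real^'n^'n" where
  "Amat v K = (SOME A. \<exists>b. \<forall>x\<in>K. v x = A *v x + b)"

definition P1grad :: "(real^'n \<Rightarrow> real^'n) \<Rightarrow> real^'n \<Rightarrow> real^'n^'n" where
  "P1grad v x = (\<Sum>K\<in>T. indicator (interior K) x *\<^sub>R Amat v K)"

lemma P1_affine:
  assumes "v \<in> P1_space \<Omega> T" "K \<in> T"
  shows "\<exists>b. \<forall>x\<in>K. v x = Amat v K *v x + b"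
  using assms unfolding Amat_def P1_space_def by (intro someI_ex[of "\<lambda>A. \<exists>b. \<forall>x\<in>K. v x = A *v x + b"]) blast

lemma P1grad_in:
  assumes "K \<in> T" "x \<in> interior K"
  shows "P1grad v x = Amat v K"
proof -
  have "indicator (interior K') x *\<^sub>R Amat v K' = 0" if "K' \<in> T - {K}" for K'
    using that assms disjT[of K K'] by (auto simp: indicator_def)
  then have "(\<Sum>K'\<in>T - {K}. indicator (interior K') x *\<^sub>R Amat v K') = 0" by (rule sum.neutral[OF ballI])
  then show ?thesis
    unfolding P1grad_def using sum.remove[OF finT assms(1), of "\<lambda>K. indicator (interior K) x *\<^sub>R Amat v K"] assms(2) by simp
qed

lemma P1grad_out: "(\<And>K. K \<in> T \<Longrightarrow> x \<notin> interior K) \<Longrightarrow> P1grad v x = 0"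
  unfolding P1grad_def by (intro sum.neutral) auto

lemma P1grad_bound: "norm (P1grad v x) \<le> (\<Sum>K\<in>T. norm (Amat v K))"
  unfolding P1grad_def by (intro sum_norm_le) (auto simp: indicator_def)

lemma P1grad_borel: "P1grad v \<in> borel_measurable borel"
  unfolding P1grad_def by (intro borel_measurable_sum borel_measurable_scaleR borel_measurable_indicator) auto

lemma P1_continuous: "v \<in> P1_space \<Omega> T \<Longrightarrow> continuous_on (closure \<Omega>) v"
  and P1_outside: "v \<in> P1_space \<Omega> T \<Longrightarrow> x \<notin> closure \<Omega> \<Longrightarrow> v x = 0"
  by (auto simp: P1_space_def)

lemma P1_isCont: "v \<in> P1_space \<Omega> T \<Longrightarrow> x \<in> \<Omega> \<Longrightarrow> isCont v x"
  using continuous_on_subset[OF P1_continuous closure_subset] continuous_on_eq_continuous_at[OF open\<Omega>] by blast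

lemma P1_bounds:
  assumes v: "v \<in> P1_space \<Omega> T"
  obtains M where "M \<ge> 0" "\<And>x. norm (v x) \<le> M"
proof -
  have "compact (v ` closure \<Omega>)" using P1_continuous[OF v] bounded\<Omega> by (intro compact_continuous_image) auto
  then have "bounded (v ` closure \<Omega>)" by (rule compact_imp_bounded)
  then obtain M where M: "\<And>x. x \<in> closure \<Omega> \<Longrightarrow> norm (v x) \<le> M" by (auto simp: bounded_iff)
  have "norm (v x) \<le> max 0 M" for x
    using M[of x] P1_outside[OF v, of x] by (cases "x \<in> closure \<Omega>") auto
  then show ?thesis using that[of "max 0 M"] by auto
qed

lemma P1_borel:
  assumes v: "v \<in> P1_space \<Omega> T" shows "v \<in> borel_measurable borel"
proof -
  have "(\<lambda>x. if x \<in> closure \<Omega> then v x else 0) \<in> borel_measurable borel"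
    by (intro borel_measurable_continuous_on_if) (use P1_continuous[OF v] in auto)
  moreover have "(\<lambda>x. if x \<in> closure \<Omega> then v x else 0) = v" using P1_outside[OF v] by auto
  ultimately show ?thesis by (rule back_subst)
qed

lemma P1_L2: "v \<in> P1_space \<Omega> T \<Longrightarrow> L2_on \<Omega> v"
  by (metis P1_borel P1_bounds L2_onI_bounded[OF S\<Omega> bounded\<Omega>] borel_measurable_lebesgue_onI)

lemma P1grad_L2: "L2_on \<Omega> (P1grad v)"
  by (rule L2_onI_bounded[OF S\<Omega> bounded\<Omega> borel_measurable_lebesgue_onI[OF P1grad_borel] P1grad_bound])

lemma \<Omega>_radius: obtains R where "\<And>x. norm x > R \<Longrightarrow> x \<notin> closure \<Omega>"
proof -
  have "bounded (closure \<Omega>)" using bounded\<Omega> by auto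
  then obtain R where "\<forall>x\<in>closure \<Omega>. norm x \<le> R" by (auto simp: bounded_iff)
  then show ?thesis using that[of R] by force
qed

lemma P1_has_derivative:
  assumes v: "v \<in> P1_space \<Omega> T" and x: "x \<notin> \<Union>(hyps T)"
  shows "(v has_derivative (\<lambda>y. P1grad v x *v y)) (at x)"
  using x
proof (cases rule: off_hyps_cases)
  case (1 K)
  obtain b where b: "\<forall>x\<in>K. v x = Amat v K *v x + b" using P1_affine[OF v 1(1)] by blast
  have "((\<lambda>x. Amat v K *v x + b) has_derivative (\<lambda>y. Amat v K *v y + 0)) (at x)"
    by (intro has_derivative_add has_derivative_const bounded_linear_imp_has_derivative matrix_vector_mul_bounded_linear)
  then have "(v has_derivative (\<lambda>y. Amat v K *v y + 0)) (at x)"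
    by (rule has_derivative_transform_within_open[OF _ open_interior 1(2)]) (use b interior_subset in force)
  then show ?thesis by (simp add: P1grad_in[OF 1])
next
  case 2
  have x': "x \<in> - closure \<Omega>" using 2 Union_T by blast
  have "P1grad v x = 0" using 2 interior_subset by (intro P1grad_out) blast
  moreover have "(v has_derivative (\<lambda>y. 0)) (at x)"
    by (rule has_derivative_transform_within_open[OF has_derivative_const[of 0] _ x']) (use P1_outside[OF v] in auto)
  ultimately show ?thesis by simp
qed

text \<open>The product of a component of v with a test function is continuous on the whole space,
  so no hyperplane contributes a jump and the derivative of the product integrates to 0.\<close>

theorem P1_weak_jacobian:
  assumes v: "v \<in> P1_space \<Omega> T"
  shows "has_weak_jacobian \<Omega> v (P1grad v)"
  unfolding has_weak_jacobian_def
proof (intro conjI allI impI)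
  show "L2_on \<Omega> (P1grad v)" by (rule P1grad_L2)
  fix \<phi> :: "real^'n \<Rightarrow> real" and i j assume \<phi>: "test_function \<Omega> \<phi>"
  obtain M where M: "M \<ge> 0" "\<And>x. norm (v x) \<le> M" using P1_bounds[OF v] by metis
  obtain B R where B: "\<And>x. \<bar>\<phi> x\<bar> \<le> B" "\<And>x i. \<bar>partial_deriv i \<phi> x\<bar> \<le> B"
    "\<And>x. norm x > R \<Longrightarrow> \<phi> x = 0" "\<And>x i. norm x > R \<Longrightarrow> partial_deriv i \<phi> x = 0"
    using test_function_bounds[OF \<phi>] by metis
  define A where "A = (\<Sum>K\<in>T. norm (Amat v K))"
  have A0: "A \<ge> 0" unfolding A_def by (intro sum_nonneg) auto
  have B0: "B \<ge> 0" using B(1)[of 0] by linarith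
  have vi: "\<bar>v x $ i\<bar> \<le> M" for x using component_le_norm_cart[of "v x" i] M(2)[of x] by linarith
  have gij: "\<bar>P1grad v x $ i $ j\<bar> \<le> A" for x
    using component_le_norm_cart[of "P1grad v x $ i" j] Finite_Cartesian_Product.norm_nth_le[of "P1grad v x" i] P1grad_bound[of v x]
    unfolding A_def by linarith
  define g where "g x = v x $ i * \<phi> x" for x
  define dg where "dg x = v x $ i * partial_deriv j \<phi> x + P1grad v x $ i $ j * \<phi> x" for x
  have mv: "(\<lambda>x. v x $ i) \<in> borel_measurable borel"
    by (rule measurable_compose[OF P1_borel[OF v] borel_measurable_continuous_onI]) (intro continuous_intros)
  have mg: "(\<lambda>x. P1grad v x $ i $ j) \<in> borel_measurable borel"
    by (rule measurable_compose[OF P1grad_borel borel_measurable_continuous_onI]) (intro continuous_intros)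
  have m\<phi>: "\<phi> \<in> borel_measurable borel" "partial_deriv j \<phi> \<in> borel_measurable borel"
    by (intro borel_measurable_continuous_onI test_function_continuous[OF \<phi>] test_function_partial_continuous[OF \<phi>])+
  \<comment> \<open>v may jump at the boundary of \<Omega>, where its extension by zero begins, but
    every point outside \<Omega> has a neighbourhood free of the support of \<phi>.\<close>
  have cont: "isCont g x" for x
  proof (cases "x \<in> \<Omega>")
    case True
    have "isCont \<phi> x" using test_function_continuous[OF \<phi>] by (simp add: continuous_on_eq_continuous_at)
    moreover have "isCont (\<lambda>x. v x $ i) x" using P1_isCont[OF v True] by (intro isCont_o2[OF _ isCont_vec_nth] continuous_intros)
    ultimately show ?thesis unfolding g_def by (intro continuous_mult)
  next
    case False
    then have x: "x \<in> - closure {x. \<phi> x \<noteq> 0}" using \<phi> by (auto simp: test_function_def)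
    have z: "g y = 0" if "y \<in> - closure {x. \<phi> x \<noteq> 0}" for y
      using that closure_subset[of "{x. \<phi> x \<noteq> 0}"] by (auto simp: g_def)
    have "\<forall>\<^sub>F y in nhds x. y \<in> - closure {x. \<phi> x \<noteq> 0}" using x by (intro eventually_nhds_in_open) auto
    then have "\<forall>\<^sub>F y in nhds x. g y = 0" by eventually_elim (rule z)
    then show ?thesis using isCont_cong[of g "\<lambda>_. 0" x] by simp
  qed
  have "(LINT x|lebesgue. dg x) =
    - (\<Sum>H\<in>hyps T. (face_normal H \<bullet> axis j 1) * (LINT y|lebesgue. indicator (slab H) y * 0))"
  proof (rule integral_directional_derivative[where HH="hyps T" and \<nu>=face_normal and c=hcst and j="\<lambda>_ _. 0"
          and g=g and M="M * B + A * B" and R=R and e="axis j 1"])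
    show "finite (hyps T)" by (rule finite_hyps)
    show "norm (face_normal H) = 1" "H = {x. face_normal H \<bullet> x = hcst H}" if "H \<in> hyps T" for H
      using hyps_unit[OF that] hyps_eq[OF that] by blast+
    show "g \<in> borel_measurable borel" unfolding g_def using mv m\<phi> by simp
    show "dg \<in> borel_measurable borel" unfolding dg_def using mv m\<phi> mg by simp
    have 1: "\<bar>v x $ i * y\<bar> \<le> M * B" if "\<bar>y\<bar> \<le> B" for x y
      using mult_mono[OF vi that] M by (simp add: abs_mult)
    have 2: "\<bar>P1grad v x $ i $ j * y\<bar> \<le> A * B" if "\<bar>y\<bar> \<le> B" for x y
      using mult_mono[OF gij that] A0 by (simp add: abs_mult)
    have AB: "A * B \<ge> 0" using A0 B0 by simp
    show "\<bar>g x\<bar> \<le> M * B + A * B" for x unfolding g_def using 1[OF B(1), of x x] AB by linarith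
    show "\<bar>dg x\<bar> \<le> M * B + A * B" for x unfolding dg_def using 1[OF B(2), of x j x] 2[OF B(1), of x x] by linarith
    show "norm x > R \<Longrightarrow> g x = 0" "norm x > R \<Longrightarrow> dg x = 0" for x using B(3,4) by (auto simp: g_def dg_def)
    show "((\<lambda>t. g (x + t *\<^sub>R axis j 1)) has_real_derivative dg x) (at 0)" if x: "x \<notin> \<Union>(hyps T)" for x
    proof -
      have d: "((\<lambda>x. v x $ i) has_derivative (\<lambda>y. (P1grad v x *v y) $ i)) (at x)"
        by (rule bounded_linear.has_derivative[OF bounded_linear_vec_nth P1_has_derivative[OF v x]])
      note d2 = test_function_differentiable[OF \<phi>, of x]
      have dd: "(\<lambda>x. v x $ i) differentiable (at x)" using d differentiableI by blast
      have "(\<lambda>x. v x $ i * \<phi> x) differentiable (at x)" using dd d2 by (rule differentiable_mult)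
      from partial_deriv_line[OF this, of j] show ?thesis
        unfolding g_def dg_def partial_deriv_mult[OF dd d2]
        using partial_derivI[OF d, of j] by (simp add: matrix_vector_mul_component inner_axis)
    qed
    show "((\<lambda>t. g (x + t *\<^sub>R face_normal H) - g (x - t *\<^sub>R face_normal H)) \<longlongrightarrow> 0) (at_right 0)" for H x
    proof -
      have "((\<lambda>t. g (x + t *\<^sub>R face_normal H) - g (x - t *\<^sub>R face_normal H)) \<longlongrightarrow> g x - g x) (at_right 0)"
        by (intro tendsto_diff isCont_tendsto_compose[OF cont]) (auto intro!: tendsto_eq_intros)
      then show ?thesis by simp
    qed
  qed
  then have 0: "(LINT x|lebesgue. dg x) = 0" by simp
  have i1: "integrable (lebesgue_on \<Omega>) (\<lambda>x. v x $ i * partial_deriv j \<phi> x)"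
    using L2_inner_integrable[OF S\<Omega> L2_component[OF open\<Omega> P1_L2[OF v], of i] test_function_L2(2)[OF open\<Omega> \<phi>], of j] by simp
  have i2: "integrable (lebesgue_on \<Omega>) (\<lambda>x. P1grad v x $ i $ j * \<phi> x)"
    using L2_inner_integrable[OF S\<Omega> L2_component2[OF open\<Omega> P1grad_L2[of v], of i j] test_function_L2(1)[OF open\<Omega> \<phi>]] by simp
  have "0 = (LINT x|lebesgue_on \<Omega>. dg x)"
    unfolding 0[symmetric]
  proof (rule integral_lebesgue_on_zero_outside(1)[OF S\<Omega>, symmetric])
    fix x assume "x \<notin> \<Omega>"
    then have "\<phi> x = 0" "partial_deriv j \<phi> x = 0"
      using test_function_nz[OF \<phi>] test_function_partial_nz[OF \<phi>] by blast+
    then show "dg x = 0" by (simp add: dg_def)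
  qed
  also have "\<dots> = (LINT x|lebesgue_on \<Omega>. v x $ i * partial_deriv j \<phi> x) + (LINT x|lebesgue_on \<Omega>. P1grad v x $ i $ j * \<phi> x)"
    unfolding dg_def by (rule Bochner_Integration.integral_add[OF i1 i2])
  finally show "(LINT x|lebesgue_on \<Omega>. v x $ i * partial_deriv j \<phi> x) = - (LINT x|lebesgue_on \<Omega>. P1grad v x $ i $ j * \<phi> x)"
    by simp
qed

lemma P1_H1: "v \<in> P1_space \<Omega> T \<Longrightarrow> v \<in> H1 \<Omega>"
  using weak_jacobian_AE_eq[OF open\<Omega> P1_L2 P1_weak_jacobian] by blast

lemma P1_divergence: "v \<in> P1_space \<Omega> T \<Longrightarrow> AE x in lebesgue_on \<Omega>. divergence \<Omega> v x = trace (P1grad v x)"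
  using weak_jacobian_AE_eq[OF open\<Omega> P1_L2 P1_weak_jacobian, of v] unfolding divergence_def by auto

text \<open>The elementwise divergence of a piecewise linear field is thus a discrete pressure up to
  the condition on its mean value.\<close>

lemma pwc_trace: "pwc (\<lambda>x. trace (P1grad v x))"
  unfolding pwc_def using P1grad_in[of _ _ v] P1grad_out[of _ v] by (force simp: trace_def)

lemma P1_lincomb:
  assumes u: "u \<in> P1_space \<Omega> T" and v: "v \<in> P1_space \<Omega> T"
  shows "(\<lambda>x. u x + a *\<^sub>R v x) \<in> P1_space \<Omega> T"
proof -
  have "\<exists>A b. \<forall>x\<in>K. u x + a *\<^sub>R v x = A *v x + b" if K: "K \<in> T" for K
  proof -
    obtain b b' where "\<forall>x\<in>K. u x = Amat u K *v x + b" "\<forall>x\<in>K. v x = Amat v K *v x + b'"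
      using P1_affine[OF u K] P1_affine[OF v K] by blast
    then have "\<forall>x\<in>K. u x + a *\<^sub>R v x = (Amat u K + a *\<^sub>R Amat v K) *v x + (b + a *\<^sub>R b')"
      by (simp add: matrix_vector_mult_add_rdistrib scaleR_matrix_vector_assoc[symmetric] algebra_simps)
    then show ?thesis by blast
  qed
  then show ?thesis
    using P1_continuous[OF u] P1_continuous[OF v] P1_outside[OF u] P1_outside[OF v]
    unfolding P1_space_def by (auto intro!: continuous_intros)
qed

text \<open>Makes the inequality of Korn available for discrete displacements. By continuity up to
  the boundary the averages near a point of \<Gamma>D tend to 0, with the empty set as exceptional
  set.\<close>

lemma P1_W_E:
  assumes v: "v \<in> WE_h \<Omega> \<Gamma>D T" and \<Gamma>D: "\<Gamma>D \<subseteq> frontier \<Omega>"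
  shows "v \<in> W_E \<Omega> \<Gamma>D"
proof -
  have vP: "v \<in> P1_space \<Omega> T" and v0: "\<And>x. x \<in> \<Gamma>D \<Longrightarrow> v x = 0" using v by (auto simp: WE_h_def)
  have "surface_null ({} :: (real^'n) set)"
    unfolding surface_null_def
  proof (intro allI impI exI conjI)
    \<comment> \<open>The exponent is at least 1 because the dimension is at least 2; the zeroth
      power of 0 would be 1 and the series would diverge.\<close>
    have d: "diameter ({} :: (real^'n) set) ^ (CARD('n) - 1) = 0" using dim2 by (simp add: power_0_left)
    show "(\<Sum>m::nat. diameter ((\<lambda>_. {} :: (real^'n) set) m) ^ (CARD('n) - 1)) < e" if "e > 0" for e
      unfolding d using that by simp
    show "summable (\<lambda>m::nat. diameter ((\<lambda>_. {} :: (real^'n) set) m) ^ (CARD('n) - 1))" unfolding d by simp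
  qed auto
  moreover have "has_trace_at \<Omega> v x 0" if x: "x \<in> \<Gamma>D" for x
    unfolding has_trace_at_def
  proof (rule tendstoI)
    fix e :: real assume e: "e > 0"
    have "x \<in> closure \<Omega>" using x \<Gamma>D by (auto simp: frontier_def)
    then obtain d where d: "d > 0" "\<And>y. y \<in> closure \<Omega> \<Longrightarrow> dist y x < d \<Longrightarrow> dist (v y) (v x) < e/2"
      using P1_continuous[OF vP] e unfolding continuous_on_iff by (meson half_gt_zero)
    have "dist ((LINT y|lebesgue_on (\<Omega> \<inter> ball x r). norm (v y - 0)) / measure lebesgue (\<Omega> \<inter> ball x r)) 0 < e"
      if r: "0 < r" "r < d" for r
    proof -
      let ?S = "\<Omega> \<inter> ball x r"
      have S: "?S \<in> sets lebesgue" "?S \<in> lmeasurable" using open\<Omega> by (auto intro!: lmeasurable_open bounded_Int)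
      have le: "norm (v y - 0) \<le> e/2" if "y \<in> ?S" for y
        using d(2)[of y] that r v0[OF x] closure_subset[of \<Omega>] by (auto simp: dist_commute)
      have i: "integrable (lebesgue_on ?S) (\<lambda>y. e/2)"
      proof -
        have "integrable lebesgue (\<lambda>y. indicator ?S y *\<^sub>R (e/2))"
          using S by (intro integrable_scaleR_left integrable_real_indicator) (auto simp: fmeasurable_def)
        then show ?thesis by (simp add: integrable_restrict_space S)
      qed
      have "(LINT y|lebesgue_on ?S. norm (v y - 0)) \<le> (LINT y|lebesgue_on ?S. e/2)"
        by (rule integral_mono_AE'[OF i]) (use le e in \<open>auto intro!: AE_I2\<close>)
      also have "\<dots> = e/2 * measure lebesgue ?S" using S by (simp add: measure_restrict_space)
      \<comment> \<open>If the intersection has measure 0, the quotient is 0 by the convention for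
        division by 0.\<close>
      finally have "(LINT y|lebesgue_on ?S. norm (v y - 0)) / measure lebesgue ?S \<le> e/2"
        using e by (cases "measure lebesgue ?S = 0") (auto simp: field_simps zero_less_measure_iff less_le)
      moreover have "0 \<le> (LINT y|lebesgue_on ?S. norm (v y - 0)) / measure lebesgue ?S" by simp
      ultimately show ?thesis using e by (simp only: dist_real_def)
    qed
    then show "\<forall>\<^sub>F r in at_right 0. dist ((LINT y|lebesgue_on (\<Omega> \<inter> ball x r). norm (v y - 0)) / measure lebesgue (\<Omega> \<inter> ball x r)) 0 < e"
      unfolding eventually_at_right_field using d(1) by blast
  qed
  ultimately show ?thesis using P1_H1[OF vP] unfolding W_E_def by blast
qed

end

section \<open>Limits of test fields\<close>

lemma L2_on_subset:
  fixes f :: "real^'n \<Rightarrow> 'b::euclidean_space"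
  assumes f: "L2_on S f" and S: "S \<in> sets lebesgue" "S' \<in> sets lebesgue" "S' \<subseteq> S"
  shows "L2_on S' f"
proof -
  have "f \<in> borel_measurable (lebesgue_on S')"
    using f measurable_restrict_mono[OF _ S(3)] unfolding L2_on_def by blast
  moreover have "set_integrable lebesgue S' (\<lambda>x. (norm (f x))\<^sup>2)"
    by (rule set_integrable_subset[OF _ S(2,3)])
      (use f S in \<open>simp add: L2_on_def set_integrable_def integrable_restrict_space\<close>)
  ultimately show ?thesis using S by (simp add: L2_on_def set_integrable_def integrable_restrict_space)
qed

lemma L2_norm_sq_eq:
  fixes f :: "real^'n \<Rightarrow> 'b::euclidean_space"
  assumes "S \<in> sets lebesgue"
  shows "(L2_norm S f)\<^sup>2 = (LINT x|lebesgue_on S. (norm (f x))\<^sup>2)"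
  using L2_norm_nonneg(3)[OF assms, of f] by (simp add: L2_inner_def power2_norm_eq_inner)

text \<open>The mixed term is controlled by the nonnegativity of the squared norm of f - a
  g.\<close>

lemma L2_norm_lincomb_sq_le:
  fixes f g :: "real^'n \<Rightarrow> 'b::euclidean_space"
  assumes S: "S \<in> sets lebesgue" and fg: "L2_on S f" "L2_on S g"
  shows "(L2_norm S (\<lambda>x. f x + a *\<^sub>R g x))\<^sup>2 \<le> 2 * (L2_norm S f)\<^sup>2 + 2 * a\<^sup>2 * (L2_norm S g)\<^sup>2"
proof -
  have "0 \<le> L2_inner S f f + 2 * (- a) * L2_inner S f g + (- a)\<^sup>2 * L2_inner S g g"
    using L2_inner_self_lincomb[OF S fg, of "- a"] L2_norm_nonneg(1)[OF S, of "\<lambda>x. f x + (- a) *\<^sub>R g x"] by linarith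
  then show ?thesis
    unfolding L2_norm_nonneg(3)[OF S] L2_inner_self_lincomb[OF S fg, of a] by (simp add: algebra_simps)
qed

lemma abs_trace_le: "\<bar>trace (A :: real^'n^'n)\<bar> \<le> real CARD('n) * norm A"
proof -
  have "\<bar>A $ i $ i\<bar> \<le> norm A" for i
    using component_le_norm_cart[of "A $ i" i] Finite_Cartesian_Product.norm_nth_le[of A i] by linarith
  then have "\<bar>\<Sum>i\<in>UNIV. A $ i $ i\<bar> \<le> (\<Sum>i\<in>(UNIV :: 'n set). norm A)" by (intro sum_abs[THEN order_trans] sum_mono)
  then show ?thesis by (simp add: trace_def)
qed

lemma trace_lincomb: "trace ((A :: real^'n^'n) + a *\<^sub>R B) = trace A + a * trace B"
  by (simp add: trace_def sum.distrib sum_distrib_left)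

lemma L2_trace:
  fixes G :: "real^'n \<Rightarrow> real^'n^'n"
  assumes S: "S \<in> sets lebesgue" and G: "L2_on S G"
  shows "L2_on S (\<lambda>x. trace (G x))" "L2_norm S (\<lambda>x. trace (G x)) \<le> real CARD('n) * L2_norm S G"
proof -
  let ?n = "real CARD('n)"
  have c: "continuous_on UNIV (trace :: real^'n^'n \<Rightarrow> real)" unfolding trace_def[abs_def] by (intro continuous_intros)
  have m: "(\<lambda>x. trace (G x)) \<in> borel_measurable (lebesgue_on S)"
    using G measurable_compose[OF _ borel_measurable_continuous_onI[OF c]] unfolding L2_on_def by blast
  have le: "(norm (trace (G x)))\<^sup>2 \<le> ?n\<^sup>2 * (norm (G x))\<^sup>2" for x
    using power_mono[OF abs_trace_le[of "G x"] abs_ge_zero, of 2] by (simp add: power_mult_distrib)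
  have i: "integrable (lebesgue_on S) (\<lambda>x. ?n\<^sup>2 * (norm (G x))\<^sup>2)" using G by (simp add: L2_on_def)
  show t: "L2_on S (\<lambda>x. trace (G x))"
    unfolding L2_on_def
    by (intro conjI m Bochner_Integration.integrable_bound[OF i] AE_I2) (use m le in auto)
  have "(LINT x|lebesgue_on S. (norm (trace (G x)))\<^sup>2) \<le> (LINT x|lebesgue_on S. ?n\<^sup>2 * (norm (G x))\<^sup>2)"
    by (rule integral_mono[OF _ i le]) (use t in \<open>simp add: L2_on_def\<close>)
  then have "(L2_norm S (\<lambda>x. trace (G x)))\<^sup>2 \<le> (?n * L2_norm S G)\<^sup>2"
    by (simp add: L2_norm_sq_eq[OF S] power_mult_distrib)
  then show "L2_norm S (\<lambda>x. trace (G x)) \<le> ?n * L2_norm S G"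
    by (rule power2_le_imp_le) (simp add: L2_norm_nonneg(2)[OF S])
qed

lemma test_function_lincomb:
  assumes \<phi>: "test_function \<Omega> \<phi>" and \<psi>: "test_function \<Omega> \<psi>"
  shows "test_function \<Omega> (\<lambda>x. \<phi> x + a * \<psi> x)"
proof -
  have "{x. \<phi> x + a * \<psi> x \<noteq> 0} \<subseteq> {x. \<phi> x \<noteq> 0} \<union> {x. \<psi> x \<noteq> 0}" by auto
  moreover have "bounded ({x. \<phi> x \<noteq> 0} \<union> {x. \<psi> x \<noteq> 0})" using \<phi> \<psi> by (simp add: test_function_def)
  ultimately have "bounded {x. \<phi> x + a * \<psi> x \<noteq> 0}"
    "closure {x. \<phi> x + a * \<psi> x \<noteq> 0} \<subseteq> closure ({x. \<phi> x \<noteq> 0} \<union> {x. \<psi> x \<noteq> 0})"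
    using bounded_subset closure_mono by blast+
  moreover have "Ck m (\<lambda>x. \<phi> x + a * \<psi> x)" for m
    using \<phi> \<psi> unfolding test_function_def by (intro Ck_add Ck_mult Ck_const) blast+
  ultimately show ?thesis using \<phi> \<psi> unfolding test_function_def compact_closure closure_Un by blast
qed

lemma H10_H1: "v \<in> H10 \<Omega> \<Longrightarrow> v \<in> H1 \<Omega>" by (simp add: H10_def)

lemma H10_diff:
  assumes \<Omega>: "open \<Omega>" and v: "v \<in> H10 \<Omega>" and w: "w \<in> H10 \<Omega>"
  shows "(\<lambda>x. v x + (-1) *\<^sub>R w x) \<in> H10 \<Omega>"
proof -
  obtain \<phi> where \<phi>: "\<And>m i. test_function \<Omega> (\<lambda>x. \<phi> m x $ i)" "(\<lambda>m. H1_norm \<Omega> (\<lambda>x. v x - \<phi> m x)) \<longlonglongrightarrow> 0"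
    using v unfolding H10_def by blast
  obtain \<psi> where \<psi>: "\<And>m i. test_function \<Omega> (\<lambda>x. \<psi> m x $ i)" "(\<lambda>m. H1_norm \<Omega> (\<lambda>x. w x - \<psi> m x)) \<longlonglongrightarrow> 0"
    using w unfolding H10_def by blast
  define \<omega> where "\<omega> m x = \<phi> m x + (-1) *\<^sub>R \<psi> m x" for m x
  have "test_function \<Omega> (\<lambda>x. \<omega> m x $ i)" for m i
    using test_function_lincomb[OF \<phi>(1)[of m i] \<psi>(1)[of m i], of "-1"] by (simp add: \<omega>_def)
  moreover have "(\<lambda>m. H1_norm \<Omega> (\<lambda>x. (v x + (-1) *\<^sub>R w x) - \<omega> m x)) \<longlonglongrightarrow> 0"
  proof (rule tendsto_sandwich)
    show "\<forall>\<^sub>F m in sequentially. 0 \<le> H1_norm \<Omega> (\<lambda>x. (v x + (-1) *\<^sub>R w x) - \<omega> m x)"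
      by (simp add: H1_norm_sq(2)[OF \<Omega>])
    have t: "\<phi> m \<in> H1 \<Omega>" "\<psi> m \<in> H1 \<Omega>" for m
      using test_field_weak_jacobian[OF \<Omega> \<phi>(1)[of m]] test_field_weak_jacobian[OF \<Omega> \<psi>(1)[of m]] unfolding H1_def by blast+
    have d: "(\<lambda>x. v x - \<phi> m x) \<in> H1 \<Omega>" "(\<lambda>x. w x - \<psi> m x) \<in> H1 \<Omega>" for m
      using H1_lincomb[OF \<Omega> H10_H1[OF v] t(1)[of m], of "-1"] H1_lincomb[OF \<Omega> H10_H1[OF w] t(2)[of m], of "-1"] by simp_all
    have "H1_norm \<Omega> (\<lambda>x. (v x + (-1) *\<^sub>R w x) - \<omega> m x) \<le> H1_norm \<Omega> (\<lambda>x. v x - \<phi> m x) + H1_norm \<Omega> (\<lambda>x. w x - \<psi> m x)" for m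
    proof -
      have e: "(\<lambda>x. (v x + (-1) *\<^sub>R w x) - \<omega> m x) = (\<lambda>x. (v x - \<phi> m x) + (-1) *\<^sub>R (w x - \<psi> m x))"
        by (simp add: \<omega>_def algebra_simps)
      show ?thesis unfolding e using H1_norm_lincomb_le[OF \<Omega> d(1)[of m] d(2)[of m], of "-1"] by simp
    qed
    then show "\<forall>\<^sub>F m in sequentially. H1_norm \<Omega> (\<lambda>x. (v x + (-1) *\<^sub>R w x) - \<omega> m x) \<le>
        H1_norm \<Omega> (\<lambda>x. v x - \<phi> m x) + H1_norm \<Omega> (\<lambda>x. w x - \<psi> m x)" by simp
    show "(\<lambda>m. H1_norm \<Omega> (\<lambda>x. v x - \<phi> m x) + H1_norm \<Omega> (\<lambda>x. w x - \<psi> m x)) \<longlonglongrightarrow> 0"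
      using tendsto_add[OF \<phi>(2) \<psi>(2)] by simp
  qed simp
  ultimately show ?thesis using H1_lincomb[OF \<Omega> H10_H1[OF v] H10_H1[OF w]] unfolding H10_def by blast
qed

text \<open>The error of the derivative is measured with an arbitrary weak Jacobian G, so that the
  explicit \<open>P1grad\<close> can be inserted.\<close>

lemma H10_approx:
  assumes \<Omega>: "open \<Omega>" and v: "v \<in> H10 \<Omega>" and G: "has_weak_jacobian \<Omega> v G" and e: "e > 0"
  obtains \<phi> where "\<And>i. test_function \<Omega> (\<lambda>x. \<phi> x $ i)" "L2_norm \<Omega> (\<lambda>x. v x + (-1) *\<^sub>R \<phi> x) \<le> e"
    "L2_norm \<Omega> (\<lambda>x. G x + (-1) *\<^sub>R field_jacobian \<phi> x) \<le> e"
proof -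
  obtain \<phi> where \<phi>: "\<And>m i. test_function \<Omega> (\<lambda>x. \<phi> m x $ i)" "(\<lambda>m. H1_norm \<Omega> (\<lambda>x. v x - \<phi> m x)) \<longlonglongrightarrow> 0"
    using v unfolding H10_def by blast
  have "\<forall>\<^sub>F m in sequentially. H1_norm \<Omega> (\<lambda>x. v x - \<phi> m x) < e"
    by (rule order_tendstoD(2)[OF \<phi>(2) e])
  then obtain m where m: "H1_norm \<Omega> (\<lambda>x. v x - \<phi> m x) < e" by (auto simp: eventually_sequentially)
  note t = test_field_weak_jacobian[OF \<Omega> \<phi>(1)[of m]]
  note vL = H1_L2(1)[OF \<Omega> H10_H1[OF v]]
  have "(H1_norm \<Omega> (\<lambda>x. v x + (-1) *\<^sub>R \<phi> m x))\<^sup>2 = (L2_norm \<Omega> (\<lambda>x. v x + (-1) *\<^sub>R \<phi> m x))\<^sup>2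
      + (L2_norm \<Omega> (\<lambda>x. G x + (-1) *\<^sub>R field_jacobian (\<phi> m) x))\<^sup>2"
    by (rule H1_norm_eq[OF \<Omega> L2_on_lincomb[OF \<Omega>_sets[OF \<Omega>] vL t(1)] has_weak_jacobian_lincomb[OF \<Omega> vL G t]])
  moreover have "(H1_norm \<Omega> (\<lambda>x. v x + (-1) *\<^sub>R \<phi> m x))\<^sup>2 \<le> e\<^sup>2"
    using m H1_norm_sq(2)[OF \<Omega>] by (intro power_mono) auto
  ultimately have "(L2_norm \<Omega> (\<lambda>x. v x + (-1) *\<^sub>R \<phi> m x))\<^sup>2 \<le> e\<^sup>2"
    "(L2_norm \<Omega> (\<lambda>x. G x + (-1) *\<^sub>R field_jacobian (\<phi> m) x))\<^sup>2 \<le> e\<^sup>2"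
    by (smt (verit) zero_le_power2)+
  then have "L2_norm \<Omega> (\<lambda>x. v x + (-1) *\<^sub>R \<phi> m x) \<le> e"
    "L2_norm \<Omega> (\<lambda>x. G x + (-1) *\<^sub>R field_jacobian (\<phi> m) x) \<le> e"
    using e power2_le_imp_le less_imp_le by blast+
  with \<phi>(1) show ?thesis by (rule that)
qed

section \<open>Summation over elements and the pairing of pressures with divergences\<close>

context mesh_domain
begin

lemma indicator_cells:
  fixes c :: real
  assumes "x \<notin> \<Union>(hyps T)"
  shows "(\<Sum>K\<in>T. indicator K x * c) = indicator \<Omega> x * c"
  using assms
proof (cases rule: off_hyps_cases)
  case (1 K)
  have "indicator K' x * c = 0" if K': "K' \<in> T - {K}" for K'
  proof -
    have "x \<notin> K'"
    proof
      assume "x \<in> K'"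
      moreover have "x \<notin> frontier K'" using frontier_subset_hyps[of K'] K' assms by blast
      ultimately have "x \<in> interior K'" using closure_subset[of K'] by (auto simp: frontier_def)
      then show False using disjT[of K K'] 1 K' by blast
    qed
    then show ?thesis by simp
  qed
  then have "(\<Sum>K'\<in>T - {K}. indicator K' x * c) = 0" by (rule sum.neutral[OF ballI])
  then have "(\<Sum>K\<in>T. indicator K x * c) = indicator K x * c"
    using sum.remove[OF finT 1(1), of "\<lambda>K. indicator K x * c"] by simp
  moreover have "x \<in> K" "x \<in> \<Omega>" using 1 interior_subset_\<Omega>[OF 1(1)] interior_subset[of K] by blast+
  ultimately show ?thesis by simp
next
  case 2
  then have "x \<notin> \<Omega>" using Union_T closure_subset[of \<Omega>] by blast
  then show ?thesis using 2 by simp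
qed

lemma cell_sets: "K \<in> T \<Longrightarrow> K \<in> sets lebesgue"
  using simplex_interior(5)[OF simT] by auto

text \<open>Off the hyperplanes every point of \<Omega> lies in exactly one element, so the
  indicators of the elements add up almost everywhere.\<close>

lemma integral_cells:
  fixes f :: "real^'n \<Rightarrow> real"
  assumes f: "integrable (lebesgue_on \<Omega>) f"
  shows "K \<in> T \<Longrightarrow> integrable (lebesgue_on K) f"
    and "(\<Sum>K\<in>T. LINT x|lebesgue_on K. f x) = (LINT x|lebesgue_on \<Omega>. f x)"
proof -
  have F: "integrable lebesgue (\<lambda>x. indicator \<Omega> x * f x)"
    using f by (simp add: integral_lebesgue_on_indicator(2)[OF S\<Omega>])
  have iK: "integrable lebesgue (\<lambda>x. indicator K x * f x)" if K: "K \<in> T" for K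
  proof -
    have i: "integrable lebesgue (\<lambda>x. (indicator \<Omega> x * f x) * indicator K x)"
      by (rule integrable_real_mult_indicator[OF cell_sets[OF K] F])
    have ae: "AE x in lebesgue. (indicator \<Omega> x * f x) * indicator K x = indicator K x * f x"
      using AE_off_hyps
    proof eventually_elim
      case (elim x)
      have "x \<in> \<Omega>" if "x \<in> K"
        using elim frontier_subset_hyps[OF K] that closure_subset[of K] interior_subset_\<Omega>[OF K]
        by (auto simp: frontier_def)
      then show ?case by (auto simp: indicator_def)
    qed
    show ?thesis
      by (rule integrable_cong_AE_imp[OF i borel_measurable_lebesgue_AE_cong[OF borel_measurable_integrable[OF i] ae]])
        (use ae in auto)
  qed
  then show "K \<in> T \<Longrightarrow> integrable (lebesgue_on K) f" using cell_sets by (simp add: integral_lebesgue_on_indicator(2))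
  have "(\<Sum>K\<in>T. LINT x|lebesgue_on K. f x) = (\<Sum>K\<in>T. LINT x|lebesgue. indicator K x * f x)"
    using cell_sets by (intro sum.cong refl integral_lebesgue_on_indicator(1))
  also have "\<dots> = (LINT x|lebesgue. (\<Sum>K\<in>T. indicator K x * f x))"
    using iK by (simp add: Bochner_Integration.integral_sum)
  also have "\<dots> = (LINT x|lebesgue. indicator \<Omega> x * f x)"
  proof (rule integral_cong_AE)
    show "(\<lambda>x. \<Sum>K\<in>T. indicator K x * f x) \<in> borel_measurable lebesgue"
      using iK by (intro borel_measurable_sum borel_measurable_integrable)
    show "AE x in lebesgue. (\<Sum>K\<in>T. indicator K x * f x) = indicator \<Omega> x * f x"
      using AE_off_hyps by eventually_elim (rule indicator_cells)
  qed (use F in auto)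
  finally show "(\<Sum>K\<in>T. LINT x|lebesgue_on K. f x) = (LINT x|lebesgue_on \<Omega>. f x)"
    by (simp add: integral_lebesgue_on_indicator(1)[OF S\<Omega>])
qed

lemma pwc_L2: "pwc q \<Longrightarrow> L2_on \<Omega> q"
  by (metis pwc_bounds pwc_borel real_norm_def L2_onI_bounded[OF S\<Omega> bounded\<Omega>] borel_measurable_lebesgue_onI)

lemma L2_norm_pwc:
  assumes q: "pwc q"
  shows "(L2_norm \<Omega> q)\<^sup>2 = (\<Sum>K\<in>T. (val q K)\<^sup>2 * measure lebesgue K)"
proof -
  have i: "integrable (lebesgue_on \<Omega>) (\<lambda>x. (norm (q x))\<^sup>2)" using pwc_L2[OF q] by (simp add: L2_on_def)
  have "(LINT x|lebesgue_on K. (norm (q x))\<^sup>2) = (val q K)\<^sup>2 * measure lebesgue K" if K: "K \<in> T" for K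
  proof -
    have fm: "K \<in> lmeasurable" using simplex_interior(4)[OF simT[OF K]] by (rule lmeasurable_compact)
    have "(LINT x|lebesgue_on K. (norm (q x))\<^sup>2) = (LINT x|lebesgue. indicator K x * (norm (q x))\<^sup>2)"
      by (rule integral_lebesgue_on_indicator(1)[OF cell_sets[OF K]])
    also have "\<dots> = (LINT x|lebesgue. indicator K x * (val q K)\<^sup>2)"
    proof (rule integral_cong_AE)
      show "(\<lambda>x. indicator K x * (norm (q x))\<^sup>2) \<in> borel_measurable lebesgue"
        using integral_cells(1)[OF i K] cell_sets[OF K] by (simp add: integral_lebesgue_on_indicator(2))
      show "AE x in lebesgue. indicator K x * (norm (q x))\<^sup>2 = indicator K x * (val q K)\<^sup>2"
        using AE_off_hyps
      proof eventually_elim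
        case (elim x)
        have "x \<in> interior K" if "x \<in> K"
          using elim frontier_subset_hyps[OF K] that closure_subset[of K] by (auto simp: frontier_def)
        then show ?case using pwc_val[OF q K] by (auto simp: indicator_def)
      qed
    qed (use cell_sets[OF K] in auto)
    also have "\<dots> = (val q K)\<^sup>2 * measure lebesgue K" using fm by simp
    finally show ?thesis .
  qed
  then show ?thesis unfolding L2_norm_sq_eq[OF S\<Omega>] integral_cells(2)[OF i, symmetric] by simp
qed

text \<open>Test functions on a patch are test functions on \<Omega>, so the norm on a patch is an
  integral of the same density. A point lies only in patches of elements within distance 2h, and
  \<open>overlap_card\<close> bounds the number of these elements.\<close>

lemma sum_patch_le:
  assumes v: "v \<in> H1 \<Omega>"
  shows "(\<Sum>K\<in>T. (H1_norm (patch T K) v)\<^sup>2) \<le> (2 * h / \<rho>) ^ CARD('n) * (H1_norm \<Omega> v)\<^sup>2"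
proof -
  let ?N = "(2 * h / \<rho>) ^ CARD('n)"
  define G where "G = weak_jacobian \<Omega> v"
  have G: "has_weak_jacobian \<Omega> v G" "L2_on \<Omega> G" "L2_on \<Omega> v"
    unfolding G_def using has_weak_jacobian_weak_jacobian[OF open\<Omega> v] H1_L2[OF open\<Omega> v] by blast+
  define F where "F x = (norm (v x))\<^sup>2 + (norm (G x))\<^sup>2" for x
  have iF: "integrable (lebesgue_on \<Omega>) F" using G unfolding F_def L2_on_def by auto
  have o: "open (patch T K)" for K by (simp add: patch_def)
  have sub: "patch T K \<subseteq> \<Omega>" for K
    unfolding patch_def using interior_mono[of "\<Union>{K' \<in> T. K' \<inter> K \<noteq> {}}" "\<Union>T"] interior_T by blast
  have N: "(H1_norm \<Omega> v)\<^sup>2 = (LINT x|lebesgue_on \<Omega>. F x)"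
    using H1_norm_eq[OF open\<Omega> G(3,1)] G unfolding L2_norm_sq_eq[OF S\<Omega>] F_def L2_on_def by simp
  have iK: "integrable (lebesgue_on (patch T K)) F"
    and NK: "(H1_norm (patch T K) v)\<^sup>2 = (LINT x|lebesgue_on (patch T K). F x)" for K
  proof -
    note SK = \<Omega>_sets[OF o[of K]]
    have L: "L2_on (patch T K) v" "L2_on (patch T K) G"
      using L2_on_subset[OF _ S\<Omega> SK sub] G by blast+
    have "has_weak_jacobian (patch T K) v G"
      unfolding has_weak_jacobian_def
    proof (intro conjI allI impI L)
      fix \<phi> :: "real^'n \<Rightarrow> real" and i j assume \<phi>: "test_function (patch T K) \<phi>"
      have \<phi>': "test_function \<Omega> \<phi>" by (rule test_function_mono[OF \<phi> sub])
      have "\<phi> x = 0 \<and> partial_deriv j \<phi> x = 0" if "x \<notin> patch T K" for x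
        using that test_function_nz[OF \<phi>] test_function_partial_nz[OF \<phi>] by blast
      moreover have "\<phi> x = 0 \<and> partial_deriv j \<phi> x = 0" if "x \<notin> \<Omega>" for x
        using that test_function_nz[OF \<phi>'] test_function_partial_nz[OF \<phi>'] by blast
      moreover have "(LINT x|lebesgue_on \<Omega>. v x $ i * partial_deriv j \<phi> x) = - (LINT x|lebesgue_on \<Omega>. G x $ i $ j * \<phi> x)"
        using G(1) \<phi>' unfolding has_weak_jacobian_def by blast
      ultimately show "(LINT x|lebesgue_on (patch T K). v x $ i * partial_deriv j \<phi> x) =
          - (LINT x|lebesgue_on (patch T K). G x $ i $ j * \<phi> x)"
        by (simp add: integral_lebesgue_on_zero_outside(1)[OF SK] integral_lebesgue_on_zero_outside(1)[OF S\<Omega>])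
    qed
    from H1_norm_eq[OF o L(1) this] L
    show "(H1_norm (patch T K) v)\<^sup>2 = (LINT x|lebesgue_on (patch T K). F x)"
      "integrable (lebesgue_on (patch T K)) F"
      unfolding L2_norm_sq_eq[OF SK] F_def L2_on_def by simp_all
  qed
  note SK = \<Omega>_sets[OF o]
  have "(\<Sum>K\<in>T. (H1_norm (patch T K) v)\<^sup>2) = (\<Sum>K\<in>T. (LINT x|lebesgue. indicator (patch T K) x * F x))"
    unfolding NK by (simp add: integral_lebesgue_on_indicator(1)[OF SK])
  also have "\<dots> = (LINT x|lebesgue. (\<Sum>K\<in>T. indicator (patch T K) x * F x))"
    using iK by (simp add: Bochner_Integration.integral_sum integral_lebesgue_on_indicator(2)[OF SK])
  also have "\<dots> \<le> (LINT x|lebesgue. ?N * (indicator \<Omega> x * F x))"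
  proof (rule integral_mono)
    show "integrable lebesgue (\<lambda>x. \<Sum>K\<in>T. indicator (patch T K) x * F x)"
      using iK by (simp add: integral_lebesgue_on_indicator(2)[OF SK])
    show "integrable lebesgue (\<lambda>x. ?N * (indicator \<Omega> x * F x))"
      using iF by (simp add: integral_lebesgue_on_indicator(2)[OF S\<Omega>])
    fix x
    define X where "X = {K \<in> T. x \<in> patch T K}"
    have F0: "F x \<ge> 0" by (simp add: F_def)
    have "real (card X) \<le> ?N"
    proof (rule overlap_card)
      show "X \<subseteq> T" by (auto simp: X_def)
      fix K assume "K \<in> X"
      then have K: "K \<in> T" "x \<in> patch T K" by (auto simp: X_def)
      then obtain K' where K': "K' \<in> T" "K' \<inter> K \<noteq> {}" "x \<in> K'" unfolding patch_def using interior_subset by blast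
      then show "K \<subseteq> cball x (2 * h)" using near_ball[OF K(1) K'(1) _ K'(3)] by blast
    qed
    have "(\<Sum>K\<in>T. indicator (patch T K) x * F x) = (\<Sum>K\<in>X. F x)"
      unfolding X_def by (rule sum.mono_neutral_cong_right[OF finT]) auto
    also have "\<dots> \<le> ?N * (indicator \<Omega> x * F x)"
    proof (cases "x \<in> \<Omega>")
      case True then show ?thesis using \<open>real (card X) \<le> ?N\<close> F0 by (simp add: mult_right_mono)
    next
      case False then have "X = {}" using sub unfolding X_def by blast
      then show ?thesis using False by simp
    qed
    finally show "(\<Sum>K\<in>T. indicator (patch T K) x * F x) \<le> ?N * (indicator \<Omega> x * F x)" .
  qed
  also have "\<dots> = ?N * (H1_norm \<Omega> v)\<^sup>2" by (simp add: N integral_lebesgue_on_indicator(1)[OF S\<Omega>])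
  finally show ?thesis .
qed

text \<open>Test fields satisfy \<open>integral_divergence_le\<close>, and \<psi> is approximated by
  them with an error e that tends to 0. The constant doubles because their squared norms are
  compared with those of \<psi> through (a + b)^2 \<le> 2 a^2 + 2 b^2.\<close>

lemma divergence_pairing_le:
  assumes q: "pwc q" and \<psi>: "\<psi> \<in> H10 \<Omega>" and s: "s > 0"
  shows "\<bar>L2_inner \<Omega> q (divergence \<Omega> \<psi>)\<bar> \<le> s / 2 * J_form \<Omega> T 1 q q + 1 / (2 * s * \<rho>\<^sup>2) *
    (real (CARD('n) + 1) * (L2_norm \<Omega> \<psi>)\<^sup>2 + h\<^sup>2 * (L2_norm \<Omega> (weak_jacobian \<Omega> \<psi>))\<^sup>2)"
    (is "?L \<le> ?J + ?c * (?n * ?a + ?h * ?b)")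
proof -
  define G where "G = weak_jacobian \<Omega> \<psi>"
  note H = H10_H1[OF \<psi>]
  have G: "has_weak_jacobian \<Omega> \<psi> G" "L2_on \<Omega> G" "L2_on \<Omega> \<psi>"
    unfolding G_def using has_weak_jacobian_weak_jacobian[OF open\<Omega> H] H1_L2[OF open\<Omega> H] by blast+
  note qL = pwc_L2[OF q]
  let ?R = "\<lambda>e. ?J + ?c * (?n * ?a + ?h * ?b) + (?c * (?n + ?h) * e\<^sup>2 + L2_norm \<Omega> q * (real CARD('n) * e))"
  have le: "?L \<le> ?R e" if e: "e > 0" for e
  proof -
    obtain \<phi> where \<phi>: "\<And>i. test_function \<Omega> (\<lambda>x. \<phi> x $ i)" "L2_norm \<Omega> (\<lambda>x. \<psi> x + (-1) *\<^sub>R \<phi> x) \<le> e"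
      "L2_norm \<Omega> (\<lambda>x. G x + (-1) *\<^sub>R field_jacobian \<phi> x) \<le> e"
      using H10_approx[OF open\<Omega> \<psi> G(1) e] by blast
    define D where "D = field_jacobian \<phi>"
    note t = test_field_weak_jacobian[OF open\<Omega> \<phi>(1)]
    have DL: "L2_on \<Omega> D" using t(2) by (simp add: has_weak_jacobian_def D_def)
    have GD: "L2_on \<Omega> (\<lambda>x. G x + (-1) *\<^sub>R D x)" by (rule L2_on_lincomb[OF S\<Omega> G(2) DL])
    have pd: "L2_on \<Omega> (\<lambda>x. \<psi> x + (-1) *\<^sub>R \<phi> x)" by (rule L2_on_lincomb[OF S\<Omega> G(3) t(1)])
    have sq: "(L2_norm \<Omega> (\<lambda>x. \<psi> x + (-1) *\<^sub>R \<phi> x))\<^sup>2 \<le> e\<^sup>2" "(L2_norm \<Omega> (\<lambda>x. G x + (-1) *\<^sub>R D x))\<^sup>2 \<le> e\<^sup>2"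
      using \<phi>(2,3) unfolding D_def by (auto intro!: power_mono L2_norm_nonneg(2)[OF S\<Omega>])
    \<comment> \<open>\<phi> is written as \<psi> minus the approximation error.\<close>
    have "(L2_norm \<Omega> (\<lambda>x. \<psi> x + (-1) *\<^sub>R (\<psi> x + (-1) *\<^sub>R \<phi> x)))\<^sup>2 \<le> 2 * ?a + 2 * (-1)\<^sup>2 * (L2_norm \<Omega> (\<lambda>x. \<psi> x + (-1) *\<^sub>R \<phi> x))\<^sup>2"
      by (rule L2_norm_lincomb_sq_le[OF S\<Omega> G(3) pd])
    then have n1: "(L2_norm \<Omega> \<phi>)\<^sup>2 \<le> 2 * ?a + 2 * e\<^sup>2" using sq(1) by simp
    have "(L2_norm \<Omega> (\<lambda>x. G x + (-1) *\<^sub>R (G x + (-1) *\<^sub>R D x)))\<^sup>2 \<le> 2 * (L2_norm \<Omega> G)\<^sup>2 + 2 * (-1)\<^sup>2 * (L2_norm \<Omega> (\<lambda>x. G x + (-1) *\<^sub>R D x))\<^sup>2"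
      by (rule L2_norm_lincomb_sq_le[OF S\<Omega> G(2) GD])
    then have n2: "(L2_norm \<Omega> D)\<^sup>2 \<le> 2 * ?b + 2 * e\<^sup>2" using sq(2) by (simp add: G_def)
    have split: "L2_inner \<Omega> q (\<lambda>x. trace (G x)) = L2_inner \<Omega> q (\<lambda>x. trace (D x)) + 1 * L2_inner \<Omega> q (\<lambda>x. trace (G x + (-1) *\<^sub>R D x))"
    proof -
      have e: "(\<lambda>x. trace (G x)) = (\<lambda>x. trace (D x) + 1 *\<^sub>R trace (G x + (-1) *\<^sub>R D x))"
        unfolding trace_lincomb by simp
      show ?thesis
        by (subst e) (rule L2_inner_lincomb(1)[OF S\<Omega> L2_trace(1)[OF S\<Omega> DL] L2_trace(1)[OF S\<Omega> GD] qL])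
    qed
    have "\<bar>L2_inner \<Omega> q (\<lambda>x. trace (G x + (-1) *\<^sub>R D x))\<bar> \<le> L2_norm \<Omega> q * L2_norm \<Omega> (\<lambda>x. trace (G x + (-1) *\<^sub>R D x))"
      by (rule L2_Cauchy_Schwarz[OF S\<Omega> qL L2_trace(1)[OF S\<Omega> GD]])
    also have "\<dots> \<le> L2_norm \<Omega> q * (real CARD('n) * e)"
    proof (rule mult_left_mono[OF _ L2_norm_nonneg(2)[OF S\<Omega>]])
      have "L2_norm \<Omega> (\<lambda>x. trace (G x + (-1) *\<^sub>R D x)) \<le> real CARD('n) * L2_norm \<Omega> (\<lambda>x. G x + (-1) *\<^sub>R D x)"
        by (rule L2_trace(2)[OF S\<Omega> GD])
      also have "\<dots> \<le> real CARD('n) * e" using \<phi>(3) unfolding D_def by (intro mult_left_mono) auto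
      finally show "L2_norm \<Omega> (\<lambda>x. trace (G x + (-1) *\<^sub>R D x)) \<le> real CARD('n) * e" .
    qed
    finally have err: "\<bar>L2_inner \<Omega> q (\<lambda>x. trace (G x + (-1) *\<^sub>R D x))\<bar> \<le> L2_norm \<Omega> q * (real CARD('n) * e)" .
    define F where "F i x = ?n * (\<phi> x $ i)\<^sup>2 + ?h * (\<Sum>k\<in>UNIV. (partial_deriv k (\<lambda>x. \<phi> x $ i) x)\<^sup>2)" for i x
    have SF: "(\<Sum>i\<in>UNIV. F i x) = ?n * (norm (\<phi> x))\<^sup>2 + ?h * (norm (D x))\<^sup>2" for x
      unfolding F_def D_def field_jacobian_def power2_norm_vec by (simp add: sum.distrib sum_distrib_left)
    have iF: "integrable (lebesgue_on \<Omega>) (F i)" for i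
      using test_function_L2[OF open\<Omega> \<phi>(1)] unfolding F_def L2_on_def by (auto simp: power2_abs)
    have "\<bar>LINT x|lebesgue. q x * (\<Sum>i\<in>UNIV. partial_deriv i (\<lambda>x. \<phi> x $ i) x)\<bar> \<le>
       ?J + 1 / (4 * s * \<rho>\<^sup>2) * (\<Sum>K\<in>T. \<Sum>i\<in>UNIV. LINT x|lebesgue. indicator K x * F i x)"
    proof -
      have "\<exists>B. \<forall>x. \<bar>\<phi> x $ i\<bar> \<le> B \<and> (\<forall>j. \<bar>partial_deriv j (\<lambda>x. \<phi> x $ i) x\<bar> \<le> B)" for i
        using test_function_bounds[OF \<phi>(1)[of i]] by metis
      then obtain B where B: "\<And>i x. \<bar>\<phi> x $ i\<bar> \<le> B i" "\<And>i x j. \<bar>partial_deriv j (\<lambda>x. \<phi> x $ i) x\<bar> \<le> B i" by metis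
      have B0: "0 \<le> B i" for i using B(1)[of 0 i] by linarith
      have B1: "norm (\<phi> x) \<le> sum B UNIV" for x
        using norm_le_l1_cart[of "\<phi> x"] sum_mono[of UNIV "\<lambda>i. \<bar>\<phi> x $ i\<bar>" B] B(1) by (meson order_trans)
      have B2: "\<bar>partial_deriv i (\<lambda>x. \<phi> x $ i) x\<bar> \<le> sum B UNIV" for x i
        using B(2)[of i i x] member_le_sum[of i UNIV B] B0 by (smt (verit) UNIV_I finite)
      have "\<phi> x = 0" if "x \<notin> \<Omega>" for x
        using that test_function_nz[OF \<phi>(1)] by (simp add: vec_eq_iff) blast
      then show ?thesis unfolding F_def
        by (rule integral_divergence_le[OF q test_function_C1[OF \<phi>(1)] B1 B2 _ s])
    qed
    also have "(LINT x|lebesgue. q x * (\<Sum>i\<in>UNIV. partial_deriv i (\<lambda>x. \<phi> x $ i) x)) = L2_inner \<Omega> q (\<lambda>x. trace (D x))"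
    proof -
      have "(LINT x|lebesgue. q x * trace (D x)) = (LINT x|lebesgue_on \<Omega>. q x * trace (D x))"
      proof (rule integral_lebesgue_on_zero_outside(1)[OF S\<Omega>, symmetric])
        fix x assume x: "x \<notin> \<Omega>"
        have "x \<notin> interior K" if "K \<in> T" for K using x interior_subset_\<Omega>[OF that] by blast
        then show "q x * trace (D x) = 0" using pwc_zero[OF q, of x] by simp
      qed
      then show ?thesis by (simp add: L2_inner_def trace_def D_def field_jacobian_def)
    qed
    also have "(\<Sum>K\<in>T. \<Sum>i\<in>UNIV. LINT x|lebesgue. indicator K x * F i x) = ?n * (L2_norm \<Omega> \<phi>)\<^sup>2 + ?h * (L2_norm \<Omega> D)\<^sup>2"
    proof -
      have "(\<Sum>K\<in>T. \<Sum>i\<in>UNIV. LINT x|lebesgue. indicator K x * F i x) = (\<Sum>i\<in>UNIV. \<Sum>K\<in>T. LINT x|lebesgue_on K. F i x)"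
        by (subst sum.swap) (intro sum.cong refl integral_lebesgue_on_indicator(1)[symmetric] cell_sets)
      also have "\<dots> = (LINT x|lebesgue_on \<Omega>. (\<Sum>i\<in>UNIV. F i x))"
        by (simp add: integral_cells(2)[OF iF] Bochner_Integration.integral_sum iF)
      also have "\<dots> = ?n * (L2_norm \<Omega> \<phi>)\<^sup>2 + ?h * (L2_norm \<Omega> D)\<^sup>2"
        unfolding SF L2_norm_sq_eq[OF S\<Omega>] using t(1) DL by (simp add: L2_on_def)
      finally show ?thesis .
    qed
    finally have main: "\<bar>L2_inner \<Omega> q (\<lambda>x. trace (D x))\<bar> \<le> ?J + 1 / (4 * s * \<rho>\<^sup>2) * (?n * (L2_norm \<Omega> \<phi>)\<^sup>2 + ?h * (L2_norm \<Omega> D)\<^sup>2)" .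
    also have "\<dots> \<le> ?J + 1 / (4 * s * \<rho>\<^sup>2) * (?n * (2 * ?a + 2 * e\<^sup>2) + ?h * (2 * ?b + 2 * e\<^sup>2))"
      using n1 n2 s by (intro add_mono mult_left_mono) auto
    also have "\<dots> = ?J + ?c * (?n * ?a + ?h * ?b) + ?c * (?n + ?h) * e\<^sup>2"
      using s \<rho> by (simp add: field_simps)
    finally show ?thesis using split err unfolding divergence_def G_def[symmetric] by linarith
  qed
  have "(?R \<longlongrightarrow> ?R 0) (at_right 0)" by (intro tendsto_intros)
  then have "?L \<le> ?R 0"
    by (rule tendsto_lowerbound) (use le in \<open>auto simp: eventually_at_right_field intro: exI[of _ 1]\<close>)
  then show ?thesis by simp
qed

end

section \<open>Boundary behaviour of piecewise linear fields\<close>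

lemma open_shift:
  fixes y \<nu> :: "'a::real_normed_vector"
  assumes "open U" "y \<in> U" "norm \<nu> = 1"
  obtains t where "t > 0" "y + t *\<^sub>R \<nu> \<in> U"
proof -
  obtain d where d: "d > 0" "ball y d \<subseteq> U" using assms openE by blast
  then have "y + (d/2) *\<^sub>R \<nu> \<in> ball y d" using assms(3) by (simp add: dist_norm)
  then show ?thesis using d that[of "d/2"] by auto
qed

text \<open>The mean value theorem for the integral over the box as a function of the shift,
  differentiated under the integral sign. The position s of the intermediate translate is not
  controlled.\<close>

lemma continuous_imp_leibniz:
  fixes f :: "real^'n \<Rightarrow> real" and D :: "real^'n \<Rightarrow> real"
  assumes der: "\<And>x. ((\<lambda>t. f (x + t *\<^sub>R e)) has_real_derivative D x) (at 0)" and f: "continuous_on UNIV f"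
    and D: "continuous_on UNIV D"
  obtains s where "integral (cbox a b) (\<lambda>x. f (x + e)) - integral (cbox a b) f = integral (cbox a b) (\<lambda>x. D (x + s *\<^sub>R e))"
proof -
  let ?F = "\<lambda>s. integral (cbox a b) (\<lambda>x. f (x + s *\<^sub>R e))"
  have d: "((\<lambda>s. f (x + s *\<^sub>R e)) has_real_derivative D (x + s *\<^sub>R e)) (at s)" for x s
  proof -
    have "((\<lambda>t. f (x + s *\<^sub>R e + t *\<^sub>R e)) has_real_derivative D (x + s *\<^sub>R e)) (at (s - s))"
      using der[of "x + s *\<^sub>R e"] by simp
    then have "((\<lambda>t. f (x + s *\<^sub>R e + (t - s) *\<^sub>R e)) has_real_derivative D (x + s *\<^sub>R e) * 1) (at s)"
      by (rule DERIV_chain2) (auto intro!: derivative_eq_intros)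
    then show ?thesis by (simp add: algebra_simps)
  qed
  have F: "(?F has_real_derivative integral (cbox a b) (\<lambda>x. D (x + s *\<^sub>R e))) (at s)" for s
  proof (rule leibniz_rule_field_derivative[where U=UNIV, simplified])
    show "((\<lambda>s. f (t + s *\<^sub>R e)) has_real_derivative D (t + x *\<^sub>R e)) (at x)" for x t by (rule d)
    show "(\<lambda>t. f (t + x *\<^sub>R e)) integrable_on cbox a b" for x
      by (intro integrable_continuous continuous_on_compose2[OF f] continuous_intros) auto
    show "continuous_on (UNIV \<times> cbox a b) (\<lambda>(x, t). D (t + x *\<^sub>R e))"
      unfolding case_prod_beta by (intro continuous_on_compose2[OF D] continuous_intros) auto
  qed
  obtain s where "?F 1 - ?F 0 = (1 - 0) * integral (cbox a b) (\<lambda>x. D (x + s *\<^sub>R e))"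
    using MVT2[of 0 1 ?F "\<lambda>s. integral (cbox a b) (\<lambda>x. D (x + s *\<^sub>R e))"] F by auto
  then show ?thesis using that[of s] by simp
qed

context mesh_domain
begin

text \<open>Near a good boundary point each half-ball lies in \<Omega> or misses its closure, and
  exactly one lies in \<Omega>. So \<Omega> is locally a half-space, the face normal is the outward
  normal up to sign, and the condition on z applies; on the other side z is 0.\<close>

lemma P1_normal_jump:
  assumes z: "z \<in> P1_space \<Omega> T"
    and normal: "\<And>x \<nu>. x \<in> frontier \<Omega> \<Longrightarrow> outward_normal \<Omega> x \<nu> \<Longrightarrow> z x \<bullet> \<nu> = 0"
    and H: "H \<in> hyps T" and x: "good H x"
  shows "\<exists>l. ((\<lambda>t. z (x + t *\<^sub>R face_normal H) - z (x - t *\<^sub>R face_normal H)) \<longlongrightarrow> l) (at_right 0) \<and> face_normal H \<bullet> l = 0"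
proof (cases "x \<in> frontier \<Omega>")
  case False
  have "isCont z x"
  proof (cases "x \<in> \<Omega>")
    case True then show ?thesis by (rule P1_isCont[OF z])
  next
    case False
    then have "x \<in> - closure \<Omega>" using \<open>x \<notin> frontier \<Omega>\<close> open\<Omega> by (auto simp: frontier_def interior_open)
    then have "\<forall>\<^sub>F y in nhds x. y \<in> - closure \<Omega>" by (intro eventually_nhds_in_open) auto
    then have "\<forall>\<^sub>F y in nhds x. z y = 0" by eventually_elim (use P1_outside[OF z] in auto)
    then show ?thesis using isCont_cong[of z "\<lambda>_. 0" x] by simp
  qed
  then have "((\<lambda>t. z (x + t *\<^sub>R face_normal H) - z (x - t *\<^sub>R face_normal H)) \<longlongrightarrow> z x - z x) (at_right 0)"
    by (intro tendsto_diff isCont_tendsto_compose[of x z]) (auto intro!: tendsto_eq_intros)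
  then show ?thesis by (intro exI[of _ 0]) simp
next
  case True
  let ?\<nu> = "face_normal H"
  have \<nu>: "norm ?\<nu> = 1" by (rule hyps_unit[OF H])
  have \<nu>x: "?\<nu> \<bullet> x = hcst H" using x hyps_mem[OF H] by (simp add: good_def)
  have \<nu>\<nu>: "?\<nu> \<bullet> ?\<nu> = 1" using \<nu> by (simp add: norm_eq_1)
  have xc: "x \<in> closure \<Omega>" "x \<notin> \<Omega>" using True open\<Omega> by (auto simp: frontier_def interior_open)
  obtain r where r: "r > 0"
    "\<And>s K. K \<in> T \<Longrightarrow> {y \<in> ball x r. 0 < s * (?\<nu> \<bullet> y - hcst H)} \<subseteq> interior K \<or>
      {y \<in> ball x r. 0 < s * (?\<nu> \<bullet> y - hcst H)} \<inter> K = {}"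
  proof (rule sides_off_hyps[OF H])
    show "x \<in> H" "x \<notin> \<Union>(hyps T - {H})" using x unfolding good_def by blast+
    fix r :: real assume r: "0 < r"
      and c: "\<And>s K. K \<in> T \<Longrightarrow> {y \<in> ball x r. 0 < s * (?\<nu> \<bullet> y - hcst H)} \<subseteq> interior K \<or>
      {y \<in> ball x r. 0 < s * (?\<nu> \<bullet> y - hcst H)} \<inter> K = {}"
    show thesis by (rule that[OF r c])
  qed
  define P where "P s = {y \<in> ball x r. 0 < s * (?\<nu> \<bullet> y - hcst H)}" for s :: real
  have dich: "P s \<subseteq> \<Omega> \<or> P s \<inter> closure \<Omega> = {}" for s
  proof (cases "\<exists>K\<in>T. P s \<subseteq> interior K")
    case True then show ?thesis using interior_subset_\<Omega> by blast
  next
    case False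
    then have "P s \<inter> K = {}" if "K \<in> T" for K using r(2)[OF that, of s] that unfolding P_def by blast
    then show ?thesis using Union_T by blast
  qed
  have shift: "\<exists>t>0. y + (s * t) *\<^sub>R ?\<nu> \<in> U \<and> ?\<nu> \<bullet> (y + (s * t) *\<^sub>R ?\<nu>) = ?\<nu> \<bullet> y + s * t"
    if "open U" "y \<in> U" "\<bar>s\<bar> = 1" for U y and s :: real
  proof -
    have "norm (s *\<^sub>R ?\<nu>) = 1" using \<nu> that(3) by simp
    from open_shift[OF that(1,2) this] obtain t where "t > 0" "y + t *\<^sub>R (s *\<^sub>R ?\<nu>) \<in> U" by blast
    then show ?thesis using \<nu>\<nu> by (auto simp: inner_add_right mult.commute)
  qed
  \<comment> \<open>The part of H inside the ball would lie in the closure of \<Omega> too, so x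
    would be interior to the union of the mesh, that is, in \<Omega>.\<close>
  have both: "\<not> (P 1 \<subseteq> \<Omega> \<and> P (-1) \<subseteq> \<Omega>)"
  proof
    assume PP: "P 1 \<subseteq> \<Omega> \<and> P (-1) \<subseteq> \<Omega>"
    have "y \<in> closure \<Omega>" if y: "y \<in> ball x r" for y
    proof (cases "?\<nu> \<bullet> y - hcst H = 0")
      case False
      then have "y \<in> P 1 \<or> y \<in> P (-1)" using y by (auto simp: P_def)
      then show ?thesis using PP closure_subset by blast
    next
      case True
      show ?thesis
      proof (rule closure_approachable[THEN iffD2], intro allI impI)
        fix e :: real assume e: "e > 0"
        have "open (ball x r \<inter> ball y e)" "y \<in> ball x r \<inter> ball y e" using y e by auto
        from shift[OF this, of 1] obtain t where t: "t > 0" "y + t *\<^sub>R ?\<nu> \<in> ball x r \<inter> ball y e"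
          "?\<nu> \<bullet> (y + t *\<^sub>R ?\<nu>) = ?\<nu> \<bullet> y + t" by auto
        then have "y + t *\<^sub>R ?\<nu> \<in> P 1" using True by (simp add: P_def)
        then show "\<exists>w\<in>\<Omega>. dist w y < e" using PP t(2) by (auto simp: dist_commute)
      qed
    qed
    then have "ball x r \<subseteq> interior (\<Union>T)" unfolding Union_T by (intro interior_maximal) auto
    then show False using xc(2) r(1) interior_T centre_in_ball by blast
  qed
  \<comment> \<open>x is a limit of points of \<Omega>. Such a point lies on one side of H or, being
    on H, can be pushed to one side within \<Omega>.\<close>
  have neither: "\<not> (P 1 \<inter> closure \<Omega> = {} \<and> P (-1) \<inter> closure \<Omega> = {})"
  proof
    assume PP: "P 1 \<inter> closure \<Omega> = {} \<and> P (-1) \<inter> closure \<Omega> = {}"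
    obtain y where y: "y \<in> \<Omega>" "dist y x < r" using xc(1) r(1) closure_approachable by blast
    have o: "open (\<Omega> \<inter> ball x r)" "y \<in> \<Omega> \<inter> ball x r" using open\<Omega> y by (auto simp: dist_commute)
    have np: "\<not> w \<in> P s" if "s = 1 \<or> s = -1" "w \<in> \<Omega>" for w s using that PP closure_subset by blast
    have "?\<nu> \<bullet> y - hcst H = 0"
      using np[of 1 y] np[of "-1" y] o(2) by (auto simp: P_def)
    moreover from shift[OF o, of 1] obtain t where t: "t > 0" "y + t *\<^sub>R ?\<nu> \<in> \<Omega> \<inter> ball x r" "?\<nu> \<bullet> (y + t *\<^sub>R ?\<nu>) = ?\<nu> \<bullet> y + t" by auto
    ultimately have "y + t *\<^sub>R ?\<nu> \<in> P 1" by (simp add: P_def)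
    then show False using np[of 1] t(2) by blast
  qed
  obtain s :: real where s: "s = 1 \<or> s = -1" "P s \<subseteq> \<Omega>" "P (- s) \<inter> closure \<Omega> = {}"
  proof (cases "P 1 \<subseteq> \<Omega>")
    case True
    then have "P (-1) \<inter> closure \<Omega> = {}" using both dich by blast
    then show ?thesis using that[of 1] True by simp
  next
    case False
    then have "P 1 \<inter> closure \<Omega> = {}" using dich by blast
    moreover then have "P (-1) \<subseteq> \<Omega>" using neither dich by blast
    ultimately show ?thesis using that[of "-1"] by simp
  qed
  have eq: "\<Omega> \<inter> ball x r = P s"
  proof
    show "P s \<subseteq> \<Omega> \<inter> ball x r" using s(2) by (auto simp: P_def)
    show "\<Omega> \<inter> ball x r \<subseteq> P s"
    proof
      fix y assume y: "y \<in> \<Omega> \<inter> ball x r"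
      have np: "w \<notin> P (- s)" if "w \<in> \<Omega>" for w using that s(3) closure_subset by blast
      have "0 \<le> s * (?\<nu> \<bullet> y - hcst H)" using np[of y] y by (auto simp: P_def not_less)
      \<comment> \<open>A point of \<Omega> on H would have neighbours in \<Omega> on the excluded
        side.\<close>
      moreover have "s * (?\<nu> \<bullet> y - hcst H) \<noteq> 0"
      proof
        assume 0: "s * (?\<nu> \<bullet> y - hcst H) = 0"
        have "open (\<Omega> \<inter> ball x r)" using open\<Omega> by auto
        from shift[OF this y, of "- s"] obtain t where t: "t > 0" "y + (- s * t) *\<^sub>R ?\<nu> \<in> \<Omega> \<inter> ball x r"
          "?\<nu> \<bullet> (y + (- s * t) *\<^sub>R ?\<nu>) = ?\<nu> \<bullet> y + - s * t" using s(1) by auto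
        have "0 < - s * (?\<nu> \<bullet> y + - s * t - hcst H)" using 0 s(1) t(1) by auto
        then have "y + (- s * t) *\<^sub>R ?\<nu> \<in> P (- s)" unfolding P_def mem_Collect_eq t(3) using t(2) by blast
        then show False using np t(2) by blast
      qed
      ultimately have "0 < s * (?\<nu> \<bullet> y - hcst H)" by (metis order_le_less)
      then show "y \<in> P s" using y by (simp add: P_def)
    qed
  qed
  have "outward_normal \<Omega> x (- s *\<^sub>R ?\<nu>)"
    unfolding outward_normal_def
  proof
    show "norm (- s *\<^sub>R ?\<nu>) = 1" using s(1) \<nu> by auto
    have e: "(y - x) \<bullet> (- s *\<^sub>R ?\<nu>) = - (s * (?\<nu> \<bullet> y - hcst H))" for y
      unfolding \<nu>x[symmetric] by (simp add: inner_diff_left inner_commute algebra_simps)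
    have "\<Omega> \<inter> ball x r = {y \<in> ball x r. (y - x) \<bullet> (- s *\<^sub>R ?\<nu>) < 0}"
      unfolding e eq P_def neg_less_0_iff_less ..
    then show "\<exists>r>0. \<Omega> \<inter> ball x r = {y \<in> ball x r. (y - x) \<bullet> (- s *\<^sub>R ?\<nu>) < 0}"
      using r(1) by blast
  qed
  from normal[OF True this] have \<nu>z: "?\<nu> \<bullet> z x = 0" using s(1) by (auto simp: inner_commute)
  have side: "x + (a * t) *\<^sub>R ?\<nu> \<in> P a" if "a = 1 \<or> a = -1" "0 < t" "t < r" for a t :: real
    using that \<nu> \<nu>\<nu> \<nu>x by (auto simp: P_def dist_norm inner_add_right inner_diff_right)
  have ev: "\<forall>\<^sub>F t in at_right 0. x + (a * t) *\<^sub>R ?\<nu> \<in> P a" if "a = 1 \<or> a = -1" for a :: real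
    unfolding eventually_at_right_field using side[OF that] r(1) by blast
  have A: "((\<lambda>t. z (x + (s * t) *\<^sub>R ?\<nu>)) \<longlongrightarrow> z x) (at_right 0)"
  proof (rule continuous_on_tendsto_compose[OF P1_continuous[OF z] _ xc(1)])
    show "((\<lambda>t. x + (s * t) *\<^sub>R ?\<nu>) \<longlongrightarrow> x) (at_right 0)" by (auto intro!: tendsto_eq_intros)
    show "\<forall>\<^sub>F t in at_right 0. x + (s * t) *\<^sub>R ?\<nu> \<in> closure \<Omega>"
      using ev[OF s(1)] by eventually_elim (use s(2) closure_subset in blast)
  qed
  have B: "((\<lambda>t. z (x + (- s * t) *\<^sub>R ?\<nu>)) \<longlongrightarrow> 0) (at_right 0)"
  proof (rule tendsto_eventually)
    have "- s = 1 \<or> - s = -1" using s(1) by auto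
    from ev[OF this] show "\<forall>\<^sub>F t in at_right 0. z (x + (- s * t) *\<^sub>R ?\<nu>) = 0"
      by eventually_elim (use s(3) P1_outside[OF z] in blast)
  qed
  from s(1) show ?thesis
  proof
    assume "s = 1"
    then have "((\<lambda>t. z (x + t *\<^sub>R ?\<nu>) - z (x - t *\<^sub>R ?\<nu>)) \<longlongrightarrow> z x - 0) (at_right 0)"
      using tendsto_diff[OF A B] by simp
    then show ?thesis using \<nu>z by auto
  next
    assume "s = -1"
    then have "((\<lambda>t. z (x + t *\<^sub>R ?\<nu>) - z (x - t *\<^sub>R ?\<nu>)) \<longlongrightarrow> 0 - z x) (at_right 0)"
      using tendsto_diff[OF B A] by simp
    then show ?thesis using \<nu>z by (intro exI[of _ "0 - z x"]) simp
  qed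
qed

text \<open>Extended by zero, z has no normal jump at almost every point of the hyperplanes, so the
  divergence theorem leaves nothing. This makes the divergence an admissible pressure when
  \<open>Q_h\<close> demands mean value zero.\<close>

lemma integral_P1_divergence:
  assumes z: "z \<in> P1_space \<Omega> T"
    and normal: "\<And>x \<nu>. x \<in> frontier \<Omega> \<Longrightarrow> outward_normal \<Omega> x \<nu> \<Longrightarrow> z x \<bullet> \<nu> = 0"
  shows "(LINT x|lebesgue. trace (P1grad z x)) = 0"
proof -
  obtain M where M: "M \<ge> 0" "\<And>x. norm (z x) \<le> M" using P1_bounds[OF z] by blast
  obtain R where R: "\<And>x. norm x > R \<Longrightarrow> x \<notin> closure \<Omega>" using \<Omega>_radius by blast
  define A where "A = (\<Sum>K\<in>T. norm (Amat z K))"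
  have A0: "A \<ge> 0" unfolding A_def by (intro sum_nonneg) auto
  \<comment> \<open>At points on several hyperplanes the choice is arbitrary, which affects only a
    null set of the slab.\<close>
  define j where "j H x = (SOME l. ((\<lambda>t. z (x + t *\<^sub>R face_normal H) - z (x - t *\<^sub>R face_normal H)) \<longlongrightarrow> l) (at_right 0) \<and>
    face_normal H \<bullet> l = 0)" for H x
  have j: "((\<lambda>t. z (x + t *\<^sub>R face_normal H) - z (x - t *\<^sub>R face_normal H)) \<longlongrightarrow> j H x) (at_right 0) \<and>
    face_normal H \<bullet> j H x = 0" if "H \<in> hyps T" "good H x" for H x
    unfolding j_def by (rule someI_ex[OF P1_normal_jump[OF z normal that]])
  have ii: "(P1grad z x *v axis i 1) $ i = P1grad z x $ i $ i" for x i
    by (simp add: matrix_vector_mul_component inner_axis)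
  have "(LINT x|lebesgue. (\<Sum>i\<in>UNIV. (P1grad z x *v axis i 1) $ i)) =
      - (\<Sum>H\<in>hyps T. LINT y|lebesgue. indicator (slab H) y * (face_normal H \<bullet> j H (hproj H y)))"
  proof (rule divergence_theorem_piecewise(1)[where M="max M A" and R=R])
    show "finite (hyps T)" by (rule finite_hyps)
    show "norm (face_normal H) = 1" "H = {x. face_normal H \<bullet> x = hcst H}" if "H \<in> hyps T" for H
      using hyps_unit[OF that] hyps_eq[OF that] by blast+
    show "z \<in> borel_measurable borel" by (rule P1_borel[OF z])
    show "(\<lambda>x. (P1grad z x *v axis i 1) $ i) \<in> borel_measurable borel" for i
      unfolding ii by (rule measurable_compose[OF P1grad_borel borel_measurable_continuous_onI]) (intro continuous_intros)
    show "norm (z x) \<le> max M A" for x using M(2)[of x] by simp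
    show "\<bar>(P1grad z x *v axis i 1) $ i\<bar> \<le> max M A" for x i
      unfolding ii using component_le_norm_cart[of "P1grad z x $ i" i] Finite_Cartesian_Product.norm_nth_le[of "P1grad z x" i]
        P1grad_bound[of z x] unfolding A_def by linarith
    show "z x = 0" if "norm x > R" for x using P1_outside[OF z R[OF that]] .
    show "(P1grad z x *v axis i 1) $ i = 0" if "norm x > R" for x i
    proof -
      have "x \<notin> interior K" if K: "K \<in> T" for K
        using R[OF \<open>norm x > R\<close>] interior_subset_\<Omega>[OF K] closure_subset by blast
      then show ?thesis using P1grad_out[of x z] by simp
    qed
    show "(z has_derivative (*v) (P1grad z x)) (at x)" if "x \<notin> \<Union>(hyps T)" for x
      using P1_has_derivative[OF z that] .
    show "((\<lambda>t. z (x + t *\<^sub>R face_normal H) - z (x - t *\<^sub>R face_normal H)) \<longlongrightarrow> j H x) (at_right 0)"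
      if "H \<in> hyps T" "x \<in> H" "x \<notin> \<Union>(hyps T - {H})" for H x
      using j[of H x] that unfolding good_def by blast
  qed
  also have "(\<Sum>H\<in>hyps T. LINT y|lebesgue. indicator (slab H) y * (face_normal H \<bullet> j H (hproj H y))) = 0"
  proof (rule sum.neutral, rule ballI)
    fix H assume H: "H \<in> hyps T"
    have "AE y in lebesgue. indicator (slab H) y * (face_normal H \<bullet> j H (hproj H y)) = 0"
      using AE_good[OF H] by eventually_elim (use j[OF H] in simp)
    then show "(LINT y|lebesgue. indicator (slab H) y * (face_normal H \<bullet> j H (hproj H y))) = 0"
      by (rule integral_eq_zero_AE)
  qed
  finally show ?thesis by (simp add: ii trace_def)
qed

text \<open>If a component of v were nonzero at x0, a small box in \<Omega> near x0 could be shifted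
  out of \<Omega> by a vector e of length at most 2r. For a test field close to v the integral over
  the box is then comparable to the volume of the box and, as an integral of a directional
  derivative, also bounded by r times this volume up to small errors.\<close>

lemma P1_H10_zero:
  assumes v: "v \<in> P1_space \<Omega> T" and v0: "v \<in> H10 \<Omega>" and x0: "x0 \<in> frontier \<Omega>"
  shows "v x0 = 0"
proof (rule ccontr)
  assume "v x0 \<noteq> 0"
  then obtain i where i: "v x0 $ i \<noteq> 0" by (auto simp: vec_eq_iff)
  define a where "a = \<bar>v x0 $ i\<bar>"
  define sg where "sg = sgn (v x0 $ i)"
  have a: "a > 0" "sg * v x0 $ i = a" "\<bar>sg\<bar> = 1" using i by (auto simp: a_def sg_def sgn_if)
  define A where "A = (\<Sum>K\<in>T. norm (Amat v K))"
  have A0: "A \<ge> 0" unfolding A_def by (intro sum_nonneg) auto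
  have xc: "x0 \<in> closure \<Omega>" "x0 \<notin> \<Omega>" using x0 open\<Omega> by (auto simp: frontier_def interior_open)
  obtain d where d: "d > 0" "\<And>y. y \<in> closure \<Omega> \<Longrightarrow> dist y x0 < d \<Longrightarrow> dist (v y) (v x0) < a / 2"
    using P1_continuous[OF v] xc(1) a(1) unfolding continuous_on_iff by (meson half_gt_zero)
  \<comment> \<open>Small enough for the gradient bound A times the shift length 2r to stay below
    a/8.\<close>
  define r where "r = min d (a / 16 / (A + 1))"
  have r: "r > 0" "r \<le> d" "2 * r * A \<le> a / 8"
  proof -
    show "r > 0" "r \<le> d" using d(1) a(1) A0 by (auto simp: r_def)
    have "r * (A + 1) \<le> a / 16 / (A + 1) * (A + 1)" using A0 by (intro mult_right_mono) (auto simp: r_def)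
    also have "\<dots> = a / 16" by (rule nonzero_eq_divide_eq[THEN iffD1, OF _ refl]) (use A0 in simp)
    finally have "r * (A + 1) \<le> a / 16" .
    moreover have "r * A \<le> r * (A + 1)" using \<open>r > 0\<close> by simp
    ultimately show "2 * r * A \<le> a / 8" by linarith
  qed
  obtain y1 where y1: "y1 \<in> \<Omega>" "dist y1 x0 < r" using xc(1) r(1) closure_approachable by blast
  \<comment> \<open>Otherwise x0 would be interior to the union of the mesh, which is
    \<Omega>.\<close>
  have "\<not> ball x0 r \<subseteq> closure \<Omega>"
  proof
    assume "ball x0 r \<subseteq> closure \<Omega>"
    then have "ball x0 r \<subseteq> interior (\<Union>T)" unfolding Union_T by (intro interior_maximal) auto
    then show False using xc(2) interior_T r(1) centre_in_ball by blast
  qed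
  then obtain y2 where "y2 \<in> ball x0 r" and y2': "y2 \<notin> closure \<Omega>" by blast
  then have y2: "dist x0 y2 < r" "y2 \<notin> closure \<Omega>" by auto
  define e where "e = y2 - y1"
  have en: "norm e \<le> 2 * r"
    unfolding e_def using y1(2) y2(1) dist_triangle[of y2 y1 x0] by (simp add: dist_norm[symmetric] dist_commute)
  define U where "U = \<Omega> \<inter> ball x0 r \<inter> (\<lambda>y. y + e) -` (- closure \<Omega>)"
  have "open U" unfolding U_def by (intro open_Int open\<Omega> open_ball open_vimage continuous_intros) auto
  moreover have "y1 \<in> U" using y1 y2 by (auto simp: U_def e_def dist_commute)
  ultimately obtain c1 c2 where c: "cbox c1 c2 \<subseteq> U" "y1 \<in> box c1 c2" by (rule open_contains_cbox)
  let ?B = "cbox c1 c2"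
  define m where "m = measure lborel ?B"
  have m: "m > 0" unfolding m_def using c(2) by (intro content_pos_lt) (auto simp: box_def intro: less_trans)
  have mB: "measure lebesgue ?B = m" unfolding m_def by simp
  have SB: "?B \<in> sets lebesgue" "?B \<in> lmeasurable" by auto
  have iB: "integrable lebesgue (\<lambda>x. indicator ?B x * k)" for k :: real
    using SB by (intro integrable_mult_left integrable_real_indicator) (auto simp: fmeasurable_def)
  have lower: "sg * v x $ i \<ge> a / 2" if x: "x \<in> ?B" for x
  proof -
    have "x \<in> \<Omega>" "dist x x0 < d" using c(1) x r(2) by (auto simp: U_def dist_commute)
    then have "norm (v x - v x0) < a / 2" using d(2)[of x] closure_subset by (auto simp: dist_norm)
    then have "\<bar>v x $ i - v x0 $ i\<bar> < a / 2" using component_le_norm_cart[of "v x - v x0" i] by simp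
    then have "\<bar>sg * (v x $ i - v x0 $ i)\<bar> < a / 2" using a(3) by (simp add: abs_mult)
    then have "\<bar>sg * v x $ i - a\<bar> < a / 2" unfolding right_diff_distrib a(2) .
    then show ?thesis by linarith
  qed
  \<comment> \<open>Chosen so that all approximation errors together amount to a m / 32.\<close>
  define t where "t = a * m / (16 * (m + 1) * (1 + 2 * r))"
  have t: "t > 0" unfolding t_def using a m r by simp
  obtain \<phi> where \<phi>: "\<And>i. test_function \<Omega> (\<lambda>x. \<phi> x $ i)" "L2_norm \<Omega> (\<lambda>x. v x + (-1) *\<^sub>R \<phi> x) \<le> t"
    "L2_norm \<Omega> (\<lambda>x. P1grad v x + (-1) *\<^sub>R field_jacobian \<phi> x) \<le> t"
    using H10_approx[OF open\<Omega> v0 P1_weak_jacobian[OF v] t] by blast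
  note tf = test_field_weak_jacobian[OF open\<Omega> \<phi>(1)]
  define f where "f x = \<phi> x $ i" for x
  define D where "D x = (field_jacobian \<phi> x *v e) $ i" for x
  have ft: "test_function \<Omega> f" using \<phi>(1)[of i] by (simp add: f_def[abs_def])
  have fj: "continuous_on UNIV (\<lambda>x. field_jacobian \<phi> x)"
    unfolding field_jacobian_def by (intro continuous_on_vec_lambda test_function_partial_continuous[OF \<phi>(1)])
  have Dc: "continuous_on UNIV D"
    unfolding D_def matrix_vector_mul_component by (intro continuous_intros fj)
  have der: "((\<lambda>t. f (x + t *\<^sub>R e)) has_real_derivative D x) (at 0)" for x
  proof -
    let ?F = "frechet_derivative f (at x)"
    have F: "(f has_derivative ?F) (at (x + 0 *\<^sub>R e))" using has_derivative_frechet[OF test_function_differentiable[OF ft]] by simp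
    have "((\<lambda>t::real. x + t *\<^sub>R e) has_derivative (\<lambda>t. t *\<^sub>R e)) (at 0)" by (auto intro!: derivative_eq_intros)
    from has_derivative_compose[OF this F]
    have 1: "((\<lambda>t. f (x + t *\<^sub>R e)) has_derivative (\<lambda>t. ?F (t *\<^sub>R e))) (at 0)" .
    have lin: "linear ?F" using has_derivative_linear[OF F] .
    have "?F e = ?F (\<Sum>k\<in>UNIV. e $ k *\<^sub>R axis k 1)" using basis_expansion[of e] by (simp add: scalar_mult_eq_scaleR)
    also have "\<dots> = D x"
      unfolding linear_sum[OF lin] linear_cmul[OF lin] D_def field_jacobian_def
      by (simp add: matrix_vector_mult_def partial_deriv_def f_def[abs_def] mult.commute)
    finally have "?F (t *\<^sub>R e) = t * D x" for t by (simp add: linear_cmul[OF lin])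
    with 1 show ?thesis by (simp add: has_field_derivative_def mult_commute_abs)
  qed
  obtain s where s: "integral ?B (\<lambda>x. f (x + e)) - integral ?B f = integral ?B (\<lambda>x. D (x + s *\<^sub>R e))"
    by (rule continuous_imp_leibniz[OF der test_function_continuous[OF ft] Dc])
  have "f (x + e) = 0" if "x \<in> ?B" for x
    using that c(1) closure_subset[of \<Omega>] test_function_nz[OF ft, of "x + e"] by (auto simp: U_def)
  then have "integral ?B (\<lambda>x. f (x + e)) = integral ?B (\<lambda>x. 0 :: real)" by (intro integral_cong) auto
  then have s': "- integral ?B f = integral ?B (\<lambda>x. D (x + s *\<^sub>R e))" using s by simp
  have conv: "integral ?B g = (LINT x|lebesgue. indicator ?B x * g x)" "integrable lebesgue (\<lambda>x. indicator ?B x * g x)"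
    if g: "continuous_on UNIV g" for g :: "real^'n \<Rightarrow> real"
  proof -
    have i: "integrable (lebesgue_on ?B) g" by (intro continuous_imp_integrable continuous_on_subset[OF g]) auto
    show "integral ?B g = (LINT x|lebesgue. indicator ?B x * g x)"
      using lebesgue_integral_eq_integral[OF i SB(1)] integral_lebesgue_on_indicator(1)[OF SB(1), of g] by simp
    show "integrable lebesgue (\<lambda>x. indicator ?B x * g x)" using i by (simp add: integral_lebesgue_on_indicator(2)[OF SB(1)])
  qed
  \<comment> \<open>E vanishes outside \<Omega> and is integrated over the whole space, because the
    translate by s e from the mean value theorem may leave the box and even \<Omega>.\<close>
  define E where "E x = (norm (P1grad v x + (-1) *\<^sub>R field_jacobian \<phi> x))\<^sup>2" for x
  define W where "W x = indicator \<Omega> x * (norm (v x + (-1) *\<^sub>R \<phi> x))\<^sup>2" for x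
  have vd: "L2_on \<Omega> (\<lambda>x. v x + (-1) *\<^sub>R \<phi> x)" by (rule L2_on_lincomb[OF S\<Omega> P1_L2[OF v] tf(1)])
  have gd: "L2_on \<Omega> (\<lambda>x. P1grad v x + (-1) *\<^sub>R field_jacobian \<phi> x)"
    using tf(2) by (intro L2_on_lincomb[OF S\<Omega> P1grad_L2]) (simp add: has_weak_jacobian_def)
  have E0: "E x = 0" if "x \<notin> \<Omega>" for x
  proof -
    have "x \<notin> interior K" if "K \<in> T" for K using interior_subset_\<Omega>[OF that] \<open>x \<notin> \<Omega>\<close> by blast
    moreover have "partial_deriv k (\<lambda>x. \<phi> x $ j) x = 0" for j k using \<open>x \<notin> \<Omega>\<close> test_function_partial_nz[OF \<phi>(1)] by blast
    ultimately show ?thesis using P1grad_out[of x v] by (simp add: E_def field_jacobian_def vec_eq_iff)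
  qed
  have iE: "integrable lebesgue E" "(LINT x|lebesgue. E x) \<le> t\<^sup>2"
  proof -
    show "integrable lebesgue E"
      using gd integral_lebesgue_on_zero_outside(2)[OF S\<Omega> E0] by (simp add: L2_on_def E_def[abs_def])
    have "(LINT x|lebesgue. E x) = (L2_norm \<Omega> (\<lambda>x. P1grad v x + (-1) *\<^sub>R field_jacobian \<phi> x))\<^sup>2"
      unfolding L2_norm_sq_eq[OF S\<Omega>] using integral_lebesgue_on_zero_outside(1)[OF S\<Omega> E0] by (simp add: E_def)
    also have "\<dots> \<le> t\<^sup>2" by (intro power_mono \<phi>(3) L2_norm_nonneg(2)[OF S\<Omega>])
    finally show "(LINT x|lebesgue. E x) \<le> t\<^sup>2" .
  qed
  have iW: "integrable lebesgue W" "(LINT x|lebesgue. W x) \<le> t\<^sup>2"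
  proof -
    show "integrable lebesgue W" using vd unfolding L2_on_def integral_lebesgue_on_indicator(2)[OF S\<Omega>] W_def[abs_def] by blast
    have "(LINT x|lebesgue. W x) = (L2_norm \<Omega> (\<lambda>x. v x + (-1) *\<^sub>R \<phi> x))\<^sup>2"
      unfolding L2_norm_sq_eq[OF S\<Omega>] W_def integral_lebesgue_on_indicator(1)[OF S\<Omega>] ..
    also have "\<dots> \<le> t\<^sup>2" by (intro power_mono \<phi>(2) L2_norm_nonneg(2)[OF S\<Omega>])
    finally show "(LINT x|lebesgue. W x) \<le> t\<^sup>2" .
  qed
  \<comment> \<open>Turns bounds on squared errors into bounds on the errors. Integrated over the
    box, each error costs at most t m / 2 + t / 2.\<close>
  have young: "y \<le> t / 2 + y\<^sup>2 / (2 * t)" for y :: real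
  proof -
    have "0 \<le> (y - t)\<^sup>2" by simp
    then have "2 * t * y \<le> t\<^sup>2 + y\<^sup>2" by (simp add: power2_diff algebra_simps)
    then show ?thesis using t by (simp add: field_simps power2_eq_square)
  qed
  have Eb: "E \<in> borel_measurable borel"
  proof -
    have [measurable]: "(\<lambda>x. P1grad v x + (-1) *\<^sub>R field_jacobian \<phi> x) \<in> borel_measurable borel"
      by (intro borel_measurable_add borel_measurable_scaleR borel_measurable_const P1grad_borel
          borel_measurable_continuous_onI[OF fj])
    show ?thesis unfolding E_def[abs_def] by measurable
  qed
  have iEs: "integrable lebesgue (\<lambda>x. E (x + s *\<^sub>R e))" "(LINT x|lebesgue. E (x + s *\<^sub>R e)) \<le> t\<^sup>2"
  proof -
    have "integrable lborel E" using iE(1) integrable_completion[of E lborel] Eb by simp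
    then have "integrable lborel (\<lambda>x. E (s *\<^sub>R e + x))"
      using integrable_distr_eq[of "(+) (s *\<^sub>R e)" lborel borel E] Eb by (simp add: lborel_distr_plus)
    then show "integrable lebesgue (\<lambda>x. E (x + s *\<^sub>R e))"
      using integrable_completion[of "\<lambda>x. E (x + s *\<^sub>R e)" lborel] Eb by (simp add: add.commute)
    show "(LINT x|lebesgue. E (x + s *\<^sub>R e)) \<le> t\<^sup>2" using iE(2) integral_lebesgue_translate[OF Eb, of "s *\<^sub>R e"] by simp
  qed
  have iW2: "integrable lebesgue (\<lambda>x. W x / (2 * t))" using iW(1) by simp
  have iE2: "integrable lebesgue (\<lambda>x. E (x + s *\<^sub>R e) / (2 * t))" using iEs(1) by simp
  have low: "(a / 2) * m - (t / 2 * m + t / 2) \<le> sg * integral ?B f"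
  proof -
    have "(LINT x|lebesgue. indicator ?B x * (a / 2 - t / 2) - W x / (2 * t)) \<le> (LINT x|lebesgue. sg * (indicator ?B x * f x))"
    proof (rule integral_mono)
      show "integrable lebesgue (\<lambda>x. indicator ?B x * (a / 2 - t / 2) - W x / (2 * t))"
        by (rule Bochner_Integration.integrable_diff[OF iB iW2])
      show "integrable lebesgue (\<lambda>x. sg * (indicator ?B x * f x))" using conv(2)[OF test_function_continuous[OF ft]] by simp
      fix x
      have W0: "0 \<le> W x / (2 * t)" using t by (simp add: W_def)
      show "indicator ?B x * (a / 2 - t / 2) - W x / (2 * t) \<le> sg * (indicator ?B x * f x)"
      proof (cases "x \<in> ?B")
        case True
        then have x: "x \<in> \<Omega>" using c(1) by (auto simp: U_def)
        have "\<bar>sg * (v x $ i - f x)\<bar> \<le> norm (v x + (-1) *\<^sub>R \<phi> x)"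
          using component_le_norm_cart[of "v x + (-1) *\<^sub>R \<phi> x" i] a(3) by (simp add: abs_mult f_def)
        moreover have "norm (v x + (-1) *\<^sub>R \<phi> x) \<le> t / 2 + W x / (2 * t)"
          using young[of "norm (v x + (-1) *\<^sub>R \<phi> x)"] x by (simp add: W_def)
        ultimately have "sg * v x $ i - sg * f x \<le> t / 2 + W x / (2 * t)" by (simp add: right_diff_distrib)
        then show ?thesis using lower[OF True] True by simp
      next
        case False then show ?thesis using W0 by simp
      qed
    qed
    also have "\<dots> = sg * integral ?B f" using conv(1)[OF test_function_continuous[OF ft]] by simp
    also have "(LINT x|lebesgue. indicator ?B x * (a / 2 - t / 2) - W x / (2 * t)) = m * (a / 2 - t / 2) - (LINT x|lebesgue. W x) / (2 * t)"
      unfolding Bochner_Integration.integral_diff[OF iB iW2] using mB by simp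
    finally have "m * (a / 2 - t / 2) - (LINT x|lebesgue. W x) / (2 * t) \<le> sg * integral ?B f" .
    moreover have "(LINT x|lebesgue. W x) / (2 * t) \<le> t / 2"
      using iW(2) t by (simp add: field_simps power2_eq_square)
    ultimately show ?thesis by (simp add: algebra_simps)
  qed
  have up: "\<bar>integral ?B (\<lambda>x. D (x + s *\<^sub>R e))\<bar> \<le> 2 * r * (A * m + t / 2 * m + t / 2)"
  proof -
    have Ds: "continuous_on UNIV (\<lambda>x. D (x + s *\<^sub>R e))" by (intro continuous_on_compose2[OF Dc] continuous_intros) auto
    have "\<bar>integral ?B (\<lambda>x. D (x + s *\<^sub>R e))\<bar> \<le> (LINT x|lebesgue. \<bar>indicator ?B x * D (x + s *\<^sub>R e)\<bar>)"
      unfolding conv(1)[OF Ds] by (rule integral_abs_bound)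
    also have "\<dots> \<le> (LINT x|lebesgue. 2 * r * (indicator ?B x * (A + t / 2) + E (x + s *\<^sub>R e) / (2 * t)))"
    proof (rule integral_mono)
      show "integrable lebesgue (\<lambda>x. \<bar>indicator ?B x * D (x + s *\<^sub>R e)\<bar>)" using conv(2)[OF Ds] by simp
      show "integrable lebesgue (\<lambda>x. 2 * r * (indicator ?B x * (A + t / 2) + E (x + s *\<^sub>R e) / (2 * t)))"
        using iB iEs(1) by simp
      fix x
      let ?y = "x + s *\<^sub>R e"
      have E1: "0 \<le> E ?y / (2 * t)" using t by (simp add: E_def)
      have "\<bar>D ?y\<bar> \<le> 2 * r * (A + t / 2 + E ?y / (2 * t))"
      proof -
        have "\<bar>D ?y\<bar> \<le> norm (field_jacobian \<phi> ?y $ i) * norm e"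
          unfolding D_def matrix_vector_mul_component by (rule Cauchy_Schwarz_ineq2)
        also have "\<dots> \<le> norm (field_jacobian \<phi> ?y) * (2 * r)"
          using en by (intro mult_mono Finite_Cartesian_Product.norm_nth_le) auto
        also have "norm (field_jacobian \<phi> ?y) \<le> A + (t / 2 + E ?y / (2 * t))"
        proof -
          have "norm (field_jacobian \<phi> ?y) \<le> norm (P1grad v ?y) + norm (P1grad v ?y + (-1) *\<^sub>R field_jacobian \<phi> ?y)"
            using norm_triangle_sub[of "field_jacobian \<phi> ?y" "P1grad v ?y"] by (simp add: norm_minus_commute)
          then show ?thesis using P1grad_bound[of v ?y] young[of "norm (P1grad v ?y + (-1) *\<^sub>R field_jacobian \<phi> ?y)"]
            unfolding A_def E_def by linarith
        qed
        finally show ?thesis using r(1) by (simp add: mult.commute mult_right_mono algebra_simps)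
      qed
      then show "\<bar>indicator ?B x * D ?y\<bar> \<le> 2 * r * (indicator ?B x * (A + t / 2) + E ?y / (2 * t))"
      proof (cases "x \<in> ?B")
        case False
        have "0 \<le> 2 * r * (E ?y / (2 * t))" using E1 r(1) by (intro mult_nonneg_nonneg) auto
        then show ?thesis using False by simp
      qed simp
    qed
    also have "\<dots> = 2 * r * (m * (A + t / 2) + (LINT x|lebesgue. E (x + s *\<^sub>R e)) / (2 * t))"
      unfolding integral_mult_right_zero Bochner_Integration.integral_add[OF iB iE2] using mB by simp
    also have "\<dots> \<le> 2 * r * (m * (A + t / 2) + t / 2)"
    proof -
      have "(LINT x|lebesgue. E (x + s *\<^sub>R e)) / (2 * t) \<le> t / 2"
        using iEs(2) t by (simp add: field_simps power2_eq_square)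
      then show ?thesis using r(1) by (intro mult_left_mono) auto
    qed
    finally show ?thesis by (simp add: algebra_simps)
  qed
  have "sg * integral ?B f \<le> \<bar>integral ?B (\<lambda>x. D (x + s *\<^sub>R e))\<bar>"
    unfolding s'[symmetric] using a(3) abs_ge_self[of "sg * integral ?B f"] by (simp add: abs_mult)
  with low up have "(a / 2) * m \<le> (t / 2 * m + t / 2) + 2 * r * (A * m + t / 2 * m + t / 2)" by linarith
  also have "\<dots> = 2 * r * A * m + (1 + 2 * r) * (t / 2 * m + t / 2)" by (simp add: field_simps)
  finally have "(a / 2) * m \<le> 2 * r * A * m + (1 + 2 * r) * (t / 2 * m + t / 2)" .
  moreover have "2 * r * A * m \<le> a / 8 * m" using r(3) m by (intro mult_right_mono) auto
  moreover have "(1 + 2 * r) * (t / 2 * m + t / 2) = a * m / 32"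
    using m r(1) unfolding t_def by (simp add: divide_simps) (simp add: algebra_simps)
  moreover have "a * m > 0" using a m by simp
  ultimately show False by linarith
qed

text \<open>The elementwise approximation property is squared and summed with the overlap bound for
  patches. Its factor h, like the weight h of the derivative, cancels against \<rho> = \<sigma>
  h.\<close>

lemma pressure_consistency_le:
  assumes q: "pwc q" and v: "v \<in> H10 \<Omega>" and w: "w \<in> H10 \<Omega>" and s: "s > 0" and \<sigma>: "\<rho> = \<sigma> * h" "\<sigma> > 0"
    and proj: "\<And>K. K \<in> T \<Longrightarrow> L2_norm K (\<lambda>x. v x - w x) \<le> C * h * H1_norm (patch T K) v"
    and vP: "H1_norm \<Omega> v \<le> c * P" and wP: "H1_norm \<Omega> w \<le> c' * P"
  shows "\<bar>L2_inner \<Omega> q (divergence \<Omega> (\<lambda>x. v x + (-1) *\<^sub>R w x))\<bar> \<le> s / 2 * J_form \<Omega> T 1 q q +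
    1 / (2 * s * \<sigma>\<^sup>2) * (real (CARD('n) + 1) * (C\<^sup>2 * ((2 / \<sigma>) ^ CARD('n) * c\<^sup>2)) + (c + c')\<^sup>2) * P\<^sup>2"
proof -
  let ?\<psi> = "\<lambda>x. v x + (-1) *\<^sub>R w x" and ?n = "real (CARD('n) + 1)"
  have \<psi>: "?\<psi> \<in> H10 \<Omega>" by (rule H10_diff[OF open\<Omega> v w])
  have hr: "2 * h / \<rho> = 2 / \<sigma>" using \<sigma> h by simp
  have "integrable (lebesgue_on \<Omega>) (\<lambda>x. (norm (?\<psi> x))\<^sup>2)"
    using H1_L2(1)[OF open\<Omega> H10_H1[OF \<psi>]] by (simp add: L2_on_def)
  note cells = integral_cells(2)[OF this]
  have "(L2_norm \<Omega> ?\<psi>)\<^sup>2 = (\<Sum>K\<in>T. (L2_norm K (\<lambda>x. v x - w x))\<^sup>2)"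
    unfolding L2_norm_sq_eq[OF S\<Omega>] cells[symmetric] by (intro sum.cong refl) (simp add: L2_norm_sq_eq[OF cell_sets])
  also have "\<dots> \<le> (\<Sum>K\<in>T. (C * h * H1_norm (patch T K) v)\<^sup>2)"
    using proj by (intro sum_mono power_mono L2_norm_nonneg(2)[OF cell_sets])
  also have "\<dots> = (C * h)\<^sup>2 * (\<Sum>K\<in>T. (H1_norm (patch T K) v)\<^sup>2)" by (simp add: power_mult_distrib sum_distrib_left)
  also have "\<dots> \<le> (C * h)\<^sup>2 * ((2 / \<sigma>) ^ CARD('n) * (H1_norm \<Omega> v)\<^sup>2)"
    using sum_patch_le[OF H10_H1[OF v]] unfolding hr by (intro mult_left_mono) auto
  also have "\<dots> \<le> (C * h)\<^sup>2 * ((2 / \<sigma>) ^ CARD('n) * (c * P)\<^sup>2)"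
    using vP \<sigma> H1_norm_sq(2)[OF open\<Omega>] by (intro mult_left_mono power_mono) auto
  finally have 1: "(L2_norm \<Omega> ?\<psi>)\<^sup>2 \<le> (C * h)\<^sup>2 * ((2 / \<sigma>) ^ CARD('n) * (c * P)\<^sup>2)" .
  have "(L2_norm \<Omega> (weak_jacobian \<Omega> ?\<psi>))\<^sup>2 \<le> (H1_norm \<Omega> ?\<psi>)\<^sup>2"
    using H1_norm_eq[OF open\<Omega> H1_L2(1)[OF open\<Omega> H10_H1[OF \<psi>]] has_weak_jacobian_weak_jacobian[OF open\<Omega> H10_H1[OF \<psi>]]] by simp
  also have "\<dots> \<le> (c * P + c' * P)\<^sup>2"
    using H1_norm_lincomb_le[OF open\<Omega> H10_H1[OF v] H10_H1[OF w], of "-1"] vP wP H1_norm_sq(2)[OF open\<Omega>]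
    by (intro power_mono) auto
  finally have 2: "(L2_norm \<Omega> (weak_jacobian \<Omega> ?\<psi>))\<^sup>2 \<le> (c * P + c' * P)\<^sup>2" .
  have "\<bar>L2_inner \<Omega> q (divergence \<Omega> ?\<psi>)\<bar> \<le> s / 2 * J_form \<Omega> T 1 q q + 1 / (2 * s * \<rho>\<^sup>2) *
    (?n * (L2_norm \<Omega> ?\<psi>)\<^sup>2 + h\<^sup>2 * (L2_norm \<Omega> (weak_jacobian \<Omega> ?\<psi>))\<^sup>2)"
    by (rule divergence_pairing_le[OF q \<psi> s])
  also have "\<dots> \<le> s / 2 * J_form \<Omega> T 1 q q + 1 / (2 * s * \<rho>\<^sup>2) *
    (?n * ((C * h)\<^sup>2 * ((2 / \<sigma>) ^ CARD('n) * (c * P)\<^sup>2)) + h\<^sup>2 * (c * P + c' * P)\<^sup>2)"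
    using s by (intro add_mono order_refl mult_left_mono 1 2) auto
  also have "\<dots> = s / 2 * J_form \<Omega> T 1 q q +
    1 / (2 * s * \<sigma>\<^sup>2) * (?n * (C\<^sup>2 * ((2 / \<sigma>) ^ CARD('n) * c\<^sup>2)) + (c + c')\<^sup>2) * P\<^sup>2"
  proof -
    have "?n * ((C * h)\<^sup>2 * ((2 / \<sigma>) ^ CARD('n) * (c * P)\<^sup>2)) + h\<^sup>2 * (c * P + c' * P)\<^sup>2 =
      h\<^sup>2 * ((?n * (C\<^sup>2 * ((2 / \<sigma>) ^ CARD('n) * c\<^sup>2)) + (c + c')\<^sup>2) * P\<^sup>2)"
      by (simp add: power_mult_distrib distrib_right[of c c' P, symmetric]) (simp add: algebra_simps)
    moreover have "1 / (2 * s * \<rho>\<^sup>2) * (h\<^sup>2 * X) = 1 / (2 * s * \<sigma>\<^sup>2) * X" for X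
      unfolding \<sigma>(1) using h \<sigma>(2) s by (simp add: power_mult_distrib)
    ultimately show ?thesis by (simp only: mult.assoc)
  qed
  finally show ?thesis .
qed

end

section \<open>The bilinear form\<close>

lemma matrix_inv_bounds:
  fixes k :: "real^'n^'n"
  assumes sym: "transpose k = k" and pos: "kmin > 0" "kmax > 0"
    and ell: "\<And>\<eta>. kmin * (norm \<eta>)\<^sup>2 \<le> \<eta> \<bullet> (k *v \<eta>) \<and> \<eta> \<bullet> (k *v \<eta>) \<le> kmax * (norm \<eta>)\<^sup>2"
  shows "det k \<noteq> 0" "k *v (matrix_inv k *v \<eta>) = \<eta>" "norm (matrix_inv k *v \<eta>) \<le> norm \<eta> / kmin"
    "(norm \<eta>)\<^sup>2 / kmax \<le> (matrix_inv k *v \<eta>) \<bullet> \<eta>"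
proof -
  have "\<eta> = 0" if "k *v \<eta> = 0" for \<eta>
  proof -
    have "kmin * (norm \<eta>)\<^sup>2 \<le> 0" using ell[of \<eta>] that by simp
    then have "(norm \<eta>)\<^sup>2 \<le> 0" using pos(1) by (simp add: mult_le_0_iff)
    then show ?thesis by simp
  qed
  then have inv: "invertible k" unfolding invertible_left_inverse matrix_left_invertible_ker by blast
  then show "det k \<noteq> 0" by (simp add: invertible_det_nz)
  have "k ** matrix_inv k = mat 1"
    using inv unfolding invertible_def matrix_inv_def by (rule someI2_ex) blast
  then show E: "k *v (matrix_inv k *v \<eta>) = \<eta>" for \<eta> by (simp add: matrix_vector_mul_assoc)
  let ?\<zeta> = "matrix_inv k *v \<eta>"
  have "kmin * (norm ?\<zeta>)\<^sup>2 \<le> ?\<zeta> \<bullet> \<eta>" using ell[of ?\<zeta>] unfolding E by blast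
  also have "\<dots> \<le> norm ?\<zeta> * norm \<eta>" by (rule norm_cauchy_schwarz)
  finally have "norm ?\<zeta> * (kmin * norm ?\<zeta>) \<le> norm ?\<zeta> * norm \<eta>" by (simp add: power2_eq_square mult_ac)
  then have "kmin * norm ?\<zeta> \<le> norm \<eta>"
    by (cases "norm ?\<zeta> = 0") (simp, metis mult_left_le_imp_le norm_ge_zero less_le)
  then show "norm ?\<zeta> \<le> norm \<eta> / kmin" using pos(1) by (simp add: field_simps)
  have kc: "?\<zeta> \<bullet> (k *v \<eta>) = \<eta> \<bullet> \<eta>"
  proof -
    have "?\<zeta> \<bullet> (k *v \<eta>) = (?\<zeta> v* k) \<bullet> \<eta>" by (rule dot_lmul_matrix[symmetric])
    also have "?\<zeta> v* k = transpose k *v ?\<zeta>" by simp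
    also have "\<dots> = \<eta>" unfolding sym by (rule E)
    finally show ?thesis .
  qed
  \<comment> \<open>The quadratic form of k at this vector is nonnegative. Expanding it, with the
    upper bound on k for the last term, yields the lower bound 1/kmax for the inverse.\<close>
  define \<xi> where "\<xi> = ?\<zeta> - (1 / kmax) *\<^sub>R \<eta>"
  have k\<xi>: "k *v \<xi> = \<eta> - (1 / kmax) *\<^sub>R (k *v \<eta>)"
    unfolding \<xi>_def by (simp add: matrix_vector_mult_diff_distrib matrix_vector_mult_scaleR E)
  have "0 \<le> kmin * (norm \<xi>)\<^sup>2" using pos(1) by simp
  also have "\<dots> \<le> \<xi> \<bullet> (k *v \<xi>)" using ell[of \<xi>] by blast
  also have "\<dots> = ?\<zeta> \<bullet> \<eta> - 2 * ((norm \<eta>)\<^sup>2 / kmax) + (\<eta> \<bullet> (k *v \<eta>)) / kmax\<^sup>2"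
    unfolding k\<xi> by (simp add: \<xi>_def inner_diff_left inner_diff_right kc power2_norm_eq_inner power2_eq_square[of kmax] diff_divide_distrib)
  also have "(\<eta> \<bullet> (k *v \<eta>)) / kmax\<^sup>2 \<le> (norm \<eta>)\<^sup>2 / kmax"
    using ell[of \<eta>] pos(2) by (simp add: field_simps power2_eq_square)
  finally show "(norm \<eta>)\<^sup>2 / kmax \<le> ?\<zeta> \<bullet> \<eta>" by simp
qed

lemma measurable_vec_lambda:
  fixes f :: "'a \<Rightarrow> real^'n"
  assumes "\<And>i. (\<lambda>x. f x $ i) \<in> borel_measurable M"
  shows "f \<in> borel_measurable M"
  by (rule borel_measurable_euclidean_space[THEN iffD2]) (use assms in \<open>auto simp: Basis_vec_def inner_axis\<close>)

lemma measurable_det: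
  fixes A :: "'a \<Rightarrow> real^'n^'n"
  assumes "\<And>i j. (\<lambda>x. A x $ i $ j) \<in> borel_measurable M"
  shows "(\<lambda>x. det (A x)) \<in> borel_measurable M"
  unfolding det_def
  by (intro borel_measurable_sum borel_measurable_times borel_measurable_const borel_measurable_prod assms)

lemma L2_matrix_inv:
  fixes k :: "real^'n \<Rightarrow> real^'n^'n"
  assumes S: "S \<in> sets lebesgue" and k: "k \<in> borel_measurable (lebesgue_on S)" and z: "L2_on S z"
    and pos: "kmin > 0" "kmax > 0"
    and sym: "\<And>x. x \<in> S \<Longrightarrow> transpose (k x) = k x"
    and ell: "\<And>x \<eta>. x \<in> S \<Longrightarrow> kmin * (norm \<eta>)\<^sup>2 \<le> \<eta> \<bullet> (k x *v \<eta>) \<and> \<eta> \<bullet> (k x *v \<eta>) \<le> kmax * (norm \<eta>)\<^sup>2"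
  shows "L2_on S (\<lambda>x. matrix_inv (k x) *v z x)"
    and "(L2_norm S z)\<^sup>2 / kmax \<le> L2_inner S (\<lambda>x. matrix_inv (k x) *v z x) z"
proof -
  note inv = matrix_inv_bounds[OF sym pos ell]
  have zm: "z \<in> borel_measurable (lebesgue_on S)" using z by (simp add: L2_on_def)
  have zi: "(\<lambda>x. z x $ i) \<in> borel_measurable (lebesgue_on S)" for i
    by (rule measurable_compose[OF zm borel_measurable_continuous_onI]) (intro continuous_intros)
  have ki: "(\<lambda>x. k x $ i $ j) \<in> borel_measurable (lebesgue_on S)" for i j
    by (rule measurable_compose[OF k borel_measurable_continuous_onI]) (intro continuous_intros)
  \<comment> \<open>Cramer's rule expresses the solution through determinants, that is, polynomials
    in measurable entries; this is the source of measurability.\<close>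
  define w where "w x = (\<chi> l. det (\<chi> i j. if j = l then z x $ i else k x $ i $ j) / det (k x))" for x
  have ki': "(\<lambda>x. (\<chi> i j. if j = l then z x $ i else k x $ i $ j) $ i' $ j') \<in> borel_measurable (lebesgue_on S)" for l i' j'
    using zi ki by (cases "j' = l") auto
  have "w \<in> borel_measurable (lebesgue_on S)"
    by (rule measurable_vec_lambda) (simp add: w_def, intro borel_measurable_divide measurable_det ki' ki)
  moreover have "matrix_inv (k x) *v z x = w x" if "x \<in> S" for x
    using cramer[OF inv(1)[OF that that], of "matrix_inv (k x) *v z x" "z x"] inv(2)[OF that that] by (simp add: w_def)
  ultimately have m: "(\<lambda>x. matrix_inv (k x) *v z x) \<in> borel_measurable (lebesgue_on S)"
    using measurable_cong[of "lebesgue_on S" "\<lambda>x. matrix_inv (k x) *v z x" w] by simp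
  have i: "integrable (lebesgue_on S) (\<lambda>x. (1 / kmin)\<^sup>2 * (norm (z x))\<^sup>2)" using z by (simp add: L2_on_def)
  have le: "(norm (matrix_inv (k x) *v z x))\<^sup>2 \<le> (1 / kmin)\<^sup>2 * (norm (z x))\<^sup>2" if "x \<in> S" for x
    using power_mono[OF inv(3)[OF that that, of "z x"] norm_ge_zero, of 2] by (simp add: power_divide)
  show L: "L2_on S (\<lambda>x. matrix_inv (k x) *v z x)"
    unfolding L2_on_def by (intro conjI m Bochner_Integration.integrable_bound[OF i] AE_I2) (use m le in auto)
  have "(LINT x|lebesgue_on S. (norm (z x))\<^sup>2 / kmax) \<le> (LINT x|lebesgue_on S. (matrix_inv (k x) *v z x) \<bullet> z x)"
  proof (rule integral_mono)
    show "integrable (lebesgue_on S) (\<lambda>x. (norm (z x))\<^sup>2 / kmax)" using z by (simp add: L2_on_def)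
    show "integrable (lebesgue_on S) (\<lambda>x. (matrix_inv (k x) *v z x) \<bullet> z x)" by (rule L2_inner_integrable[OF S L z])
  qed (use inv(4) in auto)
  then show "(L2_norm S z)\<^sup>2 / kmax \<le> L2_inner S (\<lambda>x. matrix_inv (k x) *v z x) z"
    by (simp add: L2_norm_sq_eq[OF S] L2_inner_def)
qed

context
  fixes \<Omega> :: "(real^'n) set"
  assumes \<Omega>: "open \<Omega>"
begin

lemma L2_inner_lincomb_AE:
  fixes f g h F :: "real^'n \<Rightarrow> 'b::euclidean_space"
  assumes L: "L2_on \<Omega> f" "L2_on \<Omega> g" "L2_on \<Omega> h" "L2_on \<Omega> F"
    and ae: "AE x in lebesgue_on \<Omega>. F x = f x + a *\<^sub>R g x"
  shows "L2_inner \<Omega> h F = L2_inner \<Omega> h f + a * L2_inner \<Omega> h g"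
  unfolding L2_inner_lincomb(1)[OF \<Omega>_sets[OF \<Omega>] L(1-3), symmetric]
  by (rule L2_inner_cong_AE[OF \<Omega>_sets[OF \<Omega>] L(3,3,4) L2_on_lincomb[OF \<Omega>_sets[OF \<Omega>] L(1,2)] _ ae]) simp

lemma L2_divergence: "v \<in> H1 \<Omega> \<Longrightarrow> L2_on \<Omega> (divergence \<Omega> v)"
  "v \<in> H1 \<Omega> \<Longrightarrow> L2_norm \<Omega> (divergence \<Omega> v) \<le> real CARD('n) * H1_norm \<Omega> v"
proof -
  assume v: "v \<in> H1 \<Omega>"
  note G = H1_L2(2)[OF \<Omega> v]
  show "L2_on \<Omega> (divergence \<Omega> v)" unfolding divergence_def[abs_def] by (rule L2_trace(1)[OF \<Omega>_sets[OF \<Omega>] G])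
  have "L2_norm \<Omega> (divergence \<Omega> v) \<le> real CARD('n) * L2_norm \<Omega> (weak_jacobian \<Omega> v)"
    unfolding divergence_def[abs_def] by (rule L2_trace(2)[OF \<Omega>_sets[OF \<Omega>] G])
  also have "\<dots> \<le> real CARD('n) * H1_norm \<Omega> v"
    unfolding H1_norm_def by (intro mult_left_mono real_le_rsqrt) auto
  finally show "L2_norm \<Omega> (divergence \<Omega> v) \<le> real CARD('n) * H1_norm \<Omega> v" .
qed

lemma L2_sym_grad: "v \<in> H1 \<Omega> \<Longrightarrow> L2_on \<Omega> (sym_grad \<Omega> v)"
proof -
  assume v: "v \<in> H1 \<Omega>"
  note G = H1_L2(2)[OF \<Omega> v]
  have "L2_on \<Omega> (\<lambda>x. transpose (weak_jacobian \<Omega> v x))"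
    by (intro L2_on_vecI) (simp add: transpose_def L2_component2[OF \<Omega> G])
  then show "L2_on \<Omega> (sym_grad \<Omega> v)"
    unfolding sym_grad_def[abs_def] by (intro L2_on_cmul[OF \<Omega>_sets[OF \<Omega>]] L2_on_add[OF \<Omega>_sets[OF \<Omega>]] G)
qed

lemma divergence_lincomb:
  assumes "u \<in> H1 \<Omega>" "v \<in> H1 \<Omega>"
  shows "AE x in lebesgue_on \<Omega>. divergence \<Omega> (\<lambda>x. u x + a *\<^sub>R v x) x = divergence \<Omega> u x + a *\<^sub>R divergence \<Omega> v x"
  using weak_jacobian_lincomb[OF \<Omega> assms, of a] by eventually_elim (simp add: divergence_def trace_lincomb)

lemma sym_grad_lincomb:
  assumes "u \<in> H1 \<Omega>" "v \<in> H1 \<Omega>"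
  shows "AE x in lebesgue_on \<Omega>. sym_grad \<Omega> (\<lambda>x. u x + a *\<^sub>R v x) x = sym_grad \<Omega> u x + a *\<^sub>R sym_grad \<Omega> v x"
  using weak_jacobian_lincomb[OF \<Omega> assms, of a]
  by eventually_elim (simp add: sym_grad_def transpose_def vec_eq_iff algebra_simps)

lemma L2_inner_divergence_lincomb:
  assumes "u \<in> H1 \<Omega>" "v \<in> H1 \<Omega>" "L2_on \<Omega> q"
  shows "L2_inner \<Omega> q (divergence \<Omega> (\<lambda>x. u x + a *\<^sub>R v x)) =
    L2_inner \<Omega> q (divergence \<Omega> u) + a * L2_inner \<Omega> q (divergence \<Omega> v)"
  by (rule L2_inner_lincomb_AE[OF L2_divergence(1) L2_divergence(1) _ L2_divergence(1) divergence_lincomb])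
    (use assms H1_lincomb[OF \<Omega>] in auto)

lemma elasticity_form_eq:
  assumes "u \<in> H1 \<Omega>" "v \<in> H1 \<Omega>"
  shows "elasticity_form \<Omega> lam mu u v =
    2 * mu * L2_inner \<Omega> (sym_grad \<Omega> u) (sym_grad \<Omega> v) + lam * L2_inner \<Omega> (divergence \<Omega> u) (divergence \<Omega> v)"
  using L2_inner_integrable[OF \<Omega>_sets[OF \<Omega>] L2_sym_grad[OF assms(1)] L2_sym_grad[OF assms(2)]]
    L2_inner_integrable[OF \<Omega>_sets[OF \<Omega>] L2_divergence(1)[OF assms(1)] L2_divergence(1)[OF assms(2)]]
  by (simp add: elasticity_form_def L2_inner_def)

lemma elasticity_form_lincomb:
  assumes u: "u \<in> H1 \<Omega>" and v: "v \<in> H1 \<Omega>" and w: "w \<in> H1 \<Omega>"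
  shows "elasticity_form \<Omega> lam mu u (\<lambda>x. v x + a *\<^sub>R w x) = elasticity_form \<Omega> lam mu u v + a * elasticity_form \<Omega> lam mu u w"
proof -
  note vw = H1_lincomb[OF \<Omega> v w, of a]
  have "L2_inner \<Omega> (sym_grad \<Omega> u) (sym_grad \<Omega> (\<lambda>x. v x + a *\<^sub>R w x)) =
    L2_inner \<Omega> (sym_grad \<Omega> u) (sym_grad \<Omega> v) + a * L2_inner \<Omega> (sym_grad \<Omega> u) (sym_grad \<Omega> w)"
    by (rule L2_inner_lincomb_AE[OF L2_sym_grad[OF v] L2_sym_grad[OF w] L2_sym_grad[OF u] L2_sym_grad[OF vw] sym_grad_lincomb[OF v w]])
  moreover have "L2_inner \<Omega> (divergence \<Omega> u) (divergence \<Omega> (\<lambda>x. v x + a *\<^sub>R w x)) =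
    L2_inner \<Omega> (divergence \<Omega> u) (divergence \<Omega> v) + a * L2_inner \<Omega> (divergence \<Omega> u) (divergence \<Omega> w)"
    by (rule L2_inner_divergence_lincomb[OF v w L2_divergence(1)[OF u]])
  ultimately show ?thesis by (simp add: elasticity_form_eq u v w vw algebra_simps)
qed

lemma H1_norm_lincomb_sq_le:
  assumes "u \<in> H1 \<Omega>" "v \<in> H1 \<Omega>"
  shows "(H1_norm \<Omega> (\<lambda>x. u x + a *\<^sub>R v x))\<^sup>2 \<le> 2 * (H1_norm \<Omega> u)\<^sup>2 + 2 * a\<^sup>2 * (H1_norm \<Omega> v)\<^sup>2"
proof -
  let ?U = "H1_norm \<Omega> u" and ?V = "\<bar>a\<bar> * H1_norm \<Omega> v"
  have "(H1_norm \<Omega> (\<lambda>x. u x + a *\<^sub>R v x))\<^sup>2 \<le> (?U + ?V)\<^sup>2"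
    by (intro power_mono H1_norm_lincomb_le[OF \<Omega> assms] H1_norm_sq(2)[OF \<Omega>])
  also have "\<dots> \<le> 2 * ?U\<^sup>2 + 2 * ?V\<^sup>2" using sum_squares_ge_zero[of "?U - ?V" 0] by (simp add: power2_eq_square algebra_simps)
  finally show ?thesis by (simp add: power_mult_distrib)
qed

text \<open>The one-sided bound is applied to the negative of v as well, written as v + (-2) v so
  that the rules for linear combinations apply.\<close>

lemma abs_elasticity_form_le:
  assumes cont: "\<And>u v. \<lbrakk>u \<in> H1 \<Omega>; v \<in> H1 \<Omega>\<rbrakk> \<Longrightarrow>
         elasticity_form \<Omega> lam mu u v \<le> Cc * H1_norm \<Omega> u * H1_norm \<Omega> v"
    and u: "u \<in> H1 \<Omega>" and v: "v \<in> H1 \<Omega>"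
  shows "\<bar>elasticity_form \<Omega> lam mu u v\<bar> \<le> Cc * H1_norm \<Omega> u * H1_norm \<Omega> v"
proof -
  let ?v = "\<lambda>x. v x + (-2) *\<^sub>R v x"
  have "(H1_norm \<Omega> ?v)\<^sup>2 = (H1_norm \<Omega> v)\<^sup>2"
    using H1_inner_self_lincomb[OF \<Omega> v v, of "-2"] by (simp add: H1_norm_sq(1)[OF \<Omega>])
  then have "H1_norm \<Omega> ?v = H1_norm \<Omega> v"
    using H1_norm_sq(2)[OF \<Omega>] by (meson power2_eq_imp_eq)
  moreover have "elasticity_form \<Omega> lam mu u ?v = - elasticity_form \<Omega> lam mu u v"
    unfolding elasticity_form_lincomb[OF u v v] by simp
  ultimately show ?thesis using cont[OF u v] cont[OF u H1_lincomb[OF \<Omega> v v, of "-2"]] by (simp add: abs_le_iff)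
qed

end

text \<open>U, D and P are norms, Z and J squared quantities. Of the coefficient Ck of
  \<open>U\<^sup>2\<close> two quarters pay for \<open>auw\<close> and \<open>duq\<close>; of 3/4
  \<beta> in front of \<open>P\<^sup>2\<close> a quarter of \<beta> pays for \<open>auw\<close>; of
  \<gamma> in front of \<open>dt\<^sup>2 * D\<^sup>2\<close> two quarters pay for \<open>duq\<close>
  and \<open>jpq\<close>; of J two quarters pay for \<open>pdw\<close> and \<open>jpq\<close>. The
  remainders are the bounds imposed on g.\<close>

lemma stability_algebra:
  fixes U Z D P J Ck C1 cJ CJ kmax n g dt \<beta> \<gamma> :: real
  assumes pos: "U \<ge> 0" "P \<ge> 0" "Z \<ge> 0" "J \<ge> 0" "dt > 0" "\<beta> > 0" "\<gamma> > 0" "C1 \<ge> 0"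
    and auu: "Ck * U\<^sup>2 \<le> auu" and auw: "\<bar>auw\<bar> \<le> C1 * U * P" and kzz: "Z / kmax \<le> kzz"
    and pdw: "pdw \<le> - (3/4) * P\<^sup>2 + cJ * J" and du: "\<bar>duq\<bar> \<le> n * U * D"
    and jq: "\<And>t. 0 \<le> J + 2 * t * jpq + t\<^sup>2 * jqq" and jqq: "jqq \<le> CJ * D\<^sup>2"
    and coef: "\<beta> * C1\<^sup>2 \<le> Ck / 4" "\<gamma> * n\<^sup>2 \<le> Ck / 4" "\<beta> * cJ \<le> 1/4" "\<gamma> * CJ \<le> 1/4"
    and g: "g \<le> Ck / 2" "g \<le> 1 / kmax" "g \<le> \<beta> / 2" "g \<le> \<gamma> / 2" "g \<le> 1/2"
  shows "g * (U\<^sup>2 + dt\<^sup>2 * D\<^sup>2 + dt * Z + P\<^sup>2 + J) \<le>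
    auu + \<beta> * auw + dt * kzz - \<beta> * pdw + \<gamma> * dt * duq + \<gamma> * dt\<^sup>2 * D\<^sup>2 + J + \<gamma> * dt * jpq"
proof -
  have 1: "- (\<beta> * P\<^sup>2 / 4) - Ck / 4 * U\<^sup>2 \<le> \<beta> * auw"
  proof -
    have "0 \<le> (P / 2 - C1 * U)\<^sup>2" by simp
    then have "C1 * U * P \<le> P\<^sup>2 / 4 + C1\<^sup>2 * U\<^sup>2" by (simp add: power2_eq_square algebra_simps)
    then have "- auw \<le> P\<^sup>2 / 4 + C1\<^sup>2 * U\<^sup>2" using auw by linarith
    then have "\<beta> * (- auw) \<le> \<beta> * (P\<^sup>2 / 4 + C1\<^sup>2 * U\<^sup>2)" using pos by (intro mult_left_mono) auto
    moreover have "\<beta> * C1\<^sup>2 * U\<^sup>2 \<le> Ck / 4 * U\<^sup>2" using coef(1) by (intro mult_right_mono) auto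
    ultimately show ?thesis by (simp add: algebra_simps)
  qed
  have 2: "3/4 * (\<beta> * P\<^sup>2) - J / 4 \<le> - (\<beta> * pdw)"
  proof -
    have "\<beta> * pdw \<le> \<beta> * (- (3/4) * P\<^sup>2 + cJ * J)" using pdw pos by (intro mult_left_mono) auto
    moreover have "\<beta> * cJ * J \<le> 1/4 * J" using coef(3) pos by (intro mult_right_mono) auto
    ultimately show ?thesis by (simp add: algebra_simps)
  qed
  have 3: "- (\<gamma> * (dt\<^sup>2 * D\<^sup>2) / 4) - Ck / 4 * U\<^sup>2 \<le> \<gamma> * dt * duq"
  proof -
    have "0 \<le> (dt * D / 2 - n * U)\<^sup>2" by simp
    then have "dt * (n * U * D) \<le> dt\<^sup>2 * D\<^sup>2 / 4 + n\<^sup>2 * U\<^sup>2" by (simp add: power2_eq_square algebra_simps)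
    moreover have "dt * (- duq) \<le> dt * (n * U * D)" using du pos by (intro mult_left_mono) auto
    ultimately have "\<gamma> * (dt * (- duq)) \<le> \<gamma> * (dt\<^sup>2 * D\<^sup>2 / 4 + n\<^sup>2 * U\<^sup>2)" using pos by (intro mult_left_mono) auto
    moreover have "\<gamma> * n\<^sup>2 * U\<^sup>2 \<le> Ck / 4 * U\<^sup>2" using coef(2) by (intro mult_right_mono) auto
    ultimately show ?thesis by (simp add: algebra_simps)
  qed
  have 4: "- (J / 4) - \<gamma> * (dt\<^sup>2 * D\<^sup>2) / 4 \<le> \<gamma> * dt * jpq"
  proof -
    have "(\<gamma> * dt)\<^sup>2 * jqq \<le> (\<gamma> * dt)\<^sup>2 * (CJ * D\<^sup>2)" using jqq by (intro mult_left_mono) auto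
    also have "\<dots> = (\<gamma> * CJ) * (\<gamma> * (dt\<^sup>2 * D\<^sup>2))" by (simp add: power2_eq_square)
    also have "\<dots> \<le> 1/4 * (\<gamma> * (dt\<^sup>2 * D\<^sup>2))" using coef(4) pos by (intro mult_right_mono) auto
    finally have "(\<gamma> * dt)\<^sup>2 * jqq \<le> \<gamma> * (dt\<^sup>2 * D\<^sup>2) / 4" by simp
    \<comment> \<open>The parameter 2 \<gamma> dt, after division by 4, takes exactly a quarter of
      J.\<close>
    moreover have "0 \<le> J + 2 * (2 * \<gamma> * dt) * jpq + 4 * ((\<gamma> * dt)\<^sup>2 * jqq)"
      using jq[of "2 * \<gamma> * dt"] by (simp add: power_mult_distrib)
    ultimately show ?thesis by (simp add: algebra_simps)
  qed
  have 5: "dt * (Z / kmax) \<le> dt * kzz" using kzz pos by (intro mult_left_mono) auto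
  have "g * U\<^sup>2 \<le> Ck / 2 * U\<^sup>2" "g * (dt * Z) \<le> 1 / kmax * (dt * Z)" "g * P\<^sup>2 \<le> \<beta> / 2 * P\<^sup>2"
    "g * (dt\<^sup>2 * D\<^sup>2) \<le> \<gamma> / 2 * (dt\<^sup>2 * D\<^sup>2)" "g * J \<le> 1/2 * J"
    using g pos by (intro mult_right_mono; simp)+
  with 1 2 3 4 5 auu show ?thesis by (simp add: distrib_left mult.assoc)
qed

section \<open>Stability of the discrete problem\<close>

lemma weighted_sum_le:
  fixes V E F Q S U P J b c d :: real
  assumes "V \<le> 2 * U + 2 * b" "Q \<le> 2 * P + 2 * c" "S \<le> 2 * J + 2 * d"
    and "0 \<le> U" "0 \<le> E" "0 \<le> F" "0 \<le> P" "0 \<le> J"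
  shows "V + E + F + Q + S \<le> 3 * (U + E + F + P + J) + 2 * b + 2 * c + 2 * d"
  using assms by (simp add: distrib_left)

context mesh_domain
begin

lemma Q_h_pwc: "q \<in> Q_h \<Omega> \<Gamma>N \<Gamma>P T \<Longrightarrow> pwc q"
  unfolding Q_h_def pwc_def by blast

lemma Q_h_lincomb:
  assumes p: "p \<in> Q_h \<Omega> \<Gamma>N \<Gamma>P T" and q: "q \<in> Q_h \<Omega> \<Gamma>N \<Gamma>P T"
  shows "(\<lambda>x. p x + a * q x) \<in> Q_h \<Omega> \<Gamma>N \<Gamma>P T"
proof -
  have one: "L2_on \<Omega> (\<lambda>x. 1 :: real)" by (rule L2_onI_bounded[OF S\<Omega> bounded\<Omega>, where B=1]) auto
  have i: "integrable (lebesgue_on \<Omega>) f" if "pwc f" for f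
    using L2_inner_integrable[OF S\<Omega> pwc_L2[OF that] one] by simp
  have "(LINT x|lebesgue_on \<Omega>. p x + a * q x) = (LINT x|lebesgue_on \<Omega>. p x) + a * (LINT x|lebesgue_on \<Omega>. q x)"
    using i[OF Q_h_pwc[OF p]] i[OF Q_h_pwc[OF q]] by simp
  then have "\<Gamma>N \<union> \<Gamma>P = {} \<longrightarrow> (LINT x|lebesgue_on \<Omega>. p x + a * q x) = 0"
    using p q unfolding Q_h_def by simp
  then show ?thesis
    using pwc_lincomb[OF Q_h_pwc[OF p] Q_h_pwc[OF q], of a] unfolding Q_h_def pwc_def by blast
qed

lemma WE_h_lincomb:
  assumes "v \<in> WE_h \<Omega> \<Gamma>D T" "v' \<in> WE_h \<Omega> \<Gamma>D T"
  shows "(\<lambda>x. v x + a *\<^sub>R v' x) \<in> WE_h \<Omega> \<Gamma>D T"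
  using assms P1_lincomb[of v v' a] unfolding WE_h_def by auto

lemma WD_h_lincomb:
  assumes "v \<in> WD_h \<Omega> \<Gamma>F T" "v' \<in> WD_h \<Omega> \<Gamma>F T"
  shows "(\<lambda>x. v x + a *\<^sub>R v' x) \<in> WD_h \<Omega> \<Gamma>F T"
  using assms P1_lincomb[of v v' a] unfolding WD_h_def by (auto simp: inner_add_left)

lemma WE_h_H1: "v \<in> WE_h \<Omega> \<Gamma>D T \<Longrightarrow> v \<in> H1 \<Omega>" and WD_h_H1: "w \<in> WD_h \<Omega> \<Gamma>F T \<Longrightarrow> w \<in> H1 \<Omega>"
  using P1_H1 by (auto simp: WE_h_def WD_h_def)

lemma B_h_lincomb:
  assumes u: "u \<in> H1 \<Omega>" and kz: "L2_on \<Omega> (\<lambda>x. matrix_inv (k x) *v z x)" and z: "z \<in> H1 \<Omega>" and p: "pwc p"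
    and v: "v \<in> H1 \<Omega>" "v' \<in> H1 \<Omega>" and w: "w \<in> H1 \<Omega>" "w' \<in> H1 \<Omega>" and q: "pwc q" "pwc q'"
  shows "B_h \<Omega> lam mu k T \<delta> dt (u, z, p) (\<lambda>x. v x + a *\<^sub>R v' x, \<lambda>x. w x + a *\<^sub>R w' x, \<lambda>x. q x + a * q' x) =
    B_h \<Omega> lam mu k T \<delta> dt (u, z, p) (v, w, q) + a * B_h \<Omega> lam mu k T \<delta> dt (u, z, p) (v', w', q')"
proof -
  note Lw = H1_L2(1)[OF open\<Omega> w(1)] H1_L2(1)[OF open\<Omega> w(2)]
  note Lq = L2_inner_lincomb(1)[OF S\<Omega> pwc_L2[OF q(1)] pwc_L2[OF q(2)], unfolded real_scaleR_def]
  show ?thesis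
    unfolding B_h.simps elasticity_form_lincomb[OF open\<Omega> u v] L2_inner_lincomb(1)[OF S\<Omega> Lw kz]
      L2_inner_divergence_lincomb[OF open\<Omega> v pwc_L2[OF p]] L2_inner_divergence_lincomb[OF open\<Omega> w pwc_L2[OF p]]
      Lq[OF L2_divergence(1)[OF open\<Omega> u]] Lq[OF L2_divergence(1)[OF open\<Omega> z]] J_form_lincomb[OF p q]
    by (simp add: algebra_simps)
qed

lemma norm_A_sq:
  assumes "dt > 0" "\<delta> > 0"
  shows "(norm_A \<Omega> T \<delta> dt (v, w, q))\<^sup>2 = (H1_norm \<Omega> v)\<^sup>2 + dt\<^sup>2 * (L2_norm \<Omega> (divergence \<Omega> w))\<^sup>2
    + dt * (L2_norm \<Omega> w)\<^sup>2 + (L2_norm \<Omega> q)\<^sup>2 + J_form \<Omega> T \<delta> q q"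
  using assms J_form_nonneg[of \<delta> q] by (simp add: J_seminorm_def)

lemma norm_A_nonneg: "dt > 0 \<Longrightarrow> 0 \<le> norm_A \<Omega> T \<delta> dt Y"
  by (cases Y) simp

text \<open>Besides coercivity and the size of the test state, the last conclusion excludes a
  vanishing denominator: a test state of norm 0 occurs only for a state of norm 0.\<close>

lemma stability:
  fixes \<beta> \<gamma> g cJ CJ c' Cc Ck kmax dt \<delta> :: real
  assumes X: "u \<in> WE_h \<Omega> \<Gamma>D T" "z \<in> WD_h \<Omega> \<Gamma>F T" "p \<in> Q_h \<Omega> \<Gamma>N \<Gamma>P T"
    and \<Gamma>D: "\<Gamma>D \<subseteq> frontier \<Omega>" and \<Gamma>F: "\<Gamma>N \<union> \<Gamma>P = {} \<Longrightarrow> frontier \<Omega> \<subseteq> \<Gamma>F"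
    and dt: "dt > 0" and \<delta>: "\<delta> > 0"
    and cont: "Cc > 0" "\<And>u v. \<lbrakk>u \<in> H1 \<Omega>; v \<in> H1 \<Omega>\<rbrakk> \<Longrightarrow>
         elasticity_form \<Omega> lam mu u v \<le> Cc * H1_norm \<Omega> u * H1_norm \<Omega> v"
    and korn: "\<And>v. v \<in> W_E \<Omega> \<Gamma>D \<Longrightarrow> elasticity_form \<Omega> lam mu v v \<ge> Ck * (H1_norm \<Omega> v)\<^sup>2"
    and kinv: "L2_on \<Omega> (\<lambda>x. matrix_inv (k x) *v z x)"
      "(L2_norm \<Omega> z)\<^sup>2 / kmax \<le> L2_inner \<Omega> (\<lambda>x. matrix_inv (k x) *v z x) z"
    and v: "v \<in> H10 \<Omega>" "AE x in lebesgue_on \<Omega>. divergence \<Omega> v x = - p x"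
    and w: "w \<in> P1_space \<Omega> T" "w \<in> H10 \<Omega>" "H1_norm \<Omega> w \<le> c' * L2_norm \<Omega> p"
    and cons: "\<bar>L2_inner \<Omega> p (divergence \<Omega> (\<lambda>x. v x + (-1) *\<^sub>R w x))\<bar> \<le> cJ * J_form \<Omega> T \<delta> p p + (L2_norm \<Omega> p)\<^sup>2 / 4"
    and inv: "\<And>q. pwc q \<Longrightarrow> J_form \<Omega> T \<delta> q q \<le> CJ * (L2_norm \<Omega> q)\<^sup>2" "CJ \<ge> 0"
    and pos: "\<beta> > 0" "\<gamma> > 0"
    and coef: "\<beta> * (Cc * \<bar>c'\<bar>)\<^sup>2 \<le> Ck / 4" "\<gamma> * (real CARD('n))\<^sup>2 \<le> Ck / 4" "\<beta> * cJ \<le> 1/4" "\<gamma> * CJ \<le> 1/4"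
    and g: "g \<le> Ck / 2" "g \<le> 1 / kmax" "g \<le> \<beta> / 2" "g \<le> \<gamma> / 2" "g \<le> 1/2"
  obtains Y where "Y \<in> V_h \<Omega> \<Gamma>D \<Gamma>N \<Gamma>P \<Gamma>F T"
    "g * (norm_A \<Omega> T \<delta> dt (u, z, p))\<^sup>2 \<le> B_h \<Omega> lam mu k T \<delta> dt (u, z, p) Y"
    "(norm_A \<Omega> T \<delta> dt Y)\<^sup>2 \<le> (3 + 2 * (\<beta>\<^sup>2 * c'\<^sup>2) + 2 * \<gamma>\<^sup>2 + 2 * (\<gamma>\<^sup>2 * CJ)) * (norm_A \<Omega> T \<delta> dt (u, z, p))\<^sup>2"
    "norm_A \<Omega> T \<delta> dt Y = 0 \<Longrightarrow> norm_A \<Omega> T \<delta> dt (u, z, p) = 0"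
proof -
  define q0 where "q0 x = trace (P1grad z x)" for x
  define t where "t = \<gamma> * dt"
  have zP: "z \<in> P1_space \<Omega> T" using X(2) by (simp add: WD_h_def)
  note uH = WE_h_H1[OF X(1)] and zH = WD_h_H1[OF X(2)] and wH = P1_H1[OF w(1)] and pp = Q_h_pwc[OF X(3)]
  note pL = pwc_L2[OF pp] and vH = H10_H1[OF v(1)]
  have q0p: "pwc q0" unfolding q0_def[abs_def] by (rule pwc_trace)
  note q0L = pwc_L2[OF q0p]
  \<comment> \<open>If the pressure space is constrained, the whole boundary belongs to \<Gamma>F,
    so z has no normal component there and its divergence has mean value zero.\<close>
  have q0Q: "q0 \<in> Q_h \<Omega> \<Gamma>N \<Gamma>P T"
  proof -
    have "(LINT x|lebesgue_on \<Omega>. q0 x) = 0" if "\<Gamma>N \<union> \<Gamma>P = {}"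
    proof -
      have "z x \<bullet> \<nu> = 0" if "x \<in> frontier \<Omega>" "outward_normal \<Omega> x \<nu>" for x \<nu>
        using X(2) \<Gamma>F[OF \<open>\<Gamma>N \<union> \<Gamma>P = {}\<close>] that unfolding WD_h_def by blast
      then have "(LINT x|lebesgue. q0 x) = 0" unfolding q0_def by (rule integral_P1_divergence[OF zP])
      moreover have "q0 x = 0" if "x \<notin> \<Omega>" for x
        using pwc_zero[OF q0p, of x] interior_subset_\<Omega> that by blast
      ultimately show ?thesis using integral_lebesgue_on_zero_outside(1)[OF S\<Omega>, of q0] by simp
    qed
    then show ?thesis using q0p unfolding Q_h_def pwc_def by blast
  qed
  have divz: "AE x in lebesgue_on \<Omega>. divergence \<Omega> z x = q0 x" unfolding q0_def by (rule P1_divergence[OF zP])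
  note dzL = L2_divergence(1)[OF open\<Omega> zH] and duL = L2_divergence(1)[OF open\<Omega> uH]
  define U where "U = H1_norm \<Omega> u"
  define P where "P = L2_norm \<Omega> p"
  define D where "D = L2_norm \<Omega> (divergence \<Omega> z)"
  define Z where "Z = (L2_norm \<Omega> z)\<^sup>2"
  define J where "J = J_form \<Omega> T \<delta> p p"
  define jpq where "jpq = J_form \<Omega> T \<delta> p q0"
  define jqq where "jqq = J_form \<Omega> T \<delta> q0 q0"
  have nn: "U \<ge> 0" "P \<ge> 0" "Z \<ge> 0" "J \<ge> 0" "jqq \<ge> 0" "D \<ge> 0"
    using \<delta> by (auto simp: U_def P_def Z_def J_def jqq_def D_def H1_norm_sq(2)[OF open\<Omega>] L2_norm_nonneg(2)[OF S\<Omega>] J_form_nonneg)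
  have dq: "L2_inner \<Omega> (divergence \<Omega> z) q0 = D\<^sup>2" "(L2_norm \<Omega> q0)\<^sup>2 = D\<^sup>2"
  proof -
    have "L2_inner \<Omega> (divergence \<Omega> z) (divergence \<Omega> z) = L2_inner \<Omega> (divergence \<Omega> z) q0"
      by (rule L2_inner_cong_AE[OF S\<Omega> dzL dzL dzL q0L _ divz]) simp
    moreover have "L2_inner \<Omega> (divergence \<Omega> z) (divergence \<Omega> z) = L2_inner \<Omega> q0 q0"
      by (rule L2_inner_cong_AE[OF S\<Omega> dzL q0L dzL q0L divz divz])
    ultimately show "L2_inner \<Omega> (divergence \<Omega> z) q0 = D\<^sup>2" "(L2_norm \<Omega> q0)\<^sup>2 = D\<^sup>2"
      by (simp_all add: D_def L2_norm_nonneg(3)[OF S\<Omega>])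
  qed
  have Jt: "J_form \<Omega> T \<delta> (\<lambda>x. p x + s * q0 x) (\<lambda>x. p x + s * q0 x) = J + 2 * s * jpq + s\<^sup>2 * jqq" for s
  proof -
    have l: "J_form \<Omega> T \<delta> f (\<lambda>x. p x + s * q0 x) = J_form \<Omega> T \<delta> f p + s * J_form \<Omega> T \<delta> f q0" if "pwc f" for f
      by (rule J_form_lincomb[OF that pp q0p])
    show ?thesis
      unfolding l[OF pwc_lincomb[OF pp q0p]] J_form_commute[of \<delta> "\<lambda>x. p x + s * q0 x"] l[OF pp] l[OF q0p]
        J_form_commute[of \<delta> q0 p]
      by (simp add: J_def jpq_def jqq_def algebra_simps power2_eq_square)
  qed
  have jt: "0 \<le> J + 2 * s * jpq + s\<^sup>2 * jqq" for s
    unfolding Jt[symmetric] using \<delta> by (intro J_form_nonneg) simp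
  have jqq: "jqq \<le> CJ * D\<^sup>2" using inv(1)[OF q0p] by (simp add: jqq_def dq)
  have wP: "H1_norm \<Omega> w \<le> \<bar>c'\<bar> * P"
    using w(3) mult_right_mono[OF abs_ge_self[of c'] nn(2)] unfolding P_def[symmetric] by linarith
  have wP2: "(H1_norm \<Omega> w)\<^sup>2 \<le> c'\<^sup>2 * P\<^sup>2"
    using power_mono[OF wP H1_norm_sq(2)[OF open\<Omega>], of 2] by (simp add: power_mult_distrib)
  let ?y = "\<lambda>x. u x + \<beta> *\<^sub>R w x" and ?q = "\<lambda>x. p x + t * q0 x"
  have wE: "w \<in> WE_h \<Omega> \<Gamma>D T"
    using w(1) P1_H10_zero[OF w(1,2)] \<Gamma>D unfolding WE_h_def by blast
  have Y: "(?y, z, ?q) \<in> V_h \<Omega> \<Gamma>D \<Gamma>N \<Gamma>P \<Gamma>F T"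
    unfolding V_h_def using WE_h_lincomb[OF X(1) wE] Q_h_lincomb[OF X(3) q0Q] X(2) by blast
  have auw: "\<bar>elasticity_form \<Omega> lam mu u w\<bar> \<le> (Cc * \<bar>c'\<bar>) * U * P"
  proof -
    have "\<bar>elasticity_form \<Omega> lam mu u w\<bar> \<le> Cc * U * H1_norm \<Omega> w"
      unfolding U_def by (rule abs_elasticity_form_le[OF open\<Omega> cont(2) uH wH])
    also have "\<dots> \<le> Cc * U * (\<bar>c'\<bar> * P)" using wP cont(1) nn(1) by (intro mult_left_mono) auto
    finally show ?thesis by (simp add: mult_ac)
  qed
  \<comment> \<open>With div v = -p the pairing of p with div v equals \<open>- P\<^sup>2\<close>.
    Replacing v by w costs the consistency error, whose share \<open>P\<^sup>2 / 4\<close> is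
    absorbed here.\<close>
  have pdw: "L2_inner \<Omega> p (divergence \<Omega> w) \<le> - (3/4) * P\<^sup>2 + cJ * J"
  proof -
    have "L2_inner \<Omega> p (divergence \<Omega> v) = L2_inner \<Omega> p (\<lambda>x. (-1) *\<^sub>R p x)"
      by (rule L2_inner_cong_AE[OF S\<Omega> pL pL L2_divergence(1)[OF open\<Omega> vH] L2_on_cmul[OF S\<Omega> pL]]) (use v(2) in auto)
    also have "\<dots> = - P\<^sup>2" unfolding P_def L2_norm_nonneg(3)[OF S\<Omega>] by (simp add: L2_inner_def)
    finally show ?thesis
      using cons unfolding L2_inner_divergence_lincomb[OF open\<Omega> vH wH pL] J_def[symmetric] P_def[symmetric] by linarith
  qed
  have du: "\<bar>L2_inner \<Omega> (divergence \<Omega> u) q0\<bar> \<le> real CARD('n) * U * D"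
  proof -
    have "L2_norm \<Omega> q0 = D" using dq(2) nn(6) L2_norm_nonneg(2)[OF S\<Omega>] by (meson power2_eq_imp_eq)
    then have "\<bar>L2_inner \<Omega> (divergence \<Omega> u) q0\<bar> \<le> L2_norm \<Omega> (divergence \<Omega> u) * D"
      using L2_Cauchy_Schwarz[OF S\<Omega> duL q0L] by simp
    also have "\<dots> \<le> (real CARD('n) * U) * D"
      unfolding U_def by (intro mult_right_mono L2_divergence(2)[OF open\<Omega> uH] nn(6))
    finally show ?thesis .
  qed
  have auu: "Ck * U\<^sup>2 \<le> elasticity_form \<Omega> lam mu u u" unfolding U_def by (rule korn[OF P1_W_E[OF X(1) \<Gamma>D]])
  have NX: "(norm_A \<Omega> T \<delta> dt (u, z, p))\<^sup>2 = U\<^sup>2 + dt\<^sup>2 * D\<^sup>2 + dt * Z + P\<^sup>2 + J"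
    unfolding norm_A_sq[OF dt \<delta>] U_def D_def Z_def P_def J_def ..
  have NY: "(norm_A \<Omega> T \<delta> dt (?y, z, ?q))\<^sup>2 = (H1_norm \<Omega> ?y)\<^sup>2 + dt\<^sup>2 * D\<^sup>2 + dt * Z + (L2_norm \<Omega> ?q)\<^sup>2 + (J + 2 * t * jpq + t\<^sup>2 * jqq)"
    unfolding norm_A_sq[OF dt \<delta>] D_def Z_def Jt[symmetric] ..
  \<comment> \<open>The mixed terms between p and the divergences of u and z cancel by skew symmetry
    when the state is tested with itself.\<close>
  have B: "B_h \<Omega> lam mu k T \<delta> dt (u, z, p) (?y, z, ?q) =
      elasticity_form \<Omega> lam mu u u + \<beta> * elasticity_form \<Omega> lam mu u w
      + dt * L2_inner \<Omega> (\<lambda>x. matrix_inv (k x) *v z x) z - \<beta> * L2_inner \<Omega> p (divergence \<Omega> w)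
      + \<gamma> * dt * L2_inner \<Omega> (divergence \<Omega> u) q0 + \<gamma> * dt\<^sup>2 * D\<^sup>2 + J + \<gamma> * dt * jpq"
  proof -
    note Lq = L2_inner_lincomb(1)[OF S\<Omega> pL q0L, unfolded real_scaleR_def]
    show ?thesis
      unfolding B_h.simps elasticity_form_lincomb[OF open\<Omega> uH uH wH] L2_inner_divergence_lincomb[OF open\<Omega> uH wH pL]
        Lq[OF duL] Lq[OF dzL] J_form_lincomb[OF pp pp q0p] dq(1)
        L2_inner_commute[OF S\<Omega>, of p "divergence \<Omega> u"] L2_inner_commute[OF S\<Omega>, of p "divergence \<Omega> z"]
        J_def[symmetric] jpq_def[symmetric] t_def
      by (simp add: algebra_simps power2_eq_square)
  qed
  have dD: "t\<^sup>2 * D\<^sup>2 = \<gamma>\<^sup>2 * (dt\<^sup>2 * D\<^sup>2)" by (simp add: t_def power_mult_distrib)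
  have tj: "t\<^sup>2 * jqq \<le> (\<gamma>\<^sup>2 * CJ) * (dt\<^sup>2 * D\<^sup>2)"
    using mult_left_mono[OF jqq, of "t\<^sup>2"] by (simp add: t_def power_mult_distrib mult_ac)
  have n0: "0 \<le> dt\<^sup>2 * D\<^sup>2" "0 \<le> dt * Z" "0 \<le> U\<^sup>2" "0 \<le> P\<^sup>2" using dt nn by auto
  have bb: "0 \<le> \<beta>\<^sup>2 * c'\<^sup>2" "0 \<le> \<gamma>\<^sup>2" "0 \<le> \<gamma>\<^sup>2 * CJ" using inv(2) by auto
  have bw: "\<beta>\<^sup>2 * (H1_norm \<Omega> w)\<^sup>2 \<le> (\<beta>\<^sup>2 * c'\<^sup>2) * P\<^sup>2"
    using mult_left_mono[OF wP2, of "\<beta>\<^sup>2"] by (simp add: mult_ac)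
  show ?thesis
  proof (rule that[OF Y])
    show "g * (norm_A \<Omega> T \<delta> dt (u, z, p))\<^sup>2 \<le> B_h \<Omega> lam mu k T \<delta> dt (u, z, p) (?y, z, ?q)"
      unfolding NX B
      by (rule stability_algebra[OF nn(1-4) dt pos _ auu auw _ pdw du jt jqq coef g])
        (use kinv(2) cont(1) in \<open>auto simp: Z_def\<close>)
    have 1: "(H1_norm \<Omega> ?y)\<^sup>2 \<le> 2 * U\<^sup>2 + 2 * ((\<beta>\<^sup>2 * c'\<^sup>2) * P\<^sup>2)"
      using H1_norm_lincomb_sq_le[OF open\<Omega> uH wH, of \<beta>] bw unfolding U_def by linarith
    have 2: "(L2_norm \<Omega> ?q)\<^sup>2 \<le> 2 * P\<^sup>2 + 2 * (\<gamma>\<^sup>2 * (dt\<^sup>2 * D\<^sup>2))"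
      using L2_norm_lincomb_sq_le[OF S\<Omega> pL q0L, of t] unfolding dq(2) P_def[symmetric] dD[symmetric] by simp
    \<comment> \<open>Nonnegativity at -t bounds the mixed term by the two squares.\<close>
    have 3: "J + 2 * t * jpq + t\<^sup>2 * jqq \<le> 2 * J + 2 * ((\<gamma>\<^sup>2 * CJ) * (dt\<^sup>2 * D\<^sup>2))"
      using jt[of "- t"] tj by simp
    let ?N = "U\<^sup>2 + dt\<^sup>2 * D\<^sup>2 + dt * Z + P\<^sup>2 + J"
    have "(\<beta>\<^sup>2 * c'\<^sup>2) * P\<^sup>2 \<le> (\<beta>\<^sup>2 * c'\<^sup>2) * ?N" "\<gamma>\<^sup>2 * (dt\<^sup>2 * D\<^sup>2) \<le> \<gamma>\<^sup>2 * ?N"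
      "(\<gamma>\<^sup>2 * CJ) * (dt\<^sup>2 * D\<^sup>2) \<le> (\<gamma>\<^sup>2 * CJ) * ?N"
      using n0 nn(4) bb by (intro mult_left_mono; linarith)+
    moreover have "(H1_norm \<Omega> ?y)\<^sup>2 + dt\<^sup>2 * D\<^sup>2 + dt * Z + (L2_norm \<Omega> ?q)\<^sup>2 + (J + 2 * t * jpq + t\<^sup>2 * jqq) \<le>
      3 * ?N + 2 * ((\<beta>\<^sup>2 * c'\<^sup>2) * P\<^sup>2) + 2 * (\<gamma>\<^sup>2 * (dt\<^sup>2 * D\<^sup>2)) + 2 * ((\<gamma>\<^sup>2 * CJ) * (dt\<^sup>2 * D\<^sup>2))"
      by (rule weighted_sum_le[OF 1 2 3 n0(3,1,2,4) nn(4)])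
    moreover have "(3 + 2 * (\<beta>\<^sup>2 * c'\<^sup>2) + 2 * \<gamma>\<^sup>2 + 2 * (\<gamma>\<^sup>2 * CJ)) * ?N =
      3 * ?N + 2 * ((\<beta>\<^sup>2 * c'\<^sup>2) * ?N) + 2 * (\<gamma>\<^sup>2 * ?N) + 2 * ((\<gamma>\<^sup>2 * CJ) * ?N)"
      by (simp only: distrib_right mult.assoc)
    ultimately show "(norm_A \<Omega> T \<delta> dt (?y, z, ?q))\<^sup>2 \<le> (3 + 2 * (\<beta>\<^sup>2 * c'\<^sup>2) + 2 * \<gamma>\<^sup>2 + 2 * (\<gamma>\<^sup>2 * CJ)) * (norm_A \<Omega> T \<delta> dt (u, z, p))\<^sup>2"
      unfolding NX NY by linarith
    \<comment> \<open>All five squares of the test state vanish. In particular D = 0, so t q_0 has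
      norm 0 and P = 0; hence w has norm 0 as well, and U = 0.\<close>
    assume "norm_A \<Omega> T \<delta> dt (?y, z, ?q) = 0"
    then have "(norm_A \<Omega> T \<delta> dt (?y, z, ?q))\<^sup>2 = 0" by simp
    note 0 = this[unfolded NY]
    have s0: "0 \<le> (H1_norm \<Omega> ?y)\<^sup>2" "0 \<le> (L2_norm \<Omega> ?q)\<^sup>2" by simp_all
    have z: "(H1_norm \<Omega> ?y)\<^sup>2 = 0" "dt\<^sup>2 * D\<^sup>2 = 0" "dt * Z = 0" "(L2_norm \<Omega> ?q)\<^sup>2 = 0" "J + 2 * t * jpq + t\<^sup>2 * jqq = 0"
      using 0 s0 n0 jt[of t] by linarith+
    have qq: "L2_on \<Omega> ?q" by (rule pwc_L2[OF pwc_lincomb[OF pp q0p]])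
    have "(L2_norm \<Omega> (\<lambda>x. ?q x + (- t) *\<^sub>R q0 x))\<^sup>2 \<le> 2 * (L2_norm \<Omega> ?q)\<^sup>2 + 2 * (- t)\<^sup>2 * (L2_norm \<Omega> q0)\<^sup>2"
      by (rule L2_norm_lincomb_sq_le[OF S\<Omega> qq q0L])
    then have "P\<^sup>2 \<le> 2 * (t\<^sup>2 * D\<^sup>2)" using z(4) by (simp add: P_def dq(2))
    then have P0: "P\<^sup>2 = 0" unfolding dD z(2) using n0(4) by simp
    have "(\<lambda>x. ?y x + (- \<beta>) *\<^sub>R w x) = u" by simp
    then have "U\<^sup>2 \<le> 2 * (H1_norm \<Omega> ?y)\<^sup>2 + 2 * (- \<beta>)\<^sup>2 * (H1_norm \<Omega> w)\<^sup>2"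
      using H1_norm_lincomb_sq_le[OF open\<Omega> H1_lincomb[OF open\<Omega> uH wH, of \<beta>] wH, of "- \<beta>"] by (simp add: U_def)
    then have "U\<^sup>2 \<le> 2 * (H1_norm \<Omega> ?y)\<^sup>2 + 2 * (\<beta>\<^sup>2 * (H1_norm \<Omega> w)\<^sup>2)" by (simp add: mult.assoc)
    moreover have "\<beta>\<^sup>2 * (H1_norm \<Omega> w)\<^sup>2 \<le> 0" using bw unfolding P0 by simp
    ultimately have "U\<^sup>2 \<le> 0" using z(1) by linarith
    moreover have "J \<le> 0"
    proof -
      have "t\<^sup>2 * jqq \<le> 0" using tj z(2) by simp
      \<comment> \<open>Nonnegativity at 2t, together with the value 0 at t, forces J to be at most
        twice \<open>t\<^sup>2 * jqq\<close>.\<close>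
      moreover have "0 \<le> J + 4 * t * jpq + 4 * (t\<^sup>2 * jqq)" using jt[of "2 * t"] by (simp add: power_mult_distrib)
      ultimately show ?thesis using z(5) by linarith
    qed
    ultimately have "(norm_A \<Omega> T \<delta> dt (u, z, p))\<^sup>2 = 0" unfolding NX using z(2,3) P0 n0 nn(4) by linarith
    then show "norm_A \<Omega> T \<delta> dt (u, z, p) = 0" by simp
  qed
qed

end

lemma mesh_domainI:
  fixes \<Omega> :: "(real^'n) set"
  assumes "mesh \<Omega> T" "quasi_uniform \<sigma> T" "\<sigma> > 0" "open \<Omega>" "bounded \<Omega>" "\<Omega> \<noteq> {}" "CARD('n) \<ge> 2"
  shows "mesh_domain T (mesh_size T) (\<sigma> * mesh_size T) \<Omega>" "mesh_size T > 0"
proof -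
  note m = assms(1)[unfolded mesh_def]
  note m' = m[THEN conjunct2, THEN conjunct2]
  note T = m[THEN conjunct1] m[THEN conjunct2, THEN conjunct1] m'[THEN conjunct2, THEN conjunct1]
    m'[THEN conjunct2, THEN conjunct2]
  note disj = m'[THEN conjunct1]
  note sim = bspec[OF T(2)]
  have d: "diameter K \<le> mesh_size T" if "K \<in> T" for K
    unfolding mesh_size_def using T(1) that by (intro Max_ge) auto
  have "closure \<Omega> \<noteq> {}" using assms(6) by simp
  then have "T \<noteq> {}" unfolding T(3)[symmetric] by blast
  then obtain K where K: "K \<in> T" by blast
  obtain x where x: "x \<in> interior K" using simplex_interior(1)[OF sim[OF K]] by blast
  \<comment> \<open>Two distinct points of one element show that the mesh size is positive.\<close>
  obtain r where r: "r > 0" "x + r *\<^sub>R axis undefined 1 \<in> interior K"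
    by (rule open_shift[OF open_interior x, of "axis undefined 1"]) auto
  have "dist x (x + r *\<^sub>R axis undefined 1) \<le> diameter K"
    using r(2) x interior_subset[of K] compact_imp_bounded[OF simplex_interior(4)[OF sim[OF K]]]
    by (intro diameter_bounded_bound) auto
  then show h: "mesh_size T > 0" using r(1) d[OF K] by (simp add: dist_norm)
  show "mesh_domain T (mesh_size T) (\<sigma> * mesh_size T) \<Omega>"
  proof unfold_locales
    show "\<exists>z. cball z (\<sigma> * mesh_size T) \<subseteq> K" if "K \<in> T" for K
      using assms(2) that unfolding quasi_uniform_def by blast
    show "interior K \<inter> interior K' = {}" if "K \<in> T" "K' \<in> T" "K \<noteq> K'" for K K' using disj that by blast
    show "0 < \<sigma> * mesh_size T" using h assms(3) by simp
  qed (use T(1) sim T(3,4) d h assms(4,5,7) in blast)+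
qed

theorem theorem3p2:
  fixes \<Omega> \<Gamma>D \<Gamma>N \<Gamma>P \<Gamma>F :: "(real^'n) set"
    and lam mu Cc Ck kmin kmax \<delta> \<sigma> c c' C :: real
    and k :: "real^'n \<Rightarrow> real^'n^'n"
    and Meshes :: "(real^'n) set set set"
    and Cl :: "(real^'n) set set \<Rightarrow> (real^'n \<Rightarrow> real^'n) \<Rightarrow> (real^'n \<Rightarrow> real^'n)"
  assumes dim: "CARD('n) \<in> {2, 3}"
    and domain: "open \<Omega>" "connected \<Omega>" "bounded \<Omega>" "\<Omega> \<noteq> {}"
    and boundary: "frontier \<Omega> = \<Gamma>D \<union> \<Gamma>N" "frontier \<Omega> = \<Gamma>P \<union> \<Gamma>F"
    and continuity: "Cc > 0"
      "\<And>u v. \<lbrakk>u \<in> H1 \<Omega>; v \<in> H1 \<Omega>\<rbrakk> \<Longrightarrow>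
         elasticity_form \<Omega> lam mu u v \<le> Cc * H1_norm \<Omega> u * H1_norm \<Omega> v"
    and korn: "Ck > 0"
      "\<And>v. v \<in> W_E \<Omega> \<Gamma>D \<Longrightarrow> elasticity_form \<Omega> lam mu v v \<ge> Ck * (H1_norm \<Omega> v)\<^sup>2"
    and permeability: "k \<in> borel_measurable (lebesgue_on \<Omega>)" "kmin > 0" "kmax > 0"
      "\<And>x. x \<in> \<Omega> \<Longrightarrow> transpose (k x) = k x"
      "\<And>x \<eta>. x \<in> \<Omega> \<Longrightarrow> kmin * (norm \<eta>)\<^sup>2 \<le> \<eta> \<bullet> (k x *v \<eta>) \<and> \<eta> \<bullet> (k x *v \<eta>) \<le> kmax * (norm \<eta>)\<^sup>2"
    and stabilization: "\<delta> > 0"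
    and meshes: "\<sigma> > 0" "\<And>T. T \<in> Meshes \<Longrightarrow> mesh \<Omega> T \<and> quasi_uniform \<sigma> T"
    and pressures: "\<And>T. T \<in> Meshes \<Longrightarrow> pressure_assumption \<Omega> \<Gamma>N \<Gamma>P T (Cl T) c c' C"
  shows "\<exists>\<gamma>>0. \<forall>T\<in>Meshes. \<forall>dt>0. V_h \<Omega> \<Gamma>D \<Gamma>N \<Gamma>P \<Gamma>F T \<noteq> {zero_state} \<longrightarrow>
    (\<forall>n. \<forall>U :: nat \<Rightarrow> 'n state. U n \<in> V_h \<Omega> \<Gamma>D \<Gamma>N \<Gamma>P \<Gamma>F T \<longrightarrow>
       ereal (\<gamma> * norm_A \<Omega> T \<delta> dt (U n)) \<le>
       (SUP Y\<in>V_h \<Omega> \<Gamma>D \<Gamma>N \<Gamma>P \<Gamma>F T - {zero_state}.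
          ereal (B_h \<Omega> lam mu k T \<delta> dt (U n) Y / norm_A \<Omega> T \<delta> dt Y)))"
proof -
  let ?n = "real CARD('n)" and ?n1 = "real (CARD('n) + 1)"
  \<comment> \<open>With \<rho> = \<sigma> h the ratio 2h/\<rho> becomes 2/\<sigma>, so none of the
    constants below depends on h or \<Delta>t.\<close>
  define N0 where "N0 = (2 / \<sigma>) ^ CARD('n)"
  define CJ where "CJ = \<delta> * (4 * ?n1 / \<sigma> * N0)"
  define C5 where "C5 = (?n1 * (C\<^sup>2 * (N0 * c\<^sup>2)) + (c + c')\<^sup>2) / (2 * \<sigma>\<^sup>2)"
  \<comment> \<open>Makes C5/s at most 1/4, the share of the squared pressure norm that the
    consistency error may use.\<close>
  define s where "s = 4 * C5 + 1"
  define cJ where "cJ = s / (2 * \<delta>)"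
  define C1 where "C1 = Cc * \<bar>c'\<bar>"
  \<comment> \<open>The first bound serves the elastic cross term, the second the consistency error.
    The added 1 keeps the denominators positive, for instance if c' = 0.\<close>
  define \<beta> where "\<beta> = min (Ck / (4 * (C1\<^sup>2 + 1))) (1 / (4 * (cJ + 1)))"
  define \<gamma> where "\<gamma> = min (Ck / (4 * ?n\<^sup>2)) (1 / (4 * (CJ + 1)))"
  define g where "g = min (Ck / 2) (min (1 / kmax) (min (\<beta> / 2) (min (\<gamma> / 2) (1/2))))"
  define A where "A = 3 + 2 * (\<beta>\<^sup>2 * c'\<^sup>2) + 2 * \<gamma>\<^sup>2 + 2 * (\<gamma>\<^sup>2 * CJ)"
  have N0: "N0 > 0" using meshes(1) by (simp add: N0_def)
  have CJ: "CJ \<ge> 0" using N0 meshes(1) stabilization by (simp add: CJ_def)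
  have C5: "C5 \<ge> 0" using N0 meshes(1) by (simp add: C5_def)
  have s: "s > 0" using C5 by (simp add: s_def)
  have cJ: "cJ > 0" using s stabilization by (simp add: cJ_def)
  have n: "?n\<^sup>2 > 0" using dim by auto
  have C1: "C1\<^sup>2 + 1 > 0" by (rule add_nonneg_pos) auto
  have pos: "\<beta> > 0" "\<gamma> > 0"
    using korn(1) C1 cJ CJ n by (auto simp: \<beta>_def \<gamma>_def)
  have bound: "x * y \<le> a / 4" if "x \<le> a / (4 * y)" "y > 0" for x y a :: real
    using that by (simp add: field_simps)
  have coef: "\<beta> * (Cc * \<bar>c'\<bar>)\<^sup>2 \<le> Ck / 4" "\<gamma> * ?n\<^sup>2 \<le> Ck / 4" "\<beta> * cJ \<le> 1/4" "\<gamma> * CJ \<le> 1/4"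
  proof -
    have "\<beta> * (C1\<^sup>2 + 1) \<le> Ck / 4" by (rule bound) (use C1 in \<open>simp_all add: \<beta>_def\<close>)
    then show "\<beta> * (Cc * \<bar>c'\<bar>)\<^sup>2 \<le> Ck / 4" using pos(1) by (simp add: C1_def distrib_left)
    show "\<gamma> * ?n\<^sup>2 \<le> Ck / 4" by (rule bound) (use n in \<open>simp_all add: \<gamma>_def\<close>)
    have "\<beta> * (cJ + 1) \<le> 1 / 4" by (rule bound) (use cJ in \<open>simp_all add: \<beta>_def\<close>)
    then show "\<beta> * cJ \<le> 1/4" using pos(1) by (simp add: distrib_left)
    have "\<gamma> * (CJ + 1) \<le> 1 / 4" by (rule bound) (use CJ in \<open>simp_all add: \<gamma>_def\<close>)
    then show "\<gamma> * CJ \<le> 1/4" using pos(2) by (simp add: distrib_left)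
  qed
  have g: "g \<le> Ck / 2" "g \<le> 1 / kmax" "g \<le> \<beta> / 2" "g \<le> \<gamma> / 2" "g \<le> 1/2" by (auto simp: g_def)
  have g0: "g > 0" using korn(1) permeability(3) pos by (simp add: g_def)
  have A0: "A > 0" using CJ by (auto simp: A_def intro!: add_pos_nonneg)
  have \<Gamma>D: "\<Gamma>D \<subseteq> frontier \<Omega>" using boundary(1) by blast
  have \<Gamma>F: "frontier \<Omega> \<subseteq> \<Gamma>F" if "\<Gamma>N \<union> \<Gamma>P = {}" using boundary(2) that by blast
  have dim2: "CARD('n) \<ge> 2" using dim by auto
  \<comment> \<open>From B(X, Y) \<ge> g |X|^2 and |Y| \<le> sqrt A |X| the quotient B(X, Y) / |Y|
    is at least (g / sqrt A) |X|.\<close>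
  show ?thesis
  proof (intro exI[of _ "g / sqrt A"] conjI ballI allI impI)
    show "g / sqrt A > 0" using g0 A0 by simp
    fix T dt m and U :: "nat \<Rightarrow> 'n state"
    assume T: "T \<in> Meshes" and dt: "dt > (0 :: real)" and nontriv: "V_h \<Omega> \<Gamma>D \<Gamma>N \<Gamma>P \<Gamma>F T \<noteq> {zero_state}"
      and Um: "U m \<in> V_h \<Omega> \<Gamma>D \<Gamma>N \<Gamma>P \<Gamma>F T"
    define h where "h = mesh_size T"
    have md: "mesh_domain T h (\<sigma> * h) \<Omega>" "h > 0"
      unfolding h_def using mesh_domainI[OF _ _ meshes(1) domain(1,3,4) dim2] meshes(2)[OF T] by blast+
    interpret mesh_domain T h "\<sigma> * h" \<Omega> by (rule md(1))
    have hr: "2 * h / (\<sigma> * h) = 2 / \<sigma>" using md(2) by simp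
    let ?V = "V_h \<Omega> \<Gamma>D \<Gamma>N \<Gamma>P \<Gamma>F T"
    let ?B = "B_h \<Omega> lam mu k T \<delta> dt (U m)" and ?N = "norm_A \<Omega> T \<delta> dt"
    obtain u z p where X: "U m = (u, z, p)" by (rule prod_cases3)
    have Xs: "u \<in> WE_h \<Omega> \<Gamma>D T" "z \<in> WD_h \<Omega> \<Gamma>F T" "p \<in> Q_h \<Omega> \<Gamma>N \<Gamma>P T" using Um X by (auto simp: V_h_def)
    note pp = Q_h_pwc[OF Xs(3)]
    note kinv = L2_matrix_inv[OF S\<Omega> permeability(1) H1_L2(1)[OF open\<Omega> WD_h_H1[OF Xs(2)]] permeability(2-5)]
    have lin: "?B (\<lambda>x. v x + a *\<^sub>R v x, \<lambda>x. w x + a *\<^sub>R w x, \<lambda>x. q x + a * q x) = ?B (v, w, q) + a * ?B (v, w, q)"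
      if "(v, w, q) \<in> ?V" for v w q a
      unfolding X
      by (rule B_h_lincomb[OF WE_h_H1[OF Xs(1)] kinv(1) WD_h_H1[OF Xs(2)] pp])
        (use that in \<open>auto simp: V_h_def intro: WE_h_H1 WD_h_H1 Q_h_pwc\<close>)
    have sup: "ereal (g / sqrt A * ?N (U m)) \<le>
        (SUP Y\<in>?V - {zero_state}. ereal (B_h \<Omega> lam mu k T \<delta> dt (U m) Y / ?N Y))"
      if "Y \<in> ?V" "Y \<noteq> zero_state" "g / sqrt A * ?N (U m) \<le> ?B Y / ?N Y" for Y
      by (rule SUP_upper2[of Y]) (use that in auto)
    show "ereal (g / sqrt A * ?N (U m)) \<le>
        (SUP Y\<in>?V - {zero_state}. ereal (B_h \<Omega> lam mu k T \<delta> dt (U m) Y / ?N Y))"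
    proof (cases "?N (U m) = 0")
      \<comment> \<open>The left-hand side is 0, so one nonnegative quotient suffices. Of a nonzero
        test state and its negative, one has a nonnegative value of B; if its norm is 0, the
        quotient is 0 by convention.\<close>
      case True
      have ex: "\<exists>Y\<in>V. Y \<noteq> y0" if "V \<noteq> {y0}" "y \<in> V" for V and y y0 :: "'n state"
      proof (rule ccontr)
        assume "\<not> ?thesis"
        then have "V \<subseteq> {y0}" by blast
        with that show False by (auto simp: subset_singleton_iff)
      qed
      obtain Y where Y: "Y \<in> ?V" "Y \<noteq> zero_state" by (rule bexE[OF ex[OF nontriv Um]])
      obtain v w q where vwq: "Y = (v, w, q)" by (rule prod_cases3)
      have Y3: "v \<in> WE_h \<Omega> \<Gamma>D T" "w \<in> WD_h \<Omega> \<Gamma>F T" "q \<in> Q_h \<Omega> \<Gamma>N \<Gamma>P T" using Y(1) vwq by (auto simp: V_h_def)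
      \<comment> \<open>The negative of Y, in the form for which closure of the discrete spaces and
        linearity of B are established.\<close>
      let ?Y = "(\<lambda>x. v x + (-2) *\<^sub>R v x, \<lambda>x. w x + (-2) *\<^sub>R w x, \<lambda>x. q x + (-2) * q x)"
      have Y': "?Y \<in> ?V"
        unfolding V_h_def using WE_h_lincomb[OF Y3(1,1)] WD_h_lincomb[OF Y3(2,2)] Q_h_lincomb[OF Y3(3,3)] by blast
      have neg: "y + (-2) *\<^sub>R y = - y" for y :: "real^'n" by (simp add: scaleR_2)
      have nz: "?Y \<noteq> zero_state" using Y(2) unfolding vwq neg by (auto simp: fun_eq_iff)
      have B': "?B ?Y = - ?B Y" using lin[of v w q "-2"] Y(1) unfolding vwq by simp
      have sgn: "0 \<le> a / b \<or> 0 \<le> a' / b'" if "a' = - a" "0 \<le> b" "0 \<le> b'" for a a' b b' :: real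
        proof (cases "0 \<le> a")
        case False
        then have "0 \<le> a' / b'" using that by (intro divide_nonneg_nonneg) auto
        then show ?thesis ..
      qed (use that in simp)
      have "0 \<le> ?B Y / ?N Y \<or> 0 \<le> ?B ?Y / ?N ?Y"
        by (rule sgn[OF B' norm_A_nonneg[OF dt] norm_A_nonneg[OF dt]])
      then show ?thesis
      proof
        assume "0 \<le> ?B Y / ?N Y"
        then show ?thesis by (intro sup[OF Y]) (simp only: True mult_zero_right)
      next
        assume "0 \<le> ?B ?Y / ?N ?Y"
        then show ?thesis by (intro sup[OF Y' nz]) (simp only: True mult_zero_right)
      qed
    next
      case False
      note pa = pressures[OF T, unfolded pressure_assumption_def, folded h_def]
      obtain v where v1: "v \<in> H10 \<Omega>" and v2: "(AE x in lebesgue_on \<Omega>. divergence \<Omega> v x = - p x) \<and>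
        H1_norm \<Omega> v \<le> c * L2_norm \<Omega> p \<and> Cl T v \<in> H10 \<Omega> \<and> H1_norm \<Omega> (Cl T v) \<le> c' * L2_norm \<Omega> p \<and>
        (\<forall>K\<in>T. L2_norm K (\<lambda>x. v x - Cl T v x) \<le> C * h * H1_norm (patch T K) v)"
        by (rule bexE[OF bspec[OF conjunct2[OF pa] Xs(3)]])
      note v3 = v2[THEN conjunct2]
      note v4 = v3[THEN conjunct2]
      note v5 = v4[THEN conjunct2]
      note v = v1 v2[THEN conjunct1] v3[THEN conjunct1] v4[THEN conjunct1] v5[THEN conjunct1]
        bspec[OF v5[THEN conjunct2]] bspec[OF conjunct1[OF pa] H10_H1[OF v1]]
      have Jd: "J_form \<Omega> T \<delta> q q = \<delta> * J_form \<Omega> T 1 q q" for q by (simp add: J_form_def)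
      have cons: "\<bar>L2_inner \<Omega> p (divergence \<Omega> (\<lambda>x. v x + (-1) *\<^sub>R Cl T v x))\<bar> \<le> cJ * J_form \<Omega> T \<delta> p p + (L2_norm \<Omega> p)\<^sup>2 / 4"
      proof -
        have "\<bar>L2_inner \<Omega> p (divergence \<Omega> (\<lambda>x. v x + (-1) *\<^sub>R Cl T v x))\<bar> \<le> s / 2 * J_form \<Omega> T 1 p p +
          1 / (2 * s * \<sigma>\<^sup>2) * (?n1 * (C\<^sup>2 * ((2 / \<sigma>) ^ CARD('n) * c\<^sup>2)) + (c + c')\<^sup>2) * (L2_norm \<Omega> p)\<^sup>2"
          by (rule pressure_consistency_le[OF pp v(1,4) s refl meshes(1) v(6,3,5)])
        also have "s / 2 * J_form \<Omega> T 1 p p = cJ * J_form \<Omega> T \<delta> p p"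
          unfolding Jd[of p] cJ_def using stabilization by simp
        also have "1 / (2 * s * \<sigma>\<^sup>2) * (?n1 * (C\<^sup>2 * ((2 / \<sigma>) ^ CARD('n) * c\<^sup>2)) + (c + c')\<^sup>2) = C5 / s"
          by (simp add: C5_def N0_def)
        also have "C5 / s * (L2_norm \<Omega> p)\<^sup>2 \<le> 1/4 * (L2_norm \<Omega> p)\<^sup>2"
          using C5 by (intro mult_right_mono) (auto simp: s_def field_simps)
        finally show ?thesis by simp
      qed
      have inv: "J_form \<Omega> T \<delta> q q \<le> CJ * (L2_norm \<Omega> q)\<^sup>2" if q: "pwc q" for q
      proof -
        have "4 * h * ?n1 / (\<sigma> * h) = 4 * ?n1 / \<sigma>" using md(2) by simp
        then show ?thesis using J_form_le[OF q, of \<delta>] stabilization unfolding L2_norm_pwc[OF q] CJ_def N0_def hr by simp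
      qed
      obtain Y where Y: "Y \<in> ?V" "g * (?N (U m))\<^sup>2 \<le> ?B Y" "(?N Y)\<^sup>2 \<le> A * (?N (U m))\<^sup>2" "?N Y = 0 \<Longrightarrow> ?N (U m) = 0"
      proof (rule stability[OF Xs \<Gamma>D \<Gamma>F dt stabilization continuity korn(2) kinv v(1,2,7,4,5) cons inv CJ pos coef g, folded X A_def])
        fix Y
        assume a: "Y \<in> ?V" and b: "g * (?N (U m))\<^sup>2 \<le> ?B Y" and c: "(?N Y)\<^sup>2 \<le> A * (?N (U m))\<^sup>2"
          and d: "?N Y = 0 \<Longrightarrow> ?N (U m) = 0"
        show thesis by (rule that[OF a b c d])
      qed
      \<comment> \<open>A test state of norm 0 would force the given state to have norm 0.\<close>
      have N: "?N (U m) > 0" "?N Y > 0" using False Y(4) norm_A_nonneg[OF dt] by (metis less_le)+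
      have B0: "?B Y > 0" using Y(2) N(1) g0 by (smt (verit) mult_pos_pos zero_less_power)
      have nz: "Y \<noteq> zero_state"
      proof
        assume 0: "Y = zero_state"
        \<comment> \<open>Linearity in the test state, with factor -1, gives the value 0 at the zero
          state.\<close>
        have "?B zero_state = ?B zero_state + (-1) * ?B zero_state"
          using lin[of "\<lambda>_. 0" "\<lambda>_. 0" "\<lambda>_. 0" "-1"] Y(1) unfolding 0 by simp
        then show False using B0 unfolding 0 by simp
      qed
      have le: "g / sqrt A * ?N (U m) \<le> ?B Y / ?N Y"
      proof -
        have "?N Y \<le> sqrt (A * (?N (U m))\<^sup>2)" using Y(3) N by (intro real_le_rsqrt)
        also have "\<dots> = sqrt A * ?N (U m)" using N by (simp add: real_sqrt_mult)
        finally have "g / sqrt A * ?N (U m) * ?N Y \<le> g / sqrt A * ?N (U m) * (sqrt A * ?N (U m))"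
          using g0 A0 N by (intro mult_left_mono) auto
        also have "\<dots> = g * (?N (U m))\<^sup>2" using A0 by (simp add: power2_eq_square)
        finally show ?thesis using Y(2) N(2) by (simp add: pos_le_divide_eq)
      qed
      show ?thesis by (rule sup[OF Y(1) nz le])
    qed
  qed
qed

end
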